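(* Let $r\ge1$ be an integer and consider the slow-fast system $$\dot x=f(x,\alpha),\qquad\dot\alpha=\epsilon,\qquad x\in\mathbb{R}^n,\ \alpha\in\mathbb{R},\ f\in C^r,\ 0\le\epsilon\ll1.$$ Assume that for $\epsilon=0$ the $x$-component of this system has an $\alpha$-dependent, uniformly bounded fixed point $x_0(\alpha)$, of class $C^r$ in $\alpha$, that is uniformly hyperbolic, i.e., with $A(\alpha)=D_xf(x_0(\alpha),\alpha)\in\mathbb{R}^{n\times n}$, $$f(x_0(\alpha),\alpha)=0,\qquad\left|\mathrm{Re}\left[\mathrm{spect}(A(\alpha))\right]\right|\ge K>0,\qquad\alpha\in\mathbb{R},$$ for some constant $K>0$. Let $\mathcal{L}_0=\{(x,\alpha)\in\mathbb{R}^n\times\mathbb{R}:\ x=x_0(\alpha)\}$ be the critical manifold. Then, for $\epsilon>0$ small enough, there exists a unique, attracting, one-dimensional slow manifold $\mathcal{L}_\epsilon$, composed of a slow trajectory $x_\epsilon(\alpha)$ that is uniformly bounded in $\alpha\in\mathbb{R}$. The trajectory $x_\epsilon(\alpha)$ is $\mathcal{O}(\epsilon)$ $C^1$-close and $C^r$ diffeomorphic to the critical manifold $\mathcal{L}_0$. Finally, for any nonnegative integer $N\le r$, $x_\epsilon(\alpha)$ can be approximated as $$\mathcal{L}_\epsilon=\Big\{(x,\alpha)\in\mathbb{R}^n\times\mathbb{R}:\ x=x_\epsilon(\alpha)=\sum_{\nu=0}^N\epsilon^\nu x_\nu(\alpha)+o(\epsilon^N)\Big\},$$ with the recursively defined coefficients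 $$x_\nu(\alpha)=A^{-1}(\alpha)\left[x_{\nu-1}'(\alpha)-\sum_{1<|\boldsymbol\gamma|\le\nu}\frac{\partial^{|\boldsymbol\gamma|}f(x_0(\alpha),\alpha)}{\partial x_1^{\gamma_1}\cdots\partial x_n^{\gamma_n}}\sum_{s=1}^{\nu}\sum_{p_s(\nu,\boldsymbol\gamma)}\prod_{j=1}^s\frac{\prod_{i=1}^n\left[x_{\ell_j}^i(\alpha)\right]^{k_{ji}}}{\prod_{i=1}^nk_{ji}!}\right],\qquad\nu\ge1,$$ where the index set $p_s(\nu,\boldsymbol\gamma)$ is defined as $$p_s(\nu,\boldsymbol\gamma)=\Big\{(\mathbf{k}_1,\ldots,\mathbf{k}_s,\ell_1,\ldots,\ell_s):\ \mathbf{k}_i\in\mathbb{N}^n-\{\mathbf{0}\},\ \ell_i\in\mathbb{N},\ 0<\ell_1<\cdots<\ell_s,\ \sum_{i=1}^s\mathbf{k}_i=\boldsymbol\gamma,\ \sum_{i=1}^s|\mathbf{k}_i|\ell_i=\nu\Big\}.$$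
   Context: The slow-fast system is the extended form, with $\alpha=\epsilon t$, of the slowly varying system $\dot x=f(x,\epsilon t)$. $\mathbb{N}$ includes $0$; $\boldsymbol\gamma\in\mathbb{N}^n$ is a multi-index with $|\boldsymbol\gamma|=\sum_i\gamma_i$; $x_\nu(\alpha)=(x_\nu^1(\alpha),\ldots,x_\nu^n(\alpha))$; $k_{ji}$ is the $i$-th component of $\mathbf{k}_j$; prime denotes $d/d\alpha$. The condition $|\mathrm{Re}[\mathrm{spect}(A(\alpha))]|\ge K$ means that every eigenvalue $\lambda$ of $A(\alpha)$ satisfies $|\mathrm{Re}\,\lambda|\ge K$. The critical manifold $\mathcal{L}_0$ consists of fixed points of the slow-fast system for $\epsilon=0$; the slow manifold $\mathcal{L}_\epsilon$ is an invariant manifold of the slow-fast system that acts as a continuation of $\mathcal{L}_0$.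
   Formalization: Derivatives of f up to order r are assumed bounded and uniformly continuous on a tube around L_0; "attracting" is claimed only when the spectrum of A(α) has negative real parts; for r=1 the derivative of x_ε converges uniformly to that of x_0, with the O(ε) rate only for r≥2. *)

theory Defs
  imports "HOL-Analysis.Analysis"
begin

section \<open>Functions of class $C^r$\<close>

text \<open>Derivatives are taken on the whole space; \<open>Ck r g\<close> says that \<open>g\<close> has continuous
  Frechet derivatives up to order \<open>r\<close>, expressed by directional components.\<close>

primrec Ck :: "nat \<Rightarrow> ('a::real_normed_vector \<Rightarrow> 'b::real_normed_vector) \<Rightarrow> bool" where
  "Ck 0 g \<longleftrightarrow> continuous_on UNIV g"
| "Ck (Suc r) g \<longleftrightarrow>
     (\<forall>z. g differentiable (at z)) \<and> (\<forall>v. Ck r (\<lambda>z. frechet_derivative g (at z) v))"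

text \<open>The derivatives of \<open>g\<close> up to order \<open>r\<close> are bounded and uniformly continuous on \<open>S\<close>.
  This is the notion of $C^r$ used for normally hyperbolic invariant manifolds that are not
  compact; here \<open>S\<close> is a tube of fixed radius around the critical manifold.
  It is only meant for functions with \<open>Ck r g\<close>.\<close>

primrec uniform_Ck_on ::
  "nat \<Rightarrow> 'a::real_normed_vector set \<Rightarrow> ('a \<Rightarrow> 'b::real_normed_vector) \<Rightarrow> bool" where
  "uniform_Ck_on 0 S g \<longleftrightarrow> bounded (g ` S) \<and> uniformly_continuous_on S g"
| "uniform_Ck_on (Suc r) S g \<longleftrightarrow>
     bounded (g ` S) \<and> uniformly_continuous_on S g \<and>
     (\<forall>v. uniform_Ck_on r S (\<lambda>z. frechet_derivative g (at z) v))"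

text \<open>$C^r$ diffeomorphic closed subsets of a vector space: maps on a subset are $C^r$ if they
  extend to $C^r$ maps of the ambient space.\<close>

definition Ck_diffeomorphic ::
  "nat \<Rightarrow> 'a::real_normed_vector set \<Rightarrow> 'b::real_normed_vector set \<Rightarrow> bool" where
  "Ck_diffeomorphic r S T \<longleftrightarrow>
     (\<exists>\<Phi> \<Psi>. Ck r \<Phi> \<and> Ck r \<Psi> \<and> \<Phi> ` S = T \<and> \<Psi> ` T = S \<and>
        (\<forall>p\<in>S. \<Psi> (\<Phi> p) = p) \<and> (\<forall>q\<in>T. \<Phi> (\<Psi> q) = q))"

section \<open>Slow-fast systems\<close>

text \<open>Throughout, \<open>f (x, \<alpha>)\<close> is the right-hand side of the fast equation.\<close>

definition solves ::
  "((real^'n) \<times> real \<Rightarrow> real^'n) \<Rightarrow> real \<Rightarrow> (real \<Rightarrow> (real^'n) \<times> real) \<Rightarrow> real set \<Rightarrow> bool" where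
  "solves f \<epsilon> z I \<longleftrightarrow> (\<forall>t\<in>I. (z has_vector_derivative (f (z t), \<epsilon>)) (at t within I))"

definition manifold_of :: "(real \<Rightarrow> real^'n) \<Rightarrow> ((real^'n) \<times> real) set" where
  "manifold_of u = {(x, \<alpha>). x = u \<alpha>}"

definition tube :: "(real \<Rightarrow> real^'n) \<Rightarrow> real \<Rightarrow> ((real^'n) \<times> real) set" where
  "tube u \<delta> = {(x, \<alpha>). dist x (u \<alpha>) \<le> \<delta>}"

definition invariant_set ::
  "((real^'n) \<times> real \<Rightarrow> real^'n) \<Rightarrow> real \<Rightarrow> ((real^'n) \<times> real) set \<Rightarrow> bool" where
  "invariant_set f \<epsilon> M \<longleftrightarrow> (\<forall>p\<in>M. \<exists>z. solves f \<epsilon> z UNIV \<and> z 0 = p \<and> range z \<subseteq> M)"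

text \<open>An invariant set continuing the critical manifold \<open>manifold_of x0\<close>, i.e. staying in a fixed
  neighbourhood of it.  No smoothness is required here, so that uniqueness is among all
  invariant sets in that neighbourhood, in particular among all invariant manifolds.\<close>

definition slow_manifold ::
  "((real^'n) \<times> real \<Rightarrow> real^'n) \<Rightarrow> (real \<Rightarrow> real^'n) \<Rightarrow> real \<Rightarrow> real \<Rightarrow>
   ((real^'n) \<times> real) set \<Rightarrow> bool" where
  "slow_manifold f x0 \<delta> \<epsilon> M \<longleftrightarrow> M \<noteq> {} \<and> invariant_set f \<epsilon> M \<and> M \<subseteq> tube x0 \<delta>"

definition attracting ::
  "((real^'n) \<times> real \<Rightarrow> real^'n) \<Rightarrow> real \<Rightarrow> ((real^'n) \<times> real) set \<Rightarrow> bool" where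
  "attracting f \<epsilon> M \<longleftrightarrow>
     (\<exists>\<eta>>0. \<forall>p. infdist p M < \<eta> \<longrightarrow>
        (\<exists>z. solves f \<epsilon> z {0..} \<and> z 0 = p) \<and>
        (\<forall>z. solves f \<epsilon> z {0..} \<and> z 0 = p \<longrightarrow> ((\<lambda>t. infdist (z t) M) \<longlongrightarrow> 0) at_top))"

definition jacobian_at ::
  "((real^'n) \<times> real \<Rightarrow> real^'n) \<Rightarrow> (real \<Rightarrow> real^'n) \<Rightarrow> real \<Rightarrow> real^'n^'n" where
  "jacobian_at f x0 \<alpha> = matrix (frechet_derivative (\<lambda>x. f (x, \<alpha>)) (at (x0 \<alpha>)))"

text \<open>Complex eigenvalues of a real matrix.\<close>

definition spect :: "real^'n^'n \<Rightarrow> complex set" where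
  "spect A = {\<mu>. \<exists>v. v \<noteq> 0 \<and> (\<chi> i j. complex_of_real (A $ i $ j)) *v v = \<mu> *s v}"

section \<open>Expansion coefficients of the slow manifold\<close>

definition mi_size :: "nat^'n \<Rightarrow> nat" where
  "mi_size \<gamma> = (\<Sum>i\<in>UNIV. \<gamma> $ i)"

definition partial_x ::
  "'n \<Rightarrow> ((real^'n) \<times> real \<Rightarrow> real^'n) \<Rightarrow> (real^'n) \<times> real \<Rightarrow> real^'n" where
  "partial_x i g = (\<lambda>(x, \<alpha>). vector_derivative (\<lambda>h. g (x + h *\<^sub>R axis i 1, \<alpha>)) (at 0))"

text \<open>The index type carries no order.  The partial derivatives are taken in some order with
  multiplicities \<open>\<gamma>\<close>, which is immaterial for functions of class $C^{|\gamma|}$.\<close>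

definition mixed_partial_x ::
  "nat^'n \<Rightarrow> ((real^'n) \<times> real \<Rightarrow> real^'n) \<Rightarrow> (real^'n) \<times> real \<Rightarrow> real^'n" where
  "mixed_partial_x \<gamma> g = foldr partial_x (SOME is. \<forall>i. count_list is i = \<gamma> $ i) g"

text \<open>The lists \<open>k\<close> and \<open>l\<close> are indexed from 0.\<close>

definition p_index :: "nat \<Rightarrow> nat \<Rightarrow> nat^'n \<Rightarrow> ((nat^'n) list \<times> nat list) set" where
  "p_index s \<nu> \<gamma> =
     {(k, l). length k = s \<and> length l = s \<and> (\<forall>j<s. k ! j \<noteq> 0) \<and>
        (\<forall>j<s. 0 < l ! j) \<and> sorted_wrt (<) l \<and>
        (\<Sum>j<s. k ! j) = \<gamma> \<and> (\<Sum>j<s. mi_size (k ! j) * l ! j) = \<nu>}"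

lemma mi_size_pos: "k \<noteq> 0 \<Longrightarrow> 0 < mi_size k"
  by (auto simp: mi_size_def vec_eq_iff intro!: sum_pos2[of UNIV])

lemma mi_size_sum: "mi_size (\<Sum>j\<in>J. k j) = (\<Sum>j\<in>J. mi_size (k j))"
  unfolding mi_size_def sum_component by (rule sum.swap)

lemma p_index_less:
  assumes "(k, l) \<in> p_index s \<nu> \<gamma>" "1 < mi_size \<gamma>" "j < s"
  shows "l ! j < \<nu>"
proof -
  have k: "0 < mi_size (k ! i)" and l: "0 < l ! i" if "i < s" for i
    using assms(1) that by (auto simp: p_index_def intro: mi_size_pos)
  have g: "(\<Sum>i<s. mi_size (k ! i)) = mi_size \<gamma>" and n: "(\<Sum>i<s. mi_size (k ! i) * l ! i) = \<nu>"
    using assms(1) by (auto simp: p_index_def simp flip: mi_size_sum)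
  have split: "(\<Sum>i<s. h i) = h j + (\<Sum>i\<in>{..<s} - {j}. h i)" for h :: "nat \<Rightarrow> nat"
    using assms(3) by (simp add: sum.remove)
  have n': "\<nu> = mi_size (k ! j) * l ! j + (\<Sum>i\<in>{..<s} - {j}. mi_size (k ! i) * l ! i)"
    using n split[of "\<lambda>i. mi_size (k ! i) * l ! i"] by simp
  have le: "(\<Sum>i\<in>{..<s} - {j}. mi_size (k ! i)) \<le> (\<Sum>i\<in>{..<s} - {j}. mi_size (k ! i) * l ! i)"
    using l by (intro sum_mono) (auto simp: Suc_le_eq)
  show ?thesis
  proof (cases "mi_size (k ! j) = 1")
    case True
    then have "0 < (\<Sum>i\<in>{..<s} - {j}. mi_size (k ! i))"
      using g split[of "\<lambda>i. mi_size (k ! i)"] assms(2) by simp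
    then show ?thesis using n' le True by simp
  next
    case False
    then have "2 * l ! j \<le> mi_size (k ! j) * l ! j"
      using k[OF assms(3)] by (intro mult_right_mono) auto
    then have "2 * l ! j \<le> \<nu>" using n' by linarith
    then show ?thesis using l[OF assms(3)] by simp
  qed
qed

text \<open>The recursion expresses that \<open>\<Sum>\<nu>. \<epsilon> ^ \<nu> *\<^sub>R slow_coeff f x0 \<nu> \<alpha>\<close> formally
  satisfies the invariance equation $\epsilon x' = f(x, \alpha)$.\<close>

function slow_coeff ::
  "((real^'n) \<times> real \<Rightarrow> real^'n) \<Rightarrow> (real \<Rightarrow> real^'n) \<Rightarrow> nat \<Rightarrow> real \<Rightarrow> real^'n" where
  "slow_coeff f x0 0 = x0"
| "slow_coeff f x0 (Suc \<nu>) = (\<lambda>\<alpha>. matrix_inv (jacobian_at f x0 \<alpha>) *v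
     (vector_derivative (slow_coeff f x0 \<nu>) (at \<alpha>) -
      (\<Sum>\<gamma> \<in> {\<gamma>. 1 < mi_size \<gamma> \<and> mi_size \<gamma> \<le> Suc \<nu>}.
         (\<Sum>s = 1..Suc \<nu>. \<Sum>(k, l) \<in> p_index s (Suc \<nu>) \<gamma>. \<Prod>j<s.
            (\<Prod>i\<in>UNIV. (slow_coeff f x0 (l ! j) \<alpha> $ i) ^ (k ! j $ i)) /
            (\<Prod>i\<in>UNIV. fact (k ! j $ i)))
         *\<^sub>R mixed_partial_x \<gamma> f (x0 \<alpha>, \<alpha>))))"
  by pat_completeness auto
termination
  by (relation "Wellfounded.measure (\<lambda>(f, x0, \<nu>). \<nu>)") (auto dest: p_index_less)

text \<open>The index sets are finite, so no sum above is 0 by convention.\<close>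

lemma finite_multi_indices: "finite {\<gamma> :: nat^'n. 1 < mi_size \<gamma> \<and> mi_size \<gamma> \<le> m}"
proof (rule finite_subset)
  show "{\<gamma> :: nat^'n. 1 < mi_size \<gamma> \<and> mi_size \<gamma> \<le> m} \<subseteq> vec_lambda ` (UNIV \<rightarrow>\<^sub>E {..m})"
  proof
    fix \<gamma> :: "nat^'n" assume "\<gamma> \<in> {\<gamma>. 1 < mi_size \<gamma> \<and> mi_size \<gamma> \<le> m}"
    then have "\<gamma> $ i \<le> m" for i
      using member_le_sum[of i UNIV "\<lambda>i. \<gamma> $ i"] by (simp add: mi_size_def)
    then show "\<gamma> \<in> vec_lambda ` (UNIV \<rightarrow>\<^sub>E {..m})"
      by (intro image_eqI[of _ _ "vec_nth \<gamma>"]) auto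
  qed
qed (intro finite_imageI finite_PiE; simp)

lemma finite_p_index: "finite (p_index s \<nu> (\<gamma> :: nat^'n))"
proof (rule finite_subset)
  let ?K = "vec_lambda ` (UNIV \<rightarrow>\<^sub>E {..mi_size \<gamma>}) :: (nat^'n) set"
  show "p_index s \<nu> \<gamma> \<subseteq> {k. set k \<subseteq> ?K \<and> length k = s} \<times> {l. set l \<subseteq> {..\<nu>} \<and> length l = s}"
  proof (clarify, intro SigmaI CollectI conjI subsetI)
    fix k l assume kl: "(k, l) \<in> p_index s \<nu> \<gamma>"
    then show "length k = s" "length l = s" by (auto simp: p_index_def)
    have g: "(\<Sum>i<s. mi_size (k ! i)) = mi_size \<gamma>" and n: "(\<Sum>i<s. mi_size (k ! i) * l ! i) = \<nu>"
      using kl by (auto simp: p_index_def simp flip: mi_size_sum)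
    fix q assume "q \<in> set k"
    then obtain j where j: "j < s" "q = k ! j" using kl by (auto simp: p_index_def in_set_conv_nth)
    have "mi_size q \<le> mi_size \<gamma>"
      using member_le_sum[of j "{..<s}" "\<lambda>i. mi_size (k ! i)"] j g by auto
    then have "q $ i \<le> mi_size \<gamma>" for i
      using member_le_sum[of i UNIV "\<lambda>i. q $ i"] by (simp add: mi_size_def)
    then show "q \<in> ?K" by (intro image_eqI[of _ _ "vec_nth q"]) auto
  next
    fix k l q assume kl: "(k, l) \<in> p_index s \<nu> \<gamma>" and "q \<in> set l"
    then obtain j where j: "j < s" "q = l ! j" by (auto simp: p_index_def in_set_conv_nth)
    have "0 < mi_size (k ! j)" using kl j by (auto simp: p_index_def intro: mi_size_pos)
    then have "q \<le> mi_size (k ! j) * l ! j" using j by simp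
    also have "\<dots> \<le> \<nu>"
      using member_le_sum[of j "{..<s}" "\<lambda>i. mi_size (k ! i) * l ! i"] j kl
      by (auto simp: p_index_def)
    finally show "q \<in> {..\<nu>}" by simp
  qed
qed (intro finite_cartesian_product finite_lists_length_eq finite_imageI finite_PiE; simp)

end

theory Submission
  imports Defs "HOL-Computational_Algebra.Fundamental_Theorem_Algebra" "HOL-Library.Multiset"
begin

text \<open>In the slow time $\alpha$ the system reads $\epsilon x' = f(x, \alpha)$. A constant-coefficient
  hyperbolic equation $\epsilon y' = Ay + g$ has a unique bounded solution, bounded by a multiple of
  $\sup |g|$ which depends only on $K$ and on a bound for $A$: multiply by the factors $A - \mu$ one
  eigenvalue at a time. Since $A(\alpha)$ is uniformly continuous it is nearly constant on intervals
  of length of order $\epsilon$, so for small $\epsilon$ the solutions of the frozen equations, glued by a partition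
  into bumps, form an approximate inverse of $\epsilon\, d/d\alpha - A(\alpha)$, and cut-offs give a local
  a-priori bound with exponentially small tails. A Newton iteration at $x_0$ then yields the slow
  trajectory. The a-priori bound applied to the difference of two trajectories in the tube gives
  uniqueness and, in forward time, attraction; applied to the difference of the slow trajectory
  and the formal power series, whose residual is $o(\epsilon^r)$ by Taylor's formula, it gives the
  expansion.\<close>

section \<open>Hyperbolic linear systems with constant coefficients\<close>

text \<open>The slow time runs over the whole line, so no compactness is available and every
  constant must depend only on \<open>K\<close>, the dimension and a bound for the entries of A. An
  eigenbasis or a Jordan form is avoided for this reason: its change of basis is not controlled by
  these data, whereas the number and the norms of the factors A - mu are. Attraction needs the same
  solution operator on the half line; there all modes have to be stable, because an unstable mode
  cannot keep a prescribed initial value and stay bounded. The a-priori bound is local because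
  attraction iterates it over successive time windows, while uniqueness takes a supremum over the
  line. The constants are chosen in a fixed order: \<open>C\<close>, \<open>W\<close> and \<theta>
  for the linear problem, then the radius \<delta> that makes the nonlinear remainder Lipschitz with
  constant 1/(4C), and \<epsilon> last. The expansion meets one more obstacle: the coefficient of
  index \<open>r\<close> is in general merely continuous, so the full truncated series cannot be
  inserted into the differential equation.\<close>

lemma finite_sequence_dependent:
  fixes x :: "nat \<Rightarrow> 'a::euclidean_space"
  shows "\<exists>c. (\<exists>k\<le>DIM('a). c k \<noteq> 0) \<and> (\<Sum>k\<le>DIM('a). c k *\<^sub>R x k) = 0"
\<comment> \<open>Linear dependence is a property of sets and forgets repetitions, so a repeated
  term gets its own relation x i - x j = 0.\<close>
proof (cases "inj_on x {..DIM('a)}")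
  case True
  then have "card (x ` {..DIM('a)}) > DIM('a)"
    by (simp add: card_image)
  then have "dependent (x ` {..DIM('a)})"
    by (intro dependent_biggerset) auto
  then obtain u where u: "\<exists>v\<in>x ` {..DIM('a)}. u v \<noteq> 0" "(\<Sum>v\<in>x ` {..DIM('a)}. u v *\<^sub>R v) = 0"
    by (auto simp: dependent_finite)
  then show ?thesis
    using True by (intro exI[of _ "\<lambda>k. u (x k)"]) (auto simp: sum.reindex)
next
  case False
  then obtain i j where ij: "i \<le> DIM('a)" "j \<le> DIM('a)" "i \<noteq> j" "x i = x j"
    by (auto simp: inj_on_def)
  let ?c = "\<lambda>k. if k = i then 1 else if k = j then - 1 else (0::real)"
  have "(\<Sum>k\<le>DIM('a). ?c k *\<^sub>R x k) = (\<Sum>k\<in>{i, j}. ?c k *\<^sub>R x k)"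
    using ij by (intro sum.mono_neutral_right) auto
  also have "\<dots> = 0" using ij by auto
  finally show ?thesis
    using ij(1) by (intro exI[of _ ?c]) auto
qed

section \<open>Annihilating products of factors T - z\<close>

definition cmat :: "real^'n^'n \<Rightarrow> complex^'n^'n" where
  "cmat A = (\<chi> i j. complex_of_real (A $ i $ j))"

definition shift_op :: "complex^'n^'n \<Rightarrow> complex \<Rightarrow> complex^'n \<Rightarrow> complex^'n" where
  "shift_op T z v = T *v v - z *s v"

lemma vec_scaleR_complex: "c *\<^sub>R v = complex_of_real c *s v" for v :: "complex^'n"
  unfolding vec_eq_iff vector_scaleR_component vector_smult_component
  by (simp add: scaleR_conv_of_real)

lemma vsmult_diff: "c *s (x - y) = c *s x - c *s y" for x :: "complex^'n"
  unfolding vec_eq_iff vector_smult_component vector_minus_component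
  by (simp add: right_diff_distrib)

lemma matrix_vector_smult: "T *v (c *s v) = c *s (T *v v)" for T :: "complex^'n^'n"
  by (simp add: vector_scalar_commute)

lemma shift_op_linear: "linear (shift_op T z)"
  unfolding shift_op_def
  by (rule linearI)
    (simp_all add: matrix_vector_right_distrib vector_add_ldistrib vec_scaleR_complex
      matrix_vector_smult vsmult_diff vector_smult_assoc mult.commute)

lemma shift_op_commute: "shift_op T z (shift_op T w v) = shift_op T w (shift_op T z v)"
  unfolding shift_op_def
  by (simp add: matrix_vector_mult_diff_distrib vsmult_diff matrix_vector_smult
      vector_smult_assoc mult.commute)

primrec shift_prod :: "complex^'n^'n \<Rightarrow> complex list \<Rightarrow> complex^'n \<Rightarrow> complex^'n" where
  "shift_prod T [] v = v"
| "shift_prod T (z # zs) v = shift_prod T zs (shift_op T z v)"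

lemma shift_prod_linear: "linear (shift_prod T zs)"
proof (induction zs)
  case Nil
  then show ?case by (simp add: linear_id[unfolded id_def])
next
  case (Cons z zs)
  have "linear (shift_prod T zs \<circ> shift_op T z)"
    by (rule linear_compose[OF shift_op_linear Cons])
  then show ?case by (simp add: o_def)
qed

lemma shift_prod_append: "shift_prod T (xs @ ys) v = shift_prod T ys (shift_prod T xs v)"
  by (induction xs arbitrary: v) auto

lemma shift_prod_shift_op: "shift_prod T zs (shift_op T z v) = shift_op T z (shift_prod T zs v)"
proof (induction zs arbitrary: v)
  case (Cons a zs)
  have "shift_prod T (a # zs) (shift_op T z v) = shift_prod T zs (shift_op T z (shift_op T a v))"
    by (simp add: shift_op_commute[of T a z])
  then show ?case by (simp add: Cons)
qed simp

lemma shift_prod_middle: "shift_prod T (xs @ z # ys) v = shift_op T z (shift_prod T (xs @ ys) v)"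
  by (simp add: shift_prod_append shift_prod_shift_op)

definition poly_act :: "complex^'n^'n \<Rightarrow> complex poly \<Rightarrow> complex^'n \<Rightarrow> complex^'n" where
  "poly_act T p v = (\<Sum>i\<le>degree p. coeff p i *s (((*v) T ^^ i) v))"

lemma poly_act_altdef:
  assumes "degree p \<le> N"
  shows "poly_act T p v = (\<Sum>i\<le>N. coeff p i *s (((*v) T ^^ i) v))"
  unfolding poly_act_def using assms
  by (intro sum.mono_neutral_left) (auto simp: coeff_eq_0)

text \<open>Multiplication by X - z shifts the coefficients by one place and subtracts z times them;
  after reindexing, the shift is one more application of \<open>T\<close>. Everything is evaluated
  on a vector, so matrix powers are iterates.\<close>

lemma poly_act_linear_factor:
  "poly_act T ([:-z, 1:] * p) v = shift_op T z (poly_act T p v)"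
proof -
  define N where "N = degree p"
  define w where "w i = ((*v) T ^^ i) v" for i
  have "degree ([:-z, 1:] * p) \<le> Suc N"
    using degree_mult_le[of "[:-z, 1:]" p] by (simp add: N_def)
  then have "poly_act T ([:-z, 1:] * p) v = (\<Sum>i\<le>Suc N. coeff ([:-z, 1:] * p) i *s w i)"
    unfolding w_def by (rule poly_act_altdef)
  also have "\<dots> = (\<Sum>i\<le>Suc N. (case i of 0 \<Rightarrow> 0 | Suc j \<Rightarrow> coeff p j) *s w i - (z * coeff p i) *s w i)"
    by (intro sum.cong) (auto simp: coeff_pCons vector_sub_rdistrib split: nat.splits)
  also have "\<dots> = (\<Sum>i\<le>Suc N. (case i of 0 \<Rightarrow> 0 | Suc j \<Rightarrow> coeff p j) *s w i)
                 - z *s (\<Sum>i\<le>Suc N. coeff p i *s w i)"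
    by (simp add: sum_subtractf vec.scale_sum_right vector_smult_assoc del: sum.atMost_Suc)
  also have "(\<Sum>i\<le>Suc N. (case i of 0 \<Rightarrow> 0 | Suc j \<Rightarrow> coeff p j) *s w i) = (\<Sum>i\<le>N. coeff p i *s w (Suc i))"
    by (subst sum.atMost_Suc_shift) simp
  also have "\<dots> = T *v (\<Sum>i\<le>N. coeff p i *s w i)"
    by (simp add: w_def vec.linear_sum[OF matrix_vector_mul_linear_gen] matrix_vector_smult)
  also have "(\<Sum>i\<le>N. coeff p i *s w i) = poly_act T p v"
    unfolding w_def by (rule poly_act_altdef[symmetric]) (simp add: N_def)
  also have "(\<Sum>i\<le>Suc N. coeff p i *s w i) = poly_act T p v"
    unfolding w_def by (rule poly_act_altdef[symmetric]) (simp add: N_def)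
  finally show ?thesis by (simp add: shift_op_def)
qed

lemma poly_act_prod:
  "poly_act T (smult c (\<Prod>z\<leftarrow>zs. [:-z, 1:])) v = c *s shift_prod T zs v"
proof (induction zs arbitrary: v)
  case Nil
  then show ?case by (simp add: poly_act_def)
next
  case (Cons z zs)
  have "poly_act T (smult c (\<Prod>z\<leftarrow>z # zs. [:-z, 1:])) v
      = poly_act T ([:-z, 1:] * smult c (\<Prod>z\<leftarrow>zs. [:-z, 1:])) v"
    by (simp only: list.map prod_list.Cons mult_smult_right)
  also have "\<dots> = shift_op T z (c *s shift_prod T zs v)"
    by (simp only: poly_act_linear_factor Cons)
  also have "\<dots> = c *s shift_op T z (shift_prod T zs v)"
    by (simp add: shift_op_def matrix_vector_smult vsmult_diff vector_smult_assoc mult.commute)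
  finally show ?case by (simp add: shift_prod_shift_op)
qed

text \<open>The powers of \<open>T\<close> are linearly dependent for reasons of dimension, which
  gives a nonzero polynomial that kills \<open>T\<close>; over the complex numbers it splits into
  linear factors. The degree is not optimal, but any bound that depends on the dimension alone
  serves.\<close>

lemma annihilating_list:
  fixes T :: "complex^'n^'n"
  shows "\<exists>zs. length zs \<le> DIM(complex^'n^'n) \<and> (\<forall>v. shift_prod T zs v = 0)"
proof -
  let ?N = "DIM(complex^'n^'n)"
  \<comment> \<open>The k-th power of \<open>T\<close>, stored through the images of the basis
    vectors, so that a relation among the powers can be read off at each basis vector.\<close>
  define x :: "nat \<Rightarrow> complex^'n^'n" where "x k = (\<chi> j. ((*v) T ^^ k) (axis j 1))" for k
  obtain c where c: "\<exists>k\<le>?N. c k \<noteq> 0" "(\<Sum>k\<le>?N. c k *\<^sub>R x k) = 0"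
    using finite_sequence_dependent[of x] by blast
  define p where "p = Poly (map (\<lambda>k. complex_of_real (c k)) [0..<Suc ?N])"
  have cp: "coeff p k = (if k \<le> ?N then complex_of_real (c k) else 0)" for k
    by (simp add: p_def nth_default_def del: upt_Suc)
  have p0: "p \<noteq> 0" using c(1) cp by (metis coeff_0 of_real_eq_0_iff)
  have dp: "degree p \<le> ?N" by (rule degree_le) (simp add: cp)
  have ax: "poly_act T p (axis j 1) = 0" for j
  proof -
    have "poly_act T p (axis j 1) = (\<Sum>k\<le>?N. c k *\<^sub>R x k) $ j"
      unfolding poly_act_altdef[OF dp] by (simp add: cp x_def vec_scaleR_complex)
    then show ?thesis by (simp only: c(2)) simp
  qed
  obtain roots where roots: "mset roots = proots p"
    using ex_mset by blast
  have dec: "p = smult (lead_coeff p) (\<Prod>z\<leftarrow>roots. [:-z, 1:])"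
    using complex_poly_decompose_multiset[of p] roots
    by (metis mset_map prod_mset_prod_list)
  have sp: "shift_prod T roots (axis j 1) = 0" for j
    using ax[of j] p0 poly_act_prod[of T "lead_coeff p" roots "axis j 1"] dec
    by (metis leading_coeff_0_iff vector_mul_eq_0)
  \<comment> \<open>\<open>linear\<close> means linear over the reals, while the basis expansion of
    v has complex coefficients.\<close>
  have smul: "shift_prod T zs (a *s v) = a *s shift_prod T zs v" for zs a v
    by (induction zs arbitrary: v)
      (simp_all add: shift_op_def matrix_vector_smult vsmult_diff[symmetric] vector_smult_assoc
        mult.commute, metis mult.commute vector_smult_assoc vsmult_diff)
  have "shift_prod T roots v = 0" for v
  proof -
    have "v = (\<Sum>j\<in>UNIV. v $ j *s axis j 1)" by (simp add: basis_expansion)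
    also have "shift_prod T roots \<dots> = (\<Sum>j\<in>UNIV. shift_prod T roots (v $ j *s axis j 1))"
      by (rule linear_sum[OF shift_prod_linear])
    also have "\<dots> = 0" by (simp add: smul sp)
    finally show ?thesis .
  qed
  moreover have "length roots \<le> ?N"
    using dp size_proots_complex[of p] roots by (metis size_mset)
  ultimately show ?thesis by blast
qed

text \<open>Take an annihilating list of minimal length. If z is not an eigenvalue, T - z is
  injective, and the remaining product would annihilate as well, against minimality.\<close>

lemma annihilating_eigenvalue_list:
  fixes A :: "real^'n^'n"
  shows "\<exists>zs. length zs \<le> DIM(complex^'n^'n) \<and> set zs \<subseteq> spect A \<and> (\<forall>v. shift_prod (cmat A) zs v = 0)"
proof -
  let ?P = "\<lambda>zs. \<forall>v. shift_prod (cmat A) zs v = 0"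
  obtain zs0 where zs0: "length zs0 \<le> DIM(complex^'n^'n)" "?P zs0"
    using annihilating_list by blast
  define zs where "zs = arg_min length ?P"
  have zs: "?P zs" "length zs \<le> length zs0"
    using arg_min_natI[of ?P zs0 length] arg_min_nat_le[of ?P zs0 length] zs0(2)
    unfolding zs_def by auto
  have "z \<in> spect A" if z: "z \<in> set zs" for z
  proof (rule ccontr)
    assume nz: "z \<notin> spect A"
    obtain xs ys where xy: "zs = xs @ z # ys" using z by (meson split_list)
    have "shift_prod (cmat A) (xs @ ys) v = 0" for v
    proof (rule ccontr)
      assume ne: "shift_prod (cmat A) (xs @ ys) v \<noteq> 0"
      have "shift_op (cmat A) z (shift_prod (cmat A) (xs @ ys) v) = 0"
        using zs(1) by (simp add: xy shift_prod_middle)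
      with ne nz show False by (auto simp: spect_def shift_op_def cmat_def)
    qed
    then have "length zs \<le> length (xs @ ys)"
      unfolding zs_def by (intro arg_min_nat_le) auto
    then show False by (simp add: xy)
  qed
  then show ?thesis using zs zs0 by (intro exI[of _ zs]) auto
qed

section \<open>Bounded solutions of scalar equations\<close>

lemma antiderivative_real:
  fixes g :: "real \<Rightarrow> 'a::euclidean_space"
  assumes "continuous_on UNIV g"
  shows "\<exists>G. \<forall>t. (G has_vector_derivative g t) (at t)"
proof -
  have "((\<lambda>u. LBINT y=0..u. g y) has_vector_derivative g t) (at t)" for t
  proof -
    define a b where "a = - \<bar>t\<bar> - 1" and "b = \<bar>t\<bar> + 1"
    have "((\<lambda>u. LBINT y=ereal 0..u. g y) has_vector_derivative g t) (at t within {a..b})"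
      by (rule interval_integral_FTC2)
        (auto simp: a_def b_def intro: continuous_on_subset[OF assms, OF subset_UNIV])
    moreover have "at t within {a..b} = at t"
      by (rule at_within_interior) (auto simp: a_def b_def)
    ultimately show ?thesis by (simp add: zero_ereal_def)
  qed
  then show ?thesis by blast
qed

text \<open>Variation of constants: \<open>G\<close> is a primitive of exp(-z t) h, and each
  constant c gives a solution of w' = z w + h. The bound on increments of \<open>G\<close>, obtained
  by integrating H exp(-Re z t), is what singles out the constant c with a bounded solution.\<close>

lemma exp_primitive:
  fixes h :: "real \<Rightarrow> complex" and z :: complex
  assumes h: "continuous_on UNIV h"
  shows "\<exists>G. (\<forall>c t. ((\<lambda>t. exp (z * of_real t) * (G t - c)) has_vector_derivative
      z * (exp (z * of_real t) * (G t - c)) + h t) (at t)) \<and>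
    (\<forall>H s t. Re z < 0 \<longrightarrow> s \<le> t \<longrightarrow> (\<forall>u\<ge>s. norm (h u) \<le> H) \<longrightarrow>
      norm (G t - G s) \<le> H / (- Re z) * (exp (- Re z * t) - exp (- Re z * s)))"
proof -
  have "continuous_on UNIV (\<lambda>s. exp (- z * of_real s) * h s)"
    by (intro continuous_intros h)
  then obtain G where G: "\<And>t. (G has_vector_derivative exp (- z * of_real t) * h t) (at t)"
    using antiderivative_real by blast
  have "((\<lambda>t. exp (z * of_real t) * (G t - c)) has_vector_derivative
      z * (exp (z * of_real t) * (G t - c)) + h t) (at t)" for c t
  proof -
    have e: "((\<lambda>t. exp (z * of_real t)) has_vector_derivative (z * exp (z * of_real t))) (at t)"
    proof -
      have "((\<lambda>w. exp (z * w)) has_field_derivative (z * exp (z * of_real t))) (at (of_real t))"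
        by (auto intro!: derivative_eq_intros)
      then show ?thesis by (rule has_vector_derivative_real_field)
    qed
    have "((\<lambda>t. G t - c) has_vector_derivative exp (- z * of_real t) * h t) (at t)"
      using has_vector_derivative_diff[OF G has_vector_derivative_const[of c]] by simp
    from has_vector_derivative_mult[OF e this]
    have "((\<lambda>t. exp (z * of_real t) * (G t - c)) has_vector_derivative
        exp (z * of_real t) * (exp (- z * of_real t) * h t) + z * exp (z * of_real t) * (G t - c)) (at t)" .
    moreover have "exp (z * of_real t) * (exp (- z * of_real t) * h t) = h t"
      by (simp add: mult.assoc[symmetric] exp_add[symmetric])
    moreover have "z * exp (z * of_real t) * (G t - c) = z * (exp (z * of_real t) * (G t - c))"
      by (rule mult.assoc)
    ultimately show ?thesis by (simp only: add.commute)
  qed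
  moreover have "norm (G t - G s) \<le> H / (- Re z) * (exp (- Re z * t) - exp (- Re z * s))"
    if *: "Re z < 0" "s \<le> t" and h': "\<And>u. s \<le> u \<Longrightarrow> norm (h u) \<le> H" for H s t
  proof (cases "s = t")
    case False
    define k where "k = - Re z"
    have k: "k > 0" using * by (simp add: k_def)
    have "norm (G t - G s) \<le> H / k * exp (k * t) - H / k * exp (k * s)"
    proof (rule differentiable_bound_general)
      show "s < t" using False *(2) by simp
      show "continuous_on {s..t} G"
        using G by (auto intro!: continuous_at_imp_continuous_on has_vector_derivative_continuous)
      show "continuous_on {s..t} (\<lambda>t. H / k * exp (k * t))"
        by (intro continuous_intros) (use k in auto)
      show "(G has_vector_derivative exp (- z * of_real u) * h u) (at u)" for u
        by (rule G)
      show "((\<lambda>t. H / k * exp (k * t)) has_vector_derivative H * exp (k * u)) (at u)" for u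
        using k by (auto intro!: derivative_eq_intros simp: has_real_derivative_iff_has_vector_derivative[symmetric])
      show "norm (exp (- z * of_real u) * h u) \<le> H * exp (k * u)" if "s < u" for u
        using h'[of u] that by (simp add: norm_mult k_def mult.commute)
    qed
    then show ?thesis by (simp add: k_def right_diff_distrib)
  qed auto
  ultimately show ?thesis by blast
qed

text \<open>The forcing is continuous everywhere, but it is bounded, and the solution estimated,
  only on \<open>J\<close>. On the whole line the solution is the convolution integral started at
  minus infinity; on the half line it is started at 0, which adds the initial value 0.\<close>

lemma scalar_bounded_solution_stable:
  fixes h :: "real \<Rightarrow> complex" and z :: complex
  assumes h: "continuous_on UNIV h" and K: "0 < K" "Re z \<le> - K"
    and J: "J = UNIV \<or> J = {0..}" and H: "\<And>t. t \<in> J \<Longrightarrow> norm (h t) \<le> H"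
  shows "\<exists>w. (\<forall>t. (w has_vector_derivative z * w t + h t) (at t)) \<and> (\<forall>t\<in>J. norm (w t) \<le> H / K) \<and>
    (J = {0..} \<longrightarrow> w 0 = 0)"
proof -
  obtain G where G: "\<And>c t. ((\<lambda>t. exp (z * of_real t) * (G t - c)) has_vector_derivative
      z * (exp (z * of_real t) * (G t - c)) + h t) (at t)"
    and Gb: "\<And>H s t. Re z < 0 \<Longrightarrow> s \<le> t \<Longrightarrow> (\<And>u. s \<le> u \<Longrightarrow> norm (h u) \<le> H) \<Longrightarrow>
      norm (G t - G s) \<le> H / (- Re z) * (exp (- Re z * t) - exp (- Re z * s))"
    using exp_primitive[OF h, of z] by blast
  define k where "k = - Re z"
  have k: "k > 0" "K \<le> k" using K by (auto simp: k_def)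
  have H0: "H \<ge> 0" using order_trans[OF norm_ge_zero H[of 0]] J by auto
  have HK: "H / k \<le> H / K" using k K H0 by (intro divide_left_mono) auto
  have fin: "norm (exp (z * of_real t) * (G t - c)) \<le> H / K"
    if "norm (G t - c) \<le> H / k * exp (k * t)" for c t
  proof -
    have "norm (exp (z * of_real t) * (G t - c)) = exp (- k * t) * norm (G t - c)"
      by (simp add: norm_mult k_def)
    also have "\<dots> \<le> exp (- k * t) * (H / k * exp (k * t))"
      by (intro mult_left_mono that) auto
    also have "\<dots> = H / k" by (simp add: exp_minus)
    finally show ?thesis using HK by linarith
  qed
  show ?thesis
  proof (cases "J = UNIV")
    case True
    have b: "norm (G t - G s) \<le> H / k * (exp (k * t) - exp (k * s))" if "s \<le> t" for s t
      using Gb[OF _ that, of H] H True k by (auto simp: k_def)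
    have b': "norm (G t - G s) \<le> H / k * exp (k * max s t)" for s t
    proof -
      have "norm (G (max s t) - G (min s t)) \<le> H / k * (exp (k * max s t) - exp (k * min s t))"
        by (rule b) auto
      also have "\<dots> \<le> H / k * exp (k * max s t)"
        using H0 k by (intro mult_left_mono) auto
      finally show ?thesis by (auto simp: max_def min_def norm_minus_commute split: if_splits)
    qed
    have lim0: "(\<lambda>n. H / k * exp (k * - real n)) \<longlonglongrightarrow> 0"
    proof -
      have "(\<lambda>n. exp (- k) ^ n) \<longlonglongrightarrow> 0"
        by (rule LIMSEQ_realpow_zero) (use k in auto)
      then have "(\<lambda>n. H / k * exp (- k) ^ n) \<longlonglongrightarrow> 0"
        by (rule tendsto_mult_right_zero)
      then show ?thesis by (simp add: exp_of_nat_mult[symmetric] mult.commute)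
    qed
    \<comment> \<open>Increments of \<open>G\<close> left of t are at most (H/k) exp(k t), so
      \<open>G\<close> has a limit at minus infinity. This limit is the constant c; passing along
      the negative integers is enough.\<close>
    have "Cauchy (\<lambda>n. G (- real n))"
    proof (rule metric_CauchyI)
      fix e :: real assume "e > 0"
      with lim0 obtain N where N: "\<And>n. n \<ge> N \<Longrightarrow> H / k * exp (k * - real n) < e"
        by (metis (no_types, lifting) LIMSEQ_D abs_less_iff diff_zero real_norm_def)
      have "dist (G (- real m)) (G (- real n)) < e" if "m \<ge> N" "n \<ge> N" for m n
      proof -
        have "dist (G (- real m)) (G (- real n)) \<le> H / k * exp (k * - real (min m n))"
          using b'[of "- real n" "- real m"] b'[of "- real m" "- real n"]
          by (cases "m \<le> n") (auto simp: dist_norm max_def min_def)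
        then show ?thesis using N[of "min m n"] that by auto
      qed
      then show "\<exists>M. \<forall>m\<ge>M. \<forall>n\<ge>M. dist (G (- real m)) (G (- real n)) < e" by blast
    qed
    then obtain c where c: "(\<lambda>n. G (- real n)) \<longlonglongrightarrow> c"
      using Cauchy_convergent convergent_def by blast
    have "norm (G t - c) \<le> H / k * exp (k * t)" for t
    proof (rule tendsto_upperbound)
      show "(\<lambda>n. norm (G t - G (- real n))) \<longlonglongrightarrow> norm (G t - c)"
        by (intro tendsto_intros c)
      have "norm (G t - G (- real n)) \<le> H / k * exp (k * t)" if "n \<ge> nat \<lceil>- t\<rceil>" for n
      proof -
        have "- real n \<le> t" using that by linarith
        then show ?thesis using b'[of t "- real n"] by (simp add: max_def split: if_splits)
      qed
      then show "\<forall>\<^sub>F n in sequentially. norm (G t - G (- real n)) \<le> H / k * exp (k * t)"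
        unfolding eventually_sequentially by blast
    qed simp
    then show ?thesis using G[of c] fin True
      by (intro exI[of _ "\<lambda>t. exp (z * of_real t) * (G t - c)"]) auto
  next
    case False
    then have J': "J = {0..}" using J by simp
    have "norm (G t - G 0) \<le> H / k * exp (k * t)" if "t \<ge> 0" for t
    proof -
      have "norm (G t - G 0) \<le> H / k * (exp (k * t) - exp (k * 0))"
        using Gb[of 0 t H] H J' k that by (auto simp: k_def)
      also have "\<dots> \<le> H / k * exp (k * t)"
        using H0 k by (intro mult_left_mono) auto
      finally show ?thesis .
    qed
    then show ?thesis using G[of "G 0"] fin J'
      by (intro exI[of _ "\<lambda>t. exp (z * of_real t) * (G t - G 0)"]) auto
  qed
qed

lemma scalar_bounded_solution:
  fixes h :: "real \<Rightarrow> complex" and z :: complex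
  assumes h: "continuous_on UNIV h" and K: "0 < K" "K \<le> \<bar>Re z\<bar>"
    and J: "J = UNIV \<or> J = {0..} \<and> Re z < 0" and H: "\<And>t. t \<in> J \<Longrightarrow> norm (h t) \<le> H"
  shows "\<exists>w. (\<forall>t. (w has_vector_derivative z * w t + h t) (at t)) \<and> (\<forall>t\<in>J. norm (w t) \<le> H / K) \<and>
    (J = {0..} \<longrightarrow> w 0 = 0)"
proof (cases "Re z < 0")
  case True
  then show ?thesis
    using scalar_bounded_solution_stable[OF h K(1) _ _ H, of z] J K by auto
next
  case False
  then have J': "J = UNIV" using J by simp
  have "continuous_on UNIV (\<lambda>t. h (- t))"
    by (rule continuous_on_compose2[OF h]) (auto intro: continuous_intros)
  then obtain w where w: "\<And>t. (w has_vector_derivative (- z) * w t + h (- t)) (at t)"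
    "\<And>t. norm (w t) \<le> H / K"
    using scalar_bounded_solution_stable[of "\<lambda>t. h (- t)" K "- z" UNIV H] K H J' False by auto
  have "((\<lambda>t. - w (- t)) has_vector_derivative z * (- w (- t)) + h t) (at t)" for t
  proof -
    have "((w \<circ> uminus) has_vector_derivative (- 1) *\<^sub>R ((- z) * w (- t) + h (- (- t)))) (at t)"
      by (rule vector_diff_chain_at) (use w[of "- t"] in \<open>auto intro!: derivative_eq_intros\<close>)
    from has_vector_derivative_minus[OF this] show ?thesis by (simp add: o_def)
  qed
  moreover have "norm (- w (- t)) \<le> H / K" for t using w(2) by simp
  ultimately show ?thesis using J' by (intro exI[of _ "\<lambda>t. - w (- t)"]) auto
qed

section \<open>Bounded solutions of systems\<close>

lemma norm_vec_le_sum: "norm x \<le> (\<Sum>i\<in>UNIV. norm (x $ i))" for x :: "'a::real_normed_vector^'n"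
  unfolding norm_vec_def by (rule L2_set_le_sum) auto

lemma norm_axis_le: "norm (axis i y) \<le> norm y" for y :: "'a::real_normed_vector"
proof -
  have "norm (axis i y) \<le> (\<Sum>j\<in>UNIV. norm (axis i y $ j))" by (rule norm_vec_le_sum)
  also have "\<dots> = (\<Sum>j\<in>UNIV. if j = i then norm y else 0)"
    by (intro sum.cong) (auto simp: axis_def)
  finally show ?thesis by simp
qed

lemma has_vector_derivative_vec:
  fixes f :: "real \<Rightarrow> ('a::real_normed_vector)^'n"
  assumes "\<And>i. ((\<lambda>t. f t $ i) has_vector_derivative f' $ i) (at x within S)"
  shows "(f has_vector_derivative f') (at x within S)"
proof -
  have "bounded_linear (\<lambda>y::'a. axis i y :: 'a^'n)" for i
    by (rule bounded_linear_intro[where K=1])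
      (use norm_axis_le in \<open>auto simp: vec_eq_iff axis_def\<close>)
  then have "((\<lambda>t. \<Sum>i\<in>UNIV. axis i (f t $ i)) has_vector_derivative (\<Sum>i\<in>UNIV. axis i (f' $ i))) (at x within S)"
    by (intro has_vector_derivative_sum bounded_linear.has_vector_derivative[where f="axis _"] assms)
  moreover have "(\<Sum>i\<in>UNIV. axis i (y $ i)) = y" for y :: "'a^'n"
    by (simp add: vec_eq_iff axis_def if_distrib sum.delta cong: if_cong)
  ultimately show ?thesis by simp
qed

lemma vector_bounded_solution:
  fixes h :: "real \<Rightarrow> complex^'n" and z :: complex
  assumes h: "continuous_on UNIV h" and K: "0 < K" "K \<le> \<bar>Re z\<bar>"
    and J: "J = UNIV \<or> J = {0..} \<and> Re z < 0" and H: "\<And>t. t \<in> J \<Longrightarrow> norm (h t) \<le> H"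
  shows "\<exists>w. (\<forall>t. (w has_vector_derivative z *s w t + h t) (at t)) \<and>
    (\<forall>t\<in>J. norm (w t) \<le> real CARD('n) / K * H) \<and> (J = {0..} \<longrightarrow> w 0 = 0)"
proof -
  have "\<forall>i. \<exists>w. (\<forall>t. (w has_vector_derivative z * w t + h t $ i) (at t)) \<and>
    (\<forall>t\<in>J. norm (w t) \<le> H / K) \<and> (J = {0..} \<longrightarrow> w 0 = 0)"
  proof
    fix i
    have "continuous_on UNIV (\<lambda>t. h t $ i)" by (intro continuous_intros h)
    moreover have "norm (h t $ i) \<le> H" if "t \<in> J" for t
      using H[OF that] Finite_Cartesian_Product.norm_nth_le[of "h t" i] by linarith
    ultimately show "\<exists>w. (\<forall>t. (w has_vector_derivative z * w t + h t $ i) (at t)) \<and>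
      (\<forall>t\<in>J. norm (w t) \<le> H / K) \<and> (J = {0..} \<longrightarrow> w 0 = 0)"
      by (intro scalar_bounded_solution K J)
  qed
  then obtain w where w: "\<And>i t. (w i has_vector_derivative z * w i t + h t $ i) (at t)"
    "\<And>i t. t \<in> J \<Longrightarrow> norm (w i t) \<le> H / K" "\<And>i. J = {0..} \<Longrightarrow> w i 0 = 0"
    by metis
  define u where "u t = (\<chi> i. w i t)" for t
  have "(u has_vector_derivative z *s u t + h t) (at t)" for t
    by (rule has_vector_derivative_vec) (use w(1) in \<open>simp add: u_def\<close>)
  moreover have "norm (u t) \<le> real CARD('n) / K * H" if "t \<in> J" for t
  proof -
    have "norm (u t) \<le> (\<Sum>i\<in>UNIV. norm (u t $ i))" by (rule norm_vec_le_sum)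
    also have "\<dots> \<le> (\<Sum>i\<in>(UNIV::'n set). H / K)"
      by (intro sum_mono) (simp add: u_def w(2) that)
    finally show ?thesis by simp
  qed
  moreover have "u 0 = 0" if "J = {0..}" using w(3)[OF that] by (simp add: u_def vec_eq_iff)
  ultimately show ?thesis by blast
qed

text \<open>In the spirit of Putzer's algorithm, eigenvalues are removed one at a time;
  \<open>xs\<close> holds those already used. Let P be the product over \<open>xs\<close> and let w
  solve w' = z w + v. Then P w solves the required equation up to the error - (T - z) P w, which is
  again a product of factors applied to a bounded function and is compensated by the induction
  hypothesis for \<open>xs @ [z]\<close> and w. When \<open>ys\<close> is empty the full product
  stands in front of v and the inhomogeneity is zero.\<close>

lemma putzer_solution:
  fixes T :: "complex^'n^'n" and v :: "real \<Rightarrow> complex^'n"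
  assumes K: "0 < K" and b: "1 \<le> b" and c: "1 \<le> c" "real CARD('n) / K \<le> c"
    and J: "J = UNIV \<or> J = {0..}"
  shows "(\<forall>x. shift_prod T (xs @ ys) x = 0) \<Longrightarrow>
    (\<forall>z\<in>set (xs @ ys). K \<le> \<bar>Re z\<bar> \<and> (J = {0..} \<longrightarrow> Re z < 0) \<and> (\<forall>x. norm (shift_op T z x) \<le> b * norm x)) \<Longrightarrow>
    continuous_on UNIV v \<Longrightarrow> (\<forall>t\<in>J. norm (v t) \<le> H) \<Longrightarrow>
    \<exists>u. (\<forall>t. (u has_vector_derivative T *v u t + shift_prod T xs (v t)) (at t)) \<and>
      (\<forall>t\<in>J. norm (u t) \<le> real (length ys) * b ^ (length xs + length ys) * c ^ length ys * H) \<and>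
      (J = {0..} \<longrightarrow> u 0 = 0)"
proof (induction ys arbitrary: xs v H)
  case Nil
  have d: "((\<lambda>t. 0) has_vector_derivative T *v 0 + shift_prod T xs (v t)) (at t)" for t
    using Nil.prems(1) by simp
  then show ?case by (intro exI[of _ "\<lambda>t. 0"]) auto
next
  case (Cons z ys)
  have z: "K \<le> \<bar>Re z\<bar>" "J = UNIV \<or> J = {0..} \<and> Re z < 0"
    using Cons.prems(2) J by auto
  have H0: "0 \<le> H" using Cons.prems(4) J order_trans[OF norm_ge_zero, of "v 0"] by auto
  obtain w where w: "\<And>t. (w has_vector_derivative z *s w t + v t) (at t)"
    "\<And>t. t \<in> J \<Longrightarrow> norm (w t) \<le> real CARD('n) / K * H" "J = {0..} \<longrightarrow> w 0 = 0"
    using vector_bounded_solution[OF Cons.prems(3) K z, of H] Cons.prems(4) by auto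
  have wb: "norm (w t) \<le> c * H" if "t \<in> J" for t
    using w(2)[OF that] mult_right_mono[OF c(2) H0] by linarith
  have wc: "continuous_on UNIV w"
    using w(1) by (auto intro!: continuous_at_imp_continuous_on has_vector_derivative_continuous)
  have "\<exists>u. (\<forall>t. (u has_vector_derivative T *v u t + shift_prod T (xs @ [z]) (w t)) (at t)) \<and>
      (\<forall>t\<in>J. norm (u t) \<le> real (length ys) * b ^ (length (xs @ [z]) + length ys) * c ^ length ys * (c * H)) \<and>
      (J = {0..} \<longrightarrow> u 0 = 0)"
    by (rule Cons.IH) (use Cons.prems(1,2) wc wb in auto)
  then obtain u1 where u1: "\<And>t. (u1 has_vector_derivative T *v u1 t + shift_prod T (xs @ [z]) (w t)) (at t)"
    "\<forall>t\<in>J. norm (u1 t) \<le> real (length ys) * b ^ (length (xs @ [z]) + length ys) * c ^ length ys * (c * H)"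
    "J = {0..} \<longrightarrow> u1 0 = 0"
    by blast
  define u where "u t = shift_prod T xs (w t) + u1 t" for t
  have smul: "shift_prod T zs (a *s v) = a *s shift_prod T zs v" for zs a v
    by (induction zs arbitrary: v)
      (simp_all add: shift_op_def matrix_vector_smult vsmult_diff vector_smult_assoc mult.commute,
        metis (no_types, lifting) mult.commute vector_smult_assoc vsmult_diff)
  have bl: "bounded_linear (shift_prod T xs)"
    using shift_prod_linear linear_conv_bounded_linear by blast
  have "(u has_vector_derivative T *v u t + shift_prod T xs (v t)) (at t)" for t
  proof -
    have "((\<lambda>t. shift_prod T xs (w t)) has_vector_derivative shift_prod T xs (z *s w t + v t)) (at t)"
      by (rule bounded_linear.has_vector_derivative[OF bl w(1)])
    from has_vector_derivative_add[OF this u1(1)[of t]]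
    have "(u has_vector_derivative shift_prod T xs (z *s w t + v t) +
        (T *v u1 t + shift_prod T (xs @ [z]) (w t))) (at t)"
      unfolding u_def[abs_def] .
    moreover have "shift_prod T xs (z *s w t + v t) = z *s shift_prod T xs (w t) + shift_prod T xs (v t)"
      by (simp add: linear_add[OF shift_prod_linear] smul)
    moreover have "shift_prod T (xs @ [z]) (w t) = T *v shift_prod T xs (w t) - z *s shift_prod T xs (w t)"
      by (simp add: shift_prod_append shift_op_def)
    ultimately show ?thesis
      by (simp add: u_def matrix_vector_right_distrib algebra_simps)
  qed
  moreover have "norm (u t) \<le> real (length (z # ys)) * b ^ (length xs + length (z # ys)) * c ^ length (z # ys) * H"
    if t: "t \<in> J" for t
  proof -
    have pw: "norm (shift_prod T zs x) \<le> b ^ length zs * norm x" if "set zs \<subseteq> set (xs @ z # ys)" for zs x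
      using that
    proof (induction zs arbitrary: x)
      case (Cons y zs)
      then have "norm (shift_prod T (y # zs) x) \<le> b ^ length zs * norm (shift_op T y x)" by simp
      also have "\<dots> \<le> b ^ length zs * (b * norm x)"
        using Cons.prems \<open>\<forall>z\<in>set (xs @ z # ys). _\<close> b by (intro mult_left_mono) auto
      finally show ?case by (simp add: mult_ac)
    qed simp
    let ?m = "length ys" and ?l = "length xs"
    have "norm (shift_prod T xs (w t)) \<le> b ^ ?l * norm (w t)" by (rule pw) auto
    also have "\<dots> \<le> b ^ ?l * (c * H)" using wb[OF t] b by (intro mult_left_mono) auto
    \<comment> \<open>Padding with further factors b and c, both at least 1, brings all summands to
      the same power, so that only their number \<open>length ys\<close> has to be counted.\<close>
    also have "\<dots> \<le> b ^ (?l + Suc ?m) * (c * H)"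
      using b c H0 by (intro mult_right_mono power_increasing) auto
    also have "\<dots> \<le> b ^ (?l + Suc ?m) * (c ^ Suc ?m * H)"
    proof (intro mult_left_mono mult_right_mono)
      show "c \<le> c ^ Suc ?m" using power_increasing[of 1 "Suc ?m" c] c by simp
    qed (use b H0 in auto)
    finally have "norm (shift_prod T xs (w t)) \<le> b ^ (?l + Suc ?m) * c ^ Suc ?m * H"
      by (simp add: mult_ac)
    moreover have "norm (u1 t) \<le> real ?m * b ^ (?l + Suc ?m) * c ^ Suc ?m * H"
      using u1(2) t by (simp add: mult_ac)
    moreover have "norm (u t) \<le> norm (shift_prod T xs (w t)) + norm (u1 t)"
      unfolding u_def by (rule norm_triangle_ineq)
    ultimately have "norm (u t) \<le> b ^ (?l + Suc ?m) * c ^ Suc ?m * H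
        + real ?m * b ^ (?l + Suc ?m) * c ^ Suc ?m * H" by linarith
    also have "\<dots> = real (Suc ?m) * b ^ (?l + Suc ?m) * c ^ Suc ?m * H"
      by (simp only: of_nat_Suc distrib_right mult_1 add.commute)
    finally show ?thesis by simp
  qed
  moreover have "J = {0..} \<longrightarrow> u 0 = 0"
    using u1(3) w(3) by (simp add: u_def linear_0[OF shift_prod_linear])
  ultimately show ?case by blast
qed

text \<open>The data on which all constants of the linear theory depend. The half line is allowed
  only for stable matrices: only then can every mode be given an initial value and still be solved
  by a bounded function.\<close>

definition admissible :: "real \<Rightarrow> real \<Rightarrow> real set \<Rightarrow> real^'n^'n \<Rightarrow> bool" where
  "admissible a K J A \<longleftrightarrow> (\<forall>i j. \<bar>A $ i $ j\<bar> \<le> a) \<and> (\<forall>z\<in>spect A. K \<le> \<bar>Re z\<bar>) \<and>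
     (J = UNIV \<or> J = {0..} \<and> (\<forall>z\<in>spect A. Re z < 0))"

lemma norm_cmat_mult_le:
  fixes A :: "real^'n^'n"
  assumes "\<And>i j. \<bar>A $ i $ j\<bar> \<le> a"
  shows "norm (cmat A *v v) \<le> real CARD('n) * real CARD('n) * a * norm v"
proof -
  have "norm (cmat A *v v) \<le> (\<Sum>i\<in>UNIV. norm ((cmat A *v v) $ i))" by (rule norm_vec_le_sum)
  also have "\<dots> \<le> (\<Sum>i\<in>(UNIV::'n set). \<Sum>j\<in>(UNIV::'n set). a * norm v)"
  proof (intro sum_mono)
    fix i
    have "norm ((cmat A *v v) $ i) \<le> (\<Sum>j\<in>UNIV. norm (cmat A $ i $ j * v $ j))"
      unfolding matrix_vector_mult_def by (simp add: norm_sum)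
    also have "\<dots> \<le> (\<Sum>j\<in>(UNIV::'n set). a * norm v)"
      using assms Finite_Cartesian_Product.norm_nth_le[of v] order_trans[OF abs_ge_zero assms]
      by (intro sum_mono) (auto simp: norm_mult cmat_def intro!: mult_mono)
    finally show "norm ((cmat A *v v) $ i) \<le> (\<Sum>j\<in>(UNIV::'n set). a * norm v)" .
  qed
  finally show ?thesis by simp
qed

definition cvec :: "real^'n \<Rightarrow> complex^'n" where "cvec v = (\<chi> i. complex_of_real (v $ i))"
definition re_vec :: "complex^'n \<Rightarrow> real^'n" where "re_vec v = (\<chi> i. Re (v $ i))"

lemma norm_cvec [simp]: "norm (cvec v) = norm v"
  by (simp add: norm_vec_def cvec_def)

lemma norm_re_vec_le: "norm (re_vec v) \<le> norm v"
  unfolding norm_vec_def re_vec_def by (intro L2_set_mono) (auto simp: abs_Re_le_cmod)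

lemma bounded_linear_cvec: "bounded_linear cvec"
proof (rule bounded_linear_intro[where K=1])
  show "cvec (r *\<^sub>R x) = r *\<^sub>R cvec x" for r and x :: "real^'n"
    unfolding vec_scaleR_complex by (simp add: cvec_def vec_eq_iff)
qed (simp_all, simp add: cvec_def vec_eq_iff)

lemma bounded_linear_re_vec: "bounded_linear re_vec"
proof (rule bounded_linear_intro[where K=1])
  show "norm (re_vec v) \<le> norm v * 1" for v :: "complex^'n" using norm_re_vec_le by simp
qed (auto simp: re_vec_def vec_eq_iff)

lemma re_vec_cvec [simp]: "re_vec (cvec v) = v"
  by (simp add: re_vec_def cvec_def vec_eq_iff)

lemma cvec_mult: "cvec (A *v v) = cmat A *v cvec v"
  by (simp add: cvec_def cmat_def vec_eq_iff matrix_vector_mult_def)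

lemma re_vec_mult: "re_vec (cmat A *v v) = A *v re_vec v"
  by (simp add: re_vec_def cmat_def vec_eq_iff matrix_vector_mult_def)

text \<open>The point is the order of the quantifiers: one constant for all admissible matrices and
  both time domains. It is the bound of \<open>putzer_solution\<close> with every ingredient
  estimated through \<open>K\<close>, a and the dimension.\<close>

lemma const_coeff_solution:
  fixes a K :: real
  assumes "0 < K"
  shows "\<exists>C>0. \<forall>(A::real^'n^'n) J h H. admissible a K J A \<longrightarrow> continuous_on UNIV h \<longrightarrow> (\<forall>t\<in>J. norm (h t) \<le> H) \<longrightarrow>
     (\<exists>u. (\<forall>t. (u has_vector_derivative A *v u t + h t) (at t)) \<and>
       (\<forall>t\<in>J. norm (u t) \<le> C * H) \<and> (J = {0..} \<longrightarrow> u 0 = 0))"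
proof -
  define N where "N = DIM(complex^'n^'n)"
  \<comment> \<open>\<beta> bounds the operator norm of A and hence each of its eigenvalues, so 2
    \<beta> bounds the norm of every factor A - z.\<close>
  define \<beta> where "\<beta> = real CARD('n) * real CARD('n) * \<bar>a\<bar>"
  define b where "b = max 1 (2 * \<beta>)"
  define c where "c = max 1 (real CARD('n) / K)"
  have bc: "1 \<le> b" "1 \<le> c" "real CARD('n) / K \<le> c" by (auto simp: b_def c_def)
  have N: "N > 0" by (simp add: N_def)
  show ?thesis
  proof (intro exI[of _ "real N * b ^ N * c ^ N"] conjI allI impI)
    show "real N * b ^ N * c ^ N > 0" using N bc by simp
  next
    fix A :: "real^'n^'n" and J H and h :: "real \<Rightarrow> real^'n"
    assume A: "admissible a K J A" and h: "continuous_on UNIV h" and hH: "\<forall>t\<in>J. norm (h t) \<le> H"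
    have J: "J = UNIV \<or> J = {0..}" using A by (auto simp: admissible_def)
    have H0: "0 \<le> H" using hH J order_trans[OF norm_ge_zero, of "h 0"] by auto
    obtain zs where zs: "length zs \<le> N" "set zs \<subseteq> spect A" "\<forall>v. shift_prod (cmat A) zs v = 0"
      using annihilating_eigenvalue_list[of A] unfolding N_def by blast
    have nb: "norm (cmat A *v v) \<le> \<beta> * norm v" for v
      unfolding \<beta>_def using A
      by (intro norm_cmat_mult_le) (meson abs_ge_self admissible_def order_trans)
    have sh: "norm (shift_op (cmat A) z x) \<le> b * norm x" if z: "z \<in> spect A" for z x
    proof -
      obtain v where v: "v \<noteq> 0" "cmat A *v v = z *s v" using z by (auto simp: spect_def cmat_def)
      have nz: "norm (z *s y) = norm z * norm y" for y :: "complex^'n"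
        unfolding norm_vec_def vector_smult_component norm_mult
        by (rule L2_set_right_distrib[symmetric]) simp
      have "norm z * norm v \<le> \<beta> * norm v" using nb[of v] v nz[of v] by simp
      then have "norm z \<le> \<beta>" using v by simp
      then have "norm z * norm x \<le> \<beta> * norm x" by (intro mult_right_mono) auto
      then have "norm (shift_op (cmat A) z x) \<le> \<beta> * norm x + \<beta> * norm x"
        unfolding shift_op_def using norm_triangle_ineq4[of "cmat A *v x" "z *s x"] nb[of x] nz[of x] by linarith
      also have "\<dots> = (2 * \<beta>) * norm x" by simp
      also have "\<dots> \<le> b * norm x" by (intro mult_right_mono) (auto simp: b_def)
      finally show ?thesis .
    qed
    have hc: "continuous_on UNIV (\<lambda>t. cvec (h t))"
      by (intro bounded_linear.continuous_on[OF bounded_linear_cvec] h)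
    have "\<exists>u. (\<forall>t. (u has_vector_derivative cmat A *v u t + shift_prod (cmat A) [] (cvec (h t))) (at t)) \<and>
      (\<forall>t\<in>J. norm (u t) \<le> real (length zs) * b ^ (length ([] :: complex list) + length zs) * c ^ length zs * H) \<and>
      (J = {0..} \<longrightarrow> u 0 = 0)"
      by (rule putzer_solution[OF assms bc J])
        (use A zs sh hc hH in \<open>auto simp: admissible_def\<close>)
    then obtain u where u: "\<And>t. (u has_vector_derivative cmat A *v u t + cvec (h t)) (at t)"
      "\<And>t. t \<in> J \<Longrightarrow> norm (u t) \<le> real (length zs) * b ^ length zs * c ^ length zs * H" "J = {0..} \<longrightarrow> u 0 = 0"
      by auto
    \<comment> \<open>The matrix and the forcing are real, so the real part of the complex solution
      solves the same system.\<close>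
    have "((\<lambda>t. re_vec (u t)) has_vector_derivative A *v re_vec (u t) + h t) (at t)" for t
      using bounded_linear.has_vector_derivative[OF bounded_linear_re_vec u(1)[of t]]
      by (simp add: linear_add[OF bounded_linear.linear[OF bounded_linear_re_vec]] re_vec_mult)
    moreover have "norm (re_vec (u t)) \<le> real N * b ^ N * c ^ N * H" if "t \<in> J" for t
    proof -
      have "real (length zs) * b ^ length zs * c ^ length zs * H \<le> real N * b ^ N * c ^ N * H"
        using bc zs(1) H0 by (intro mult_mono power_increasing mult_nonneg_nonneg) auto
      then show ?thesis using u(2)[OF that] norm_re_vec_le[of "u t"] by linarith
    qed
    moreover have "J = {0..} \<longrightarrow> re_vec (u 0) = 0" using u(3) by (simp add: re_vec_def vec_eq_iff)
    ultimately show "\<exists>u. (\<forall>t. (u has_vector_derivative A *v u t + h t) (at t)) \<and>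
       (\<forall>t\<in>J. norm (u t) \<le> real N * b ^ N * c ^ N * H) \<and> (J = {0..} \<longrightarrow> u 0 = 0)"
      by (intro exI[of _ "\<lambda>t. re_vec (u t)"]) auto
  qed
qed

section \<open>Uniqueness of bounded solutions\<close>

text \<open>Such a function is c exp(z t), and its modulus is unbounded in one of the two time
  directions unless c = 0.\<close>

lemma bounded_eigenfunction_zero:
  fixes y :: "real \<Rightarrow> complex"
  assumes y: "\<And>t. (y has_vector_derivative z * y t) (at t)" and z: "Re z \<noteq> 0"
    and b: "\<And>t. norm (y t) \<le> M"
  shows "y t = 0"
proof -
  have "((\<lambda>t. exp (- z * of_real t) * y t) has_vector_derivative 0) (at t)" for t
  proof -
    have "((\<lambda>w. exp (- z * w)) has_field_derivative (- z * exp (- z * of_real t))) (at (of_real t))"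
      by (auto intro!: derivative_eq_intros)
    then have "((\<lambda>t. exp (- z * of_real t)) has_vector_derivative (- z * exp (- z * of_real t))) (at t)"
      by (rule has_vector_derivative_real_field)
    from has_vector_derivative_mult[OF this y[of t]] show ?thesis
      by (simp add: mult_ac)
  qed
  then obtain c where c: "\<And>t. exp (- z * of_real t) * y t = c"
    using has_vector_derivative_zero_constant[of UNIV "\<lambda>t. exp (- z * of_real t) * y t" thesis]
    by (metis UNIV_I convex_UNIV)
  have y': "y t = exp (z * of_real t) * c" for t
    by (simp add: c[of t, symmetric] mult.assoc[symmetric] exp_add[symmetric])
  have M: "exp (Re z * t) * norm c \<le> M" for t
    using b[of t] by (simp add: y' norm_mult)
  have "norm c = 0"
  proof (rule ccontr)
    assume "norm c \<noteq> 0"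
    then have nc: "norm c > 0" by simp
    \<comment> \<open>At this time the exponent equals x = M / norm c, and the bound would give exp
      x <= x, against exp x >= 1 + x.\<close>
    define s where "s = (M / norm c) / Re z"
    have e: "Re z * s = M / norm c" using z by (simp add: s_def)
    have "M / norm c + 1 \<le> exp (M / norm c)" using exp_ge_add_one_self[of "M / norm c"] by linarith
    also have "\<dots> \<le> M / norm c" using M[of s] nc unfolding e by (simp add: field_simps)
    finally show False by simp
  qed
  then show ?thesis by (simp add: y')
qed

text \<open>The full annihilating product kills u. If the product P over a prefix followed by T - z
  kills u, then P u is a bounded solution of the scalar equation with eigenvalue z and therefore
  vanishes. Removing the factors from the end of the list in this way leaves u itself.\<close>

lemma const_coeff_unique:
  fixes A :: "real^'n^'n"
  assumes A: "\<And>z. z \<in> spect A \<Longrightarrow> Re z \<noteq> 0"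
    and u: "\<And>t. (u has_vector_derivative A *v u t) (at t)" and b: "\<And>t. norm (u t) \<le> M"
  shows "u t = 0"
proof -
  obtain zs where zs: "set zs \<subseteq> spect A" "\<And>v. shift_prod (cmat A) zs v = 0"
    using annihilating_eigenvalue_list[of A] by blast
  have "\<forall>t. shift_prod (cmat A) xs (cvec (u t)) = 0" if "zs = xs @ ys" for xs ys
    using that
  proof (induction ys arbitrary: xs)
    case Nil
    then show ?case using zs(2) by simp
  next
    case (Cons z ys)
    let ?S = "shift_prod (cmat A) xs"
    have z: "Re z \<noteq> 0" using A zs(1) Cons.prems by auto
    have "shift_prod (cmat A) (xs @ [z]) (cvec (u t)) = 0" for t
      using Cons.IH[of "xs @ [z]"] Cons.prems by simp
    then have e: "cmat A *v ?S (cvec (u t)) = z *s ?S (cvec (u t))" for t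
      by (simp add: shift_prod_append shift_op_def)
    have comm: "shift_prod (cmat A) xs (cmat A *v x) = cmat A *v shift_prod (cmat A) xs x" for xs x
      by (induction xs arbitrary: x)
        (simp_all add: shift_op_def matrix_vector_mult_diff_distrib matrix_vector_smult,
         metis matrix_vector_mult_diff_distrib matrix_vector_smult)
    have bl: "bounded_linear ?S"
      using shift_prod_linear linear_conv_bounded_linear by blast
    obtain B where B: "\<And>x. norm (?S x) \<le> norm x * B" "B > 0"
      using bounded_linear.pos_bounded[OF bl] by blast
    have d: "((\<lambda>t. ?S (cvec (u t))) has_vector_derivative z *s ?S (cvec (u t))) (at t)" for t
      using bounded_linear.has_vector_derivative[OF bl bounded_linear.has_vector_derivative[OF bounded_linear_cvec u[of t]]]
      by (simp add: cvec_mult comm e)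
    have "?S (cvec (u t)) $ i = 0" for i t
    proof (rule bounded_eigenfunction_zero[OF _ z, of "\<lambda>t. ?S (cvec (u t)) $ i"])
      show "((\<lambda>t. ?S (cvec (u t)) $ i) has_vector_derivative z * ?S (cvec (u t)) $ i) (at t)" for t
        using bounded_linear.has_vector_derivative[OF bounded_linear_vec_nth d[of t], of i] by simp
      show "norm (?S (cvec (u t)) $ i) \<le> M * B" for t
      proof -
        have "norm (?S (cvec (u t)) $ i) \<le> norm (?S (cvec (u t)))"
          by (rule Finite_Cartesian_Product.norm_nth_le)
        also have "\<dots> \<le> norm (u t) * B" using B(1)[of "cvec (u t)"] by simp
        also have "\<dots> \<le> M * B" using b B(2) by (intro mult_right_mono) auto
        finally show ?thesis .
      qed
    qed
    then show ?case by (simp add: vec_eq_iff)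
  qed
  from this[of "[]" zs] have "cvec (u t) = 0" by simp
  then show ?thesis by (metis re_vec_cvec norm_cvec norm_eq_zero)
qed

section \<open>Linear systems with slowly varying coefficients\<close>

lemma bounded_bilinear_matrix_vector:
  "bounded_bilinear ((*v) :: real^'n^'m \<Rightarrow> real^'n \<Rightarrow> real^'m)"
  unfolding bilinear_conv_bounded_bilinear[symmetric] bilinear_def
  by (auto intro!: linearI simp: matrix_vector_right_distrib matrix_vector_mult_scaleR
      matrix_vector_mult_add_rdistrib scaleR_matrix_vector_assoc)

lemmas continuous_on_matrix_vector_mult =
  bounded_bilinear.continuous_on[OF bounded_bilinear_matrix_vector]

section \<open>A continuously differentiable partition of unity\<close>

text \<open>A quadratic spline rising from 0 to 1 on the unit interval. Its derivative
  \<open>ramp'\<close> is the hat function of height 2 on that interval. One continuous derivative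
  suffices, since cut-offs are differentiated only once.\<close>

definition ramp :: "real \<Rightarrow> real" where
  "ramp x = 2 * (x * max 0 x) - 4 * ((x - 1/2) * max 0 (x - 1/2)) + 2 * ((x - 1) * max 0 (x - 1))"

definition ramp' :: "real \<Rightarrow> real" where
  "ramp' x = 4 * max 0 x - 8 * max 0 (x - 1/2) + 4 * max 0 (x - 1)"

lemma has_real_derivative_pos_part_sq:
  "((\<lambda>x. (x - a) * max 0 (x - a)) has_real_derivative 2 * max 0 (x - a)) (at x)" for a x :: real
proof (cases "x = a")
  case True
  have "((\<lambda>h. h * max 0 h / h) \<longlongrightarrow> 0) (at (0::real))"
  proof (rule Lim_transform_eventually)
    show "((\<lambda>h. max 0 h) \<longlongrightarrow> 0) (at (0::real))"
      using tendsto_max[OF tendsto_const[of 0] tendsto_ident_at, of 0 UNIV] by simp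
    show "\<forall>\<^sub>F h in at (0::real). max 0 h = h * max 0 h / h"
      by (simp add: eventually_at_filter)
  qed
  then show ?thesis using True by (simp add: DERIV_def)
next
  case False
  show ?thesis
  proof (cases "x < a")
    case True
    have "((\<lambda>x. 0) has_real_derivative 0) (at x)" by simp
    then have "((\<lambda>x. (x - a) * max 0 (x - a)) has_real_derivative 0) (at x)"
      by (rule has_field_derivative_transform_within_open[where S="{..<a}"]) (use True in auto)
    then show ?thesis using True by simp
  next
    case F: False
    have "((\<lambda>x. (x - a)^2) has_real_derivative 2 * (x - a)) (at x)"
      by (auto intro!: derivative_eq_intros)
    then have "((\<lambda>x. (x - a) * max 0 (x - a)) has_real_derivative 2 * (x - a)) (at x)"
      by (rule has_field_derivative_transform_within_open[where S="{a<..}"])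
        (use F False in \<open>auto simp: power2_eq_square\<close>)
    then show ?thesis using F by simp
  qed
qed

lemma ramp_deriv: "(ramp has_real_derivative ramp' x) (at x)"
proof -
  have "(ramp has_real_derivative 2 * (2 * max 0 (x - 0)) - 4 * (2 * max 0 (x - 1/2)) + 2 * (2 * max 0 (x - 1))) (at x)"
    unfolding ramp_def[abs_def]
    using has_real_derivative_pos_part_sq[of 0 x]
    by (intro DERIV_add DERIV_diff DERIV_cmult has_real_derivative_pos_part_sq) simp
  then show ?thesis by (simp add: ramp'_def)
qed

lemma continuous_ramp': "continuous_on S ramp'"
  unfolding ramp'_def[abs_def] by (intro continuous_intros)

lemma ramp_simps: "x \<le> 0 \<Longrightarrow> ramp x = 0" "1 \<le> x \<Longrightarrow> ramp x = 1"
  "x \<le> 0 \<Longrightarrow> ramp' x = 0" "1 \<le> x \<Longrightarrow> ramp' x = 0"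
  by (auto simp: ramp_def ramp'_def max_def algebra_simps)

lemma ramp_bounds: "0 \<le> ramp x" "ramp x \<le> 1" "0 \<le> ramp' x" "ramp' x \<le> 2"
proof -
  consider "x \<le> 0" | "0 \<le> x" "x \<le> 1/2" | "1/2 \<le> x" "x \<le> 1" | "1 \<le> x" by linarith
  then have "0 \<le> ramp x \<and> ramp x \<le> 1 \<and> 0 \<le> ramp' x \<and> ramp' x \<le> 2"
  proof cases
    case 2
    have "x * x \<le> 1/2 * (1/2)" using 2 by (intro mult_mono) auto
    moreover have "ramp x = 2 * (x * x)" "ramp' x = 4 * x" using 2
      by (cases "x = 1/2"; simp add: ramp_def ramp'_def max_def)+
    ultimately show ?thesis using 2 by auto
  next
    case 3
    have e: "ramp x = 1 - 2 * ((1 - x) * (1 - x))" using 3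
      by (auto simp: ramp_def max_def algebra_simps)
    have "(1 - x) * (1 - x) \<le> 1/2 * (1/2)" using 3 by (intro mult_mono) auto
    then show ?thesis using 3 e by (auto simp: ramp'_def max_def)
  qed (auto simp: ramp_simps)
  then show "0 \<le> ramp x" "ramp x \<le> 1" "0 \<le> ramp' x" "ramp' x \<le> 2" by auto
qed

definition bump :: "real \<Rightarrow> real" where "bump x = ramp (x + 1) - ramp x"
definition bump' :: "real \<Rightarrow> real" where "bump' x = ramp' (x + 1) - ramp' x"

lemma bump_deriv: "(bump has_real_derivative bump' x) (at x)"
proof -
  have "((\<lambda>x. ramp (x + 1)) has_real_derivative ramp' (x + 1)) (at x)"
    using ramp_deriv[of "x + 1"] by (simp only: DERIV_shift)
  then show ?thesis unfolding bump_def[abs_def] bump'_def by (intro DERIV_diff ramp_deriv)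
qed

lemma continuous_bump: "continuous_on S bump"
  using bump_deriv by (meson DERIV_isCont continuous_at_imp_continuous_on)

lemma continuous_bump': "continuous_on S bump'"
  unfolding bump'_def[abs_def]
  by (intro continuous_intros continuous_ramp' continuous_on_compose2[OF continuous_ramp'[of UNIV]]) auto

lemma bump_outside: "1 \<le> \<bar>x\<bar> \<Longrightarrow> bump x = 0" "1 \<le> \<bar>x\<bar> \<Longrightarrow> bump' x = 0"
  by (auto simp: bump_def bump'_def ramp_simps abs_if split: if_splits)

lemma bump_bounds: "\<bar>bump x\<bar> \<le> 1" "\<bar>bump' x\<bar> \<le> 2"
  using ramp_bounds[of x] ramp_bounds[of "x + 1"] by (auto simp: bump_def bump'_def)

lemma bump_0 [simp]: "bump 0 = 1"
  by (simp add: bump_def ramp_simps)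

lemma bump_scaled_deriv:
  assumes "0 < W"
  shows "((\<lambda>t. bump (t / W - c)) has_real_derivative bump' (t / W - c) / W) (at t)"
proof -
  have "((\<lambda>t. t / W - c) has_real_derivative 1 / W) (at t)"
    using assms by (auto intro!: derivative_eq_intros)
  from DERIV_chain2[OF bump_deriv this] show ?thesis by simp
qed

text \<open>A bump is a difference of two neighbouring ramps, so the sum of its integer translates
  telescopes to one ramp that is already 1 minus one that is still 0.\<close>

lemma bump_partition:
  assumes "m \<le> \<lfloor>x\<rfloor>" "\<lfloor>x\<rfloor> + 1 \<le> n"
  shows "(\<Sum>k\<in>{m..n}. bump (x - of_int k)) = 1"
proof -
  have "(\<Sum>k\<in>{m..m + int d}. bump (x - of_int k)) = ramp (x - of_int m + 1) - ramp (x - of_int (m + int d))" for d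
  proof (induction d)
    case (Suc d)
    have "{m..m + int (Suc d)} = insert (m + int (Suc d)) {m..m + int d}" by auto
    then show ?case using Suc by (simp add: bump_def algebra_simps)
  qed (simp add: bump_def algebra_simps)
  from this[of "nat (n - m)"] have "(\<Sum>k\<in>{m..n}. bump (x - of_int k)) = ramp (x - of_int m + 1) - ramp (x - of_int n)"
    using assms by simp
  also have "ramp (x - of_int m + 1) = 1" using assms by (intro ramp_simps) linarith
  also have "ramp (x - of_int n) = 0" using assms by (intro ramp_simps) linarith
  finally show ?thesis by simp
qed

text \<open>The sum over all integers k of functions supported where t/W is within 1 of k. At most
  two of them are nonzero at a given t; the window of six indices has slack on both sides so that it
  can be held fixed while t moves by less than \<open>W\<close>.\<close>

definition near_sum :: "real \<Rightarrow> (int \<Rightarrow> real \<Rightarrow> 'a::comm_monoid_add) \<Rightarrow> real \<Rightarrow> 'a" where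
  "near_sum W g t = (\<Sum>k\<in>{\<lfloor>t / W\<rfloor> - 2..\<lfloor>t / W\<rfloor> + 3}. g k t)"

text \<open>Replaces the index window that moves with t by a fixed one near s. Differentiation and
  continuity are then questions about a finite sum.\<close>

lemma near_sum_local:
  assumes "0 < W" and z: "\<And>k t. 1 \<le> \<bar>t / W - of_int k\<bar> \<Longrightarrow> g k t = 0" and t: "\<bar>t - s\<bar> < W"
  shows "near_sum W g t = (\<Sum>k\<in>{\<lfloor>s / W\<rfloor> - 2..\<lfloor>s / W\<rfloor> + 3}. g k t)"
proof -
  have d: "\<bar>t / W - s / W\<bar> < 1" using assms(1) t by (simp flip: diff_divide_distrib)
  have "near_sum W g t = (\<Sum>k\<in>{\<lfloor>t / W\<rfloor> - 3..\<lfloor>t / W\<rfloor> + 4} \<inter> {\<lfloor>s / W\<rfloor> - 2..\<lfloor>s / W\<rfloor> + 3}. g k t)"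
    unfolding near_sum_def
  proof (rule sum.mono_neutral_cong)
    fix k assume k: "k \<in> {\<lfloor>t / W\<rfloor> - 2..\<lfloor>t / W\<rfloor> + 3} - {\<lfloor>t / W\<rfloor> - 3..\<lfloor>t / W\<rfloor> + 4} \<inter> {\<lfloor>s / W\<rfloor> - 2..\<lfloor>s / W\<rfloor> + 3}"
    then have "k < \<lfloor>s / W\<rfloor> - 2 \<or> k > \<lfloor>s / W\<rfloor> + 3" by auto
    then have "1 \<le> \<bar>t / W - of_int k\<bar>" using d by linarith
    then show "g k t = 0" by (rule z)
  next
    fix k assume k: "k \<in> {\<lfloor>t / W\<rfloor> - 3..\<lfloor>t / W\<rfloor> + 4} \<inter> {\<lfloor>s / W\<rfloor> - 2..\<lfloor>s / W\<rfloor> + 3} - {\<lfloor>t / W\<rfloor> - 2..\<lfloor>t / W\<rfloor> + 3}"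
    then have "k < \<lfloor>t / W\<rfloor> - 2 \<or> k > \<lfloor>t / W\<rfloor> + 3" by auto
    then have "1 \<le> \<bar>t / W - of_int k\<bar>" by linarith
    then show "g k t = 0" by (rule z)
  qed auto
  also have "\<dots> = (\<Sum>k\<in>{\<lfloor>s / W\<rfloor> - 2..\<lfloor>s / W\<rfloor> + 3}. g k t)"
  proof (rule sum.mono_neutral_left)
    show "\<forall>k\<in>{\<lfloor>s / W\<rfloor> - 2..\<lfloor>s / W\<rfloor> + 3} - ({\<lfloor>t / W\<rfloor> - 3..\<lfloor>t / W\<rfloor> + 4} \<inter> {\<lfloor>s / W\<rfloor> - 2..\<lfloor>s / W\<rfloor> + 3}). g k t = 0"
    proof
      fix k assume "k \<in> {\<lfloor>s / W\<rfloor> - 2..\<lfloor>s / W\<rfloor> + 3} - ({\<lfloor>t / W\<rfloor> - 3..\<lfloor>t / W\<rfloor> + 4} \<inter> {\<lfloor>s / W\<rfloor> - 2..\<lfloor>s / W\<rfloor> + 3})"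
      then have "k < \<lfloor>t / W\<rfloor> - 3 \<or> k > \<lfloor>t / W\<rfloor> + 4" by auto
      then have "1 \<le> \<bar>t / W - of_int k\<bar>" by linarith
      then show "g k t = 0" by (rule z)
    qed
  qed auto
  finally show ?thesis .
qed

lemma near_sum_deriv:
  fixes g :: "int \<Rightarrow> real \<Rightarrow> 'a::real_normed_vector"
  assumes "0 < W" and z: "\<And>k t. 1 \<le> \<bar>t / W - of_int k\<bar> \<Longrightarrow> g k t = 0"
    and d: "\<And>k. (g k has_vector_derivative g' k t) (at t)"
  shows "(near_sum W g has_vector_derivative near_sum W g' t) (at t)"
proof (rule has_vector_derivative_transform_within_open)
  show "((\<lambda>u. \<Sum>k\<in>{\<lfloor>t / W\<rfloor> - 2..\<lfloor>t / W\<rfloor> + 3}. g k u) has_vector_derivative near_sum W g' t) (at t)"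
    unfolding near_sum_def by (intro has_vector_derivative_sum d)
  show "open {t - W<..<t + W}" by simp
  show "t \<in> {t - W<..<t + W}" using assms(1) by simp
  show "(\<Sum>k\<in>{\<lfloor>t / W\<rfloor> - 2..\<lfloor>t / W\<rfloor> + 3}. g k u) = near_sum W g u" if "u \<in> {t - W<..<t + W}" for u
    using near_sum_local[OF assms(1) z, where t=u and s=t] that by auto
qed

lemma near_sum_continuous:
  fixes g :: "int \<Rightarrow> real \<Rightarrow> 'a::real_normed_vector"
  assumes "0 < W" and z: "\<And>k t. 1 \<le> \<bar>t / W - of_int k\<bar> \<Longrightarrow> g k t = 0"
    and c: "\<And>k. continuous_on UNIV (g k)"
  shows "continuous_on UNIV (near_sum W g)"
proof (rule continuous_at_imp_continuous_on, rule ballI)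
  fix t
  have "continuous (at t) (\<lambda>u. \<Sum>k\<in>{\<lfloor>t / W\<rfloor> - 2..\<lfloor>t / W\<rfloor> + 3}. g k u)"
    using continuous_on_sum[of _ UNIV g] c by (simp add: continuous_on_eq_continuous_at)
  moreover have "\<forall>\<^sub>F u in nhds t. (\<Sum>k\<in>{\<lfloor>t / W\<rfloor> - 2..\<lfloor>t / W\<rfloor> + 3}. g k u) = near_sum W g u"
    unfolding eventually_nhds
    by (rule exI[of _ "{t - W<..<t + W}"])
      (use assms(1) near_sum_local[OF assms(1) z, where s=t] in auto)
  ultimately show "isCont (near_sum W g) t"
    by (subst (asm) isCont_cong) simp_all
qed

lemma near_sum_norm_le:
  fixes g :: "int \<Rightarrow> real \<Rightarrow> 'a::real_normed_vector"
  assumes "\<And>k. norm (g k t) \<le> b"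
  shows "norm (near_sum W g t) \<le> 6 * b"
proof -
  have "norm (near_sum W g t) \<le> (\<Sum>k\<in>{\<lfloor>t / W\<rfloor> - 2..\<lfloor>t / W\<rfloor> + 3}. b)"
    unfolding near_sum_def by (rule order_trans[OF norm_sum]) (intro sum_mono assms)
  also have "\<dots> = 6 * b" by simp
  finally show ?thesis .
qed

lemma near_sum_bump: "near_sum W (\<lambda>k t. bump (t / W - of_int k) *\<^sub>R h) t = h" for h :: "'a::real_normed_vector"
  unfolding near_sum_def scaleR_left.sum[symmetric] by (subst bump_partition) auto

text \<open>Freezing the coefficients at the points \<open>k * W\<close> and gluing the frozen solutions with a
  partition of unity leaves an error coming only from the slopes of the bumps and the
  oscillation of the coefficients over distance \<open>W\<close>.\<close>

lemma approximate_inverse: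
  fixes B :: "real \<Rightarrow> real^'n^'n" and h :: "real \<Rightarrow> real^'n"
  assumes C: "\<And>(A::real^'n^'n) h H. admissible a K J A \<Longrightarrow> continuous_on UNIV h \<Longrightarrow> (\<forall>t\<in>J. norm (h t) \<le> H) \<Longrightarrow>
     (\<exists>u. (\<forall>t. (u has_vector_derivative A *v u t + h t) (at t)) \<and>
       (\<forall>t\<in>J. norm (u t) \<le> C * H) \<and> (J = {0..} \<longrightarrow> u 0 = 0))"
    and W: "0 < W" "96 * C \<le> W" and \<theta>: "48 * C * \<theta> \<le> 1" "0 \<le> \<theta>" "0 < C"
    and B: "\<And>t. admissible a K J (B t)" "continuous_on UNIV B"
      "\<And>s t v. \<bar>s - t\<bar> \<le> W \<Longrightarrow> norm ((B s - B t) *v v) \<le> \<theta> * norm v"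
    and h: "continuous_on UNIV h" "\<And>t. t \<in> J \<Longrightarrow> norm (h t) \<le> H"
  shows "\<exists>p p'. (\<forall>t. (p has_vector_derivative p' t) (at t)) \<and> continuous_on UNIV p' \<and>
    (\<forall>t\<in>J. norm (p t) \<le> 6 * C * H \<and> norm (p' t - B t *v p t - h t) \<le> H / 4) \<and> (J = {0..} \<longrightarrow> p 0 = 0)"
proof -
  have "\<forall>k::int. \<exists>u. (\<forall>t. (u has_vector_derivative B (k * W) *v u t + h t) (at t)) \<and>
       (\<forall>t\<in>J. norm (u t) \<le> C * H) \<and> (J = {0..} \<longrightarrow> u 0 = 0)"
    using C[OF B(1) h(1)] h(2) by blast
  then obtain v :: "int \<Rightarrow> real \<Rightarrow> real^'n" where v: "\<And>k t. (v k has_vector_derivative B (k * W) *v v k t + h t) (at t)"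
     "\<And>k t. t \<in> J \<Longrightarrow> norm (v k t) \<le> C * H" "\<And>k. J = {0..} \<Longrightarrow> v k 0 = 0"
    by metis
  define \<phi> where "\<phi> k t = bump (t / W - of_int k)" for k t
  define \<phi>' where "\<phi>' k t = bump' (t / W - of_int k) / W" for k t
  define p where "p = near_sum W (\<lambda>k t. \<phi> k t *\<^sub>R v k t)"
  define p' where "p' = near_sum W (\<lambda>k t. \<phi> k t *\<^sub>R (B (k * W) *v v k t + h t) + \<phi>' k t *\<^sub>R v k t)"
  have J: "J = UNIV \<or> J = {0..}" using B(1)[of 0] by (auto simp: admissible_def)
  have H0: "0 \<le> H" using h(2)[of 0] J order_trans[OF norm_ge_zero, of "h 0"] by auto
  have vc: "continuous_on UNIV (v k)" for k
    using v(1) by (auto intro!: continuous_at_imp_continuous_on has_vector_derivative_continuous)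
  have \<phi>c: "continuous_on UNIV (\<phi> k)" "continuous_on UNIV (\<phi>' k)" for k
    unfolding \<phi>_def[abs_def] \<phi>'_def[abs_def] using W
    by (auto intro!: continuous_intros continuous_on_compose2[OF continuous_bump[of UNIV]] continuous_on_compose2[OF continuous_bump'[of UNIV]])
  have bl: "bounded_linear ((*v) M)" for M :: "real^'n^'n"
    by (rule matrix_vector_mul_bounded_linear)
  have "(p has_vector_derivative p' t) (at t)" for t
    unfolding p_def p'_def
  proof (rule near_sum_deriv[OF W(1)])
    fix k
    show "((\<lambda>t. \<phi> k t *\<^sub>R v k t) has_vector_derivative
        \<phi> k t *\<^sub>R (B (real_of_int k * W) *v v k t + h t) + \<phi>' k t *\<^sub>R v k t) (at t)"
      unfolding \<phi>_def[abs_def] \<phi>'_def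
      by (rule has_vector_derivative_scaleR[OF bump_scaled_deriv[OF W(1)] v(1)])
  qed (simp add: \<phi>_def bump_outside)
  moreover have "continuous_on UNIV p'"
    unfolding p'_def
  proof (rule near_sum_continuous[OF W(1)])
    show "continuous_on UNIV (\<lambda>t. \<phi> k t *\<^sub>R (B (real_of_int k * W) *v v k t + h t) + \<phi>' k t *\<^sub>R v k t)" for k
      by (intro continuous_intros \<phi>c vc h(1) bounded_linear.continuous_on[OF bl])
  qed (simp add: \<phi>_def \<phi>'_def bump_outside)
  moreover have "norm (p t) \<le> 6 * C * H" if t: "t \<in> J" for t
  proof -
    have "norm (\<phi> k t *\<^sub>R v k t) \<le> C * H" for k
    proof -
      have "norm (\<phi> k t *\<^sub>R v k t) = \<bar>\<phi> k t\<bar> * norm (v k t)" by simp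
      also have "\<dots> \<le> 1 * (C * H)"
        unfolding \<phi>_def by (intro mult_mono bump_bounds v(2) t) auto
      finally show ?thesis by simp
    qed
    then show ?thesis unfolding p_def mult.assoc by (rule near_sum_norm_le)
  qed
  moreover have "norm (p' t - B t *v p t - h t) \<le> H / 4" if t: "t \<in> J" for t
  proof -
    have "B t *v p t = near_sum W (\<lambda>k t'. \<phi> k t' *\<^sub>R (B t *v v k t')) t"
      unfolding p_def near_sum_def
      by (simp add: linear_sum[OF bounded_linear.linear[OF bl]] matrix_vector_mult_scaleR)
    moreover have "h t = near_sum W (\<lambda>k t'. \<phi> k t' *\<^sub>R h t) t"
      unfolding \<phi>_def by (rule near_sum_bump[symmetric])
    \<comment> \<open>The bumps sum to 1 and B t acts on each term, so the residual is a single
      local sum in which h cancels.\<close>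
    ultimately have "p' t - B t *v p t - h t =
      near_sum W (\<lambda>k t. \<phi> k t *\<^sub>R (B (k * W) *v v k t + h t) + \<phi>' k t *\<^sub>R v k t
        - \<phi> k t *\<^sub>R (B t *v v k t) - \<phi> k t *\<^sub>R h t) t"
      unfolding p'_def near_sum_def by (simp add: sum_subtractf)
    also have "\<dots> = near_sum W (\<lambda>k t. \<phi> k t *\<^sub>R ((B (k * W) - B t) *v v k t) + \<phi>' k t *\<^sub>R v k t) t"
      by (simp add: near_sum_def algebra_simps scaleR_right_distrib)
    \<comment> \<open>There are six terms in the window. The condition on \<theta> bounds the
      oscillation part 6 C \<theta> H by H/8, and the condition on \<open>W\<close> bounds the slope
      part 12 C H / W by H/8.\<close>
    also have "norm \<dots> \<le> 6 * (\<theta> * (C * H) + 2 / W * (C * H))"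
    proof (rule near_sum_norm_le)
      fix k
      have "norm (\<phi> k t *\<^sub>R ((B (k * W) - B t) *v v k t)) \<le> \<theta> * (C * H)"
      proof (cases "1 \<le> \<bar>t / W - of_int k\<bar>")
        case True
        then show ?thesis using \<theta> H0 by (simp add: \<phi>_def bump_outside)
      next
        case False
        have "\<bar>of_int k * W - t\<bar> = \<bar>t / W - of_int k\<bar> * W"
          using W by (simp add: abs_mult[symmetric, of _ W, simplified] field_simps abs_minus_commute flip: abs_mult_pos)
        also have "\<dots> \<le> 1 * W" using False W by (intro mult_right_mono) auto
        finally have "norm ((B (k * W) - B t) *v v k t) \<le> \<theta> * norm (v k t)" by (intro B(3)) simp
        also have "\<dots> \<le> \<theta> * (C * H)" using \<theta> v(2)[OF t] by (intro mult_left_mono) auto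
        finally have "norm (\<phi> k t *\<^sub>R ((B (k * W) - B t) *v v k t)) \<le> 1 * (\<theta> * (C * H))"
          unfolding norm_scaleR \<phi>_def by (intro mult_mono bump_bounds) auto
        then show ?thesis by simp
      qed
      moreover have "norm (\<phi>' k t *\<^sub>R v k t) \<le> 2 / W * (C * H)"
        unfolding norm_scaleR \<phi>'_def abs_divide using W
        by (intro mult_mono divide_mono bump_bounds v(2) t) auto
      ultimately show "norm (\<phi> k t *\<^sub>R ((B (k * W) - B t) *v v k t) + \<phi>' k t *\<^sub>R v k t) \<le> \<theta> * (C * H) + 2 / W * (C * H)"
        by (intro norm_triangle_mono)
    qed
    also have "\<dots> = (48 * C * \<theta>) * H / 8 + (96 * C / W) * H / 8" by (simp add: field_simps)
    also have "\<dots> \<le> 1 * H / 8 + 1 * H / 8"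
      using W \<theta> H0 by (intro add_mono divide_right_mono mult_right_mono) auto
    finally show ?thesis by simp
  qed
  moreover have "J = {0..} \<longrightarrow> p 0 = 0"
    using v(3) by (simp add: p_def near_sum_def)
  ultimately show ?thesis by blast
qed

text \<open>Cut y off by a bump \<phi> of half-width W/2 around T. Then \<phi> y solves the equation
  frozen at T on the whole line, with a forcing made of \<phi>' y, \<phi> g and the oscillation of
  B; by uniqueness it is the bounded solution, whose size is known. The slope and the oscillation
  cost at most a quarter of \<open>Y\<close>. Repeating the estimate therefore gains a factor with
  each window, which is the exponential smallness of the tails.\<close>

lemma local_estimate:
  fixes B :: "real \<Rightarrow> real^'n^'n" and y :: "real \<Rightarrow> real^'n"
  assumes C: "\<And>(A::real^'n^'n) h H. admissible a K UNIV A \<Longrightarrow> continuous_on UNIV h \<Longrightarrow> (\<forall>t. norm (h t) \<le> H) \<Longrightarrow>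
     (\<exists>u. (\<forall>t. (u has_vector_derivative A *v u t + h t) (at t)) \<and> (\<forall>t. norm (u t) \<le> C * H))"
    and K: "0 < K" and W: "0 < W" "96 * C \<le> W" and \<theta>: "48 * C * \<theta> \<le> 1" "0 \<le> \<theta>" "0 < C"
    and B: "admissible a K UNIV (B T)" "continuous_on {T - W<..<T + W} B"
      "\<And>s v. \<bar>s - T\<bar> \<le> W \<Longrightarrow> norm ((B s - B T) *v v) \<le> \<theta> * norm v"
    and y: "\<And>t. \<bar>t - T\<bar> < W \<Longrightarrow> (y has_vector_derivative B t *v y t + g t) (at t)"
      "\<And>t. \<bar>t - T\<bar> < W \<Longrightarrow> norm (y t) \<le> Y" "\<And>t. \<bar>t - T\<bar> < W \<Longrightarrow> norm (g t) \<le> G"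
    and g: "continuous_on {T - W<..<T + W} g"
  shows "norm (y T) \<le> Y / 4 + C * G"
proof -
  define \<phi> where "\<phi> t = bump (t / (W / 2) - T / (W / 2))" for t
  define \<phi>' where "\<phi>' t = bump' (t / (W / 2) - T / (W / 2)) / (W / 2)" for t
  have \<phi>d: "(\<phi> has_real_derivative \<phi>' t) (at t)" for t
    unfolding \<phi>_def[abs_def] \<phi>'_def using W by (intro bump_scaled_deriv) auto
  have \<phi>0: "\<phi> t = 0" "\<phi>' t = 0" if "W / 2 \<le> \<bar>t - T\<bar>" for t
  proof -
    have "1 \<le> \<bar>t / (W / 2) - T / (W / 2)\<bar>" 
      using that W by (simp add: diff_divide_distrib[symmetric] abs_divide del: divide_divide_eq_right)
    then show "\<phi> t = 0" "\<phi>' t = 0" by (simp_all add: \<phi>_def \<phi>'_def bump_outside)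
  qed
  have \<phi>b: "\<bar>\<phi> t\<bar> \<le> 1" "\<bar>\<phi>' t\<bar> \<le> 2 / (W / 2)" for t
    unfolding \<phi>_def \<phi>'_def abs_divide using W by (auto intro!: divide_mono bump_bounds)
  have \<phi>c: "continuous_on S \<phi>" "continuous_on S \<phi>'" for S
    unfolding \<phi>_def[abs_def] \<phi>'_def[abs_def] using W
    by (auto intro!: continuous_intros continuous_on_compose2[OF continuous_bump[of UNIV]] continuous_on_compose2[OF continuous_bump'[of UNIV]])
  let ?I = "{T - W<..<T + W}"
  have I: "t \<in> ?I \<longleftrightarrow> \<bar>t - T\<bar> < W" for t by auto
  have Y0: "0 \<le> Y" and G0: "0 \<le> G"
    using y(2)[of T] y(3)[of T] W order_trans[OF norm_ge_zero] by auto
  \<comment> \<open>The cut-off vanishes already at distance W/2. The zero branch therefore extends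
    the forcing continuously past the window, outside which nothing is assumed about y, g and the
    differential equation.\<close>
  define F where "F t = (if \<bar>t - T\<bar> < W then \<phi>' t *\<^sub>R y t + \<phi> t *\<^sub>R (g t + (B t - B T) *v y t) else 0)" for t
  define u where "u t = \<phi> t *\<^sub>R y t" for t
  have yc: "continuous_on ?I y"
    using y(1) I by (auto intro!: continuous_at_imp_continuous_on has_vector_derivative_continuous)
  have "continuous_on (?I \<union> - cball T (W / 2)) F"
  proof (rule continuous_on_open_Un)
    have "continuous_on ?I (\<lambda>t. \<phi>' t *\<^sub>R y t + \<phi> t *\<^sub>R (g t + (B t - B T) *v y t))"
      by (intro continuous_intros \<phi>c yc g continuous_on_matrix_vector_mult B(2))
    then show "continuous_on ?I F" by (rule continuous_on_eq) (auto simp: F_def)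
    have "continuous_on (- cball T (W / 2)) (\<lambda>t. 0::real^'n)" by simp
    then show "continuous_on (- cball T (W / 2)) F"
    proof (rule continuous_on_eq)
      fix t assume "t \<in> - cball T (W / 2)"
      then have "W / 2 \<le> \<bar>t - T\<bar>" by (auto simp: dist_real_def abs_minus_commute)
      then show "0 = F t" by (simp add: F_def \<phi>0)
    qed
  qed auto
  moreover have "?I \<union> - cball T (W / 2) = UNIV" using W by (auto simp: dist_real_def)
  ultimately have Fc: "continuous_on UNIV F" by simp
  have ud: "(u has_vector_derivative B T *v u t + F t) (at t)" for t
  proof (cases "\<bar>t - T\<bar> < W")
    case True
    have "(u has_vector_derivative \<phi> t *\<^sub>R (B t *v y t + g t) + \<phi>' t *\<^sub>R y t) (at t)"
      unfolding u_def[abs_def] by (rule has_vector_derivative_scaleR[OF \<phi>d y(1)[OF True]])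
    then show ?thesis using True
      by (simp add: F_def u_def matrix_vector_mult_scaleR algebra_simps scaleR_right_distrib)
  next
    case False
    have "((\<lambda>t. 0) has_vector_derivative 0) (at t)" by simp
    then have "(u has_vector_derivative 0) (at t)"
    proof (rule has_vector_derivative_transform_within_open[where S="- cball T (W / 2)"])
      show "t \<in> - cball T (W / 2)" using False W by (auto simp: dist_real_def abs_minus_commute)
      show "0 = u s" if "s \<in> - cball T (W / 2)" for s
      proof -
        have "W / 2 \<le> \<bar>s - T\<bar>" using that by (auto simp: dist_real_def abs_minus_commute)
        then show ?thesis by (simp add: u_def \<phi>0)
      qed
    qed auto
    then show ?thesis using False W by (simp add: F_def u_def \<phi>0)
  qed
  have Fb: "norm (F t) \<le> 4 / W * Y + (G + \<theta> * Y)" for t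
  proof (cases "\<bar>t - T\<bar> < W")
    case True
    have "norm ((B t - B T) *v y t) \<le> \<theta> * norm (y t)" using True by (intro B(3)) auto
    also have "\<dots> \<le> \<theta> * Y" using \<theta> y(2)[OF True] by (intro mult_left_mono) auto
    finally have "norm (g t + (B t - B T) *v y t) \<le> G + \<theta> * Y"
      using y(3)[OF True] by (intro norm_triangle_mono)
    then have "norm (\<phi> t *\<^sub>R (g t + (B t - B T) *v y t)) \<le> 1 * (G + \<theta> * Y)"
      unfolding norm_scaleR by (intro mult_mono \<phi>b) auto
    moreover have "norm (\<phi>' t *\<^sub>R y t) \<le> 2 / (W / 2) * Y"
      unfolding norm_scaleR using W by (intro mult_mono \<phi>b y(2) True) auto
    ultimately have "norm (\<phi>' t *\<^sub>R y t + \<phi> t *\<^sub>R (g t + (B t - B T) *v y t)) \<le> 2 / (W / 2) * Y + 1 * (G + \<theta> * Y)"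
      by (intro norm_triangle_mono)
    then show ?thesis using True by (simp add: F_def)
  next
    case False
    then show ?thesis using Y0 G0 W \<theta> by (simp add: F_def)
  qed
  obtain w where w: "\<And>t. (w has_vector_derivative B T *v w t + F t) (at t)"
    "\<And>t. norm (w t) \<le> C * (4 / W * Y + (G + \<theta> * Y))"
    using C[OF B(1) Fc] Fb by blast
  \<comment> \<open>The cut-off function is bounded, so it coincides with the solution that comes
    with an estimate.\<close>
  have "u t - w t = 0" for t
  proof (rule const_coeff_unique[of "B T"])
    show "Re z \<noteq> 0" if "z \<in> spect (B T)" for z using B(1) that K by (auto simp: admissible_def)
    show "((\<lambda>t. u t - w t) has_vector_derivative B T *v (u t - w t)) (at t)" for t
      using has_vector_derivative_diff[OF ud w(1)] by (simp add: matrix_vector_mult_diff_distrib)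
    have "norm (u t) \<le> Y" for t
    proof (cases "\<bar>t - T\<bar> < W")
      case True
      have "norm (u t) \<le> 1 * Y" unfolding u_def norm_scaleR by (intro mult_mono \<phi>b y(2) True) auto
      then show ?thesis by simp
    next
      case False
      then show ?thesis using W Y0 by (simp add: u_def \<phi>0)
    qed
    then show "norm (u t - w t) \<le> Y + C * (4 / W * Y + (G + \<theta> * Y))" for t
      by (intro norm_triangle_le_diff add_mono w(2))
  qed
  then have "norm (u T) \<le> C * (4 / W * Y + (G + \<theta> * Y))" using w(2)[of T] by simp
  also have "u T = y T" by (simp add: u_def \<phi>_def)
  \<comment> \<open>The slope contributes at most Y/24 and the oscillation at most Y/48.\<close>
  also have "C * (4 / W * Y + (G + \<theta> * Y)) = (96 * C / W) * Y / 24 + C * G + (48 * C * \<theta>) * Y / 48"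
    by (simp add: field_simps)
  also have "\<dots> \<le> 1 * Y / 24 + C * G + 1 * Y / 48"
    using W \<theta> Y0 by (intro add_mono divide_right_mono mult_right_mono order_refl) auto
  also have "\<dots> \<le> Y / 4 + C * G" using Y0 by simp
  finally show ?thesis .
qed

definition slow_hyperbolic :: "real \<Rightarrow> real \<Rightarrow> real \<Rightarrow> real \<Rightarrow> (real \<Rightarrow> real^'n^'n) \<Rightarrow> bool" where
  "slow_hyperbolic a K W \<theta> B \<longleftrightarrow> continuous_on UNIV B \<and> (\<forall>t. admissible a K UNIV (B t)) \<and>
     (\<forall>s t v. \<bar>s - t\<bar> \<le> W \<longrightarrow> norm ((B s - B t) *v v) \<le> \<theta> * norm v)"

definition time_domain :: "real set \<Rightarrow> (real \<Rightarrow> real^'n^'n) \<Rightarrow> bool" where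
  "time_domain J B \<longleftrightarrow> J = UNIV \<or> J = {0..} \<and> (\<forall>t. \<forall>z\<in>spect (B t). Re z < 0)"

text \<open>The equation p' = B p + h is solved only up to a quarter of the size of h, which is
  enough for an iteration. The derivative is named because the next residual has to be continuous
  again.\<close>

definition approx_invertible :: "real \<Rightarrow> (real \<Rightarrow> real^'n^'n) \<Rightarrow> bool" where
  "approx_invertible C B \<longleftrightarrow> (\<forall>J h H. time_domain J B \<longrightarrow> continuous_on UNIV h \<longrightarrow> (\<forall>t\<in>J. norm (h t) \<le> H) \<longrightarrow>
     (\<exists>p p'. (\<forall>t. (p has_vector_derivative p' t) (at t)) \<and> continuous_on UNIV p' \<and>
       (\<forall>t\<in>J. norm (p t) \<le> C * H \<and> norm (p' t - B t *v p t - h t) \<le> H / 4) \<and> (J = {0..} \<longrightarrow> p 0 = 0)))"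

text \<open>An a-priori bound at T from data on one window around T: Y/4 is the influence of what
  lies outside. No condition at infinity occurs, so the bound can be used on the line as well as far
  out on a half line.\<close>

definition locally_controlled :: "real \<Rightarrow> real \<Rightarrow> (real \<Rightarrow> real^'n^'n) \<Rightarrow> bool" where
  "locally_controlled C W B \<longleftrightarrow> (\<forall>T y g Y G.
     (\<forall>t. \<bar>t - T\<bar> < W \<longrightarrow> (y has_vector_derivative B t *v y t + g t) (at t) \<and> norm (y t) \<le> Y \<and> norm (g t) \<le> G) \<longrightarrow>
     continuous_on {T - W<..<T + W} g \<longrightarrow> norm (y T) \<le> Y / 4 + C * G)"

text \<open>The constants precede B and depend only on a, \<open>K\<close> and the dimension. The
  smallness of the oscillation over a window of length \<open>W\<close> is the only place where slow
  variation enters; it is met later by taking \<epsilon> small.\<close>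

lemma linear_theory:
  fixes a K :: real
  assumes K: "0 < K"
  shows "\<exists>C>0. \<exists>W>0. \<exists>\<theta>>0. \<forall>B::real \<Rightarrow> real^'n^'n. slow_hyperbolic a K W \<theta> B \<longrightarrow>
    approx_invertible C B \<and> locally_controlled C W B"
proof -
  obtain C where C: "0 < C" "\<forall>(A::real^'n^'n) J h H. admissible a K J A \<longrightarrow> continuous_on UNIV h \<longrightarrow> (\<forall>t\<in>J. norm (h t) \<le> H) \<longrightarrow>
     (\<exists>u. (\<forall>t. (u has_vector_derivative A *v u t + h t) (at t)) \<and>
       (\<forall>t\<in>J. norm (u t) \<le> C * H) \<and> (J = {0..} \<longrightarrow> u 0 = 0))"
    using const_coeff_solution[OF K, of a] by blast
  define W where "W = 96 * C"
  define \<theta> where "\<theta> = 1 / (48 * C)"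
  have W\<theta>: "0 < W" "96 * C \<le> W" "48 * C * \<theta> \<le> 1" "0 \<le> \<theta>" "0 < \<theta>" using C(1) by (auto simp: W_def \<theta>_def)
  have "\<forall>B::real \<Rightarrow> real^'n^'n. slow_hyperbolic a K W \<theta> B \<longrightarrow>
    approx_invertible (6 * C) B \<and> locally_controlled (6 * C) W B"
  proof (intro conjI allI impI)
    fix B :: "real \<Rightarrow> real^'n^'n" assume B: "slow_hyperbolic a K W \<theta> B"
    have BB: "\<And>t. admissible a K UNIV (B t)" "continuous_on UNIV B"
      "\<And>s t v. \<bar>s - t\<bar> \<le> W \<Longrightarrow> norm ((B s - B t) *v v) \<le> \<theta> * norm v"
      using B unfolding slow_hyperbolic_def by blast+
    show "approx_invertible (6 * C) B"
      unfolding approx_invertible_def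
    proof (intro allI impI)
      fix J H and h :: "real \<Rightarrow> real^'n"
      assume *: "time_domain J B" "continuous_on UNIV h" "\<forall>t\<in>J. norm (h t) \<le> H"
      have CL: "\<exists>u. (\<forall>t. (u has_vector_derivative A *v u t + h t) (at t)) \<and>
       (\<forall>t\<in>J. norm (u t) \<le> C * H) \<and> (J = {0..} \<longrightarrow> u 0 = 0)"
        if "admissible a K J A" "continuous_on UNIV h" "\<forall>t\<in>J. norm (h t) \<le> H"
        for A :: "real^'n^'n" and h H using C(2) that by blast
      have BJ: "admissible a K J (B t)" for t
        using BB(1)[of t] *(1) unfolding admissible_def time_domain_def by blast
      show "\<exists>p p'. (\<forall>t. (p has_vector_derivative p' t) (at t)) \<and> continuous_on UNIV p' \<and>
       (\<forall>t\<in>J. norm (p t) \<le> 6 * C * H \<and> norm (p' t - B t *v p t - h t) \<le> H / 4) \<and> (J = {0..} \<longrightarrow> p 0 = 0)"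
        by (rule approximate_inverse[OF CL W\<theta>(1,2,3,4) C(1) BJ BB(2,3) *(2) bspec[OF *(3)]])
    qed
    show "locally_controlled (6 * C) W B"
      unfolding locally_controlled_def
    proof (intro allI impI)
      fix T Y G and y g :: "real \<Rightarrow> real^'n"
      assume *: "\<forall>t. \<bar>t - T\<bar> < W \<longrightarrow> (y has_vector_derivative B t *v y t + g t) (at t) \<and> norm (y t) \<le> Y \<and> norm (g t) \<le> G"
        "continuous_on {T - W<..<T + W} g"
      have CL: "\<exists>u. (\<forall>t. (u has_vector_derivative A *v u t + h t) (at t)) \<and> (\<forall>t. norm (u t) \<le> C * H)"
        if "admissible a K UNIV A" "continuous_on UNIV h" "\<forall>t. norm (h t) \<le> H"
        for A :: "real^'n^'n" and h H
        using C(2)[THEN spec[of _ A], THEN spec[of _ UNIV], THEN spec[of _ h], THEN spec[of _ H]] that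
        by auto
      have "norm (y T) \<le> Y / 4 + C * G"
        by (rule local_estimate[OF CL K W\<theta>(1,2,3,4) C(1) BB(1) continuous_on_subset[OF BB(2) subset_UNIV] BB(3) _ _ _ *(2)])
          (use *(1) in blast)+
      moreover have "0 \<le> G" using *(1)[rule_format, of T] W\<theta>(1) order_trans[OF norm_ge_zero] by auto
      then have "C * G \<le> 6 * C * G" using C(1) by (simp add: mult_left_le_one_le)
      ultimately show "norm (y T) \<le> Y / 4 + 6 * C * G" by linarith
    qed
  qed
  moreover have "0 < 6 * C" using C(1) by simp
  ultimately show ?thesis using W\<theta>(1,5) by blast
qed

text \<open>The constant is tuned to a solution operator of size C: the nonlinear remainder, pushed
  through it, returns at most a quarter of the difference of its arguments, and this is
  absorbed.\<close>

definition nearly_linear ::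
  "real \<Rightarrow> (real \<Rightarrow> real^'n) \<Rightarrow> real \<Rightarrow> (real \<Rightarrow> real^'n^'n) \<Rightarrow> (real \<Rightarrow> real^'n \<Rightarrow> real^'n) \<Rightarrow> bool" where
  "nearly_linear \<delta> c C B F \<longleftrightarrow> (\<forall>t x y. dist x (c t) \<le> \<delta> \<longrightarrow> dist y (c t) \<le> \<delta> \<longrightarrow>
     norm (F t x - F t y - B t *v (x - y)) \<le> norm (x - y) / (4 * C))"

lemma norm_matrix_vector_le:
  fixes A :: "real^'n^'n"
  assumes "\<And>i j. \<bar>A $ i $ j\<bar> \<le> a"
  shows "norm (A *v v) \<le> real CARD('n) * real CARD('n) * a * norm v"
  using norm_cmat_mult_le[OF assms, of "cvec v"] by (simp flip: cvec_mult)

text \<open>Each Newton step uses the approximate inverse and halves the residual.\<close>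

lemma newton_solution:
  fixes B :: "real \<Rightarrow> real^'n^'n" and F :: "real \<Rightarrow> real^'n \<Rightarrow> real^'n"
  assumes C: "0 < C" "approx_invertible C B" and J: "time_domain J B" and B: "\<And>t. admissible a K UNIV (B t)"
    and F: "nearly_linear \<delta> c C B F"
    and Fc: "\<And>u. continuous_on UNIV u \<Longrightarrow> continuous_on UNIV (\<lambda>t. F t (u t))"
    and u0: "\<And>t. (u0 has_vector_derivative u0' t) (at t)" "continuous_on UNIV u0'"
      "\<And>t. t \<in> J \<Longrightarrow> norm (u0 t - c t) \<le> \<delta> / 2" "\<And>t. t \<in> J \<Longrightarrow> norm (u0' t - F t (u0 t)) \<le> \<rho>"
    and \<rho>: "2 * C * \<rho> \<le> \<delta> / 2"
  shows "\<exists>u. (\<forall>t\<in>J. (u has_vector_derivative F t (u t)) (at t within J)) \<and>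
    (\<forall>t\<in>J. norm (u t - u0 t) \<le> 2 * C * \<rho>) \<and> (J = {0..} \<longrightarrow> u 0 = u0 0)"
proof -
  have J': "J = UNIV \<or> J = {0..}" using J by (auto simp: time_domain_def)
  have \<rho>0: "0 \<le> \<rho>" using u0(4)[of 0] J' order_trans[OF norm_ge_zero] by auto
  define P where "P n up \<longleftrightarrow> (case up of (u, u') \<Rightarrow> (\<forall>t. (u has_vector_derivative u' t) (at t)) \<and> continuous_on UNIV u' \<and>
     (\<forall>t\<in>J. norm (u' t - F t (u t)) \<le> \<rho> / 2 ^ n \<and> norm (u t - u0 t) \<le> 2 * C * \<rho> * (1 - 1 / 2 ^ n)) \<and>
     (J = {0..} \<longrightarrow> u 0 = u0 0))" for n :: nat and up :: "(real \<Rightarrow> real^'n) \<times> (real \<Rightarrow> real^'n)"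
  define Q where "Q n up vp \<longleftrightarrow> (\<forall>t\<in>J. norm (fst vp t - fst up t) \<le> C * (\<rho> / 2 ^ n))"
    for n :: nat and up vp :: "(real \<Rightarrow> real^'n) \<times> (real \<Rightarrow> real^'n)"
  have "\<exists>f. \<forall>n. P n (f n) \<and> Q n (f n) (f (Suc n))"
  proof (rule dependent_nat_choice)
    show "\<exists>up. P 0 up" using u0 by (intro exI[of _ "(u0, u0')"]) (auto simp: P_def)
  next
    fix up n assume "P n up"
    then obtain u u' where up: "up = (u, u')" "\<And>t. (u has_vector_derivative u' t) (at t)" "continuous_on UNIV u'"
     "\<And>t. t \<in> J \<Longrightarrow> norm (u' t - F t (u t)) \<le> \<rho> / 2 ^ n"
     "\<And>t. t \<in> J \<Longrightarrow> norm (u t - u0 t) \<le> 2 * C * \<rho> * (1 - 1 / 2 ^ n)" "J = {0..} \<longrightarrow> u 0 = u0 0"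
      by (auto simp: P_def)
    define h where "h t = F t (u t) - u' t" for t
    have uc: "continuous_on UNIV u"
      using up(2) by (auto intro!: continuous_at_imp_continuous_on has_vector_derivative_continuous)
    have hc: "continuous_on UNIV h" unfolding h_def[abs_def] by (intro continuous_intros Fc uc up)
    have hb: "\<forall>t\<in>J. norm (h t) \<le> \<rho> / 2 ^ n" using up(4) by (simp add: h_def norm_minus_commute)
    have "\<exists>p p'. (\<forall>t. (p has_vector_derivative p' t) (at t)) \<and> continuous_on UNIV p' \<and>
       (\<forall>t\<in>J. norm (p t) \<le> C * (\<rho> / 2 ^ n) \<and> norm (p' t - B t *v p t - h t) \<le> \<rho> / 2 ^ n / 4) \<and>
       (J = {0..} \<longrightarrow> p 0 = 0)"
      using C(2) J hc hb unfolding approx_invertible_def by presburger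
    then obtain p p' where p: "\<And>t. (p has_vector_derivative p' t) (at t)" "continuous_on UNIV p'"
      "\<And>t. t \<in> J \<Longrightarrow> norm (p t) \<le> C * (\<rho> / 2 ^ n)" "\<And>t. t \<in> J \<Longrightarrow> norm (p' t - B t *v p t - h t) \<le> \<rho> / 2 ^ n / 4"
      "J = {0..} \<longrightarrow> p 0 = 0"
      by blast
    define v where "v t = u t + p t" for t
    define v' where "v' t = u' t + p' t" for t
    have "(v has_vector_derivative v' t) (at t)" for t
      unfolding v_def[abs_def] v'_def by (intro has_vector_derivative_add up p)
    moreover have "continuous_on UNIV v'" unfolding v'_def[abs_def] by (intro continuous_intros up p)
    moreover have vb: "norm (v t - u0 t) \<le> 2 * C * \<rho> * (1 - 1 / 2 ^ Suc n)" if t: "t \<in> J" for t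
    proof -
      have "norm (v t - u0 t) \<le> norm (u t - u0 t) + norm (p t)"
        unfolding v_def using norm_triangle_ineq[of "u t - u0 t" "p t"] by (simp add: algebra_simps)
      also have "\<dots> \<le> 2 * C * \<rho> * (1 - 1 / 2 ^ n) + C * (\<rho> / 2 ^ n)" using up(5) p(3) t by (intro add_mono)
      also have "\<dots> = 2 * C * \<rho> * (1 - 1 / 2 ^ Suc n)" by (simp add: field_simps)
      finally show ?thesis .
    qed
    moreover have "norm (v' t - F t (v t)) \<le> \<rho> / 2 ^ Suc n" if t: "t \<in> J" for t
    proof -
      have tube: "dist x (c t) \<le> \<delta>" if "norm (x - u0 t) \<le> 2 * C * \<rho> * (1 - 1 / 2 ^ m)" for x and m :: nat
      proof -
        have "2 * C * \<rho> * (1 - 1 / 2 ^ m) \<le> 2 * C * \<rho> * 1" using C \<rho>0 by (intro mult_left_mono) auto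
        then have "norm (x - u0 t) \<le> \<delta> / 2" using that \<rho> by linarith
        then show ?thesis using u0(3)[OF t] norm_triangle_ineq[of "x - u0 t" "u0 t - c t"] by (simp add: dist_norm)
      qed
      have "norm (F t (v t) - F t (u t) - B t *v (v t - u t)) \<le> norm (v t - u t) / (4 * C)"
        using F tube[OF vb[OF t]] tube[OF up(5)[OF t]] by (auto simp: nearly_linear_def)
      also have "\<dots> \<le> (C * (\<rho> / 2 ^ n)) / (4 * C)"
        using p(3)[OF t] C by (intro divide_right_mono) (auto simp: v_def)
      also have "\<dots> = \<rho> / 2 ^ n / 4" using C by simp
      finally have 1: "norm (F t (v t) - F t (u t) - B t *v p t) \<le> \<rho> / 2 ^ n / 4" by (simp add: v_def)
      \<comment> \<open>The residual is halved: one quarter is left by the approximate inverse and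
        one quarter by the nonlinear remainder.\<close>
      have "v' t - F t (v t) = (p' t - B t *v p t - h t) - (F t (v t) - F t (u t) - B t *v p t)"
        by (simp add: v'_def h_def)
      also have "norm \<dots> \<le> \<rho> / 2 ^ n / 4 + \<rho> / 2 ^ n / 4"
        by (rule order_trans[OF norm_triangle_ineq4 add_mono[OF p(4)[OF t] 1]])
      finally show ?thesis by simp
    qed
    ultimately have "P (Suc n) (v, v')" using up(6) p(5) by (simp add: P_def v_def)
    moreover have "Q n up (v, v')" using p(3) by (simp add: Q_def up(1) v_def)
    ultimately show "\<exists>vp. P (Suc n) vp \<and> Q n up vp" by blast
  qed
  then obtain f where f: "\<And>n. P n (f n)" "\<And>n. Q n (f n) (f (Suc n))" by blast
  define U where "U n = fst (f n)" for n
  define U' where "U' n = snd (f n)" for n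
  have U: "(U n has_vector_derivative U' n t) (at t)" for n t
    using f(1)[of n] by (auto simp: P_def U_def U'_def)
  have Ur: "norm (U' n t - F t (U n t)) \<le> \<rho> / 2 ^ n" "norm (U n t - u0 t) \<le> 2 * C * \<rho> * (1 - 1 / 2 ^ n)"
    if "t \<in> J" for n t
    using f(1)[of n] that by (auto simp: P_def U_def U'_def)
  have U0: "U n 0 = u0 0" if "J = {0..}" for n
    using f(1)[of n] that by (auto simp: P_def U_def U'_def)
  have step: "norm (U (Suc n) t - U n t) \<le> C * (\<rho> / 2 ^ n)" if "t \<in> J" for n t
    using f(2)[of n] that by (auto simp: Q_def U_def)
  have far: "norm (U (n + k) t - U n t) \<le> 2 * C * \<rho> / 2 ^ n" if "t \<in> J" for n k t
  proof -
    have "norm (U (n + k) t - U n t) \<le> 2 * C * \<rho> / 2 ^ n * (1 - 1 / 2 ^ k)"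
    proof (induction k)
      case (Suc k)
      have "norm (U (n + Suc k) t - U n t) \<le> C * (\<rho> / 2 ^ (n + k)) + 2 * C * \<rho> / 2 ^ n * (1 - 1 / 2 ^ k)"
        using norm_triangle_mono[OF step[OF that, of "n + k"] Suc] by simp
      also have "\<dots> = 2 * C * \<rho> / 2 ^ n * (1 - 1 / 2 ^ Suc k)" by (simp add: field_simps power_add)
      finally show ?case .
    qed simp
    also have "\<dots> \<le> 2 * C * \<rho> / 2 ^ n * 1" using C \<rho>0 by (intro mult_left_mono) auto
    finally show ?thesis by simp
  qed
  have small: "\<exists>N. \<forall>n\<ge>N. M / 2 ^ n < e" if "e > 0" for M e :: real
  proof -
    have "(\<lambda>n. M * (1 / 2) ^ n) \<longlonglongrightarrow> 0" by (intro tendsto_mult_right_zero LIMSEQ_realpow_zero) auto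
    from order_tendstoD(2)[OF this that] show ?thesis
      by (simp add: eventually_sequentially power_divide)
  qed
  have "\<exists>u. \<forall>t\<in>J. (\<lambda>n. U n t) \<longlonglongrightarrow> u t"
  proof (intro bchoice ballI)
    fix t assume t: "t \<in> J"
    have "Cauchy (\<lambda>n. U n t)"
    proof (rule metric_CauchyI)
      fix e :: real assume "e > 0"
      then obtain N where N: "\<And>n. n \<ge> N \<Longrightarrow> 2 * C * \<rho> / 2 ^ n < e / 2" using small[of "e / 2" "2 * C * \<rho>"] by auto
      have 1: "dist (U m t) (U N t) < e / 2" if "m \<ge> N" for m
        using far[OF t, of N "m - N"] N[of N] that by (simp add: dist_norm)
      have "dist (U m t) (U n t) < e" if "m \<ge> N" "n \<ge> N" for m n
        using dist_triangle_half_l[OF 1 1] that by simp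
      then show "\<exists>M. \<forall>m\<ge>M. \<forall>n\<ge>M. dist (U m t) (U n t) < e" by blast
    qed
    then show "\<exists>l. (\<lambda>n. U n t) \<longlonglongrightarrow> l" using Cauchy_convergent convergent_def by blast
  qed
  then obtain u where u: "\<And>t. t \<in> J \<Longrightarrow> (\<lambda>n. U n t) \<longlonglongrightarrow> u t" by blast
  have unif: "norm (u t - U n t) \<le> 2 * C * \<rho> / 2 ^ n" if "t \<in> J" for t n
  proof (rule tendsto_upperbound)
    show "(\<lambda>k. norm (U k t - U n t)) \<longlonglongrightarrow> norm (u t - U n t)" by (intro tendsto_intros u that)
    have "norm (U k t - U n t) \<le> 2 * C * \<rho> / 2 ^ n" if "k \<ge> n" for k
      using far[OF \<open>t \<in> J\<close>, of n "k - n"] that by simp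
    then show "\<forall>\<^sub>F k in sequentially. norm (U k t - U n t) \<le> 2 * C * \<rho> / 2 ^ n"
      unfolding eventually_sequentially by blast
  qed simp
  have ub: "norm (u t - u0 t) \<le> 2 * C * \<rho>" if "t \<in> J" for t
  proof -
    have "norm (u t - U 0 t) \<le> 2 * C * \<rho>" using unif[OF that, of 0] by simp
    moreover have "U 0 t = u0 t" using Ur(2)[OF that, of 0] by simp
    ultimately show ?thesis by simp
  qed
  have tube: "dist x (c t) \<le> \<delta>" if "norm (x - u0 t) \<le> 2 * C * \<rho>" "t \<in> J" for x t
    using that \<rho> u0(3)[OF that(2)] norm_triangle_ineq[of "x - u0 t" "u0 t - c t"] by (simp add: dist_norm)
  \<comment> \<open>A Lipschitz constant for F t on the tube, from the operator bound for B t and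
    the remainder. It makes the derivatives of the iterates converge uniformly on \<open>J\<close>
    to F t (u t).\<close>
  define \<beta> where "\<beta> = real CARD('n) * real CARD('n) * a + 1 / (4 * C)"
  have lip: "norm (U' n t - F t (u t)) \<le> (\<rho> + \<beta> * (2 * C * \<rho>)) / 2 ^ n" if t: "t \<in> J" for n t
  proof -
    have "norm (U n t - u0 t) \<le> 2 * C * \<rho> * 1"
      by (rule order_trans[OF Ur(2)[OF t]], intro mult_left_mono) (use C \<rho>0 in auto)
    then have "norm (F t (U n t) - F t (u t) - B t *v (U n t - u t)) \<le> norm (U n t - u t) / (4 * C)"
      using F tube[OF _ t] ub[OF t] by (auto simp: nearly_linear_def)
    moreover have "norm (B t *v (U n t - u t)) \<le> real CARD('n) * real CARD('n) * a * norm (U n t - u t)"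
      using B by (intro norm_matrix_vector_le) (auto simp: admissible_def)
    ultimately have "norm (F t (U n t) - F t (u t)) \<le> norm (U n t - u t) / (4 * C) + real CARD('n) * real CARD('n) * a * norm (U n t - u t)"
      using norm_triangle_mono by fastforce
    also have "\<dots> = \<beta> * norm (U n t - u t)" by (simp add: \<beta>_def algebra_simps)
    also have "\<dots> \<le> \<beta> * (2 * C * \<rho> / 2 ^ n)"
    proof (rule mult_left_mono)
      show "norm (U n t - u t) \<le> 2 * C * \<rho> / 2 ^ n" using unif[OF t, of n] by (simp add: norm_minus_commute)
      have "0 \<le> a" using B[of 0] order_trans[OF abs_ge_zero] by (auto simp: admissible_def)
      then show "0 \<le> \<beta>" using C by (simp add: \<beta>_def)
    qed
    finally have "norm (U' n t - F t (U n t) + (F t (U n t) - F t (u t))) \<le> \<rho> / 2 ^ n + \<beta> * (2 * C * \<rho> / 2 ^ n)"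
      using Ur(1)[OF t] by (intro norm_triangle_mono)
    then show ?thesis by (simp add: add_divide_distrib)
  qed
  have J0: "0 \<in> J" using J' by auto
  \<comment> \<open>Uniform convergence of the derivatives shows that the limit is differentiable
    and solves the equation.\<close>
  have "\<exists>g. \<forall>t\<in>J. (\<lambda>n. U n t) \<longlonglongrightarrow> g t \<and> (g has_derivative (\<lambda>h. h *\<^sub>R F t (u t))) (at t within J)"
  proof (rule has_derivative_sequence[where f=U and f'="\<lambda>n t h. h *\<^sub>R U' n t"])
    show "convex J" using J' by auto
    show "(U n has_derivative (\<lambda>h. h *\<^sub>R U' n t)) (at t within J)" for n t
      using has_vector_derivative_at_within[OF U] by (simp add: has_vector_derivative_def)
    show "0 \<in> J" by (rule J0)
    show "(\<lambda>n. U n 0) \<longlonglongrightarrow> u 0" by (rule u[OF J0])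
    show "\<forall>\<^sub>F n in sequentially. \<forall>t\<in>J. \<forall>h. norm (h *\<^sub>R U' n t - h *\<^sub>R F t (u t)) \<le> e * norm h" if e: "e > 0" for e
    proof -
      obtain N where N: "\<And>n. n \<ge> N \<Longrightarrow> (\<rho> + \<beta> * (2 * C * \<rho>)) / 2 ^ n < e" using small[OF e] by blast
      have "norm (h *\<^sub>R U' n t - h *\<^sub>R F t (u t)) \<le> e * norm h" if "n \<ge> N" "t \<in> J" for n t h
      proof -
        have "norm (h *\<^sub>R U' n t - h *\<^sub>R F t (u t)) = \<bar>h\<bar> * norm (U' n t - F t (u t))"
          by (simp flip: scaleR_diff_right)
        also have "\<dots> \<le> \<bar>h\<bar> * e" using lip[OF that(2), of n] N[OF that(1)] by (intro mult_left_mono) auto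
        finally show ?thesis by (simp add: mult.commute)
      qed
      then show ?thesis unfolding eventually_sequentially by blast
    qed
  qed
  then obtain g where g: "\<And>t. t \<in> J \<Longrightarrow> (\<lambda>n. U n t) \<longlonglongrightarrow> g t" "\<And>t. t \<in> J \<Longrightarrow> (g has_derivative (\<lambda>h. h *\<^sub>R F t (u t))) (at t within J)"
    by blast
  have gu: "g t = u t" if "t \<in> J" for t using LIMSEQ_unique[OF g(1) u] that by blast
  have "(u has_vector_derivative F t (u t)) (at t within J)" if "t \<in> J" for t
    unfolding has_vector_derivative_def
    by (rule has_derivative_transform[OF that _ g(2)[OF that]]) (simp add: gu)
  moreover have "u 0 = u0 0" if "J = {0..}"
    using LIMSEQ_unique[OF u[OF J0]] U0[OF that] by simp
  ultimately show ?thesis using ub by blast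
qed

text \<open>The difference of the two curves solves the linear equation with a forcing of size at
  most Y/(4C) + \<rho>, where Y is its supremum. Local control gives Y <= Y/4 + Y/4 + C \<rho>. The
  supremum is finite because both curves stay in the tube, so it can be absorbed on the
  left.\<close>

lemma tube_estimate:
  fixes B :: "real \<Rightarrow> real^'n^'n" and F :: "real \<Rightarrow> real^'n \<Rightarrow> real^'n"
  assumes C: "0 < C" "0 < W" "locally_controlled C W B" and F: "nearly_linear \<delta> c C B F" and B: "continuous_on UNIV B"
    and x: "\<And>t. (x has_vector_derivative x' t) (at t)" "continuous_on UNIV x'" "\<And>t. dist (x t) (c t) \<le> \<delta>"
    and y: "\<And>t. (y has_vector_derivative y' t) (at t)" "continuous_on UNIV y'" "\<And>t. dist (y t) (c t) \<le> \<delta>"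
    and \<rho>: "\<And>t. norm ((x' t - F t (x t)) - (y' t - F t (y t))) \<le> \<rho>"
  shows "norm (x t - y t) \<le> 2 * C * \<rho>"
proof -
  define u where "u t = x t - y t" for t
  define g where "g t = (x' t - y' t) - B t *v u t" for t
  have ud: "(u has_vector_derivative B t *v u t + g t) (at t)" for t
    unfolding u_def[abs_def] g_def using has_vector_derivative_diff[OF x(1) y(1)] by simp
  have uc: "continuous_on S u" for S
    using ud by (auto intro!: continuous_at_imp_continuous_on has_vector_derivative_continuous)
  have gc: "continuous_on S g" for S
    unfolding g_def[abs_def]
    by (intro continuous_intros continuous_on_matrix_vector_mult uc continuous_on_subset[OF x(2)]
        continuous_on_subset[OF y(2)] continuous_on_subset[OF B]) auto
  define Y where "Y = (SUP t. norm (u t))"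
  have ub: "norm (u t) \<le> 2 * \<delta>" for t
    using x(3)[of t] y(3)[of t] dist_triangle2[of "x t" "y t" "c t"] by (simp add: u_def dist_norm)
  then have bdd: "bdd_above (range (\<lambda>t. norm (u t)))" by (intro bdd_aboveI[where M="2 * \<delta>"]) auto
  have uY: "norm (u t) \<le> Y" for t unfolding Y_def by (intro cSUP_upper bdd) auto
  have gb: "norm (g t) \<le> Y / (4 * C) + \<rho>" for t
  proof -
    have "norm (F t (x t) - F t (y t) - B t *v u t) \<le> norm (u t) / (4 * C)"
      using F x(3) y(3) by (auto simp: nearly_linear_def u_def)
    also have "\<dots> \<le> Y / (4 * C)" using uY C by (intro divide_right_mono) auto
    finally have "norm ((F t (x t) - F t (y t) - B t *v u t) + ((x' t - F t (x t)) - (y' t - F t (y t)))) \<le> Y / (4 * C) + \<rho>"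
      using \<rho> by (intro norm_triangle_mono)
    then show ?thesis by (simp add: g_def algebra_simps)
  qed
  have "norm (u t) \<le> Y / 2 + C * \<rho>" for t
  proof -
    have "norm (u t) \<le> Y / 4 + C * (Y / (4 * C) + \<rho>)"
      using C(3)[unfolded locally_controlled_def, rule_format, of t u g Y "Y / (4 * C) + \<rho>"] ud uY gb gc by auto
    also have "\<dots> = Y / 2 + C * \<rho>" using C by (simp add: field_simps)
    finally show ?thesis .
  qed
  then have "Y \<le> Y / 2 + C * \<rho>" unfolding Y_def by (intro cSUP_least) auto
  then show ?thesis using uY[of t] by (simp add: u_def)
qed

text \<open>The same estimate for two exact solutions, but window by window: a bound valid from time
  n W on is halved from time (n + 1) W on. Here the two-sided window of half-length \<open>W\<close>
  around t must lie in the region where the previous bound holds, which is why each halving costs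
  one \<open>W\<close>.\<close>

lemma tube_decay:
  fixes B :: "real \<Rightarrow> real^'n^'n" and F :: "real \<Rightarrow> real^'n \<Rightarrow> real^'n"
  assumes C: "0 < C" "0 < W" "locally_controlled C W B" and F: "nearly_linear \<delta> c C B F" and B: "continuous_on UNIV B"
    and Fc: "\<And>S u. continuous_on S u \<Longrightarrow> continuous_on S (\<lambda>t. F t (u t))"
    and x: "\<And>t. 0 \<le> t \<Longrightarrow> (x has_vector_derivative F t (x t)) (at t within {0..})" "\<And>t. 0 \<le> t \<Longrightarrow> dist (x t) (c t) \<le> \<delta>"
    and y: "\<And>t. 0 \<le> t \<Longrightarrow> (y has_vector_derivative F t (y t)) (at t within {0..})" "\<And>t. 0 \<le> t \<Longrightarrow> dist (y t) (c t) \<le> \<delta>"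
  shows "((\<lambda>t. norm (x t - y t)) \<longlongrightarrow> 0) at_top"
proof -
  define u where "u t = x t - y t" for t
  define g where "g t = (F t (x t) - F t (y t)) - B t *v u t" for t
  have at: "at t within {0..} = at t" if "t > 0" for t :: real
    by (rule at_within_interior) (use that in auto)
  have ud: "(u has_vector_derivative B t *v u t + g t) (at t)" if "t > 0" for t
    unfolding u_def[abs_def] g_def using has_vector_derivative_diff[OF x(1) y(1), of t] that by (simp add: at)
  have xc: "continuous_on {0<..} x" and yc: "continuous_on {0<..} y"
    using has_vector_derivative_continuous[OF x(1)] has_vector_derivative_continuous[OF y(1)] at
    by (auto intro!: continuous_at_imp_continuous_on) (metis less_imp_le)+
  have gc: "continuous_on {0<..} g"
    unfolding g_def[abs_def] u_def
    by (intro continuous_intros continuous_on_matrix_vector_mult xc yc Fc continuous_on_subset[OF B]) auto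
  have dec: "norm (u t) \<le> 2 * \<delta> / 2 ^ n" if "t \<ge> real n * W" "t \<ge> 0" for n t
    using that
  proof (induction n arbitrary: t)
    case 0
    then show ?case using x(2)[of t] y(2)[of t] dist_triangle2[of "x t" "y t" "c t"] by (simp add: u_def dist_norm)
  next
    case (Suc n)
    define Y where "Y = 2 * \<delta> / 2 ^ n"
    have w: "s > 0" "norm (u s) \<le> Y" if "\<bar>s - t\<bar> < W" for s
    proof -
      have "t \<ge> real n * W + W" using Suc.prems by (simp add: algebra_simps)
      then have "s > real n * W" using that by linarith
      then show "s > 0" using C(2) by (meson mult_nonneg_nonneg less_le_trans of_nat_0_le_iff not_le order_less_imp_le)
      then show "norm (u s) \<le> Y" using Suc.IH[of s] \<open>s > real n * W\<close> by (simp add: Y_def)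
    qed
    have gb: "norm (g s) \<le> Y / (4 * C)" if "\<bar>s - t\<bar> < W" for s
    proof -
      have "norm (g s) \<le> norm (u s) / (4 * C)"
        using F x(2)[of s] y(2)[of s] w(1)[OF that] by (auto simp: nearly_linear_def u_def g_def)
      also have "\<dots> \<le> Y / (4 * C)" using w(2)[OF that] C by (intro divide_right_mono) auto
      finally show ?thesis .
    qed
    have "{t - W<..<t + W} \<subseteq> {0<..}" using w(1) by (auto simp: abs_less_iff)
    then have "continuous_on {t - W<..<t + W} g" using gc continuous_on_subset by blast
    then have "norm (u t) \<le> Y / 4 + C * (Y / (4 * C))"
      using C(3)[unfolded locally_controlled_def, rule_format, of t u g Y "Y / (4 * C)"] ud w gb by auto
    also have "\<dots> = Y / 2" using C by (simp add: field_simps)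
    finally show ?case by (simp add: Y_def)
  qed
  show ?thesis
  proof (rule tendstoI)
    fix e :: real assume "e > 0"
    have "(\<lambda>n. 2 * \<delta> * (1 / 2) ^ n) \<longlonglongrightarrow> 0" by (intro tendsto_mult_right_zero LIMSEQ_realpow_zero) auto
    from order_tendstoD(2)[OF this \<open>e > 0\<close>] obtain n where n: "2 * \<delta> / 2 ^ n < e"
      by (auto simp: eventually_sequentially power_divide)
    have "dist (norm (x t - y t)) 0 < e" if "t \<ge> real n * W" for t
    proof -
      have "t \<ge> 0" using that C(2) by (meson mult_nonneg_nonneg of_nat_0_le_iff order_trans less_imp_le)
      then show ?thesis using dec[of n t] that n by (simp add: u_def)
    qed
    then show "\<forall>\<^sub>F t in at_top. dist (norm (x t - y t)) 0 < e"
      unfolding eventually_at_top_linorder by blast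
  qed
qed

section \<open>Curves with bounded uniformly continuous derivatives\<close>

text \<open>The counterpart of \<open>uniform_Ck_on\<close> for curves. The derivative is quantified
  instead of computed, so that a closed formula for it can be supplied directly. Uniform continuity
  of the last derivative is part of the notion.\<close>

primrec UC :: "nat \<Rightarrow> (real \<Rightarrow> 'a::real_normed_vector) \<Rightarrow> bool" where
  "UC 0 y \<longleftrightarrow> bounded (range y) \<and> uniformly_continuous_on UNIV y"
| "UC (Suc k) y \<longleftrightarrow> bounded (range y) \<and> uniformly_continuous_on UNIV y \<and>
     (\<exists>y'. (\<forall>t. (y has_vector_derivative y' t) (at t)) \<and> UC k y')"

lemma UC_base: "UC k y \<Longrightarrow> bounded (range y)" "UC k y \<Longrightarrow> uniformly_continuous_on UNIV y"
  by (cases k; simp)+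

lemma uniformly_continuous_of_bounded_derivative:
  fixes y :: "real \<Rightarrow> 'a::real_normed_vector"
  assumes "\<And>t. (y has_vector_derivative y' t) (at t)" and "bounded (range y')"
  shows "uniformly_continuous_on UNIV y"
proof -
  obtain B where B: "\<And>t. norm (y' t) \<le> B" using assms(2) by (auto simp: bounded_iff)
  have lip: "norm (y s - y t) \<le> B * norm (s - t)" for s t
  proof (rule differentiable_bound[of UNIV y "\<lambda>t h. h *\<^sub>R y' t"])
    show "(y has_derivative (\<lambda>h. h *\<^sub>R y' t)) (at t within UNIV)" for t
      using assms(1) by (simp add: has_vector_derivative_def)
    show "onorm (\<lambda>h. h *\<^sub>R y' t) \<le> B" for t
    proof (rule onorm_le)
      show "norm (h *\<^sub>R y' t) \<le> B * norm h" for h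
        using mult_left_mono[OF B[of t], of "\<bar>h\<bar>"] by (simp add: mult.commute)
    qed
  qed auto
  have "B \<ge> 0" using B order_trans[OF norm_ge_zero] by blast
  then have "B-lipschitz_on UNIV y" using lip by (intro lipschitz_onI) (auto simp: dist_norm)
  then show ?thesis by (rule lipschitz_on_uniformly_continuous)
qed

lemma UC_SucI:
  assumes "\<And>t. (y has_vector_derivative y' t) (at t)" "UC k y'" "bounded (range y)"
  shows "UC (Suc k) y"
  unfolding UC.simps(2)
  using assms uniformly_continuous_of_bounded_derivative[OF assms(1) UC_base(1)[OF assms(2)]] by blast

lemma UC_SucD: "UC (Suc k) y \<Longrightarrow> UC k y"
proof (induction k arbitrary: y)
  case (Suc k)
  from Suc.prems obtain y' where d: "bounded (range y)" "uniformly_continuous_on UNIV y"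
    "\<forall>t. (y has_vector_derivative y' t) (at t)" "UC (Suc k) y'"
    by (metis UC.simps(2))
  from Suc.IH[OF d(4)] d(1-3) show ?case by (metis UC.simps(2))
qed simp

lemma UC_le: "UC k y \<Longrightarrow> j \<le> k \<Longrightarrow> UC j y"
  by (induction k) (auto simp: le_Suc_eq dest: UC_SucD simp del: UC.simps)

lemma UC_SucE:
  assumes "UC (Suc k) y"
  shows "(y has_vector_derivative vector_derivative y (at t)) (at t)"
    "UC k (\<lambda>t. vector_derivative y (at t))"
proof -
  obtain y' where y': "\<And>t. (y has_vector_derivative y' t) (at t)" "UC k y'" using assms by auto
  have "(\<lambda>t. vector_derivative y (at t)) = y'" using vector_derivative_at[OF y'(1)] by auto
  then show "(y has_vector_derivative vector_derivative y (at t)) (at t)"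
    "UC k (\<lambda>t. vector_derivative y (at t))" using y' by (auto simp: fun_eq_iff)
qed

lemma UC_const [simp]: "UC k (\<lambda>t. c)"
proof (induction k arbitrary: c)
  case (Suc k)
  then show ?case by (intro UC_SucI[where y'="\<lambda>t. 0"]) auto
qed (simp add: uniformly_continuous_on_const)

lemma UC_add: "UC k y \<Longrightarrow> UC k z \<Longrightarrow> UC k (\<lambda>t. y t + z t)"
proof (induction k arbitrary: y z)
  case 0
  then show ?case by (auto intro: bounded_plus_comp uniformly_continuous_on_add)
next
  case (Suc k)
  obtain y' z' where d: "\<And>t. (y has_vector_derivative y' t) (at t)" "UC k y'"
    "\<And>t. (z has_vector_derivative z' t) (at t)" "UC k z'" using Suc.prems by auto
  show ?case
    by (rule UC_SucI[where y'="\<lambda>t. y' t + z' t"])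
      (use d Suc in \<open>auto intro: has_vector_derivative_add bounded_plus_comp\<close>)
qed

lemma UC_linear: "bounded_linear f \<Longrightarrow> UC k y \<Longrightarrow> UC k (\<lambda>t. f (y t))"
proof (induction k arbitrary: y)
  case 0
  then show ?case
    using bounded_linear_image[of "range y" f] bounded_linear.uniformly_continuous_on[of f UNIV y]
    by (simp add: image_image)
next
  case (Suc k)
  obtain y' where d: "\<And>t. (y has_vector_derivative y' t) (at t)" "UC k y'" using Suc.prems by auto
  show ?case
  proof (rule UC_SucI)
    show "((\<lambda>t. f (y t)) has_vector_derivative f (y' t)) (at t)" for t
      using bounded_linear.has_vector_derivative[OF Suc.prems(1) d(1)] .
    show "UC k (\<lambda>t. f (y' t))" by (rule Suc.IH[OF Suc.prems(1) d(2)])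
    show "bounded (range (\<lambda>t. f (y t)))"
      using bounded_linear_image[of "range y" f] Suc.prems by (auto simp: image_image)
  qed
qed

lemma UC_bilinear_0:
  assumes "bounded_bilinear b" and yz: "UC 0 y" "UC 0 z"
  shows "UC 0 (\<lambda>t. b (y t) (z t))"
proof -
    interpret b: bounded_bilinear b by (rule assms(1))
    obtain B where B: "\<And>x y. norm (b x y) \<le> norm x * norm y * B" "B > 0"
      using b.pos_bounded by blast
    obtain Y Z where YZ: "\<And>t. norm (y t) \<le> Y" "\<And>t. norm (z t) \<le> Z" "Y > 0" "Z > 0"
      using UC_base(1)[OF yz(1)] UC_base(1)[OF yz(2)] by (auto simp: bounded_pos)
    have "norm (b (y t) (z t)) \<le> Y * Z * B" for t
      using B(1)[of "y t" "z t"] YZ B(2) by (smt (verit, best) mult_mono mult_right_mono norm_ge_zero)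
    then have "bounded (range (\<lambda>t. b (y t) (z t)))" by (auto simp: bounded_iff)
    moreover have "uniformly_continuous_on UNIV (\<lambda>t. b (y t) (z t))"
      unfolding uniformly_continuous_on_def
    proof (intro allI impI)
      fix e :: real assume e: "e > 0"
      define M where "M = Y + Z"
      have M: "M > 0" using YZ by (simp add: M_def)
      define d where "d = e / (2 * M * B)"
      have d: "d > 0" using e M B by (simp add: d_def)
      obtain d1 where d1: "d1 > 0" "\<And>s t. dist s t < d1 \<Longrightarrow> dist (y s) (y t) < d"
        using yz(1) d unfolding UC.simps uniformly_continuous_on_def by blast
      obtain d2 where d2: "d2 > 0" "\<And>s t. dist s t < d2 \<Longrightarrow> dist (z s) (z t) < d"
        using yz(2) d unfolding UC.simps uniformly_continuous_on_def by blast
      have "dist (b (y s) (z s)) (b (y t) (z t)) < e" if st: "dist s t < min d1 d2" for s t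
      proof -
        have "b (y s) (z s) - b (y t) (z t) = b (y s - y t) (z s) + b (y t) (z s - z t)"
          by (simp add: b.diff_left b.diff_right)
        also have "norm \<dots> \<le> norm (y s - y t) * norm (z s) * B + norm (y t) * norm (z s - z t) * B"
          by (intro norm_triangle_mono B)
        also have "\<dots> \<le> d * Z * B + Y * d * B"
          using d1(2)[of s t] d2(2)[of s t] st YZ B d
          by (intro add_mono mult_right_mono mult_mono) (auto simp: dist_norm)
        also have "\<dots> = d * M * B" by (simp add: M_def algebra_simps)
        also have "\<dots> = e / 2" using M B by (simp add: d_def)
        also have "\<dots> < e" using e by simp
        finally show ?thesis by (simp add: dist_norm)
      qed
      then show "\<exists>d>0. \<forall>x\<in>UNIV. \<forall>x'\<in>UNIV. dist x' x < d \<longrightarrow> dist (b (y x') (z x')) (b (y x) (z x)) < e"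
        using d1(1) d2(1) by (intro exI[of _ "min d1 d2"]) auto
    qed
  ultimately show ?thesis by simp
qed

lemma UC_bilinear:
  assumes "bounded_bilinear b"
  shows "UC k y \<Longrightarrow> UC k z \<Longrightarrow> UC k (\<lambda>t. b (y t) (z t))"
proof (induction k arbitrary: y z)
  case 0
  then show ?case by (rule UC_bilinear_0[OF assms])
next
  case (Suc k)
  obtain y' z' where d: "\<And>t. (y has_vector_derivative y' t) (at t)" "UC k y'"
    "\<And>t. (z has_vector_derivative z' t) (at t)" "UC k z'" using Suc.prems by auto
  show ?case
  proof (rule UC_SucI)
    show "((\<lambda>t. b (y t) (z t)) has_vector_derivative b (y t) (z' t) + b (y' t) (z t)) (at t)" for t
      by (rule bounded_bilinear.has_vector_derivative[OF assms d(1,3)])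
    show "UC k (\<lambda>t. b (y t) (z' t) + b (y' t) (z t))"
      by (rule UC_add[OF Suc.IH[OF UC_SucD[OF Suc.prems(1)] d(4)] Suc.IH[OF d(2) UC_SucD[OF Suc.prems(2)]]])
    show "bounded (range (\<lambda>t. b (y t) (z t)))"
      using UC_bilinear_0[OF assms UC_le[OF Suc.prems(1), of 0] UC_le[OF Suc.prems(2), of 0]] by simp
  qed
qed

lemma UC_scaleR_const: "UC k y \<Longrightarrow> UC k (\<lambda>t. c *\<^sub>R y t)"
  by (rule UC_linear[OF bounded_linear_scaleR_right])

lemma UC_minus: "UC k y \<Longrightarrow> UC k (\<lambda>t. - y t)"
  using UC_linear[OF bounded_linear_minus[OF bounded_linear_ident]] .

lemma UC_diff: "UC k y \<Longrightarrow> UC k z \<Longrightarrow> UC k (\<lambda>t. y t - z t)"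
  using UC_add[OF _ UC_minus, of k y z] by simp

lemma UC_sum: "(\<And>i. i \<in> I \<Longrightarrow> UC k (y i)) \<Longrightarrow> UC k (\<lambda>t. \<Sum>i\<in>I. y i t)"
  by (induction I rule: infinite_finite_induct) (auto intro: UC_add)

lemma UC_mult: "UC k y \<Longrightarrow> UC k z \<Longrightarrow> UC k (\<lambda>t. y t * z t)"
  for y z :: "real \<Rightarrow> 'a::real_normed_algebra"
  by (rule UC_bilinear[OF bounded_bilinear_mult])

lemma UC_scaleR: "UC k y \<Longrightarrow> UC k z \<Longrightarrow> UC k (\<lambda>t. y t *\<^sub>R z t)"
  by (rule UC_bilinear[OF bounded_bilinear_scaleR])

lemma UC_prod: "(\<And>i. i \<in> I \<Longrightarrow> UC k (y i)) \<Longrightarrow> UC k (\<lambda>t. \<Prod>i\<in>I. y i t :: real)"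
  by (induction I rule: infinite_finite_induct) (auto intro: UC_mult)

lemma UC_power: "UC k y \<Longrightarrow> UC k (\<lambda>t. y t ^ n :: real)"
  by (induction n) (auto intro: UC_mult)

lemma UC_vec: "(\<And>i. UC k (\<lambda>t. y t $ i)) \<Longrightarrow> UC k y" for y :: "real \<Rightarrow> 'a::real_normed_vector^'n"
proof -
  assume *: "\<And>i. UC k (\<lambda>t. y t $ i)"
  have bl: "bounded_linear (\<lambda>x::'a. axis i x :: 'a^'n)" for i
    by (rule bounded_linear_intro[where K=1])
      (use norm_axis_le in \<open>auto simp: vec_eq_iff axis_def\<close>)
  have "UC k (\<lambda>t. \<Sum>i\<in>UNIV. axis i (y t $ i))"
    by (intro UC_sum UC_linear[OF bl] *)
  moreover have "(\<Sum>i\<in>UNIV. axis i (x $ i)) = x" for x :: "'a^'n"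
    by (simp add: vec_eq_iff axis_def if_distrib sum.delta cong: if_cong)
  ultimately show ?thesis by simp
qed

lemma UC_nth: "UC k y \<Longrightarrow> UC k (\<lambda>t. y t $ i)"
  by (rule UC_linear[OF bounded_linear_vec_nth])

lemma bounded_bilinear_matrix_mult:
  "bounded_bilinear ((**) :: real^'n^'m \<Rightarrow> real^'p^'n \<Rightarrow> real^'p^'m)"
  unfolding bilinear_conv_bounded_bilinear[symmetric] bilinear_def
proof (intro conjI allI linearI)
  fix x y :: "real^'n^'m" and z w :: "real^'p^'n" and c :: real
  show "x ** (z + w) = x ** z + x ** w"
    by (simp add: vec_eq_iff matrix_matrix_mult_def distrib_left sum.distrib)
  show "x ** (c *\<^sub>R z) = c *\<^sub>R (x ** z)"
    by (simp add: vec_eq_iff matrix_matrix_mult_def sum_distrib_left mult.left_commute)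
  show "(x + y) ** z = x ** z + y ** z"
    by (simp add: vec_eq_iff matrix_matrix_mult_def distrib_right sum.distrib)
  show "(c *\<^sub>R x) ** z = c *\<^sub>R (x ** z)"
    by (simp add: vec_eq_iff matrix_matrix_mult_def sum_distrib_left mult.assoc)
qed

text \<open>Used for the inverse of a matrix curve, whose difference quotient has a closed
  form.\<close>

lemma has_vector_derivative_iff_quotient:
  "(f has_vector_derivative D) (at x) \<longleftrightarrow> ((\<lambda>y. (f y - f x) /\<^sub>R (y - x)) \<longlongrightarrow> D) (at x)"
proof -
  have "norm ((f y - f x - (y - x) *\<^sub>R D) /\<^sub>R norm (y - x)) = norm ((f y - f x) /\<^sub>R (y - x) - D)"
    if "y \<noteq> x" for y
  proof -
    have "(f y - f x) /\<^sub>R (y - x) - D = (f y - f x - (y - x) *\<^sub>R D) /\<^sub>R (y - x)"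
      using that by (simp add: scaleR_diff_right)
    then show ?thesis by simp
  qed
  then have ev: "\<forall>\<^sub>F y in at x. norm ((f y - f x - (y - x) *\<^sub>R D) /\<^sub>R norm (y - x)) = norm ((f y - f x) /\<^sub>R (y - x) - D)"
    by (auto simp: eventually_at_filter)
  have "(f has_vector_derivative D) (at x) \<longleftrightarrow>
      ((\<lambda>y. norm ((f y - f x - (y - x) *\<^sub>R D) /\<^sub>R norm (y - x))) \<longlongrightarrow> 0) (at x)"
    unfolding has_vector_derivative_def has_derivative_at_within tendsto_norm_zero_iff
    by (simp add: bounded_linear_scaleR_left)
  also have "\<dots> \<longleftrightarrow> ((\<lambda>y. norm ((f y - f x) /\<^sub>R (y - x) - D)) \<longlongrightarrow> 0) (at x)"
    by (rule tendsto_cong[OF ev])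
  also have "\<dots> \<longleftrightarrow> ((\<lambda>y. (f y - f x) /\<^sub>R (y - x)) \<longlongrightarrow> D) (at x)"
    unfolding tendsto_norm_zero_iff LIM_zero_iff by simp
  finally show ?thesis .
qed

text \<open>The identity R s - R t = R s (A t - A s) R t transfers uniform continuity from A to R
  once R is bounded, and in the limit gives R' = - R A' R. This expresses R' through R and A', so
  the induction gains one derivative at a time.\<close>

lemma UC_matrix_inverse:
  fixes A R :: "real \<Rightarrow> real^'n^'n"
  assumes inv: "\<And>t. A t ** R t = mat 1" "\<And>t. R t ** A t = mat 1" and b: "bounded (range R)"
  shows "UC k A \<Longrightarrow> UC k R"
proof (induction k)
  case 0
  interpret m: bounded_bilinear "(**) :: real^'n^'n \<Rightarrow> real^'n^'n \<Rightarrow> real^'n^'n"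
    by (rule bounded_bilinear_matrix_mult)
  have diff: "R s - R t = R s ** (A t - A s) ** R t" for s t
  proof -
    have "R s ** A t ** R t = R s" by (simp only: matrix_mul_assoc[symmetric] inv matrix_mul_rid)
    moreover have "R s ** A s ** R t = R t" by (simp only: inv matrix_mul_lid)
    ultimately show ?thesis by (simp only: m.diff_right m.diff_left)
  qed
  obtain B where B: "\<And>(x :: real^'n^'n) (y :: real^'n^'n). norm (x ** y) \<le> norm x * norm y * B" "B > 0"
    using m.pos_bounded by blast
  obtain M where M: "\<And>t. norm (R t) \<le> M" "M > 0" using b by (auto simp: bounded_pos)
  have "uniformly_continuous_on UNIV R"
    unfolding uniformly_continuous_on_def
  proof (intro allI impI)
    fix e :: real assume e: "e > 0"
    define d where "d = e / (M * B * M * B)"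
    have d: "d > 0" using e M B by (simp add: d_def)
    obtain d1 where d1: "d1 > 0" "\<And>s t. dist s t < d1 \<Longrightarrow> dist (A s) (A t) < d"
      using 0 d unfolding UC.simps uniformly_continuous_on_def by blast
    have "dist (R s) (R t) < e" if st: "dist s t < d1" for s t
    proof -
      have "norm (R s - R t) \<le> norm (R s ** (A t - A s)) * norm (R t) * B"
        unfolding diff by (rule B)
      also have "\<dots> \<le> (norm (R s) * norm (A t - A s) * B) * norm (R t) * B"
        using B by (intro mult_right_mono) auto
      also have "\<dots> \<le> (M * norm (A t - A s) * B) * M * B"
        using B M by (intro mult_mono) auto
      also have "\<dots> = (M * B * M * B) * norm (A t - A s)" by simp
      also have "\<dots> < (M * B * M * B) * d"
        using d1(2)[OF st] M B by (intro mult_strict_left_mono) (auto simp: dist_norm norm_minus_commute)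
      also have "\<dots> = e" using M B by (simp add: d_def)
      finally show ?thesis by (simp add: dist_norm)
    qed
    then show "\<exists>d>0. \<forall>x\<in>UNIV. \<forall>x'\<in>UNIV. dist x' x < d \<longrightarrow> dist (R x') (R x) < e" using d1(1) by auto
  qed
  then show ?case using b by simp
next
  case (Suc k)
  obtain A' where d: "\<And>t. (A has_vector_derivative A' t) (at t)" "UC k A'" using Suc.prems by auto
  interpret m: bounded_bilinear "(**) :: real^'n^'n \<Rightarrow> real^'n^'n \<Rightarrow> real^'n^'n"
    by (rule bounded_bilinear_matrix_mult)
  have Rk: "UC k R" using Suc UC_SucD by blast
  have diff: "R s - R t = R s ** (A t - A s) ** R t" for s t
  proof -
    have "R s ** A t ** R t = R s" by (simp only: matrix_mul_assoc[symmetric] inv matrix_mul_rid)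
    moreover have "R s ** A s ** R t = R t" by (simp only: inv matrix_mul_lid)
    ultimately show ?thesis by (simp only: m.diff_right m.diff_left)
  qed
  show ?case
  proof (rule UC_SucI)
    show "(R has_vector_derivative - (R t ** A' t ** R t)) (at t)" for t
    proof -
      have "continuous_on UNIV R" using UC_base(2)[OF Rk] by (rule uniformly_continuous_imp_continuous)
      then have "(R \<longlongrightarrow> R t) (at t)" by (simp add: continuous_on_eq_continuous_at isCont_def)
      then have "((\<lambda>s. - (R s ** ((A s - A t) /\<^sub>R (s - t)) ** R t)) \<longlongrightarrow> - (R t ** A' t ** R t)) (at t)"
        using d(1)[of t, unfolded has_vector_derivative_iff_quotient]
        by (intro tendsto_minus m.tendsto tendsto_const)
      moreover have "- (R s ** ((A s - A t) /\<^sub>R (s - t)) ** R t) = (R s - R t) /\<^sub>R (s - t)" for s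
        unfolding diff m.scaleR_right m.scaleR_left
        by (simp add: m.diff_left m.diff_right scaleR_diff_right)
      ultimately show ?thesis by (simp add: has_vector_derivative_iff_quotient)
    qed
    show "UC k (\<lambda>t. - (R t ** A' t ** R t))"
      by (intro UC_minus UC_bilinear[OF bounded_bilinear_matrix_mult] Rk d)
    show "bounded (range R)" by (rule b)
  qed
qed

section \<open>Relation to differentiable maps of several variables\<close>

lemma has_derivative_of_vector_derivative:
  "(y has_vector_derivative y' t) (at t) \<Longrightarrow> frechet_derivative y (at t) = (\<lambda>h. h *\<^sub>R y' t)"
  unfolding has_vector_derivative_def by (rule frechet_derivative_at[symmetric])

lemma UC_imp_Ck: "UC k y \<Longrightarrow> Ck k y"
proof (induction k arbitrary: y)
  case 0
  then show ?case by (simp add: uniformly_continuous_imp_continuous)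
next
  case (Suc k)
  obtain y' where d: "\<And>t. (y has_vector_derivative y' t) (at t)" "UC k y'" using Suc.prems by auto
  have e: "frechet_derivative y (at z) = (\<lambda>h. h *\<^sub>R y' z)" for z
    using d(1)[of z] by (rule has_derivative_of_vector_derivative)
  have "Ck k (\<lambda>z. frechet_derivative y (at z) v)" for v
    unfolding e by (intro Suc.IH UC_scaleR_const d)
  moreover have "y differentiable (at z)" for z
    using d(1)[of z] unfolding has_vector_derivative_def differentiable_def by blast
  ultimately show ?case by simp
qed

lemma Ck_SucD: "Ck (Suc k) g \<Longrightarrow> Ck k g"
proof (induction k arbitrary: g)
  case 0
  have "isCont g z" for z
    by (rule differentiable_imp_continuous_within) (use 0 in simp)
  then show ?case by (simp add: continuous_at_imp_continuous_on)
next
  case (Suc k)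
  from Suc.prems have "\<forall>z. g differentiable (at z)" "\<And>v. Ck (Suc k) (\<lambda>z. frechet_derivative g (at z) v)"
    by (simp_all only: Ck.simps(2)[of "Suc k"]) blast+
  with Suc.IH show ?case by (simp only: Ck.simps(2)[of k]) blast
qed

lemma Ck_le: "Ck k g \<Longrightarrow> j \<le> k \<Longrightarrow> Ck j g"
  by (induction k) (simp, metis Ck_SucD le_Suc_eq)

lemma uniform_Ck_on_SucD: "uniform_Ck_on (Suc k) S g \<Longrightarrow> uniform_Ck_on k S g"
proof (induction k arbitrary: g)
  case (Suc k)
  from Suc.prems have "bounded (g ` S)" "uniformly_continuous_on S g"
    "\<And>v. uniform_Ck_on (Suc k) S (\<lambda>z. frechet_derivative g (at z) v)"
    by (simp_all only: uniform_Ck_on.simps(2)[of "Suc k"])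
  with Suc.IH show ?case by (simp only: uniform_Ck_on.simps(2)[of k]) blast
qed simp

lemma uniform_Ck_on_le: "uniform_Ck_on k S g \<Longrightarrow> j \<le> k \<Longrightarrow> uniform_Ck_on j S g"
  by (induction k) (simp, metis uniform_Ck_on_SucD le_Suc_eq)

lemma uniformly_continuous_on_subset:
  "uniformly_continuous_on S g \<Longrightarrow> T \<subseteq> S \<Longrightarrow> uniformly_continuous_on T g"
  unfolding uniformly_continuous_on_uniformity
  by (erule filterlim_mono[OF _ order_refl]) (intro inf_mono order_refl, auto)

lemma uniform_Ck_on_base: "uniform_Ck_on k S g \<Longrightarrow> bounded (g ` S)"
  "uniform_Ck_on k S g \<Longrightarrow> uniformly_continuous_on S g"
  by (cases k; simp)+

text \<open>The curve itself may be unbounded, as is the graph of a curve over the slow time.\<close>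

lemma UC_compose:
  fixes g :: "'a::euclidean_space \<Rightarrow> 'b::real_normed_vector"
  assumes "Ck k g" "uniform_Ck_on k S g" "range y \<subseteq> S" "uniformly_continuous_on UNIV y"
    and "k = 0 \<or> (\<exists>y'. (\<forall>t. (y has_vector_derivative y' t) (at t)) \<and> UC (k - 1) y')"
  shows "UC k (\<lambda>t. g (y t))"
  using assms
proof (induction k arbitrary: g)
  case 0
  have "uniformly_continuous_on UNIV (\<lambda>t. g (y t))"
  proof (rule uniformly_continuous_on_compose[OF 0(4)])
    have "uniformly_continuous_on S g" using 0(2) by simp
    then show "uniformly_continuous_on (range y) g"
      by (rule uniformly_continuous_on_subset) (rule 0(3))
  qed
  moreover have "bounded (range (\<lambda>t. g (y t)))"
    by (rule bounded_subset[of "g ` S"]) (use 0(2,3) in auto)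
  ultimately show ?case by simp
next
  case (Suc k)
  obtain y' where d: "\<And>t. (y has_vector_derivative y' t) (at t)" "UC k y'" using Suc.prems by auto
  have gd: "(g has_derivative frechet_derivative g (at z)) (at z)" for z
    using Suc.prems(1) by (simp add: frechet_derivative_works)
  show ?case
  proof (rule UC_SucI)
    show "((\<lambda>t. g (y t)) has_vector_derivative frechet_derivative g (at (y t)) (y' t)) (at t)" for t
    proof -
      have "((\<lambda>t. g (y t)) has_derivative (\<lambda>h. frechet_derivative g (at (y t)) (h *\<^sub>R y' t))) (at t)"
        using has_derivative_compose[OF d(1)[of t, unfolded has_vector_derivative_def] gd] .
      then show ?thesis
        by (simp add: has_vector_derivative_def linear_scale[OF has_derivative_linear[OF gd]])
    qed
    have e: "frechet_derivative g (at (y t)) (y' t) =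
        (\<Sum>b\<in>Basis. (y' t \<bullet> b) *\<^sub>R frechet_derivative g (at (y t)) b)" for t
    proof -
      have "frechet_derivative g (at (y t)) (y' t) =
          frechet_derivative g (at (y t)) (\<Sum>b\<in>Basis. (y' t \<bullet> b) *\<^sub>R b)" by (simp add: euclidean_representation)
      also have "\<dots> = (\<Sum>b\<in>Basis. (y' t \<bullet> b) *\<^sub>R frechet_derivative g (at (y t)) b)"
        by (simp add: linear_sum[OF has_derivative_linear[OF gd]] linear_scale[OF has_derivative_linear[OF gd]])
      finally show ?thesis .
    qed
    show "UC k (\<lambda>t. frechet_derivative g (at (y t)) (y' t))"
      unfolding e
    proof (intro UC_sum UC_scaleR)
      show "UC k (\<lambda>t. y' t \<bullet> b)" for b by (rule UC_linear[OF bounded_linear_inner_left d(2)])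
      have "k = 0 \<or> (\<exists>y'. (\<forall>t. (y has_vector_derivative y' t) (at t)) \<and> UC (k - 1) y')"
        using d UC_le[OF d(2), of "k - 1"] by auto
      then show "UC k (\<lambda>t. frechet_derivative g (at (y t)) b)" for b
        using Suc.prems by (intro Suc.IH) auto
    qed
    show "bounded (range (\<lambda>t. g (y t)))"
      by (rule bounded_subset[of "g ` S"]) (use Suc.prems(2,3) in auto)
  qed
qed

lemma UC_compose_graph:
  fixes g :: "(real^'n) \<times> real \<Rightarrow> 'b::real_normed_vector" and u :: "real \<Rightarrow> real^'n"
  assumes g: "Ck k g" "uniform_Ck_on k S g" and S: "\<And>t. (u t, t) \<in> S" and u: "UC k u"
  shows "UC k (\<lambda>t. g (u t, t))"
proof (rule UC_compose[OF g])
  have 1: "bounded_linear (\<lambda>x::real^'n. (x, 0::real))" and 2: "bounded_linear (\<lambda>x::real. (0::real^'n, x))"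
    by (auto intro!: bounded_linear_Pair bounded_linear_ident bounded_linear_zero)
  have "uniformly_continuous_on UNIV (\<lambda>t. (u t, 0) + (0, t))"
    by (intro uniformly_continuous_on_add bounded_linear.uniformly_continuous_on[OF 1]
        bounded_linear.uniformly_continuous_on[OF 2] UC_base(2)[OF u] uniformly_continuous_on_id)
  then show "uniformly_continuous_on UNIV (\<lambda>t. (u t, t))" by simp
  show "k = 0 \<or> (\<exists>y'. (\<forall>t. ((\<lambda>t. (u t, t)) has_vector_derivative y' t) (at t)) \<and> UC (k - 1) y')"
  proof (cases k)
    case (Suc j)
    then obtain u' where d: "\<And>t. (u has_vector_derivative u' t) (at t)" "UC j u'" using u by auto
    have "((\<lambda>t. (u t, t)) has_vector_derivative (u' t, 1::real)) (at t)" for t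
      by (intro has_vector_derivative_Pair d has_vector_derivative_id)
    moreover have "UC j (\<lambda>t. (u' t, 0) + (0, 1::real))"
      by (rule UC_add[OF UC_linear[OF 1 d(2)] UC_const])
    then have "UC j (\<lambda>t. (u' t, 1::real))" by simp
    ultimately show ?thesis unfolding Suc diff_Suc_1 by (intro disjI2 exI[of _ "\<lambda>t. (u' t, 1)"]) blast
  qed simp
  show "range (\<lambda>t. (u t, t)) \<subseteq> S" using S by blast
qed

section \<open>Coefficients of the formal power series\<close>

lemma Ck_SucE:
  assumes "Ck (Suc k) g"
  shows "(g has_derivative frechet_derivative g (at z)) (at z)" "Ck k (\<lambda>z. frechet_derivative g (at z) v)"
  using assms by (simp_all add: frechet_derivative_works[symmetric])

lemma partial_x_eq:
  fixes g :: "(real^'n) \<times> real \<Rightarrow> real^'n"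
  assumes "Ck (Suc k) g"
  shows "partial_x i g = (\<lambda>z. frechet_derivative g (at z) (axis i 1, 0))"
proof
  fix z :: "(real^'n) \<times> real"
  obtain x \<alpha> where z: "z = (x, \<alpha>)" by (cases z)
  let ?D = "frechet_derivative g (at z)"
  have gd: "(g has_derivative ?D) (at z)" by (rule Ck_SucE(1)[OF assms])
  have "((\<lambda>h::real. (x + h *\<^sub>R axis i 1, \<alpha>)) has_derivative (\<lambda>h. (h *\<^sub>R axis i 1, 0))) (at 0)"
    by (auto intro!: derivative_eq_intros)
  from has_derivative_compose[OF this, of g ?D] gd
  have "((\<lambda>h. g (x + h *\<^sub>R axis i 1, \<alpha>)) has_derivative (\<lambda>h. ?D (h *\<^sub>R axis i 1, 0))) (at 0)"
    by (simp add: z)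
  moreover have "?D (h *\<^sub>R axis i 1, 0) = h *\<^sub>R ?D (axis i 1, 0)" for h
    using linear_scale[OF has_derivative_linear[OF gd], of h "(axis i 1, 0)"] by simp
  ultimately have "((\<lambda>h. g (x + h *\<^sub>R axis i 1, \<alpha>)) has_vector_derivative ?D (axis i 1, 0)) (at 0)"
    by (simp add: has_vector_derivative_def)
  then show "partial_x i g z = ?D (axis i 1, 0)"
    by (simp add: partial_x_def z vector_derivative_at)
qed

lemma partial_x_Ck: "Ck (Suc k) g \<Longrightarrow> Ck k (partial_x i g)"
  by (subst partial_x_eq) (assumption, rule Ck_SucE(2))

lemma partial_x_uniform: "Ck (Suc k) g \<Longrightarrow> uniform_Ck_on (Suc k) S g \<Longrightarrow> uniform_Ck_on k S (partial_x i g)"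
  by (subst partial_x_eq) (assumption, simp)

lemma foldr_partial_x:
  "Ck (k + length is) g \<Longrightarrow> Ck k (foldr partial_x is g) \<and>
    (uniform_Ck_on (k + length is) S g \<longrightarrow> uniform_Ck_on k S (foldr partial_x is g))"
proof (induction "is" arbitrary: k)
  case (Cons i "is")
  have "Ck (Suc k) (foldr partial_x is g) \<and>
    (uniform_Ck_on (Suc k + length is) S g \<longrightarrow> uniform_Ck_on (Suc k) S (foldr partial_x is g))"
    by (rule Cons.IH) (use Cons.prems in simp)
  then show ?case using partial_x_Ck partial_x_uniform by (metis add_Suc_shift comp_apply foldr_Cons length_Cons)
qed simp

text \<open>Shows that the choice in \<open>mixed_partial_x\<close> is not void: any listing of the
  multiset in which i occurs with multiplicity \<gamma> $ i qualifies. Its length is the order of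
  differentiation.\<close>

lemma multi_index_list:
  fixes \<gamma> :: "nat^'n"
  defines "xs \<equiv> (SOME is. \<forall>i. count_list is i = \<gamma> $ i)"
  shows "count_list xs i = \<gamma> $ i" "length xs = mi_size \<gamma>"
proof -
  obtain ys where ys: "mset ys = (\<Sum>i\<in>UNIV. replicate_mset (\<gamma> $ i) i)" using ex_mset by blast
  have "count_list ys i = \<gamma> $ i" for i
    unfolding count_mset[symmetric] ys by (simp add: count_sum)
  then have "\<exists>is. \<forall>i. count_list is i = \<gamma> $ i" by blast
  then have c: "\<forall>i. count_list xs i = \<gamma> $ i" unfolding xs_def by (rule someI_ex)
  then show "count_list xs i = \<gamma> $ i" by blast
  have "length xs = (\<Sum>i\<in>UNIV. count_list xs i)" by (subst sum_count_set) auto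
  then show "length xs = mi_size \<gamma>" using c by (simp add: mi_size_def)
qed

lemma mixed_partial_x_regular:
  assumes "mi_size \<gamma> + k \<le> r" "Ck r g" "uniform_Ck_on r S g"
  shows "Ck k (mixed_partial_x \<gamma> g)" "uniform_Ck_on k S (mixed_partial_x \<gamma> g)"
proof -
  have 1: "Ck (k + mi_size \<gamma>) g" by (rule Ck_le[OF assms(2)]) (use assms(1) in simp)
  have 2: "uniform_Ck_on (k + mi_size \<gamma>) S g" by (rule uniform_Ck_on_le[OF assms(3)]) (use assms(1) in simp)
  show "Ck k (mixed_partial_x \<gamma> g)" "uniform_Ck_on k S (mixed_partial_x \<gamma> g)"
    unfolding mixed_partial_x_def
    using foldr_partial_x[of k "SOME is. \<forall>i. count_list is i = \<gamma> $ i" g S] 1 2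
    by (simp_all only: multi_index_list(2)[of \<gamma>])
qed

text \<open>The constant function v is the bounded solution of u' = A u - A v, and the only one. The
  bound on bounded solutions thus reads as a lower bound for A v, which makes the inverse of A
  uniformly bounded over all admissible matrices.\<close>

lemma spect_inverse_bound:
  fixes a K :: real
  assumes K: "0 < K"
  shows "\<exists>C>0. \<forall>(A::real^'n^'n) v. admissible a K UNIV A \<longrightarrow> norm v \<le> C * norm (A *v v)"
proof -
  obtain C where C: "0 < C" "\<forall>(A::real^'n^'n) J h H. admissible a K J A \<longrightarrow> continuous_on UNIV h \<longrightarrow> (\<forall>t\<in>J. norm (h t) \<le> H) \<longrightarrow>
     (\<exists>u. (\<forall>t. (u has_vector_derivative A *v u t + h t) (at t)) \<and>
       (\<forall>t\<in>J. norm (u t) \<le> C * H) \<and> (J = {0..} \<longrightarrow> u 0 = 0))"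
    using const_coeff_solution[OF K, of a] by blast
  have "norm v \<le> C * norm (A *v v)" if A: "admissible a K UNIV A" for A :: "real^'n^'n" and v
  proof -
    have "\<exists>u. (\<forall>t. (u has_vector_derivative A *v u t + - (A *v v)) (at t)) \<and>
       (\<forall>t\<in>UNIV. norm (u t) \<le> C * norm (A *v v)) \<and> (UNIV = {0::real..} \<longrightarrow> u 0 = 0)"
      using C(2)[THEN spec[of _ A], THEN spec[of _ UNIV], THEN spec[of _ "\<lambda>t. - (A *v v)"], THEN spec[of _ "norm (A *v v)"]] A
      by simp
    then obtain u where u: "\<And>t. (u has_vector_derivative A *v u t + - (A *v v)) (at t)"
       "\<And>t. norm (u t) \<le> C * norm (A *v v)" by blast
    have "u t - v = 0" for t
    proof (rule const_coeff_unique[of A "\<lambda>t. u t - v"])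
      show "Re z \<noteq> 0" if "z \<in> spect A" for z using A that K by (auto simp: admissible_def)
      show "((\<lambda>t. u t - v) has_vector_derivative A *v (u t - v)) (at t)" for t
        using has_vector_derivative_diff[OF u(1) has_vector_derivative_const[of v]]
        by (simp add: matrix_vector_mult_diff_distrib)
      show "norm (u t - v) \<le> C * norm (A *v v) + norm v" for t
        by (rule order_trans[OF norm_triangle_ineq4 add_mono[OF u(2) order_refl]])
    qed
    then show ?thesis using u(2)[of 0] by simp
  qed
  then show ?thesis using C(1) by blast
qed

text \<open>The lower bound makes A injective, hence invertible; applied to the columns of the
  inverse it bounds their entries.\<close>

lemma matrix_inv_inverse:
  fixes A :: "real^'n^'n"
  assumes "\<And>v. norm v \<le> C * norm (A *v v)"
  shows "A ** matrix_inv A = mat 1" "matrix_inv A ** A = mat 1" "\<bar>matrix_inv A $ i $ j\<bar> \<le> \<bar>C\<bar>"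
proof -
  have "x = 0" if "A *v x = 0" for x
    using assms[of x] that by simp
  then have "inj ((*v) A)"
    by (simp add: linear_injective_0)
  then have "invertible A"
    using matrix_left_invertible_injective[of A] invertible_left_inverse[of A] by blast
  then have "\<exists>B. A ** B = mat 1 \<and> B ** A = mat 1" by (simp add: invertible_def)
  then have inv: "A ** matrix_inv A = mat 1 \<and> matrix_inv A ** A = mat 1"
    unfolding matrix_inv_def by (rule someI_ex)
  then show "A ** matrix_inv A = mat 1" "matrix_inv A ** A = mat 1" by auto
  have "\<bar>matrix_inv A $ i $ j\<bar> = \<bar>(matrix_inv A *v axis j 1) $ i\<bar>"
    by (simp add: matrix_vector_mult_basis column_def)
  also have "\<dots> \<le> norm (matrix_inv A *v axis j 1)" by (rule component_le_norm_cart)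
  also have "\<dots> \<le> C * norm (A *v (matrix_inv A *v axis j 1))" by (rule assms)
  also have "\<dots> = C" using inv by (simp add: matrix_vector_mul_assoc)
  finally show "\<bar>matrix_inv A $ i $ j\<bar> \<le> \<bar>C\<bar>" by simp
qed

lemma norm_matrix_le_entries:
  fixes A :: "real^'n^'m"
  assumes "\<And>i j. \<bar>A $ i $ j\<bar> \<le> c"
  shows "norm A \<le> real CARD('m) * (real CARD('n) * c)"
proof -
  have row: "norm (A $ i) \<le> real CARD('n) * c" for i
  proof -
    have "norm (A $ i) \<le> (\<Sum>j\<in>UNIV. norm (A $ i $ j))" by (rule norm_vec_le_sum)
    also have "\<dots> \<le> (\<Sum>j\<in>(UNIV::'n set). c)" using assms by (intro sum_mono) simp
    finally show ?thesis by simp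
  qed
  have "norm A \<le> (\<Sum>i\<in>UNIV. norm (A $ i))" by (rule norm_vec_le_sum)
  also have "\<dots> \<le> (\<Sum>i\<in>(UNIV::'m set). real CARD('n) * c)" by (intro sum_mono row)
  finally show ?thesis by simp
qed

section \<open>Regularity of the critical manifold and of the coefficients\<close>

locale slow_fast =
  fixes f :: "(real^'n) \<times> real \<Rightarrow> real^'n" and x0 :: "real \<Rightarrow> real^'n"
    and r :: nat and K \<rho> :: real
  assumes r: "1 \<le> r"
    and Ck_f: "Ck r f" and \<rho>: "0 < \<rho>" and uniform_f: "uniform_Ck_on r (tube x0 \<rho>) f"
    and Ck_x0: "Ck r x0" and bounded_x0: "bounded (range x0)"
    and zero: "\<And>\<alpha>. f (x0 \<alpha>, \<alpha>) = 0"
    and K: "0 < K" and hyperbolic: "\<And>\<alpha> \<mu>. \<mu> \<in> spect (jacobian_at f x0 \<alpha>) \<Longrightarrow> K \<le> \<bar>Re \<mu>\<bar>"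
begin

abbreviation "A \<equiv> jacobian_at f x0"
abbreviation "Df z \<equiv> frechet_derivative f (at z)"
abbreviation "R \<alpha> \<equiv> matrix_inv (A \<alpha>)"

lemma Ck_f1: "Ck (Suc 0) f" by (rule Ck_le[OF Ck_f]) (use r in simp)

lemma uniform_f1: "uniform_Ck_on (Suc 0) (tube x0 \<rho>) f"
  by (rule uniform_Ck_on_le[OF uniform_f]) (use r in simp)

lemma f_deriv: "(f has_derivative Df z) (at z)"
  by (rule Ck_SucE(1)[OF Ck_f1])

lemma Df_linear: "linear (Df z)" by (rule has_derivative_linear[OF f_deriv])

lemma graph_in_tube: "(x0 \<alpha>, \<alpha>) \<in> tube x0 \<rho>" using \<rho> by (simp add: tube_def)

lemma A_entry: "A \<alpha> $ i $ j = partial_x j f (x0 \<alpha>, \<alpha>) $ i"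
  and A_mult: "A \<alpha> *v v = Df (x0 \<alpha>, \<alpha>) (v, 0)"
proof -
  have "((\<lambda>x. (x, \<alpha>)) has_derivative (\<lambda>h. (h, 0))) (at (x0 \<alpha>))"
    by (auto intro!: derivative_eq_intros)
  from has_derivative_compose[OF this f_deriv]
  have d: "((\<lambda>x. f (x, \<alpha>)) has_derivative (\<lambda>h. Df (x0 \<alpha>, \<alpha>) (h, 0))) (at (x0 \<alpha>))" .
  have e: "frechet_derivative (\<lambda>x. f (x, \<alpha>)) (at (x0 \<alpha>)) = (\<lambda>h. Df (x0 \<alpha>, \<alpha>) (h, 0))"
    by (rule frechet_derivative_at[OF d, symmetric])
  have l: "linear (\<lambda>h. Df (x0 \<alpha>, \<alpha>) (h, 0))" by (rule has_derivative_linear[OF d])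
  show "A \<alpha> $ i $ j = partial_x j f (x0 \<alpha>, \<alpha>) $ i"
    unfolding jacobian_at_def e by (simp add: matrix_def partial_x_eq[OF Ck_f1])
  show "A \<alpha> *v v = Df (x0 \<alpha>, \<alpha>) (v, 0)"
    unfolding jacobian_at_def e using l by (simp add: matrix_works)
qed

lemma Df_bounded: "\<exists>b>0. \<forall>z\<in>tube x0 \<rho>. norm (Df z v) \<le> b"
proof -
  have "bounded ((\<lambda>z. Df z v) ` tube x0 \<rho>)" using uniform_f1 by (cases v) simp
  then show ?thesis unfolding bounded_pos by auto
qed

lemma A_admissible: "\<exists>a>0. \<forall>\<alpha>. admissible a K UNIV (A \<alpha>)"
proof -
  have "\<forall>j::'n. \<exists>b>0. \<forall>z\<in>tube x0 \<rho>. norm (Df z (axis j 1, 0)) \<le> b" using Df_bounded by blast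
  then obtain b where b: "\<And>j::'n. b j > 0" "\<And>j z. z \<in> tube x0 \<rho> \<Longrightarrow> norm (Df z (axis j 1, 0)) \<le> b j"
    by metis
  have e: "\<bar>A \<alpha> $ i $ j\<bar> \<le> (\<Sum>j\<in>UNIV. b j)" for \<alpha> i j
  proof -
    have "\<bar>A \<alpha> $ i $ j\<bar> \<le> norm (Df (x0 \<alpha>, \<alpha>) (axis j 1, 0))"
      unfolding A_entry partial_x_eq[OF Ck_f1] by (rule component_le_norm_cart)
    also have "\<dots> \<le> b j" by (intro b graph_in_tube)
    also have "\<dots> \<le> (\<Sum>j\<in>UNIV. b j)" using b(1) by (intro member_le_sum) (auto intro: less_imp_le)
    finally show ?thesis .
  qed
  have "(\<Sum>j\<in>UNIV. b j) > 0" using b(1) by (intro sum_pos) auto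
  then show ?thesis using e hyperbolic unfolding admissible_def by blast
qed

lemma R_inverse: "A \<alpha> ** R \<alpha> = mat 1" "R \<alpha> ** A \<alpha> = mat 1"
  and R_bounded: "bounded (range (\<lambda>\<alpha>. R \<alpha>))"
proof -
  obtain a where a: "\<And>\<alpha>. admissible a K UNIV (A \<alpha>)" using A_admissible by blast
  obtain C where C: "\<And>\<alpha> v. norm v \<le> C * norm (A \<alpha> *v v)"
    using spect_inverse_bound[OF K, of a] a by blast
  show "A \<alpha> ** R \<alpha> = mat 1" "R \<alpha> ** A \<alpha> = mat 1" using matrix_inv_inverse[OF C] by auto
  have "norm (R \<alpha>) \<le> real CARD('n) * (real CARD('n) * \<bar>C\<bar>)" for \<alpha>
    by (intro norm_matrix_le_entries matrix_inv_inverse(3)[OF C])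
  then show "bounded (range (\<lambda>\<alpha>. R \<alpha>))" unfolding bounded_iff by blast
qed

lemma R_A_mult: "R \<alpha> *v (A \<alpha> *v v) = v" "A \<alpha> *v (R \<alpha> *v v) = v"
  by (simp_all add: matrix_vector_mul_assoc R_inverse)

lemma UC_A:
  assumes k: "UC k x0" "Suc k \<le> r"
  shows "UC k A"
proof (intro UC_vec)
  fix i j
  have 1: "Ck (Suc k) f" "uniform_Ck_on (Suc k) (tube x0 \<rho>) f"
    using Ck_le[OF Ck_f k(2)] uniform_Ck_on_le[OF uniform_f k(2)] by blast+
  have "UC k (\<lambda>\<alpha>. partial_x j f (x0 \<alpha>, \<alpha>))"
    by (rule UC_compose_graph[OF partial_x_Ck[OF 1(1)] partial_x_uniform[OF 1] graph_in_tube k(1)])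
  then show "UC k (\<lambda>\<alpha>. A \<alpha> $ i $ j)" unfolding A_entry by (rule UC_nth)
qed

text \<open>Differentiating f (x0 \<alpha>, \<alpha>) = 0 gives A x0' plus the \<alpha>-derivative
  of f equal to 0. The formula matters because its right-hand side contains no derivative of
  \<open>x0\<close>.\<close>

lemma x0_deriv: "(x0 has_vector_derivative - (R \<alpha> *v Df (x0 \<alpha>, \<alpha>) (0, 1))) (at \<alpha>)"
proof -
  have "Ck (Suc 0) x0" by (rule Ck_le[OF Ck_x0]) (use r in simp)
  then have "x0 differentiable (at \<alpha>)" by simp
  then obtain x0' where d: "(x0 has_vector_derivative x0') (at \<alpha>)"
    using vector_derivative_works by blast
  have "((\<lambda>\<alpha>. (x0 \<alpha>, \<alpha>)) has_derivative (\<lambda>h. (h *\<^sub>R x0', h))) (at \<alpha>)"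
    by (rule has_derivative_Pair[OF d[unfolded has_vector_derivative_def] has_derivative_ident])
  from has_derivative_compose[OF this f_deriv]
  have 1: "((\<lambda>\<alpha>. 0) has_derivative (\<lambda>h. Df (x0 \<alpha>, \<alpha>) (h *\<^sub>R x0', h))) (at \<alpha>)" by (simp only: zero)
  have "((\<lambda>\<alpha>. 0::real^'n) has_derivative (\<lambda>h. 0)) (at \<alpha>)" by simp
  from has_derivative_unique[OF 1 this]
  have "Df (x0 \<alpha>, \<alpha>) (1 *\<^sub>R x0', 1) = 0" by (rule fun_cong)
  then have "Df (x0 \<alpha>, \<alpha>) ((x0', 0) + (0, 1)) = 0" by simp
  then have "A \<alpha> *v x0' + Df (x0 \<alpha>, \<alpha>) (0, 1) = 0" by (simp only: linear_add[OF Df_linear] A_mult)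
  then have "A \<alpha> *v x0' = - Df (x0 \<alpha>, \<alpha>) (0, 1)" by (simp add: eq_neg_iff_add_eq_0)
  then have "x0' = R \<alpha> *v (- Df (x0 \<alpha>, \<alpha>) (0, 1))" by (metis R_A_mult(1))
  then show ?thesis using d by (simp add: vec.neg)
qed

text \<open>The hypotheses bound only the values of \<open>x0\<close>. Bounds for its derivatives
  are bootstrapped from the formula for x0': if \<open>x0\<close> has k bounded uniformly continuous
  derivatives with k < r, so has the right-hand side, and \<open>x0\<close> has one more.\<close>

lemma UC_x0: "UC r x0"
proof -
  have "UC k x0" if "k \<le> r" for k
    using that
  proof (induction k)
    case 0
    obtain b where b: "\<And>\<alpha>. norm (Df (x0 \<alpha>, \<alpha>) (0, 1)) \<le> b" using Df_bounded[of "(0, 1)"] graph_in_tube by blast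
    obtain c where c: "\<And>\<alpha>. norm (R \<alpha>) \<le> c" using R_bounded unfolding bounded_iff by blast
    obtain M where M: "\<And>(A::real^'n^'n) (v::real^'n). norm (A *v v) \<le> norm A * norm v * M" "M > 0"
      using bounded_bilinear.pos_bounded[OF bounded_bilinear_matrix_vector] by blast
    have "norm (- (R \<alpha> *v Df (x0 \<alpha>, \<alpha>) (0, 1))) \<le> c * b * M" for \<alpha>
    proof -
      have "norm (- (R \<alpha> *v Df (x0 \<alpha>, \<alpha>) (0, 1))) \<le> norm (R \<alpha>) * norm (Df (x0 \<alpha>, \<alpha>) (0, 1)) * M"
        unfolding norm_minus_cancel by (rule M)
      also have "\<dots> \<le> c * b * M"
        using b c M(2) order_trans[OF norm_ge_zero c] by (intro mult_right_mono mult_mono) auto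
      finally show ?thesis .
    qed
    then have "bounded (range (\<lambda>\<alpha>. - (R \<alpha> *v Df (x0 \<alpha>, \<alpha>) (0, 1))))" unfolding bounded_iff by blast
    then show ?case using uniformly_continuous_of_bounded_derivative[OF x0_deriv] bounded_x0 by simp
  next
    case (Suc k)
    then have k: "UC k x0" by simp
    have 1: "Ck (Suc k) f" "uniform_Ck_on (Suc k) (tube x0 \<rho>) f"
      using Ck_le[OF Ck_f Suc.prems] uniform_Ck_on_le[OF uniform_f Suc.prems] by blast+
    have "UC k (\<lambda>\<alpha>. Df (x0 \<alpha>, \<alpha>) (0, 1))"
      by (rule UC_compose_graph[OF Ck_SucE(2)[OF 1(1)] _ graph_in_tube k]) (use 1(2) in simp)
    moreover have "UC k (\<lambda>\<alpha>. R \<alpha>)"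
      by (rule UC_matrix_inverse[OF R_inverse R_bounded UC_A[OF k Suc.prems]])
    ultimately have "UC k (\<lambda>\<alpha>. - (R \<alpha> *v Df (x0 \<alpha>, \<alpha>) (0, 1)))"
      by (intro UC_minus UC_bilinear[OF bounded_bilinear_matrix_vector])
    then show ?case by (rule UC_SucI[OF x0_deriv]) (rule bounded_x0)
  qed
  then show ?thesis by simp
qed

text \<open>Each index costs one derivative. The recursion differentiates the preceding coefficient
  once, and uses x-derivatives of f up to order \<nu>, which leaves r - \<nu> derivatives for both.
  The coefficients inside the product have smaller index by \<open>p_index_less\<close>, so strong
  induction applies.\<close>

lemma UC_slow_coeff: "\<nu> \<le> r \<Longrightarrow> UC (r - \<nu>) (slow_coeff f x0 \<nu>)"
proof (induction \<nu> rule: less_induct)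
  case (less \<nu>)
  show ?case
  proof (cases \<nu>)
    case 0
    then show ?thesis using UC_x0 by simp
  next
    case (Suc \<mu>)
    let ?k = "r - Suc \<mu>"
    have k: "Suc ?k \<le> r" "?k \<le> r" using less.prems Suc by auto
    have R: "UC ?k (\<lambda>\<alpha>. R \<alpha>)"
      by (rule UC_matrix_inverse[OF R_inverse R_bounded UC_A[OF UC_le[OF UC_x0 k(2)] k(1)]])
    have lower: "UC ?k (slow_coeff f x0 l)" if "l < \<nu>" for l
      by (rule UC_le[OF less.IH[OF that]]) (use that less.prems Suc in auto)
    have "UC (Suc ?k) (slow_coeff f x0 \<mu>)"
      by (rule UC_le[OF less.IH[of \<mu>]]) (use less.prems Suc in auto)
    then have D: "UC ?k (\<lambda>\<alpha>. vector_derivative (slow_coeff f x0 \<mu>) (at \<alpha>))" by (rule UC_SucE(2))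
    have mp: "UC ?k (\<lambda>\<alpha>. mixed_partial_x \<gamma> f (x0 \<alpha>, \<alpha>))" if "mi_size \<gamma> \<le> \<nu>" for \<gamma> :: "nat^'n"
    proof (rule UC_compose_graph[where S="tube x0 \<rho>"])
      have "mi_size \<gamma> + ?k \<le> r" using that less.prems Suc by simp
      then show "Ck ?k (mixed_partial_x \<gamma> f)" "uniform_Ck_on ?k (tube x0 \<rho>) (mixed_partial_x \<gamma> f)"
        using mixed_partial_x_regular Ck_f uniform_f by blast+
      show "UC ?k x0" by (rule UC_le[OF UC_x0 k(2)])
    qed (rule graph_in_tube)
    have summand: "UC ?k (\<lambda>\<alpha>. case p of (k, l) \<Rightarrow> \<Prod>j<s. (\<Prod>i\<in>UNIV. (slow_coeff f x0 (l ! j) \<alpha> $ i) ^ (k ! j $ i)) /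
            (\<Prod>i\<in>UNIV. fact (k ! j $ i)))"
      if "p \<in> p_index s (Suc \<mu>) \<gamma>" "1 < mi_size \<gamma>" for p s and \<gamma> :: "nat^'n"
    proof -
      obtain k l where p: "p = (k, l)" by (cases p)
      have "UC ?k (\<lambda>\<alpha>. \<Prod>j<s. inverse (\<Prod>i\<in>UNIV. fact (k ! j $ i)) *\<^sub>R
          (\<Prod>i\<in>UNIV. (slow_coeff f x0 (l ! j) \<alpha> $ i) ^ (k ! j $ i)))"
      proof (intro UC_prod UC_scaleR_const UC_power UC_nth lower)
        fix j assume "j \<in> {..<s}"
        then show "l ! j < \<nu>" using p_index_less[of k l s "Suc \<mu>" \<gamma> j] that p Suc by simp
      qed
      then show ?thesis by (simp add: p divide_inverse mult.commute)
    qed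
    show ?thesis
      unfolding Suc slow_coeff.simps
      by (intro UC_bilinear[OF bounded_bilinear_matrix_vector] R UC_diff D UC_sum UC_scaleR mp summand)
        (use Suc in auto)
  qed
qed

end

section \<open>Symmetry of partial derivatives and Taylor expansion\<close>

lemma Ck_linear:
  assumes "bounded_linear h"
  shows "Ck k g \<Longrightarrow> Ck k (\<lambda>z. h (g z))"
proof (induction k arbitrary: g)
  case 0
  then show ?case by (simp add: bounded_linear.continuous_on[OF assms])
next
  case (Suc k)
  have d: "((\<lambda>z. h (g z)) has_derivative (\<lambda>v. h (frechet_derivative g (at z) v))) (at z)" for z
    by (rule bounded_linear.has_derivative[OF assms Ck_SucE(1)[OF Suc.prems]])
  have e: "frechet_derivative (\<lambda>z. h (g z)) (at z) = (\<lambda>v. h (frechet_derivative g (at z) v))" for z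
    by (rule frechet_derivative_at[OF d, symmetric])
  have "(\<lambda>z. h (g z)) differentiable (at z)" for z using d differentiable_def by blast
  then show ?case unfolding Ck.simps e using Suc.IH[OF Ck_SucE(2)[OF Suc.prems]] by blast
qed

text \<open>The mean value theorem, first in direction u for the increment of g along v, then in
  direction v for the derivative.\<close>

lemma second_difference:
  fixes g :: "'a::real_normed_vector \<Rightarrow> real"
  assumes g: "Ck (Suc (Suc 0)) g" and h: "0 < h"
  shows "\<exists>s t. 0 \<le> s \<and> s \<le> h \<and> 0 \<le> t \<and> t \<le> h \<and>
    g (z + h *\<^sub>R u + h *\<^sub>R v) - g (z + h *\<^sub>R u) - g (z + h *\<^sub>R v) + g z =
    h * (h * frechet_derivative (\<lambda>z. frechet_derivative g (at z) u) (at (z + s *\<^sub>R u + t *\<^sub>R v)) v)"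
proof -
  let ?D = "\<lambda>z. frechet_derivative g (at z) u"
  have d1: "((\<lambda>s. g (w + s *\<^sub>R u)) has_real_derivative ?D (w + s *\<^sub>R u)) (at s)" for w s
  proof -
    have "((\<lambda>s. w + s *\<^sub>R u) has_derivative (\<lambda>k. k *\<^sub>R u)) (at s)"
      by (auto intro!: derivative_eq_intros)
    from has_derivative_compose[OF this Ck_SucE(1)[OF g]]
    show ?thesis
      unfolding has_real_derivative_iff_has_vector_derivative has_vector_derivative_def
      by (simp add: linear_scale[OF has_derivative_linear[OF Ck_SucE(1)[OF g]]])
  qed
  have d2: "((\<lambda>t. ?D (w + t *\<^sub>R v)) has_real_derivative frechet_derivative ?D (at (w + t *\<^sub>R v)) v) (at t)" for w t
  proof -
    have "((\<lambda>s. w + s *\<^sub>R v) has_derivative (\<lambda>k. k *\<^sub>R v)) (at t)"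
      by (auto intro!: derivative_eq_intros)
    from has_derivative_compose[OF this Ck_SucE(1)[OF Ck_SucE(2)[OF g, of u]]]
    show ?thesis
      unfolding has_real_derivative_iff_has_vector_derivative has_vector_derivative_def
      by (simp add: linear_scale[OF has_derivative_linear[OF Ck_SucE(1)[OF Ck_SucE(2)[OF g, of u]]]])
  qed
  define \<psi> where "\<psi> s = g ((z + h *\<^sub>R v) + s *\<^sub>R u) - g (z + s *\<^sub>R u)" for s
  have "\<exists>s>0. s < h \<and> \<psi> h - \<psi> 0 = (h - 0) * (?D ((z + h *\<^sub>R v) + s *\<^sub>R u) - ?D (z + s *\<^sub>R u))"
    unfolding \<psi>_def using h by (intro MVT2 DERIV_diff d1) auto
  then obtain s where s: "0 < s" "s < h" "\<psi> h - \<psi> 0 = h * (?D ((z + h *\<^sub>R v) + s *\<^sub>R u) - ?D (z + s *\<^sub>R u))"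
    by auto
  have "\<exists>t>0. t < h \<and> ?D ((z + s *\<^sub>R u) + h *\<^sub>R v) - ?D ((z + s *\<^sub>R u) + 0 *\<^sub>R v) =
     (h - 0) * frechet_derivative ?D (at ((z + s *\<^sub>R u) + t *\<^sub>R v)) v"
    using h by (intro MVT2 d2) auto
  then obtain t where t: "0 < t" "t < h"
    "?D ((z + s *\<^sub>R u) + h *\<^sub>R v) - ?D (z + s *\<^sub>R u) = h * frechet_derivative ?D (at ((z + s *\<^sub>R u) + t *\<^sub>R v)) v"
    by auto
  have "g (z + h *\<^sub>R u + h *\<^sub>R v) - g (z + h *\<^sub>R u) - g (z + h *\<^sub>R v) + g z = \<psi> h - \<psi> 0"
    by (simp add: \<psi>_def algebra_simps)
  also have "\<dots> = h * (?D ((z + s *\<^sub>R u) + h *\<^sub>R v) - ?D (z + s *\<^sub>R u))"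
    unfolding s(3) by (simp add: algebra_simps)
  finally show ?thesis using s(1,2) t by (intro exI[of _ s] exI[of _ t]) auto
qed

text \<open>The second difference is symmetric in u and v. Dividing its two representations by the
  square of the step and letting the step tend to 0, continuity of the second derivatives identifies
  both limits at z.\<close>

lemma second_derivative_symmetric_real:
  fixes g :: "'a::real_normed_vector \<Rightarrow> real"
  assumes g: "Ck (Suc (Suc 0)) g"
  shows "frechet_derivative (\<lambda>z. frechet_derivative g (at z) u) (at z) v =
    frechet_derivative (\<lambda>z. frechet_derivative g (at z) v) (at z) u"
proof -
  let ?D = "\<lambda>u v z. frechet_derivative (\<lambda>z. frechet_derivative g (at z) u) (at z) v"
  have lim: "(\<lambda>n. ?D u v (z + s n *\<^sub>R u' + t n *\<^sub>R v')) \<longlonglongrightarrow> ?D u v z"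
    if st: "\<And>n. 0 \<le> s n \<and> s n \<le> 1 / real (Suc n) \<and> 0 \<le> t n \<and> t n \<le> 1 / real (Suc n)" for s t u v u' v'
  proof -
    have "continuous_on UNIV (?D u v)"
      using Ck_SucE(2)[OF Ck_SucE(2)[OF g, of u], of v] by simp
    then have c: "isCont (?D u v) z" by (simp add: continuous_on_eq_continuous_at)
    have "s \<longlonglongrightarrow> 0" "t \<longlonglongrightarrow> 0"
      by (rule tendsto_sandwich[OF _ _ tendsto_const[of 0] LIMSEQ_inverse_real_of_nat[unfolded inverse_eq_divide]];
          use st in simp)+
    then have "(\<lambda>n. z + s n *\<^sub>R u' + t n *\<^sub>R v') \<longlonglongrightarrow> z + 0 *\<^sub>R u' + 0 *\<^sub>R v'"
      by (intro tendsto_intros)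
    then have "(\<lambda>n. z + s n *\<^sub>R u' + t n *\<^sub>R v') \<longlonglongrightarrow> z" by simp
    then show ?thesis by (rule isCont_tendsto_compose[OF c])
  qed
  have "\<forall>n. \<exists>s t. 0 \<le> s \<and> s \<le> 1 / real (Suc n) \<and> 0 \<le> t \<and> t \<le> 1 / real (Suc n) \<and>
    g (z + (1 / real (Suc n)) *\<^sub>R u + (1 / real (Suc n)) *\<^sub>R v) - g (z + (1 / real (Suc n)) *\<^sub>R u) - g (z + (1 / real (Suc n)) *\<^sub>R v) + g z =
    1 / real (Suc n) * (1 / real (Suc n) * ?D u v (z + s *\<^sub>R u + t *\<^sub>R v))" for u v
    by (intro allI second_difference[OF g]) simp
  then have "\<exists>s t. \<forall>n. 0 \<le> s n \<and> s n \<le> 1 / real (Suc n) \<and> 0 \<le> t n \<and> t n \<le> 1 / real (Suc n) \<and>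
    g (z + (1 / real (Suc n)) *\<^sub>R u + (1 / real (Suc n)) *\<^sub>R v) - g (z + (1 / real (Suc n)) *\<^sub>R u) - g (z + (1 / real (Suc n)) *\<^sub>R v) + g z =
    1 / real (Suc n) * (1 / real (Suc n) * ?D u v (z + s n *\<^sub>R u + t n *\<^sub>R v))" for u v
    by (simp only: choice_iff)
  note * = this
  obtain s t where 1: "\<And>n. 0 \<le> s n \<and> s n \<le> 1 / real (Suc n) \<and> 0 \<le> t n \<and> t n \<le> 1 / real (Suc n)"
    "\<And>n. g (z + (1 / real (Suc n)) *\<^sub>R u + (1 / real (Suc n)) *\<^sub>R v) - g (z + (1 / real (Suc n)) *\<^sub>R u) - g (z + (1 / real (Suc n)) *\<^sub>R v) + g z =
    1 / real (Suc n) * (1 / real (Suc n) * ?D u v (z + s n *\<^sub>R u + t n *\<^sub>R v))"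
    using *[of u v] by blast
  obtain s' t' where 2: "\<And>n. 0 \<le> s' n \<and> s' n \<le> 1 / real (Suc n) \<and> 0 \<le> t' n \<and> t' n \<le> 1 / real (Suc n)"
    "\<And>n. g (z + (1 / real (Suc n)) *\<^sub>R v + (1 / real (Suc n)) *\<^sub>R u) - g (z + (1 / real (Suc n)) *\<^sub>R v) - g (z + (1 / real (Suc n)) *\<^sub>R u) + g z =
    1 / real (Suc n) * (1 / real (Suc n) * ?D v u (z + s' n *\<^sub>R v + t' n *\<^sub>R u))"
    using *[of v u] by blast
  have eq: "?D u v (z + s n *\<^sub>R u + t n *\<^sub>R v) = ?D v u (z + s' n *\<^sub>R v + t' n *\<^sub>R u)" for n
  proof -
    define h where "h = 1 / real (Suc n)"
    have h: "h \<noteq> 0" by (simp add: h_def)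
    have "g (z + h *\<^sub>R v + h *\<^sub>R u) = g (z + h *\<^sub>R u + h *\<^sub>R v)" by (simp add: add_ac)
    then have "h * (h * ?D u v (z + s n *\<^sub>R u + t n *\<^sub>R v)) = h * (h * ?D v u (z + s' n *\<^sub>R v + t' n *\<^sub>R u))"
      using 1(2)[of n] 2(2)[of n] unfolding h_def[symmetric] by linarith
    then show ?thesis using h by simp
  qed
  have "(\<lambda>n. ?D u v (z + s n *\<^sub>R u + t n *\<^sub>R v)) \<longlonglongrightarrow> ?D u v z" by (rule lim[OF 1(1)])
  moreover have "(\<lambda>n. ?D v u (z + s' n *\<^sub>R v + t' n *\<^sub>R u)) \<longlonglongrightarrow> ?D v u z" by (rule lim[OF 2(1)])
  ultimately show ?thesis unfolding eq by (rule LIMSEQ_unique)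
qed

text \<open>Passing to components reduces this to real-valued functions, for which the mean value
  theorem is available.\<close>

lemma partial_x_commute:
  fixes g :: "(real^'n) \<times> real \<Rightarrow> real^'n"
  assumes g: "Ck (Suc (Suc 0)) g"
  shows "partial_x i (partial_x j g) = partial_x j (partial_x i g)"
proof
  fix z
  let ?e = "\<lambda>i. (axis i 1, 0) :: (real^'n) \<times> real"
  have comp: "frechet_derivative (\<lambda>z. h z $ m) (at z) v = frechet_derivative h (at z) v $ m"
    if "Ck (Suc 0) h" for h :: "(real^'n) \<times> real \<Rightarrow> real^'n" and z v m
    using frechet_derivative_at[OF bounded_linear.has_derivative[OF bounded_linear_vec_nth Ck_SucE(1)[OF that, of z]], of m]
    by (rule fun_cong[OF sym])
  have g1: "Ck (Suc 0) g" by (rule Ck_SucD[OF g])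
  have eq: "partial_x i (partial_x j g) z $ m =
      frechet_derivative (\<lambda>z. frechet_derivative (\<lambda>z. g z $ m) (at z) (?e j)) (at z) (?e i)" for i j m
    unfolding partial_x_eq[OF partial_x_Ck[OF g]] unfolding partial_x_eq[OF g]
    unfolding comp[OF g1] comp[OF Ck_SucE(2)[OF g]] ..
  have "Ck (Suc (Suc 0)) (\<lambda>z. g z $ m)" for m by (rule Ck_linear[OF bounded_linear_vec_nth g])
  then show "partial_x i (partial_x j g) z = partial_x j (partial_x i g) z"
    unfolding vec_eq_iff eq using second_derivative_symmetric_real by blast
qed

lemma foldr_partial_x_move:
  "Ck (length (xs @ i # ys)) g \<Longrightarrow> foldr partial_x (xs @ i # ys) g = partial_x i (foldr partial_x (xs @ ys) g)"
proof (induction xs)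
  case (Cons x xs)
  have "Ck (length (xs @ i # ys)) g" by (rule Ck_le[OF Cons.prems]) simp
  then have "foldr partial_x ((x # xs) @ i # ys) g = partial_x x (partial_x i (foldr partial_x (xs @ ys) g))"
    using Cons.IH by simp
  also have "\<dots> = partial_x i (partial_x x (foldr partial_x (xs @ ys) g))"
  proof (rule partial_x_commute)
    have "Ck (Suc (Suc 0) + length (xs @ ys)) g" by (rule Ck_le[OF Cons.prems]) simp
    then show "Ck (Suc (Suc 0)) (foldr partial_x (xs @ ys) g)" using foldr_partial_x by blast
  qed
  finally show ?case by simp
qed simp

text \<open>Makes the order of differentiation that \<open>mixed_partial_x\<close> happens to choose
  immaterial.\<close>

lemma foldr_partial_x_perm:
  "mset xs = mset ys \<Longrightarrow> Ck (length xs) g \<Longrightarrow> foldr partial_x xs g = foldr partial_x ys g"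
proof (induction xs arbitrary: ys)
  case (Cons x xs)
  then have "x \<in> set ys" by (metis list.set_intros(1) mset_eq_setD)
  then obtain as bs where ys: "ys = as @ x # bs" by (meson split_list)
  have m: "mset xs = mset (as @ bs)" using Cons.prems(1) by (simp add: ys)
  have "length ys = length (x # xs)" using Cons.prems(1) by (metis size_mset)
  then have C: "Ck (length (as @ x # bs)) g" using Cons.prems(2) by (simp only: ys)
  have "Ck (length xs) g" by (rule Ck_le[OF Cons.prems(2)]) simp
  then have "foldr partial_x xs g = foldr partial_x (as @ bs) g" using Cons.IH[OF m] by blast
  then show ?case unfolding ys foldr_partial_x_move[OF C] by simp
qed simp

text \<open>The lists chosen for \<gamma> and for \<gamma> with one more i are picked independently
  of each other. They agree only as multisets, so the permutation lemma is needed.\<close>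

lemma partial_x_mixed_partial:
  fixes \<gamma> :: "nat^'n"
  assumes "Ck (Suc (mi_size \<gamma>)) g"
  shows "partial_x i (mixed_partial_x \<gamma> g) = mixed_partial_x (\<gamma> + axis i 1) g"
proof -
  let ?l = "\<lambda>\<gamma>::nat^'n. SOME is. \<forall>i. count_list is i = \<gamma> $ i"
  have "mset (i # ?l \<gamma>) = mset (?l (\<gamma> + axis i 1))"
  proof (rule multiset_eqI)
    fix x
    have c: "count_list (?l \<gamma>) x = \<gamma> $ x" for \<gamma> by (rule multi_index_list(1))
    have "count (mset (i # ?l \<gamma>)) x = count_list (?l \<gamma>) x + (if i = x then 1 else 0)"
      by (simp only: count_mset) simp
    also have "\<dots> = (\<gamma> + axis i 1) $ x" unfolding c by (simp add: axis_def)
    also have "\<dots> = count (mset (?l (\<gamma> + axis i 1))) x" by (simp only: count_mset c)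
    finally show "count (mset (i # ?l \<gamma>)) x = count (mset (?l (\<gamma> + axis i 1))) x" .
  qed
  moreover have "Ck (length (i # ?l \<gamma>)) g" using assms by (simp add: multi_index_list(2) del: Ck.simps)
  ultimately have "foldr partial_x (i # ?l \<gamma>) g = foldr partial_x (?l (\<gamma> + axis i 1)) g"
    by (rule foldr_partial_x_perm)
  then show ?thesis by (simp add: mixed_partial_x_def)
qed

lemma mixed_partial_x_0 [simp]: "mixed_partial_x (0::nat^'n) g = g"
proof -
  have "length (SOME is. \<forall>i. count_list is i = (0::nat^'n) $ i) = mi_size (0::nat^'n)"
    by (rule multi_index_list(2))
  then show ?thesis by (simp add: mixed_partial_x_def mi_size_def)
qed

text \<open>The divided power of v with exponent \<gamma>. With the factorials included, both
  Taylor's formula and the multinomial theorem hold without numerical coefficients.\<close>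

definition vmonom :: "real^'n \<Rightarrow> nat^'n \<Rightarrow> real" where
  "vmonom v \<gamma> = (\<Prod>i\<in>UNIV. (v $ i) ^ (\<gamma> $ i)) / (\<Prod>i\<in>UNIV. fact (\<gamma> $ i))"

lemma vmonom_altdef: "vmonom v \<gamma> = (\<Prod>i\<in>UNIV. (v $ i) ^ (\<gamma> $ i) / fact (\<gamma> $ i))"
  by (simp add: vmonom_def prod_dividef)

lemma vmonom_0 [simp]: "vmonom v 0 = 1" by (simp add: vmonom_def)

lemma vmonom_bound: "\<bar>vmonom v \<gamma>\<bar> \<le> norm v ^ mi_size \<gamma>"
proof -
  have "\<bar>vmonom v \<gamma>\<bar> = (\<Prod>i\<in>UNIV. \<bar>(v $ i) ^ (\<gamma> $ i) / fact (\<gamma> $ i)\<bar>)"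
    unfolding vmonom_altdef by (rule abs_prod)
  also have "\<dots> \<le> (\<Prod>i\<in>UNIV. norm v ^ (\<gamma> $ i))"
  proof (intro prod_mono conjI)
    fix i
    have "\<bar>(v $ i) ^ (\<gamma> $ i) / fact (\<gamma> $ i)\<bar> = \<bar>v $ i\<bar> ^ (\<gamma> $ i) / fact (\<gamma> $ i)"
      by (simp add: power_abs)
    also have "\<dots> \<le> \<bar>v $ i\<bar> ^ (\<gamma> $ i) / 1" by (intro divide_left_mono) (auto simp: fact_ge_1)
    also have "\<dots> \<le> norm v ^ (\<gamma> $ i)" by (simp add: power_mono component_le_norm_cart)
    finally show "\<bar>(v $ i) ^ (\<gamma> $ i) / fact (\<gamma> $ i)\<bar> \<le> norm v ^ (\<gamma> $ i)" .
  qed simp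
  also have "\<dots> = norm v ^ mi_size \<gamma>" by (simp add: mi_size_def power_sum)
  finally show ?thesis .
qed

lemma vmonom_add_axis: "vmonom v (\<gamma> + axis i 1) * real (Suc (\<gamma> $ i)) = vmonom v \<gamma> * v $ i"
proof -
  have split: "(\<Prod>j\<in>UNIV. h j) = h i * (\<Prod>j\<in>UNIV - {i}. h j)" for h :: "'a \<Rightarrow> real"
    by (rule prod.remove) auto
  have "(\<Prod>j\<in>UNIV - {i}. (v $ j) ^ ((\<gamma> + axis i 1) $ j) / fact ((\<gamma> + axis i 1) $ j)) =
      (\<Prod>j\<in>UNIV - {i}. (v $ j) ^ (\<gamma> $ j) / fact (\<gamma> $ j))"
    by (intro prod.cong) (auto simp: axis_def)
  moreover have "(v $ i) ^ ((\<gamma> + axis i 1) $ i) / fact ((\<gamma> + axis i 1) $ i) * real (Suc (\<gamma> $ i)) =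
      (v $ i) ^ (\<gamma> $ i) / fact (\<gamma> $ i) * v $ i"
    by (simp add: axis_def fact_Suc del: of_nat_Suc)
  moreover have "a * b * s = c * d * w" if "b = d" "a * s = c * w" for a b c d s w :: real
  proof -
    have "a * b * s = (a * s) * b" by simp
    then show ?thesis using that by simp
  qed
  ultimately show ?thesis unfolding vmonom_altdef split by blast
qed

lemma finite_mi_size_eq: "finite {\<gamma> :: nat^'n. mi_size \<gamma> = m}"
proof (rule finite_subset)
  show "{\<gamma> :: nat^'n. mi_size \<gamma> = m} \<subseteq> vec_lambda ` (UNIV \<rightarrow>\<^sub>E {..m})"
  proof
    fix \<gamma> :: "nat^'n" assume "\<gamma> \<in> {\<gamma>. mi_size \<gamma> = m}"
    then have "\<gamma> $ i \<le> m" for i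
      using member_le_sum[of i UNIV "\<lambda>i. \<gamma> $ i"] by (simp add: mi_size_def)
    then show "\<gamma> \<in> vec_lambda ` (UNIV \<rightarrow>\<^sub>E {..m})"
      by (intro image_eqI[of _ _ "vec_nth \<gamma>"]) auto
  qed
qed (intro finite_imageI finite_PiE; simp)

lemma mi_size_add_axis [simp]: "mi_size (\<gamma> + axis i 1) = Suc (mi_size \<gamma>)"
  by (simp add: mi_size_def axis_def sum.distrib)

text \<open>Differentiating a homogeneous Taylor term along v produces the left-hand side. Each
  multi-index of size m + 1 arises once for every i it contains, with weight \<gamma> $ i, and these
  weights add up to m + 1.\<close>

lemma sum_vmonom_add_axis:
  fixes M :: "nat^'n \<Rightarrow> real"
  shows "(\<Sum>\<gamma> | mi_size \<gamma> = m. vmonom v \<gamma> * (\<Sum>i\<in>UNIV. v $ i * M (\<gamma> + axis i 1))) =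
    real (Suc m) * (\<Sum>\<gamma> | mi_size \<gamma> = Suc m. vmonom v \<gamma> * M \<gamma>)"
proof -
  have pos: "\<gamma> - axis i 1 + axis i 1 = \<gamma>" if "0 < \<gamma> $ i" for \<gamma> :: "nat^'n" and i
    using that by (auto simp: vec_eq_iff axis_def)
  have "(\<Sum>\<gamma> | mi_size \<gamma> = m. vmonom v \<gamma> * (\<Sum>i\<in>UNIV. v $ i * M (\<gamma> + axis i 1))) =
    (\<Sum>(\<gamma>, i)\<in>{\<gamma>. mi_size \<gamma> = m} \<times> UNIV. vmonom v \<gamma> * v $ i * M (\<gamma> + axis i 1))"
    by (simp add: sum.cartesian_product[symmetric] sum_distrib_left mult.assoc)
  also have "\<dots> = (\<Sum>(\<gamma>, i)\<in>{(\<gamma>, i). mi_size \<gamma> = Suc m \<and> 0 < \<gamma> $ i}. real (\<gamma> $ i) * (vmonom v \<gamma> * M \<gamma>))"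
  proof (rule sum.reindex_bij_witness[of _ "\<lambda>(\<gamma>, i). (\<gamma> - axis i 1, i)" "\<lambda>(\<gamma>, i). (\<gamma> + axis i 1, i)"], goal_cases)
    case (1 a)
    then show ?case by (auto simp: vec_eq_iff)
  next
    case (2 a)
    have "0 < (\<gamma> + axis i 1 :: nat^'n) $ i" for \<gamma> i by (simp add: axis_def)
    then show ?case using 2 by (auto simp del: One_nat_def)
  next
    case (3 b)
    then show ?case using pos by auto
  next
    case (4 b)
    obtain \<gamma> i where b: "b = (\<gamma>, i)" by (cases b)
    have "mi_size (\<gamma> - axis i 1 + axis i 1) = Suc m" using 4 b pos by auto
    then have "mi_size (\<gamma> - axis i 1) = m" unfolding mi_size_add_axis by (rule Suc_inject)
    then show ?case by (simp add: b)
  next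
    case (5 a)
    obtain \<gamma> i where a: "a = (\<gamma>, i)" by (cases a)
    have "real ((\<gamma> + axis i 1) $ i) * vmonom v (\<gamma> + axis i 1) = vmonom v \<gamma> * v $ i"
      using vmonom_add_axis[of v \<gamma> i] by (simp add: mult.commute axis_def)
    then show ?case unfolding a prod.case by (metis mult.assoc)
  qed
  \<comment> \<open>Pairs with \<gamma> $ i = 0 are not reached by raising an exponent, but their
    weight is 0, so they may be added.\<close>
  also have "\<dots> = (\<Sum>(\<gamma>, i)\<in>{\<gamma>. mi_size \<gamma> = Suc m} \<times> UNIV. real (\<gamma> $ i) * (vmonom v \<gamma> * M \<gamma>))"
    by (rule sum.mono_neutral_left) (auto simp: finite_mi_size_eq)
  also have "\<dots> = (\<Sum>\<gamma> | mi_size \<gamma> = Suc m. real (mi_size \<gamma>) * (vmonom v \<gamma> * M \<gamma>))"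
    by (simp only: sum.cartesian_product[symmetric] sum_distrib_right mi_size_def of_nat_sum)
  also have "\<dots> = real (Suc m) * (\<Sum>\<gamma> | mi_size \<gamma> = Suc m. vmonom v \<gamma> * M \<gamma>)"
    by (simp add: sum_distrib_left)
  finally show ?thesis .
qed

text \<open>Maclaurin's formula with Lagrange remainder for one component of f along the segment
  from x to x + v. The intermediate point depends on the component m, so no such formula holds for
  the whole vector.\<close>

lemma multivariate_taylor:
  fixes f :: "(real^'n) \<times> real \<Rightarrow> real^'n"
  assumes f: "Ck r f" and r: "0 < r"
  shows "\<exists>\<theta>. 0 < \<theta> \<and> \<theta> < 1 \<and> f (x + v, \<alpha>) $ m =
    (\<Sum>k<r. \<Sum>\<gamma> | mi_size \<gamma> = k. vmonom v \<gamma> * mixed_partial_x \<gamma> f (x, \<alpha>) $ m) +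
    (\<Sum>\<gamma> | mi_size \<gamma> = r. vmonom v \<gamma> * mixed_partial_x \<gamma> f (x + \<theta> *\<^sub>R v, \<alpha>) $ m)"
proof -
  \<comment> \<open>The k-th derivative in s of the m-th component along the segment; the factor k!
    undoes the divided powers.\<close>
  define d where "d k s = fact k * (\<Sum>\<gamma> | mi_size \<gamma> = k. vmonom v \<gamma> * mixed_partial_x \<gamma> f (x + s *\<^sub>R v, \<alpha>) $ m)" for k s
  have "(d k has_real_derivative d (Suc k) s) (at s)" if k: "k < r" for k s
  proof -
    have "((\<lambda>s. mixed_partial_x \<gamma> f (x + s *\<^sub>R v, \<alpha>) $ m) has_real_derivative
        (\<Sum>i\<in>UNIV. v $ i * mixed_partial_x (\<gamma> + axis i 1) f (x + s *\<^sub>R v, \<alpha>) $ m)) (at s)"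
      if \<gamma>: "mi_size \<gamma> = k" for \<gamma> :: "nat^'n"
    proof -
      let ?M = "mixed_partial_x \<gamma> f"
      let ?z = "(x + s *\<^sub>R v, \<alpha>)"
      have "Ck (Suc 0 + mi_size \<gamma>) f" by (rule Ck_le[OF f]) (use k \<gamma> in simp)
      then have M: "Ck (Suc 0) ?M" unfolding mixed_partial_x_def
        using foldr_partial_x[of "Suc 0" "SOME is. \<forall>i. count_list is i = \<gamma> $ i"]
        by (simp only: multi_index_list(2)[of \<gamma>])
      have lin: "linear (frechet_derivative ?M (at ?z))" by (rule has_derivative_linear[OF Ck_SucE(1)[OF M]])
      have "((\<lambda>s. (x + s *\<^sub>R v, \<alpha>)) has_derivative (\<lambda>h. (h *\<^sub>R v, 0))) (at s)"
        by (auto intro!: derivative_eq_intros)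
      from has_derivative_compose[OF this Ck_SucE(1)[OF M]]
      have D: "((\<lambda>s. ?M (x + s *\<^sub>R v, \<alpha>)) has_derivative (\<lambda>h. frechet_derivative ?M (at ?z) (h *\<^sub>R v, 0))) (at s)" .
      have "frechet_derivative ?M (at ?z) (h *\<^sub>R v, 0) = h *\<^sub>R (\<Sum>i\<in>UNIV. v $ i *\<^sub>R mixed_partial_x (\<gamma> + axis i 1) f ?z)" for h
      proof -
        have "(h *\<^sub>R v, 0::real) = h *\<^sub>R (\<Sum>i\<in>UNIV. v $ i *\<^sub>R (axis i 1, 0))"
          by (simp add: prod_eq_iff fst_sum snd_sum basis_expansion[of v, unfolded scalar_mult_eq_scaleR])
        then have "frechet_derivative ?M (at ?z) (h *\<^sub>R v, 0) =
           h *\<^sub>R (\<Sum>i\<in>UNIV. v $ i *\<^sub>R frechet_derivative ?M (at ?z) (axis i 1, 0))"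
          by (simp only: linear_scale[OF lin] linear_sum[OF lin])
        moreover have "frechet_derivative ?M (at ?z) (axis i 1, 0) = mixed_partial_x (\<gamma> + axis i 1) f ?z" for i
        proof -
          have "Ck (Suc (mi_size \<gamma>)) f" by (rule Ck_le[OF f]) (use k \<gamma> in simp)
          from partial_x_mixed_partial[OF this, of i] show ?thesis
            unfolding partial_x_eq[OF M] by (rule fun_cong)
        qed
        ultimately show ?thesis by simp
      qed
      with D have "((\<lambda>s. ?M (x + s *\<^sub>R v, \<alpha>)) has_vector_derivative (\<Sum>i\<in>UNIV. v $ i *\<^sub>R mixed_partial_x (\<gamma> + axis i 1) f ?z)) (at s)"
        by (simp add: has_vector_derivative_def)
      from bounded_linear.has_vector_derivative[OF bounded_linear_vec_nth this, of m]
      show ?thesis by (simp add: has_real_derivative_iff_has_vector_derivative)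
    qed
    then have "(d k has_real_derivative fact k * (\<Sum>\<gamma> | mi_size \<gamma> = k. vmonom v \<gamma> *
        (\<Sum>i\<in>UNIV. v $ i * mixed_partial_x (\<gamma> + axis i 1) f (x + s *\<^sub>R v, \<alpha>) $ m))) (at s)"
      unfolding d_def by (intro DERIV_cmult DERIV_sum) auto
    moreover have "fact k * (\<Sum>\<gamma> | mi_size \<gamma> = k. vmonom v \<gamma> *
        (\<Sum>i\<in>UNIV. v $ i * mixed_partial_x (\<gamma> + axis i 1) f (x + s *\<^sub>R v, \<alpha>) $ m)) = d (Suc k) s"
      unfolding sum_vmonom_add_axis[where m=k and v=v and M="\<lambda>\<gamma>. mixed_partial_x \<gamma> f (x + s *\<^sub>R v, \<alpha>) $ m"] d_def
      by (simp add: mult_ac)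
    ultimately show ?thesis by simp
  qed
  then have "\<exists>t>0. t < 1 \<and> d 0 1 = (\<Sum>k<r. d k 0 / fact k * 1 ^ k) + d r t / fact r * 1 ^ r"
    by (intro Maclaurin) (use r in auto)
  then obtain t where t: "0 < t" "t < 1" "d 0 1 = (\<Sum>k<r. d k 0 / fact k) + d r t / fact r" by auto
  have "{\<gamma>::nat^'n. mi_size \<gamma> = 0} = {0}"
    by (auto simp: mi_size_def vec_eq_iff)
  then have "d 0 1 = f (x + v, \<alpha>) $ m" by (simp add: d_def)
  then show ?thesis using t by (intro exI[of _ t]) (simp add: d_def)
qed

section \<open>Multinomial expansion along increasing lists of indices\<close>

lemma binomial_fact_form:
  "(a + b :: real) ^ n / fact n = (\<Sum>k\<le>n. a ^ k / fact k * (b ^ (n - k) / fact (n - k)))"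
proof -
  have "(a + b) ^ n / fact n = (\<Sum>k\<le>n. real (n choose k) * a ^ k * b ^ (n - k) / fact n)"
    by (simp add: binomial_ring sum_divide_distrib)
  also have "\<dots> = (\<Sum>k\<le>n. a ^ k / fact k * (b ^ (n - k) / fact (n - k)))"
    by (intro sum.cong) (auto simp: binomial_fact)
  finally show ?thesis .
qed

lemma multi_index_le_iff: "\<kappa> \<le> \<gamma> \<longleftrightarrow> (\<forall>i. \<kappa> $ i \<le> \<gamma> $ i)" for \<kappa> :: "nat^'n"
  by (simp add: less_eq_vec_def)

lemma multi_indices_below: "{\<kappa>. \<kappa> \<le> (\<gamma>::nat^'n)} = vec_lambda ` (\<Pi>\<^sub>E i\<in>UNIV. {..\<gamma> $ i})"
proof
  show "{\<kappa>. \<kappa> \<le> \<gamma>} \<subseteq> vec_lambda ` (\<Pi>\<^sub>E i\<in>UNIV. {..\<gamma> $ i})"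
  proof
    fix \<kappa> :: "nat^'n" assume "\<kappa> \<in> {\<kappa>. \<kappa> \<le> \<gamma>}"
    then show "\<kappa> \<in> vec_lambda ` (\<Pi>\<^sub>E i\<in>UNIV. {..\<gamma> $ i})"
      by (intro image_eqI[of _ _ "vec_nth \<kappa>"]) (auto simp: multi_index_le_iff)
  qed
qed (auto simp: multi_index_le_iff)

lemma finite_multi_indices_below: "finite {\<kappa>. \<kappa> \<le> (\<gamma>::nat^'n)}"
  unfolding multi_indices_below by (intro finite_imageI finite_PiE) auto

text \<open>The binomial theorem in each coordinate, followed by expanding the product over the
  coordinates.\<close>

lemma vmonom_add: "vmonom (a + b) \<gamma> = (\<Sum>\<kappa> | \<kappa> \<le> \<gamma>. vmonom a \<kappa> * vmonom b (\<gamma> - \<kappa>))"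
proof -
  have "vmonom (a + b) \<gamma> = (\<Prod>i\<in>UNIV. \<Sum>k\<in>{..\<gamma> $ i}. (a $ i) ^ k / fact k * ((b $ i) ^ (\<gamma> $ i - k) / fact (\<gamma> $ i - k)))"
    unfolding vmonom_altdef vector_add_component binomial_fact_form ..
  also have "\<dots> = (\<Sum>g\<in>(\<Pi>\<^sub>E i\<in>UNIV. {..\<gamma> $ i}). \<Prod>i\<in>UNIV. (a $ i) ^ g i / fact (g i) * ((b $ i) ^ (\<gamma> $ i - g i) / fact (\<gamma> $ i - g i)))"
    by (rule prod_sum_PiE) auto
  also have "\<dots> = (\<Sum>g\<in>(\<Pi>\<^sub>E i\<in>UNIV. {..\<gamma> $ i}). vmonom a (vec_lambda g) * vmonom b (\<gamma> - vec_lambda g))"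
    by (simp only: vmonom_altdef prod.distrib vector_minus_component vec_lambda_beta)
  also have "\<dots> = (\<Sum>\<kappa> | \<kappa> \<le> \<gamma>. vmonom a \<kappa> * vmonom b (\<gamma> - \<kappa>))"
    unfolding multi_indices_below
    by (subst sum.reindex) (auto simp: inj_on_def vec_lambda_inject)
  finally show ?thesis .
qed

lemma vmonom_zero: "vmonom 0 \<gamma> = (if \<gamma> = 0 then 1 else 0)"
proof (cases "\<gamma> = 0")
  case False
  then obtain i where "\<gamma> $ i \<noteq> 0" by (auto simp: vec_eq_iff)
  then show ?thesis using False unfolding vmonom_altdef by (auto intro!: prod_zero bexI[of _ i])
qed simp

lemma vmonom_scaleR: "vmonom (c *\<^sub>R v) \<gamma> = c ^ mi_size \<gamma> * vmonom v \<gamma>"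
  by (simp add: vmonom_altdef mi_size_def power_mult_distrib power_sum prod.distrib[symmetric])

lemma vmonom_axis: "vmonom v (axis i 1) = v $ i"
  using vmonom_add_axis[of v 0 i] by simp

text \<open>Collects the index sets of the recursion for all lengths and all weights at once, with N
  as an upper bound for the indices. This form admits induction on N by splitting off the last
  entry.\<close>

definition index_lists :: "nat \<Rightarrow> nat^'n \<Rightarrow> ((nat^'n) list \<times> nat list) set" where
  "index_lists N \<gamma> = {(k, l). length k = length l \<and> (\<forall>x\<in>set k. x \<noteq> 0) \<and> (\<forall>x\<in>set l. 0 < x \<and> x \<le> N) \<and>
     sorted_wrt (<) l \<and> sum_list k = \<gamma>}"

definition list_vmonom :: "(nat \<Rightarrow> real^'n) \<Rightarrow> (nat^'n) list \<times> nat list \<Rightarrow> real" where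
  "list_vmonom z p = prod_list (map2 (\<lambda>\<kappa> n. vmonom (z n) \<kappa>) (fst p) (snd p))"

lemma index_lists_0: "index_lists 0 \<gamma> = (if \<gamma> = 0 then {([], [])} else {})"
proof -
  have "k = [] \<and> l = []" if "(k, l) \<in> index_lists 0 \<gamma>" for k l
    using that by (cases l) (auto simp: index_lists_def)
  moreover have "([], []) \<in> index_lists 0 \<gamma> \<longleftrightarrow> \<gamma> = 0" by (auto simp: index_lists_def)
  ultimately show ?thesis by auto
qed

lemma index_lists_snoc:
  "(k @ [\<kappa>], l @ [n]) \<in> index_lists N \<gamma> \<longleftrightarrow>
    0 < n \<and> n \<le> N \<and> \<kappa> \<noteq> 0 \<and> \<kappa> \<le> \<gamma> \<and> (k, l) \<in> index_lists (n - 1) (\<gamma> - \<kappa>)"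
proof -
  have "sum_list k + \<kappa> = \<gamma> \<longleftrightarrow> \<kappa> \<le> \<gamma> \<and> sum_list k = \<gamma> - \<kappa>"
  proof -
    have "a + b = c \<longleftrightarrow> b \<le> c \<and> a = c - b" for a b c :: nat by arith
    then show ?thesis by (simp add: vec_eq_iff multi_index_le_iff all_conj_distrib)
  qed
  moreover have "(\<forall>x\<in>set l. 0 < x \<and> x \<le> N) \<and> (\<forall>x\<in>set l. x < n) \<longleftrightarrow> (\<forall>x\<in>set l. 0 < x \<and> x \<le> n - 1)"
    if "0 < n" "n \<le> N"
    using that by fastforce
  ultimately show ?thesis
    unfolding index_lists_def by (auto simp: sorted_wrt_append)
qed

text \<open>In an increasing list bounded by N + 1, the value N + 1 can occur only at the
  end.\<close>

lemma index_lists_last: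
  assumes "(k, l) \<in> index_lists (Suc N) \<gamma>" "\<not> (l \<noteq> [] \<and> last l = Suc N)"
  shows "(k, l) \<in> index_lists N \<gamma>"
proof (cases l rule: rev_cases)
  case Nil
  then show ?thesis using assms by (auto simp: index_lists_def)
next
  case (snoc l' n)
  then have "x < n" if "x \<in> set l'" for x
    using assms(1) that by (auto simp: index_lists_def sorted_wrt_append)
  moreover have "n \<le> N" using assms snoc by (auto simp: index_lists_def)
  ultimately show ?thesis using assms(1) snoc by (fastforce simp: index_lists_def)
qed

lemma index_lists_mono: "p \<in> index_lists N \<gamma> \<Longrightarrow> p \<in> index_lists (Suc N) \<gamma>"
  by (auto simp: index_lists_def)

lemma finite_index_lists: "finite (index_lists N \<gamma>)"
proof (induction N arbitrary: \<gamma>)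
  case 0
  show ?case by (simp add: index_lists_0)
next
  case (Suc N)
  have "index_lists (Suc N) \<gamma> \<subseteq> index_lists N \<gamma> \<union>
     (\<lambda>(\<kappa>, k, l). (k @ [\<kappa>], l @ [Suc N])) ` (SIGMA \<kappa>:{\<kappa>. \<kappa> \<le> \<gamma>}. index_lists N (\<gamma> - \<kappa>))"
  proof
    fix p assume p: "p \<in> index_lists (Suc N) \<gamma>"
    obtain k l where kl: "p = (k, l)" by (cases p)
    show "p \<in> index_lists N \<gamma> \<union>
     (\<lambda>(\<kappa>, k, l). (k @ [\<kappa>], l @ [Suc N])) ` (SIGMA \<kappa>:{\<kappa>. \<kappa> \<le> \<gamma>}. index_lists N (\<gamma> - \<kappa>))"
    proof (cases "l \<noteq> [] \<and> last l = Suc N")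
      case True
      then obtain l' where l: "l = l' @ [Suc N]" by (metis append_butlast_last_id)
      have "k \<noteq> []" using p kl l by (auto simp: index_lists_def)
      then obtain k' \<kappa> where k: "k = k' @ [\<kappa>]" by (metis append_butlast_last_id)
      have "\<kappa> \<le> \<gamma>" "(k', l') \<in> index_lists N (\<gamma> - \<kappa>)" using p unfolding kl k l index_lists_snoc by auto
      then show ?thesis unfolding kl k l by force
    qed (use index_lists_last p kl in blast)
  qed
  then show ?case
    by (rule finite_subset) (intro finite_UnI finite_imageI finite_SigmaI finite_multi_indices_below Suc.IH)
qed

text \<open>The multinomial theorem, by induction on the number of summands. The two-term formula
  splits \<gamma> into the exponent \<kappa> of the last summand and the rest; \<kappa> = 0 means
  that the index of this summand does not occur in the list.\<close>

lemma vmonom_sum: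
  "vmonom (\<Sum>\<nu>=1..N. z \<nu>) \<gamma> = (\<Sum>p\<in>index_lists N \<gamma>. list_vmonom z p)"
proof (induction N arbitrary: \<gamma>)
  case 0
  show ?case by (simp add: index_lists_0 vmonom_zero list_vmonom_def)
next
  case (Suc N)
  have "vmonom (\<Sum>\<nu>=1..Suc N. z \<nu>) \<gamma> = (\<Sum>\<kappa> | \<kappa> \<le> \<gamma>. vmonom (z (Suc N)) \<kappa> * vmonom (\<Sum>\<nu>=1..N. z \<nu>) (\<gamma> - \<kappa>))"
    using vmonom_add[of "z (Suc N)" "\<Sum>\<nu>=1..N. z \<nu>" \<gamma>] by (simp add: add.commute)
  also have "\<dots> = (\<Sum>\<kappa> | \<kappa> \<le> \<gamma>. \<Sum>p\<in>index_lists N (\<gamma> - \<kappa>). vmonom (z (Suc N)) \<kappa> * list_vmonom z p)"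
    unfolding Suc.IH by (simp add: sum_distrib_left)
  also have "\<dots> = (\<Sum>(\<kappa>, p)\<in>(SIGMA \<kappa>:{\<kappa>. \<kappa> \<le> \<gamma>}. index_lists N (\<gamma> - \<kappa>)). vmonom (z (Suc N)) \<kappa> * list_vmonom z p)"
    by (rule sum.Sigma) (auto simp: finite_multi_indices_below finite_index_lists)
  also have "\<dots> = (\<Sum>p\<in>index_lists (Suc N) \<gamma>. list_vmonom z p)"
  \<comment> \<open>A nonzero \<kappa> is appended at the end of the lists together with the index N
    + 1. A zero \<kappa> leaves the lists unchanged, because entries of an index list have to be
    nonzero.\<close>
  proof (rule sum.reindex_bij_witness[where
        i="\<lambda>(k, l). if l \<noteq> [] \<and> last l = Suc N then (last k, (butlast k, butlast l)) else (0, (k, l))" and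
        j="\<lambda>(\<kappa>, (k, l)). if \<kappa> = 0 then (k, l) else (k @ [\<kappa>], l @ [Suc N])"], goal_cases)
    case (1 a)
    obtain \<kappa> k l where a: "a = (\<kappa>, k, l)" by (cases a)
    have "(k, l) \<in> index_lists N (\<gamma> - \<kappa>)" using 1 a by auto
    then have "l \<noteq> [] \<longrightarrow> last l \<noteq> Suc N" using last_in_set[of l] by (fastforce simp: index_lists_def)
    then show ?case unfolding a by auto
  next
    case (2 a)
    obtain \<kappa> k l where a: "a = (\<kappa>, k, l)" by (cases a)
    then show ?case using 2 index_lists_mono[of "(k, l)" N \<gamma>] by (auto simp: index_lists_snoc)
  next
    case (3 b)
    obtain k l where b: "b = (k, l)" by (cases b)
    show ?case
    proof (cases "l \<noteq> [] \<and> last l = Suc N")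
      case True
      then have k: "k \<noteq> []" using 3 b by (auto simp: index_lists_def)
      then have "last k \<noteq> 0" using 3 b last_in_set[OF k] by (auto simp: index_lists_def)
      moreover have "butlast l @ [Suc N] = l" using True append_butlast_last_id[of l] by simp
      ultimately show ?thesis using True k by (simp add: b)
    qed (auto simp: b)
  next
    case (4 b)
    obtain k l where b: "b = (k, l)" by (cases b)
    show ?case
    proof (cases "l \<noteq> [] \<and> last l = Suc N")
      case True
      then have k: "k \<noteq> []" using 4 b by (auto simp: index_lists_def)
      have l: "butlast l @ [Suc N] = l" using True append_butlast_last_id[of l] by simp
      have "(butlast k @ [last k], butlast l @ [Suc N]) \<in> index_lists (Suc N) \<gamma>" using 4 b k l by simp
      then have "last k \<le> \<gamma>" "(butlast k, butlast l) \<in> index_lists N (\<gamma> - last k)" unfolding index_lists_snoc by auto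
      then show ?thesis using True by (simp add: b)
    next
      case False
      then have "(k, l) \<in> index_lists N \<gamma>" using index_lists_last 4 b by blast
      moreover have "0 \<le> \<gamma>" by (simp add: multi_index_le_iff)
      moreover have "\<gamma> - 0 = \<gamma>" by simp
      ultimately show ?thesis using False by (auto simp: b)
    qed
  next
    case (5 a)
    obtain \<kappa> k l where a: "a = (\<kappa>, k, l)" by (cases a)
    then have "length k = length l" using 5 by (auto simp: index_lists_def)
    then show ?case by (simp add: a list_vmonom_def mult.commute)
  qed
  finally show ?case .
qed

text \<open>The power of \<epsilon> that a product collects when each z n is replaced by
  \<epsilon>^n z n.\<close>

definition list_weight :: "(nat^'n) list \<times> nat list \<Rightarrow> nat" where
  "list_weight p = sum_list (map2 (\<lambda>\<kappa> n. mi_size \<kappa> * n) (fst p) (snd p))"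

lemma list_vmonom_scale:
  fixes z :: "nat \<Rightarrow> real^'n"
  assumes "length (fst p) = length (snd p)"
  shows "list_vmonom (\<lambda>n. (\<epsilon> ^ n) *\<^sub>R z n) p = \<epsilon> ^ list_weight p * list_vmonom z p"
proof -
  have "list_vmonom (\<lambda>n. (\<epsilon> ^ n) *\<^sub>R z n) (k, l) = \<epsilon> ^ list_weight (k, l) * list_vmonom z (k, l)"
    if "length k = length l" for k :: "(nat^'n) list" and l
    using that
    by (induction k l rule: list_induct2)
      (auto simp: list_vmonom_def list_weight_def vmonom_scaleR power_add power_mult[symmetric] mult_ac)
  then show ?thesis using assms by (cases p) auto
qed

lemma mi_size_plus: "mi_size (a + b) = mi_size a + mi_size b"
  by (simp add: mi_size_def sum.distrib)

lemma mi_size_zero [simp]: "mi_size 0 = 0" by (simp add: mi_size_def)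

lemma list_vmonom_bound:
  fixes z :: "nat \<Rightarrow> real^'n"
  assumes "p \<in> index_lists N \<gamma>" "\<And>n. 0 < n \<Longrightarrow> n \<le> N \<Longrightarrow> norm (z n) \<le> B"
  shows "\<bar>list_vmonom z p\<bar> \<le> B ^ mi_size \<gamma>"
proof -
  have "\<bar>list_vmonom z (k, l)\<bar> \<le> B ^ mi_size (sum_list k)"
    if "length k = length l" "\<forall>x\<in>set l. 0 < x \<and> x \<le> N" for k :: "(nat^'n) list" and l
    using that
  proof (induction k l rule: list_induct2)
    case (Cons x xs y ys)
    have "\<bar>vmonom (z y) x\<bar> \<le> B ^ mi_size x"
      using vmonom_bound[of "z y" x] assms(2)[of y] Cons.prems power_mono[of "norm (z y)" B "mi_size x"] by force
    then have "\<bar>vmonom (z y) x\<bar> * \<bar>list_vmonom z (xs, ys)\<bar> \<le> B ^ mi_size x * B ^ mi_size (sum_list xs)"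
      using Cons by (intro mult_mono) auto
    then show ?case by (simp add: list_vmonom_def mi_size_plus power_add abs_mult)
  qed (simp add: list_vmonom_def)
  then show ?thesis using assms(1) by (auto simp: index_lists_def)
qed

text \<open>Each pair contributes the product of two numbers that are at least 1, so its
  contribution dominates the size of the exponent, the index and the number 1.\<close>

lemma list_weight_ge:
  assumes "p \<in> index_lists N \<gamma>"
  shows "mi_size \<gamma> \<le> list_weight p" "length (fst p) \<le> list_weight p" "\<And>n. n \<in> set (snd p) \<Longrightarrow> n \<le> list_weight p"
proof -
  have "mi_size (sum_list k) \<le> list_weight (k, l) \<and> length k \<le> list_weight (k, l) \<and> (\<forall>n\<in>set l. n \<le> list_weight (k, l))"
    if "length k = length l" "\<forall>x\<in>set k. x \<noteq> 0" "\<forall>x\<in>set l. 0 < x" for k :: "(nat^'n) list" and l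
    using that
  proof (induction k l rule: list_induct2)
    case (Cons x xs y ys)
    have x: "0 < mi_size x" "0 < y" using Cons.prems mi_size_pos by auto
    have w: "list_weight (x # xs, y # ys) = mi_size x * y + list_weight (xs, ys)" by (simp add: list_weight_def)
    have 1: "mi_size x \<le> mi_size x * y" "y \<le> mi_size x * y" using x by auto
    have IH: "mi_size (sum_list xs) \<le> list_weight (xs, ys)" "length xs \<le> list_weight (xs, ys)"
      "\<forall>n\<in>set ys. n \<le> list_weight (xs, ys)" using Cons by auto
    have "1 \<le> mi_size x * y" using x by (simp add: Suc_le_eq)
    then have "length (x # xs) \<le> mi_size x * y + list_weight (xs, ys)" using IH(2) unfolding length_Cons by linarith
    moreover have "mi_size (sum_list (x # xs)) \<le> mi_size x * y + list_weight (xs, ys)"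
      using add_mono[OF 1(1) IH(1)] by (simp only: sum_list.Cons mi_size_plus)
    moreover have "\<forall>n\<in>set (y # ys). n \<le> mi_size x * y + list_weight (xs, ys)"
      by (auto intro: trans_le_add1[OF 1(2)] trans_le_add2[OF bspec[OF IH(3)]])
    ultimately show ?case unfolding w by blast
  qed simp
  note * = this
  obtain k l where p: "p = (k, l)" by (cases p)
  have "length k = length l" "\<forall>x\<in>set k. x \<noteq> 0" "\<forall>x\<in>set l. 0 < x" "sum_list k = \<gamma>"
    using assms p by (auto simp: index_lists_def)
  with *[of k l] show "mi_size \<gamma> \<le> list_weight p" "length (fst p) \<le> list_weight p" "\<And>n. n \<in> set (snd p) \<Longrightarrow> n \<le> list_weight p"
    by (auto simp: p)
qed

lemma list_sums_nth:
  assumes "length k = length l"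
  shows "list_weight (k, l) = (\<Sum>j<length k. mi_size (k ! j) * l ! j)"
    "sum_list k = (\<Sum>j<length k. k ! j)"
    "list_vmonom z (k, l) = (\<Prod>j<length k. vmonom (z (l ! j)) (k ! j))"
  using assms
  by (simp_all add: list_weight_def list_vmonom_def sum.list_conv_set_nth prod.list_conv_set_nth atLeast0LessThan)

text \<open>The index sets with different s are disjoint and together form the lists of weight m.
  The range of s is right because \<gamma> is nonzero and every block has weight at least 1. The
  bound by N is automatic: for exponents of size above 1 all indices are below m, by
  \<open>p_index_less\<close>.\<close>

lemma p_index_sum:
  assumes \<gamma>: "1 < mi_size \<gamma>" and m: "m \<le> N"
  shows "(\<Sum>s = 1..m. \<Sum>(k, l) \<in> p_index s m \<gamma>. \<Prod>j<s. (\<Prod>i\<in>UNIV. (z (l ! j) $ i) ^ (k ! j $ i)) /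
            (\<Prod>i\<in>UNIV. fact (k ! j $ i))) =
    (\<Sum>p | p \<in> index_lists N \<gamma> \<and> list_weight p = m. list_vmonom z p)"
proof -
  have set: "{p. p \<in> index_lists N \<gamma> \<and> list_weight p = m} = (\<Union>s\<in>{1..m}. p_index s m \<gamma>)"
  proof (intro equalityI subsetI)
    fix p assume p: "p \<in> {p. p \<in> index_lists N \<gamma> \<and> list_weight p = m}"
    obtain k l where kl: "p = (k, l)" by (cases p)
    have len: "length k = length l" using p kl by (auto simp: index_lists_def)
    have "k \<noteq> []" using p kl \<gamma> by (auto simp: index_lists_def)
    moreover have "length k \<le> m" using p kl list_weight_ge(2)[of p N \<gamma>] by auto
    moreover have "(k, l) \<in> p_index (length k) m \<gamma>"
      using p kl len list_sums_nth(1,2)[OF len] unfolding p_index_def index_lists_def by auto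
    ultimately show "p \<in> (\<Union>s\<in>{1..m}. p_index s m \<gamma>)" unfolding kl by (intro UN_I[of "length k"]) (auto simp: Suc_le_eq)
  next
    fix p assume "p \<in> (\<Union>s\<in>{1..m}. p_index s m \<gamma>)"
    then obtain s where s: "p \<in> p_index s m \<gamma>" by auto
    obtain k l where kl: "p = (k, l)" by (cases p)
    have len: "length k = length l" and "length k = s" using s kl by (auto simp: p_index_def)
    then have "(k, l) \<in> index_lists m \<gamma> \<and> list_weight (k, l) = m"
    proof -
      have w: "list_weight (k, l) = m" using s kl list_sums_nth(1)[OF len] by (auto simp: p_index_def)
      have "l ! j < m" if "j < s" for j using p_index_less[OF s[unfolded kl] \<gamma> that] .
      then show ?thesis
        using s kl len w list_sums_nth(2)[OF len]
        by (auto simp: p_index_def index_lists_def in_set_conv_nth less_imp_le)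
    qed
    then show "p \<in> {p. p \<in> index_lists N \<gamma> \<and> list_weight p = m}"
      using m kl by (auto simp: index_lists_def)
  qed
  have "(\<Sum>p\<in>(\<Union>s\<in>{1..m}. p_index s m \<gamma>). list_vmonom z p) = (\<Sum>s\<in>{1..m}. \<Sum>p\<in>p_index s m \<gamma>. list_vmonom z p)"
  proof (rule sum.UNION_disjoint)
    show "\<forall>s\<in>{1..m}. finite (p_index s m \<gamma>)" by (simp add: finite_p_index)
    show "\<forall>s\<in>{1..m}. \<forall>s'\<in>{1..m}. s \<noteq> s' \<longrightarrow> p_index s m \<gamma> \<inter> p_index s' m \<gamma> = {}"
      by (auto simp: p_index_def)
  qed simp
  also have "\<dots> = (\<Sum>s = 1..m. \<Sum>(k, l) \<in> p_index s m \<gamma>. \<Prod>j<s. (\<Prod>i\<in>UNIV. (z (l ! j) $ i) ^ (k ! j $ i)) /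
            (\<Prod>i\<in>UNIV. fact (k ! j $ i)))"
  proof (intro sum.cong refl, clarify)
    fix s k l assume "(k, l) \<in> p_index s m \<gamma>"
    then have "length k = length l" "length k = s" by (auto simp: p_index_def)
    then show "list_vmonom z (k, l) = (\<Prod>j<s. (\<Prod>i\<in>UNIV. (z (l ! j) $ i) ^ (k ! j $ i)) / (\<Prod>i\<in>UNIV. fact (k ! j $ i)))"
      using list_sums_nth(3)[of k l z] by (simp add: vmonom_def)
  qed
  finally show ?thesis unfolding set by simp
qed

lemma finite_mi_size_le: "finite {\<gamma> :: nat^'n. mi_size \<gamma> \<le> m}"
proof -
  have "{\<gamma> :: nat^'n. mi_size \<gamma> \<le> m} = (\<Union>k\<le>m. {\<gamma>. mi_size \<gamma> = k})" by auto
  then show ?thesis by (simp add: finite_mi_size_eq)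
qed

lemma sum_mi_size_le:
  "(\<Sum>\<gamma> | mi_size (\<gamma> :: nat^'n) \<le> m. g \<gamma>) = (\<Sum>k\<le>m. \<Sum>\<gamma> | mi_size \<gamma> = k. g \<gamma>)"
proof -
  have "{\<gamma> :: nat^'n. mi_size \<gamma> \<le> m} = (\<Union>k\<in>{..m}. {\<gamma>. mi_size \<gamma> = k})" by auto
  then show ?thesis by (simp only:) (rule sum.UNION_disjoint; auto simp: finite_mi_size_eq)
qed

lemma mi_size_1: "{\<gamma> :: nat^'n. mi_size \<gamma> = 1} = range (\<lambda>i. axis i 1)"
proof
  show "{\<gamma> :: nat^'n. mi_size \<gamma> = 1} \<subseteq> range (\<lambda>i. axis i 1)"
  proof
    fix \<gamma> :: "nat^'n" assume \<gamma>: "\<gamma> \<in> {\<gamma>. mi_size \<gamma> = 1}"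
    then have "\<gamma> \<noteq> 0" by auto
    then obtain i where i: "\<gamma> $ i \<noteq> 0" by (auto simp: vec_eq_iff)
    have "mi_size \<gamma> = \<gamma> $ i + (\<Sum>j\<in>UNIV - {i}. \<gamma> $ j)"
      unfolding mi_size_def by (rule sum.remove) auto
    moreover have "mi_size \<gamma> = 1" using \<gamma> by simp
    ultimately have "\<gamma> $ i = 1" "(\<Sum>j\<in>UNIV - {i}. \<gamma> $ j) = 0" using i by linarith+
    then have "\<gamma> = axis i 1" by (auto simp: vec_eq_iff axis_def)
    then show "\<gamma> \<in> range (\<lambda>i. axis i 1)" by blast
  qed
  have "mi_size (axis i 1 :: nat^'n) = 1" for i
    using mi_size_add_axis[of "0 :: nat^'n" i] by simp
  then show "range (\<lambda>i. axis i 1) \<subseteq> {\<gamma> :: nat^'n. mi_size \<gamma> = 1}" by auto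
qed

section \<open>The truncated series as a formal solution\<close>

context slow_fast
begin

abbreviation "X \<nu> \<alpha> \<equiv> slow_coeff f x0 \<nu> \<alpha>"
abbreviation "X' \<nu> \<alpha> \<equiv> vector_derivative (slow_coeff f x0 \<nu>) (at \<alpha>)"
abbreviation "M \<gamma> \<alpha> \<equiv> mixed_partial_x \<gamma> f (x0 \<alpha>, \<alpha>)"

definition "corr \<epsilon> \<alpha> = (\<Sum>\<nu>=1..r. \<epsilon> ^ \<nu> *\<^sub>R X \<nu> \<alpha>)"
text \<open>The coefficient of \<epsilon>^m in
  \<open>vmonom (corr \<epsilon> \<alpha>) \<gamma>\<close>.\<close>

definition "coef m \<gamma> \<alpha> = (\<Sum>p | p \<in> index_lists r \<gamma> \<and> list_weight p = m. list_vmonom (\<lambda>n. X n \<alpha>) p)"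

lemma coeff_bound: "\<exists>B\<ge>1. \<forall>\<nu>\<le>r. \<forall>\<alpha>. norm (X \<nu> \<alpha>) \<le> B"
proof -
  have "\<forall>\<nu>. \<exists>b. \<nu> \<le> r \<longrightarrow> (\<forall>\<alpha>. norm (X \<nu> \<alpha>) \<le> b)"
    using UC_base(1)[OF UC_slow_coeff] unfolding bounded_iff by blast
  then obtain b where b: "\<And>\<nu> \<alpha>. \<nu> \<le> r \<Longrightarrow> norm (X \<nu> \<alpha>) \<le> b \<nu>" by metis
  have "norm (X \<nu> \<alpha>) \<le> 1 + (\<Sum>\<nu>\<le>r. \<bar>b \<nu>\<bar>)" if "\<nu> \<le> r" for \<nu> \<alpha>
    using b[OF that, of \<alpha>] member_le_sum[of \<nu> "{..r}" "\<lambda>\<nu>. \<bar>b \<nu>\<bar>"] that by auto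
  moreover have "1 \<le> 1 + (\<Sum>\<nu>\<le>r. \<bar>b \<nu>\<bar>)" by (simp add: sum_nonneg)
  ultimately show ?thesis by blast
qed

lemma M_bound: "\<exists>D>0. \<forall>\<gamma> \<alpha>. mi_size \<gamma> \<le> r \<longrightarrow> norm (M \<gamma> \<alpha>) \<le> D"
proof -
  have "\<exists>b. mi_size \<gamma> \<le> r \<longrightarrow> (\<forall>\<alpha>. norm (M \<gamma> \<alpha>) \<le> b)" for \<gamma> :: "nat^'n"
  proof (cases "mi_size \<gamma> \<le> r")
    case True
    have "bounded (mixed_partial_x \<gamma> f ` tube x0 \<rho>)"
      using uniform_Ck_on_base(1)[OF mixed_partial_x_regular(2)[of \<gamma> 0 r f, OF _ Ck_f uniform_f]] True by simp
    then show ?thesis unfolding bounded_iff using graph_in_tube by blast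
  qed auto
  then obtain b where b: "\<And>\<gamma> \<alpha>. mi_size \<gamma> \<le> r \<Longrightarrow> norm (M \<gamma> \<alpha>) \<le> b \<gamma>" by metis
  have "norm (M \<gamma> \<alpha>) \<le> 1 + (\<Sum>\<gamma> | mi_size \<gamma> \<le> r. \<bar>b \<gamma>\<bar>)" if "mi_size \<gamma> \<le> r" for \<gamma> \<alpha>
    using b[OF that, of \<alpha>] member_le_sum[of \<gamma> "{\<gamma>. mi_size \<gamma> \<le> r}" "\<lambda>\<gamma>. \<bar>b \<gamma>\<bar>"] that
    by (auto simp: finite_mi_size_le)
  moreover have "0 < 1 + (\<Sum>\<gamma> | mi_size \<gamma> \<le> r. \<bar>b \<gamma>\<bar>)" by (simp add: sum_nonneg add_pos_nonneg)
  ultimately show ?thesis by blast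
qed

lemma coef_eq_0:
  assumes "m < mi_size \<gamma>"
  shows "coef m \<gamma> \<alpha> = 0"
proof -
  have "{p. p \<in> index_lists r \<gamma> \<and> list_weight p = m} = {}"
    using list_weight_ge(1)[of _ r \<gamma>] assms by (auto simp: not_le[symmetric])
  then show ?thesis unfolding coef_def by (simp only: sum.empty)
qed

text \<open>The recursion with the inverse of A removed: the coefficients of \<epsilon>^m on both
  sides of the invariance equation agree. The sum may run over all \<gamma> up to size r, since an
  exponent of size above m produces no term of weight m.\<close>

lemma coeff_equation:
  assumes m: "1 \<le> m" "m \<le> r"
  shows "A \<alpha> *v X m \<alpha> + (\<Sum>\<gamma> | 1 < mi_size \<gamma> \<and> mi_size \<gamma> \<le> r. coef m \<gamma> \<alpha> *\<^sub>R M \<gamma> \<alpha>) = X' (m - 1) \<alpha>"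
proof -
  obtain \<nu> where \<nu>: "m = Suc \<nu>" using m by (cases m) auto
  have "(\<Sum>\<gamma> | 1 < mi_size \<gamma> \<and> mi_size \<gamma> \<le> r. coef m \<gamma> \<alpha> *\<^sub>R M \<gamma> \<alpha>) =
      (\<Sum>\<gamma> | 1 < mi_size \<gamma> \<and> mi_size \<gamma> \<le> m. coef m \<gamma> \<alpha> *\<^sub>R M \<gamma> \<alpha>)"
  proof (rule sum.mono_neutral_right)
    show "finite {\<gamma>::nat^'n. 1 < mi_size \<gamma> \<and> mi_size \<gamma> \<le> r}" by (rule finite_multi_indices)
    show "\<forall>\<gamma>\<in>{\<gamma>. 1 < mi_size \<gamma> \<and> mi_size \<gamma> \<le> r} - {\<gamma>. 1 < mi_size \<gamma> \<and> mi_size \<gamma> \<le> m}. coef m \<gamma> \<alpha> *\<^sub>R M \<gamma> \<alpha> = 0"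
    proof
      fix \<gamma> :: "nat^'n"
      assume "\<gamma> \<in> {\<gamma>. 1 < mi_size \<gamma> \<and> mi_size \<gamma> \<le> r} - {\<gamma>. 1 < mi_size \<gamma> \<and> mi_size \<gamma> \<le> m}"
      then have "m < mi_size \<gamma>" by auto
      then show "coef m \<gamma> \<alpha> *\<^sub>R M \<gamma> \<alpha> = 0" by (simp add: coef_eq_0)
    qed
  qed (use m in auto)
  also have "\<dots> = (\<Sum>\<gamma> | 1 < mi_size \<gamma> \<and> mi_size \<gamma> \<le> m.
      (\<Sum>s = 1..m. \<Sum>(k, l) \<in> p_index s m \<gamma>. \<Prod>j<s. (\<Prod>i\<in>UNIV. (X (l ! j) \<alpha> $ i) ^ (k ! j $ i)) /
            (\<Prod>i\<in>UNIV. fact (k ! j $ i))) *\<^sub>R M \<gamma> \<alpha>)"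
  proof (intro sum.cong refl arg_cong2[where f=scaleR])
    fix \<gamma> :: "nat^'n" assume "\<gamma> \<in> {\<gamma>. 1 < mi_size \<gamma> \<and> mi_size \<gamma> \<le> m}"
    then show "coef m \<gamma> \<alpha> = (\<Sum>s = 1..m. \<Sum>(k, l) \<in> p_index s m \<gamma>. \<Prod>j<s. (\<Prod>i\<in>UNIV. (X (l ! j) \<alpha> $ i) ^ (k ! j $ i)) /
            (\<Prod>i\<in>UNIV. fact (k ! j $ i)))"
      unfolding coef_def using p_index_sum[of \<gamma> m r "\<lambda>n. X n \<alpha>"] m by simp
  qed
  also have "\<dots> = X' \<nu> \<alpha> - A \<alpha> *v X m \<alpha>"
    unfolding \<nu> slow_coeff.simps R_A_mult by simp
  finally show ?thesis using \<nu> by simp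
qed

text \<open>Inserting the series into the Taylor polynomial of f, the terms up to weight r match
  those of \<epsilon> x' by \<open>coeff_equation\<close>. What remains is a finite sum of terms of
  weight above r, each uniformly of order \<epsilon>^(r+1) because \<epsilon> <= 1.\<close>

lemma formal_expansion:
  "\<exists>C\<ge>0. \<forall>\<epsilon> \<alpha>. 0 < \<epsilon> \<longrightarrow> \<epsilon> \<le> 1 \<longrightarrow>
    norm ((\<Sum>\<gamma> | mi_size \<gamma> \<le> r. vmonom (corr \<epsilon> \<alpha>) \<gamma> *\<^sub>R M \<gamma> \<alpha>) - (\<Sum>m=1..r. \<epsilon> ^ m *\<^sub>R X' (m - 1) \<alpha>)) \<le> C * \<epsilon> ^ Suc r"
proof -
  obtain B where B: "1 \<le> B" "\<And>\<nu> \<alpha>. \<nu> \<le> r \<Longrightarrow> norm (X \<nu> \<alpha>) \<le> B" using coeff_bound by blast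
  obtain D where D: "0 < D" "\<And>\<gamma> \<alpha>. mi_size \<gamma> \<le> r \<Longrightarrow> norm (M \<gamma> \<alpha>) \<le> D" using M_bound by blast
  let ?G = "{\<gamma>::nat^'n. 1 < mi_size \<gamma> \<and> mi_size \<gamma> \<le> r}"
  have fG: "finite ?G" by (rule finite_multi_indices)
  define C where "C = (\<Sum>\<gamma>\<in>?G. real (card (index_lists r \<gamma>)) * B ^ r * D)"
  have C0: "C \<ge> 0" unfolding C_def using B D by (intro sum_nonneg) auto
  have main: "norm ((\<Sum>\<gamma> | mi_size \<gamma> \<le> r. vmonom (corr \<epsilon> \<alpha>) \<gamma> *\<^sub>R M \<gamma> \<alpha>) - (\<Sum>m=1..r. \<epsilon> ^ m *\<^sub>R X' (m - 1) \<alpha>)) \<le> C * \<epsilon> ^ Suc r"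
    if \<epsilon>: "0 < \<epsilon>" "\<epsilon> \<le> 1" for \<epsilon> \<alpha>
  proof -
    define W where "W p = list_vmonom (\<lambda>n. X n \<alpha>) p" for p
    define rem where "rem \<gamma> = (\<Sum>p | p \<in> index_lists r \<gamma> \<and> r < list_weight p. \<epsilon> ^ list_weight p * W p)" for \<gamma>
    have vm: "vmonom (corr \<epsilon> \<alpha>) \<gamma> = (\<Sum>m=1..r. \<epsilon> ^ m * coef m \<gamma> \<alpha>) + rem \<gamma>" if \<gamma>: "\<gamma> \<in> ?G" for \<gamma>
    proof -
      have "vmonom (corr \<epsilon> \<alpha>) \<gamma> = (\<Sum>p\<in>index_lists r \<gamma>. list_vmonom (\<lambda>n. \<epsilon> ^ n *\<^sub>R X n \<alpha>) p)"
        unfolding corr_def by (rule vmonom_sum)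
      also have "\<dots> = (\<Sum>p\<in>index_lists r \<gamma>. \<epsilon> ^ list_weight p * W p)"
        unfolding W_def by (intro sum.cong refl list_vmonom_scale) (auto simp: index_lists_def)
      also have "\<dots> = (\<Sum>p | p \<in> index_lists r \<gamma> \<and> list_weight p \<le> r. \<epsilon> ^ list_weight p * W p) + rem \<gamma>"
        unfolding rem_def
        by (subst sum.union_disjoint[symmetric]) (auto simp: finite_index_lists intro!: sum.cong)
      also have "(\<Sum>p | p \<in> index_lists r \<gamma> \<and> list_weight p \<le> r. \<epsilon> ^ list_weight p * W p) =
         (\<Sum>m=1..r. \<Sum>p | p \<in> {p. p \<in> index_lists r \<gamma> \<and> list_weight p \<le> r} \<and> list_weight p = m. \<epsilon> ^ list_weight p * W p)"
      proof (rule sum.group[symmetric])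
        show "finite {p. p \<in> index_lists r \<gamma> \<and> list_weight p \<le> r}" by (simp add: finite_index_lists)
        show "list_weight ` {p. p \<in> index_lists r \<gamma> \<and> list_weight p \<le> r} \<subseteq> {1..r}"
          using list_weight_ge(1)[of _ r \<gamma>] \<gamma> by force
      qed simp
      also have "\<dots> = (\<Sum>m=1..r. \<epsilon> ^ m * coef m \<gamma> \<alpha>)"
      proof (intro sum.cong refl)
        fix m assume m: "m \<in> {1..r}"
        then have "{p. p \<in> {p. p \<in> index_lists r \<gamma> \<and> list_weight p \<le> r} \<and> list_weight p = m} =
           {p. p \<in> index_lists r \<gamma> \<and> list_weight p = m}" by auto
        then have "(\<Sum>p | p \<in> {p. p \<in> index_lists r \<gamma> \<and> list_weight p \<le> r} \<and> list_weight p = m. \<epsilon> ^ list_weight p * W p) =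
          (\<Sum>p | p \<in> index_lists r \<gamma> \<and> list_weight p = m. \<epsilon> ^ m * W p)"
          by (auto intro!: sum.cong)
        then show "(\<Sum>p | p \<in> {p. p \<in> index_lists r \<gamma> \<and> list_weight p \<le> r} \<and> list_weight p = m. \<epsilon> ^ list_weight p * W p) =
          \<epsilon> ^ m * coef m \<gamma> \<alpha>"
          by (simp add: coef_def W_def sum_distrib_left)
      qed
      finally show ?thesis .
    qed
    have remb: "\<bar>rem \<gamma>\<bar> \<le> real (card (index_lists r \<gamma>)) * (\<epsilon> ^ Suc r * B ^ r)" if \<gamma>: "\<gamma> \<in> ?G" for \<gamma>
    proof -
      have "\<bar>rem \<gamma>\<bar> \<le> (\<Sum>p | p \<in> index_lists r \<gamma> \<and> r < list_weight p. \<bar>\<epsilon> ^ list_weight p * W p\<bar>)"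
        unfolding rem_def by (rule sum_abs)
      also have "\<dots> \<le> (\<Sum>p | p \<in> index_lists r \<gamma> \<and> r < list_weight p. \<epsilon> ^ Suc r * B ^ r)"
      proof (intro sum_mono)
        fix p assume p: "p \<in> {p. p \<in> index_lists r \<gamma> \<and> r < list_weight p}"
        have "\<bar>W p\<bar> \<le> B ^ mi_size \<gamma>"
          unfolding W_def using p B(2) by (intro list_vmonom_bound[where N=r]) auto
        also have "\<dots> \<le> B ^ r" using B(1) \<gamma> by (intro power_increasing) auto
        finally have "\<bar>W p\<bar> \<le> B ^ r" .
        moreover have "\<bar>\<epsilon> ^ list_weight p\<bar> \<le> \<epsilon> ^ Suc r"
          using \<epsilon> p power_decreasing[of "Suc r" "list_weight p" \<epsilon>] by auto
        ultimately show "\<bar>\<epsilon> ^ list_weight p * W p\<bar> \<le> \<epsilon> ^ Suc r * B ^ r"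
          unfolding abs_mult using \<epsilon> by (intro mult_mono) auto
      qed
      also have "\<dots> = real (card {p. p \<in> index_lists r \<gamma> \<and> r < list_weight p}) * (\<epsilon> ^ Suc r * B ^ r)" by simp
      also have "\<dots> \<le> real (card (index_lists r \<gamma>)) * (\<epsilon> ^ Suc r * B ^ r)"
        using \<epsilon> B by (intro mult_right_mono of_nat_mono card_mono finite_index_lists) auto
      finally show ?thesis .
    qed
    \<comment> \<open>The size of \<gamma> decides the role of its term: size 0 gives f on the
      critical manifold, which is 0, size 1 gives A applied to the correction, and larger sizes
      enter the sum of the recursion.\<close>
    have split: "{\<gamma>::nat^'n. mi_size \<gamma> \<le> r} = insert 0 (range (\<lambda>i. axis i 1) \<union> ?G)"
    proof -
      have "mi_size \<gamma> \<le> r \<longleftrightarrow> \<gamma> = 0 \<or> mi_size \<gamma> = 1 \<or> \<gamma> \<in> ?G" for \<gamma> :: "nat^'n"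
        using mi_size_pos[of \<gamma>] r by force
      then show ?thesis using mi_size_1 by blast
    qed
    have inj: "inj (\<lambda>i::'n. axis i (1::nat))" by (auto simp: inj_on_def axis_eq_axis)
    have z1: "(0::nat^'n) \<notin> range (\<lambda>i. axis i 1) \<union> ?G" unfolding mi_size_1[symmetric] by simp
    have z2: "range (\<lambda>i::'n. axis i (1::nat)) \<inter> ?G = {}" unfolding mi_size_1[symmetric] by auto
    have fin: "finite (range (\<lambda>i::'n. axis i (1::nat)))" by simp
    have Maxis: "M (axis i 1) \<alpha> = Df (x0 \<alpha>, \<alpha>) (axis i 1, 0)" for i
    proof -
      have "partial_x i (mixed_partial_x 0 f) = mixed_partial_x (0 + axis i 1) f"
        by (rule partial_x_mixed_partial) (use Ck_f1 in simp)
      then show ?thesis by (simp add: partial_x_eq[OF Ck_f1] fun_eq_iff)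
    qed
    have first: "(\<Sum>\<gamma>\<in>range (\<lambda>i. axis i 1). vmonom (corr \<epsilon> \<alpha>) \<gamma> *\<^sub>R M \<gamma> \<alpha>) = A \<alpha> *v corr \<epsilon> \<alpha>"
    proof -
      have "(\<Sum>\<gamma>\<in>range (\<lambda>i. axis i 1). vmonom (corr \<epsilon> \<alpha>) \<gamma> *\<^sub>R M \<gamma> \<alpha>) =
        (\<Sum>i\<in>UNIV. corr \<epsilon> \<alpha> $ i *\<^sub>R Df (x0 \<alpha>, \<alpha>) (axis i 1, 0))"
        by (simp only: sum.reindex[OF inj] o_def vmonom_axis Maxis)
      also have "\<dots> = (\<Sum>i\<in>UNIV. A \<alpha> *v (corr \<epsilon> \<alpha> $ i *\<^sub>R axis i 1))"
        by (simp only: A_mult[symmetric] matrix_vector_mult_scaleR)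
      also have "\<dots> = A \<alpha> *v (\<Sum>i\<in>UNIV. corr \<epsilon> \<alpha> $ i *\<^sub>R axis i 1)"
        by (rule linear_sum[symmetric]) simp
      also have "(\<Sum>i\<in>UNIV. corr \<epsilon> \<alpha> $ i *\<^sub>R axis i 1) = corr \<epsilon> \<alpha>"
        using basis_expansion[of "corr \<epsilon> \<alpha>"] by (simp add: scalar_mult_eq_scaleR)
      finally show ?thesis .
    qed
    have "(\<Sum>\<gamma> | mi_size \<gamma> \<le> r. vmonom (corr \<epsilon> \<alpha>) \<gamma> *\<^sub>R M \<gamma> \<alpha>) =
       vmonom (corr \<epsilon> \<alpha>) 0 *\<^sub>R M 0 \<alpha> + (A \<alpha> *v corr \<epsilon> \<alpha> + (\<Sum>\<gamma>\<in>?G. vmonom (corr \<epsilon> \<alpha>) \<gamma> *\<^sub>R M \<gamma> \<alpha>))"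
      unfolding split using z1 z2 fG fin
      by (subst sum.insert) (auto simp: sum.union_disjoint first simp del: One_nat_def)
    also have "M 0 \<alpha> = 0" by (simp add: zero)
    also have "(\<Sum>\<gamma>\<in>?G. vmonom (corr \<epsilon> \<alpha>) \<gamma> *\<^sub>R M \<gamma> \<alpha>) =
       (\<Sum>\<gamma>\<in>?G. (\<Sum>m=1..r. \<epsilon> ^ m * coef m \<gamma> \<alpha>) *\<^sub>R M \<gamma> \<alpha>) + (\<Sum>\<gamma>\<in>?G. rem \<gamma> *\<^sub>R M \<gamma> \<alpha>)"
      unfolding sum.distrib[symmetric] by (rule sum.cong[OF refl]) (simp only: vm scaleR_add_left)
    also have "(\<Sum>\<gamma>\<in>?G. (\<Sum>m=1..r. \<epsilon> ^ m * coef m \<gamma> \<alpha>) *\<^sub>R M \<gamma> \<alpha>) =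
       (\<Sum>m=1..r. \<epsilon> ^ m *\<^sub>R (\<Sum>\<gamma>\<in>?G. coef m \<gamma> \<alpha> *\<^sub>R M \<gamma> \<alpha>))"
      unfolding scaleR_sum_left scaleR_sum_right by (subst sum.swap) simp
    also have "A \<alpha> *v corr \<epsilon> \<alpha> = (\<Sum>m=1..r. \<epsilon> ^ m *\<^sub>R (A \<alpha> *v X m \<alpha>))"
      unfolding corr_def by (subst linear_sum) (simp_all add: matrix_vector_mult_scaleR)
    finally have "(\<Sum>\<gamma> | mi_size \<gamma> \<le> r. vmonom (corr \<epsilon> \<alpha>) \<gamma> *\<^sub>R M \<gamma> \<alpha>) =
      (\<Sum>m=1..r. \<epsilon> ^ m *\<^sub>R (A \<alpha> *v X m \<alpha> + (\<Sum>\<gamma>\<in>?G. coef m \<gamma> \<alpha> *\<^sub>R M \<gamma> \<alpha>))) + (\<Sum>\<gamma>\<in>?G. rem \<gamma> *\<^sub>R M \<gamma> \<alpha>)"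
      by (simp add: scaleR_add_right sum.distrib)
    also have "(\<Sum>m=1..r. \<epsilon> ^ m *\<^sub>R (A \<alpha> *v X m \<alpha> + (\<Sum>\<gamma>\<in>?G. coef m \<gamma> \<alpha> *\<^sub>R M \<gamma> \<alpha>))) =
      (\<Sum>m=1..r. \<epsilon> ^ m *\<^sub>R X' (m - 1) \<alpha>)"
      by (intro sum.cong refl arg_cong2[where f=scaleR] coeff_equation) auto
    finally have "norm ((\<Sum>\<gamma> | mi_size \<gamma> \<le> r. vmonom (corr \<epsilon> \<alpha>) \<gamma> *\<^sub>R M \<gamma> \<alpha>) - (\<Sum>m=1..r. \<epsilon> ^ m *\<^sub>R X' (m - 1) \<alpha>)) =
      norm (\<Sum>\<gamma>\<in>?G. rem \<gamma> *\<^sub>R M \<gamma> \<alpha>)" by simp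
    also have "\<dots> \<le> (\<Sum>\<gamma>\<in>?G. real (card (index_lists r \<gamma>)) * (\<epsilon> ^ Suc r * B ^ r) * D)"
      using remb D B \<epsilon> by (intro sum_norm_le) (auto intro!: mult_mono)
    also have "\<dots> = C * \<epsilon> ^ Suc r" unfolding C_def sum_distrib_right by (intro sum.cong) (auto simp: mult_ac)
    finally show ?thesis .
  qed
  then show ?thesis using C0 by blast
qed

text \<open>The Lagrange remainder differs from the Taylor term of order r only through the point at
  which the derivatives of order r are taken. Their uniform continuity on the tube makes this
  difference small uniformly in \<alpha>, without any derivative of order r + 1.\<close>

lemma uniform_taylor:
  assumes \<eta>: "0 < \<eta>"
  shows "\<exists>d>0. d \<le> \<rho> \<and> (\<forall>\<alpha> v. norm v \<le> d \<longrightarrow>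
    norm (f (x0 \<alpha> + v, \<alpha>) - (\<Sum>\<gamma> | mi_size \<gamma> \<le> r. vmonom v \<gamma> *\<^sub>R M \<gamma> \<alpha>)) \<le> \<eta> * norm v ^ r)"
proof -
  let ?G = "{\<gamma>::nat^'n. mi_size \<gamma> = r}"
  \<comment> \<open>Shares \<eta> among the components of f and the multi-indices of size r; adding
    1 keeps the constant positive without counting them.\<close>
  define c where "c = real CARD('n) * (real (card ?G) + 1)"
  have c: "c > 0" by (simp add: c_def)
  have "\<exists>d>0. mi_size \<gamma> = r \<longrightarrow> (\<forall>z\<in>tube x0 \<rho>. \<forall>z'\<in>tube x0 \<rho>. dist z' z < d \<longrightarrow>
      dist (mixed_partial_x \<gamma> f z') (mixed_partial_x \<gamma> f z) < \<eta> / c)" for \<gamma> :: "nat^'n"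
  proof (cases "mi_size \<gamma> = r")
    case True
    have "uniformly_continuous_on (tube x0 \<rho>) (mixed_partial_x \<gamma> f)"
      using uniform_Ck_on_base(2)[OF mixed_partial_x_regular(2)[of \<gamma> 0 r f, OF _ Ck_f uniform_f]] True by simp
    moreover have "0 < \<eta> / c" using \<eta> c by simp
    ultimately show ?thesis unfolding uniformly_continuous_on_def by blast
  qed (auto intro: exI[of _ 1])
  then obtain d where d: "\<And>\<gamma>. 0 < d \<gamma>"
    "\<And>\<gamma> z z'. mi_size \<gamma> = r \<Longrightarrow> z \<in> tube x0 \<rho> \<Longrightarrow> z' \<in> tube x0 \<rho> \<Longrightarrow> dist z' z < d \<gamma> \<Longrightarrow>
      dist (mixed_partial_x \<gamma> f z') (mixed_partial_x \<gamma> f z) < \<eta> / c" by metis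
  \<comment> \<open>Halving the moduli turns the weak inequality \<open>norm v <= e\<close> into the
    strict one required by uniform continuity.\<close>
  define e where "e = Min (insert \<rho> ((\<lambda>\<gamma>. d \<gamma> / 2) ` ?G))"
  have e: "0 < e" "e \<le> \<rho>" "\<And>\<gamma>. mi_size \<gamma> = r \<Longrightarrow> e < d \<gamma>"
  proof -
    show "0 < e" unfolding e_def using d(1) \<rho> finite_mi_size_eq by (subst Min_gr_iff) auto
    show "e \<le> \<rho>" unfolding e_def using finite_mi_size_eq by (intro Min_le) auto
    show "e < d \<gamma>" if "mi_size \<gamma> = r" for \<gamma>
    proof -
      have "e \<le> d \<gamma> / 2" unfolding e_def using finite_mi_size_eq that by (intro Min_le) auto
      then show ?thesis using d(1)[of \<gamma>] by simp
    qed
  qed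
  have "norm (f (x0 \<alpha> + v, \<alpha>) - (\<Sum>\<gamma> | mi_size \<gamma> \<le> r. vmonom v \<gamma> *\<^sub>R M \<gamma> \<alpha>)) \<le> \<eta> * norm v ^ r"
    if v: "norm v \<le> e" for \<alpha> v
  proof -
    let ?E = "f (x0 \<alpha> + v, \<alpha>) - (\<Sum>\<gamma> | mi_size \<gamma> \<le> r. vmonom v \<gamma> *\<^sub>R M \<gamma> \<alpha>)"
    have comp: "\<bar>?E $ m\<bar> \<le> real (card ?G) * (norm v ^ r * (\<eta> / c))" for m
    proof -
      obtain \<theta> where \<theta>: "0 < \<theta>" "\<theta> < 1" "f (x0 \<alpha> + v, \<alpha>) $ m =
        (\<Sum>k<r. \<Sum>\<gamma> | mi_size \<gamma> = k. vmonom v \<gamma> * M \<gamma> \<alpha> $ m) +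
        (\<Sum>\<gamma> | mi_size \<gamma> = r. vmonom v \<gamma> * mixed_partial_x \<gamma> f (x0 \<alpha> + \<theta> *\<^sub>R v, \<alpha>) $ m)"
        using multivariate_taylor[OF Ck_f, of "x0 \<alpha>" v \<alpha> m] r by auto
      have "(\<Sum>\<gamma> | mi_size \<gamma> \<le> r. vmonom v \<gamma> *\<^sub>R M \<gamma> \<alpha>) $ m =
        (\<Sum>k<r. \<Sum>\<gamma> | mi_size \<gamma> = k. vmonom v \<gamma> * M \<gamma> \<alpha> $ m) + (\<Sum>\<gamma> | mi_size \<gamma> = r. vmonom v \<gamma> * M \<gamma> \<alpha> $ m)"
        by (simp add: sum_mi_size_le lessThan_Suc_atMost[symmetric] algebra_simps)
      then have "?E $ m = (\<Sum>\<gamma>\<in>?G. vmonom v \<gamma> * (mixed_partial_x \<gamma> f (x0 \<alpha> + \<theta> *\<^sub>R v, \<alpha>) - M \<gamma> \<alpha>) $ m)"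
        unfolding vector_minus_component \<theta>(3) by (simp add: right_diff_distrib sum_subtractf)
      also have "\<bar>\<dots>\<bar> \<le> (\<Sum>\<gamma>\<in>?G. norm v ^ r * (\<eta> / c))"
      proof (rule order_trans[OF sum_abs], rule sum_mono)
        fix \<gamma> assume \<gamma>: "\<gamma> \<in> ?G"
        have nv: "norm (\<theta> *\<^sub>R v) \<le> norm v" using \<theta> by (simp add: mult_left_le_one_le)
        have "(x0 \<alpha> + \<theta> *\<^sub>R v, \<alpha>) \<in> tube x0 \<rho>" using nv v e(2) by (simp add: tube_def dist_norm)
        moreover have "dist (x0 \<alpha> + \<theta> *\<^sub>R v, \<alpha>) (x0 \<alpha>, \<alpha>) < d \<gamma>"
          using nv v e(3)[of \<gamma>] \<gamma> by (simp add: dist_Pair_Pair dist_norm)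
        ultimately have "dist (mixed_partial_x \<gamma> f (x0 \<alpha> + \<theta> *\<^sub>R v, \<alpha>)) (M \<gamma> \<alpha>) < \<eta> / c"
          using d(2) \<gamma> graph_in_tube by blast
        then have "\<bar>(mixed_partial_x \<gamma> f (x0 \<alpha> + \<theta> *\<^sub>R v, \<alpha>) - M \<gamma> \<alpha>) $ m\<bar> \<le> \<eta> / c"
          using component_le_norm_cart[of "mixed_partial_x \<gamma> f (x0 \<alpha> + \<theta> *\<^sub>R v, \<alpha>) - M \<gamma> \<alpha>" m]
          by (simp add: dist_norm)
        moreover have "\<bar>vmonom v \<gamma>\<bar> \<le> norm v ^ r" using vmonom_bound[of v \<gamma>] \<gamma> by simp
        ultimately show "\<bar>vmonom v \<gamma> * (mixed_partial_x \<gamma> f (x0 \<alpha> + \<theta> *\<^sub>R v, \<alpha>) - M \<gamma> \<alpha>) $ m\<bar> \<le> norm v ^ r * (\<eta> / c)"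
          unfolding abs_mult by (intro mult_mono) auto
      qed
      finally show ?thesis by simp
    qed
    have "norm ?E \<le> (\<Sum>m\<in>UNIV. \<bar>?E $ m\<bar>)" by (rule norm_le_l1_cart)
    also have "\<dots> \<le> (\<Sum>m\<in>(UNIV::'n set). real (card ?G) * (norm v ^ r * (\<eta> / c)))" by (intro sum_mono comp)
    also have "\<dots> = (real CARD('n) * real (card ?G)) * (\<eta> / c) * norm v ^ r" by simp
    also have "\<dots> \<le> c * (\<eta> / c) * norm v ^ r"
      using \<eta> c by (intro mult_right_mono) (auto simp: c_def distrib_left)
    also have "\<dots> = \<eta> * norm v ^ r" using c by simp
    finally show ?thesis .
  qed
  then show ?thesis using e by blast
qed

lemma corr_bound: "\<exists>V>0. \<forall>\<epsilon> \<alpha>. 0 < \<epsilon> \<longrightarrow> \<epsilon> \<le> 1 \<longrightarrow> norm (corr \<epsilon> \<alpha>) \<le> V * \<epsilon>"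
proof -
  obtain B where B: "1 \<le> B" "\<And>\<nu> \<alpha>. \<nu> \<le> r \<Longrightarrow> norm (X \<nu> \<alpha>) \<le> B" using coeff_bound by blast
  have "norm (corr \<epsilon> \<alpha>) \<le> (real r * B) * \<epsilon>" if \<epsilon>: "0 < \<epsilon>" "\<epsilon> \<le> 1" for \<epsilon> \<alpha>
  proof -
    have "norm (corr \<epsilon> \<alpha>) \<le> (\<Sum>\<nu>=1..r. \<epsilon> * B)"
      unfolding corr_def
    proof (rule sum_norm_le)
      fix \<nu> assume \<nu>: "\<nu> \<in> {1..r}"
      have "\<epsilon> ^ \<nu> \<le> \<epsilon> ^ 1" using \<epsilon> \<nu> by (intro power_decreasing) auto
      then show "norm (\<epsilon> ^ \<nu> *\<^sub>R X \<nu> \<alpha>) \<le> \<epsilon> * B"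
        using \<epsilon> \<nu> B(2) by (auto intro!: mult_mono)
    qed
    then show ?thesis by (simp add: mult_ac)
  qed
  moreover have "0 < real r * B" using r B by simp
  ultimately show ?thesis by blast
qed

text \<open>The correction is of order \<epsilon>, so the Taylor remainder is a small multiple of
  \<epsilon>^r, while the formal error is of order \<epsilon>^(r+1). Each of them is given half of
  \<sigma>.\<close>

lemma f_expansion:
  assumes \<sigma>: "0 < \<sigma>"
  shows "\<exists>e>0. e \<le> 1 \<and> (\<forall>\<epsilon> \<alpha>. 0 < \<epsilon> \<longrightarrow> \<epsilon> < e \<longrightarrow>
    norm (f (x0 \<alpha> + corr \<epsilon> \<alpha>, \<alpha>) - (\<Sum>m=1..r. \<epsilon> ^ m *\<^sub>R X' (m - 1) \<alpha>)) \<le> \<sigma> * \<epsilon> ^ r)"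
proof -
  obtain V where V: "0 < V" "\<And>\<epsilon> \<alpha>. 0 < \<epsilon> \<Longrightarrow> \<epsilon> \<le> 1 \<Longrightarrow> norm (corr \<epsilon> \<alpha>) \<le> V * \<epsilon>" using corr_bound by blast
  obtain C where C: "0 \<le> C" "\<And>\<epsilon> \<alpha>. 0 < \<epsilon> \<Longrightarrow> \<epsilon> \<le> 1 \<Longrightarrow>
    norm ((\<Sum>\<gamma> | mi_size \<gamma> \<le> r. vmonom (corr \<epsilon> \<alpha>) \<gamma> *\<^sub>R M \<gamma> \<alpha>) - (\<Sum>m=1..r. \<epsilon> ^ m *\<^sub>R X' (m - 1) \<alpha>)) \<le> C * \<epsilon> ^ Suc r"
    using formal_expansion by blast
  \<comment> \<open>Compensates the factor V^r that arises when the norm of the correction is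
    replaced by V \<epsilon>.\<close>
  define \<eta> where "\<eta> = \<sigma> / (2 * V ^ r)"
  have \<eta>: "0 < \<eta>" using \<sigma> V by (simp add: \<eta>_def)
  obtain d where d: "0 < d" "\<And>\<alpha> v. norm v \<le> d \<Longrightarrow>
    norm (f (x0 \<alpha> + v, \<alpha>) - (\<Sum>\<gamma> | mi_size \<gamma> \<le> r. vmonom v \<gamma> *\<^sub>R M \<gamma> \<alpha>)) \<le> \<eta> * norm v ^ r"
    using uniform_taylor[OF \<eta>] by blast
  define e where "e = min 1 (min (d / V) (\<sigma> / (2 * (C + 1))))"
  have e: "0 < e" "e \<le> 1" using d V \<sigma> C by (auto simp: e_def)
  have "norm (f (x0 \<alpha> + corr \<epsilon> \<alpha>, \<alpha>) - (\<Sum>m=1..r. \<epsilon> ^ m *\<^sub>R X' (m - 1) \<alpha>)) \<le> \<sigma> * \<epsilon> ^ r"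
    if \<epsilon>: "0 < \<epsilon>" "\<epsilon> < e" for \<epsilon> \<alpha>
  proof -
    have \<epsilon>1: "\<epsilon> \<le> 1" "V * \<epsilon> \<le> d" "C * \<epsilon> \<le> \<sigma> / 2"
    proof -
      show "\<epsilon> \<le> 1" using \<epsilon> e by simp
      have "\<epsilon> \<le> d / V" using \<epsilon> by (simp add: e_def)
      then show "V * \<epsilon> \<le> d" using V by (simp add: pos_le_divide_eq mult.commute)
      have "\<epsilon> \<le> \<sigma> / (2 * (C + 1))" using \<epsilon> by (simp add: e_def)
      then have "(C + 1) * \<epsilon> \<le> \<sigma> / 2" using C by (simp add: field_simps)
      then show "C * \<epsilon> \<le> \<sigma> / 2" using \<epsilon> by (simp add: distrib_right)
    qed
    have cb: "norm (corr \<epsilon> \<alpha>) \<le> V * \<epsilon>" using V(2) \<epsilon>(1) \<epsilon>1(1) by blast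
    have "norm (f (x0 \<alpha> + corr \<epsilon> \<alpha>, \<alpha>) - (\<Sum>\<gamma> | mi_size \<gamma> \<le> r. vmonom (corr \<epsilon> \<alpha>) \<gamma> *\<^sub>R M \<gamma> \<alpha>)) \<le> \<eta> * norm (corr \<epsilon> \<alpha>) ^ r"
      using cb \<epsilon>1 by (intro d(2)) linarith
    also have "\<dots> \<le> \<eta> * (V * \<epsilon>) ^ r" using cb \<eta> by (intro mult_left_mono power_mono) auto
    also have "\<dots> = \<sigma> / 2 * \<epsilon> ^ r" using V by (simp add: \<eta>_def power_mult_distrib)
    finally have 1: "norm (f (x0 \<alpha> + corr \<epsilon> \<alpha>, \<alpha>) - (\<Sum>\<gamma> | mi_size \<gamma> \<le> r. vmonom (corr \<epsilon> \<alpha>) \<gamma> *\<^sub>R M \<gamma> \<alpha>)) \<le> \<sigma> / 2 * \<epsilon> ^ r" .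
    have "norm ((\<Sum>\<gamma> | mi_size \<gamma> \<le> r. vmonom (corr \<epsilon> \<alpha>) \<gamma> *\<^sub>R M \<gamma> \<alpha>) - (\<Sum>m=1..r. \<epsilon> ^ m *\<^sub>R X' (m - 1) \<alpha>)) \<le> (C * \<epsilon>) * \<epsilon> ^ r"
      using C(2)[OF \<epsilon>(1) \<epsilon>1(1), of \<alpha>] by (simp add: mult_ac)
    also have "\<dots> \<le> \<sigma> / 2 * \<epsilon> ^ r" using \<epsilon> \<epsilon>1 by (intro mult_right_mono) auto
    finally have 2: "norm ((\<Sum>\<gamma> | mi_size \<gamma> \<le> r. vmonom (corr \<epsilon> \<alpha>) \<gamma> *\<^sub>R M \<gamma> \<alpha>) - (\<Sum>m=1..r. \<epsilon> ^ m *\<^sub>R X' (m - 1) \<alpha>)) \<le> \<sigma> / 2 * \<epsilon> ^ r" .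
    show ?thesis using norm_triangle_mono[OF 1 2] by simp
  qed
  then show ?thesis using e by blast
qed

end

section \<open>The slow trajectory\<close>

lemma continuous_of_vector_derivative:
  "(\<And>t. (y has_vector_derivative y' t) (at t)) \<Longrightarrow> continuous_on S y"
  by (auto intro!: continuous_at_imp_continuous_on has_vector_derivative_continuous)

lemma has_vector_derivative_affine:
  assumes "\<And>s. (y has_vector_derivative y' s) (at s)"
  shows "((\<lambda>t. y (a + c * t)) has_vector_derivative c *\<^sub>R y' (a + c * t)) (at t)"
proof -
  have "((\<lambda>t. a + c * t) has_vector_derivative c) (at t)"
    by (auto intro!: derivative_eq_intros)
  from vector_diff_chain_at[OF this assms] show ?thesis by (simp add: o_def)
qed

section \<open>Existence and uniqueness of the slow manifold\<close>

context slow_fast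
begin

lemma f_continuous: "continuous_on S u \<Longrightarrow> continuous_on S v \<Longrightarrow> continuous_on S (\<lambda>t. f (u t, v t))"
  using continuous_on_compose2[of UNIV f S "\<lambda>t. (u t, v t)"] Ck_le[OF Ck_f, of 0]
  by (auto intro: continuous_on_Pair)

lemma A_operator_bound: "\<exists>\<beta>>0. \<forall>\<alpha> v. norm (A \<alpha> *v v) \<le> \<beta> * norm v"
proof -
  obtain a where a: "a > 0" "\<And>\<alpha>. admissible a K UNIV (A \<alpha>)" using A_admissible by blast
  have "norm (A \<alpha> *v v) \<le> (real CARD('n) * real CARD('n) * a) * norm v" for \<alpha> v
    using a by (intro norm_matrix_vector_le) (auto simp: admissible_def)
  then show ?thesis using a by (intro exI[of _ "real CARD('n) * real CARD('n) * a"]) auto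
qed

text \<open>The map f (x, \<alpha>) - A x has derivative 0 at x0 \<alpha>, and a small derivative on
  a ball whose radius does not depend on \<alpha>, by uniform continuity of the derivative of f on
  the tube. The mean value inequality on this convex ball gives the claim.\<close>

lemma nonlinear_bound:
  assumes \<kappa>: "0 < \<kappa>"
  shows "\<exists>\<delta>>0. \<delta> \<le> \<rho> \<and> (\<forall>\<alpha> x y. dist x (x0 \<alpha>) \<le> \<delta> \<longrightarrow> dist y (x0 \<alpha>) \<le> \<delta> \<longrightarrow>
    norm (f (x, \<alpha>) - f (y, \<alpha>) - A \<alpha> *v (x - y)) \<le> \<kappa> * norm (x - y))"
proof -
  define c where "c = \<kappa> / real CARD('n)"
  have c: "c > 0" using \<kappa> by (simp add: c_def)
  have "\<exists>d>0. \<forall>z\<in>tube x0 \<rho>. \<forall>z'\<in>tube x0 \<rho>. dist z' z < d \<longrightarrow> dist (Df z' (axis j 1, 0)) (Df z (axis j 1, 0)) < c"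
    for j :: 'n
    using uniform_f1 c unfolding uniform_Ck_on.simps uniformly_continuous_on_def by blast
  then obtain d where d: "\<And>j::'n. d j > 0"
    "\<And>j z z'. z \<in> tube x0 \<rho> \<Longrightarrow> z' \<in> tube x0 \<rho> \<Longrightarrow> dist z' z < d j \<Longrightarrow> dist (Df z' (axis j 1, 0)) (Df z (axis j 1, 0)) < c"
    by metis
  define \<delta> where "\<delta> = Min (insert \<rho> (range (\<lambda>j. d j / 2)))"
  have \<delta>: "0 < \<delta>" "\<delta> \<le> \<rho>" "\<And>j. \<delta> < d j"
  proof -
    show "0 < \<delta>" unfolding \<delta>_def using d(1) \<rho> by (subst Min_gr_iff) auto
    show "\<delta> \<le> \<rho>" unfolding \<delta>_def by (intro Min_le) auto
    show "\<delta> < d j" for j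
    proof -
      have "\<delta> \<le> d j / 2" unfolding \<delta>_def by (intro Min_le) auto
      then show ?thesis using d(1)[of j] by simp
    qed
  qed
  have "norm (f (x, \<alpha>) - f (y, \<alpha>) - A \<alpha> *v (x - y)) \<le> \<kappa> * norm (x - y)"
    if xy: "dist x (x0 \<alpha>) \<le> \<delta>" "dist y (x0 \<alpha>) \<le> \<delta>" for x y \<alpha>
  proof -
    let ?g = "\<lambda>x. f (x, \<alpha>) - A \<alpha> *v x"
    have "norm (?g x - ?g y) \<le> \<kappa> * norm (x - y)"
    proof (rule differentiable_bound[of "cball (x0 \<alpha>) \<delta>" ?g "\<lambda>w v. Df (w, \<alpha>) (v, 0) - A \<alpha> *v v"])
      fix w assume w: "w \<in> cball (x0 \<alpha>) \<delta>"
      have "((\<lambda>x. (x, \<alpha>)) has_derivative (\<lambda>h. (h, 0))) (at w)" by (auto intro!: derivative_eq_intros)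
      from has_derivative_compose[OF this f_deriv]
      have "((\<lambda>x. f (x, \<alpha>)) has_derivative (\<lambda>h. Df (w, \<alpha>) (h, 0))) (at w)" .
      then show "(?g has_derivative (\<lambda>v. Df (w, \<alpha>) (v, 0) - A \<alpha> *v v)) (at w within cball (x0 \<alpha>) \<delta>)"
        by (intro has_derivative_diff bounded_linear_imp_has_derivative matrix_vector_mul_bounded_linear)
          (rule has_derivative_at_withinI)
      have t: "(w, \<alpha>) \<in> tube x0 \<rho>" using w \<delta>(2) by (simp add: tube_def dist_commute)
      have dj: "norm (Df (w, \<alpha>) (axis j 1, 0) - Df (x0 \<alpha>, \<alpha>) (axis j 1, 0)) \<le> c" for j
        using d(2)[OF graph_in_tube t, of \<alpha> j] w \<delta>(3)[of j] by (simp add: dist_Pair_Pair dist_commute dist_norm)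
      show "onorm (\<lambda>v. Df (w, \<alpha>) (v, 0) - A \<alpha> *v v) \<le> \<kappa>"
      proof (rule onorm_le)
        fix v :: "real^'n"
        have e: "Df z (v, 0) = (\<Sum>j\<in>UNIV. v $ j *\<^sub>R Df z (axis j 1, 0))" for z
        proof -
          have "(v, 0::real) = (\<Sum>j\<in>UNIV. v $ j *\<^sub>R (axis j 1, 0))"
            by (simp add: prod_eq_iff fst_sum snd_sum basis_expansion[of v, unfolded scalar_mult_eq_scaleR])
          then show ?thesis by (simp only: linear_sum[OF Df_linear] linear_scale[OF Df_linear])
        qed
        have "Df (w, \<alpha>) (v, 0) - A \<alpha> *v v =
          (\<Sum>j\<in>UNIV. v $ j *\<^sub>R (Df (w, \<alpha>) (axis j 1, 0) - Df (x0 \<alpha>, \<alpha>) (axis j 1, 0)))"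
          unfolding A_mult e by (simp add: scaleR_diff_right sum_subtractf)
        also have "norm \<dots> \<le> (\<Sum>j\<in>(UNIV::'n set). norm v * c)"
          using dj component_le_norm_cart[of v] by (intro sum_norm_le) (auto intro!: mult_mono)
        also have "\<dots> = \<kappa> * norm v" by (simp add: c_def)
        finally show "norm (Df (w, \<alpha>) (v, 0) - A \<alpha> *v v) \<le> \<kappa> * norm v" .
      qed
    qed (use xy in \<open>auto simp: dist_commute\<close>)
    then show ?thesis by (simp add: matrix_vector_mult_diff_distrib algebra_simps)
  qed
  then show ?thesis using \<delta> by blast
qed

text \<open>The linear and nonlinear estimates in fast time t, with slow time \<alpha> + \<epsilon>
  t. All base points \<alpha> are included, so that orbits through arbitrary points can be treated
  with the same constants.\<close>

definition fast_ok :: "real \<Rightarrow> real \<Rightarrow> real \<Rightarrow> real \<Rightarrow> bool" where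
  "fast_ok C W \<delta> \<epsilon> \<longleftrightarrow> (\<forall>\<alpha>. approx_invertible C (\<lambda>t. A (\<alpha> + \<epsilon> * t)) \<and>
     locally_controlled C W (\<lambda>t. A (\<alpha> + \<epsilon> * t)) \<and>
     nearly_linear \<delta> (\<lambda>t. x0 (\<alpha> + \<epsilon> * t)) C (\<lambda>t. A (\<alpha> + \<epsilon> * t)) (\<lambda>t x. f (x, \<alpha> + \<epsilon> * t)))"

lemma UC_A0: "UC 0 A"
  by (rule UC_A[OF UC_le[OF UC_x0]]) (use r in auto)

lemma A_affine_continuous: "continuous_on S (\<lambda>t. A (\<alpha> + \<epsilon> * t))"
  using uniformly_continuous_imp_continuous[OF UC_base(2)[OF UC_A0]]
  by (rule continuous_on_compose2) (auto intro!: continuous_intros)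

text \<open>Over a fast window of length \<open>W\<close> the slow time advances by \<epsilon> W.
  Uniform continuity of A makes its oscillation there as small as the linear theory demands as soon
  as \<epsilon> < h / W.\<close>

lemma fast_ok_exists:
  "\<exists>C>0. \<exists>W>0. \<exists>\<delta>>0. \<delta> \<le> \<rho> \<and> (\<exists>e>0. \<forall>\<epsilon>. 0 < \<epsilon> \<and> \<epsilon> < e \<longrightarrow> fast_ok C W \<delta> \<epsilon>)"
proof -
  obtain a where a: "\<And>\<alpha>. admissible a K UNIV (A \<alpha>)" using A_admissible by blast
  obtain C W \<theta> where C: "C > 0" "W > 0" "\<theta> > 0"
    "\<And>B::real \<Rightarrow> real^'n^'n. slow_hyperbolic a K W \<theta> B \<Longrightarrow> approx_invertible C B \<and> locally_controlled C W B"
    using linear_theory[OF K, of a] by blast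
  obtain \<delta> where \<delta>: "0 < \<delta>" "\<delta> \<le> \<rho>" "\<And>\<alpha> x y. dist x (x0 \<alpha>) \<le> \<delta> \<Longrightarrow> dist y (x0 \<alpha>) \<le> \<delta> \<Longrightarrow>
    norm (f (x, \<alpha>) - f (y, \<alpha>) - A \<alpha> *v (x - y)) \<le> (1 / (4 * C)) * norm (x - y)"
    using nonlinear_bound[of "1 / (4 * C)"] C(1) by auto
  obtain N where N: "\<And>(A::real^'n^'n) (v::real^'n). norm (A *v v) \<le> norm A * norm v * N" "N > 0"
    using bounded_bilinear.pos_bounded[OF bounded_bilinear_matrix_vector] by blast
  have "\<theta> / N > 0" using C N by simp
  then obtain h where h: "h > 0" "\<And>s t. dist s t < h \<Longrightarrow> dist (A s) (A t) < \<theta> / N"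
    using UC_base(2)[OF UC_A0] unfolding uniformly_continuous_on_def by blast
  have "fast_ok C W \<delta> \<epsilon>" if \<epsilon>: "0 < \<epsilon>" "\<epsilon> < h / W" for \<epsilon>
    unfolding fast_ok_def
  proof
    fix \<alpha>
    have "slow_hyperbolic a K W \<theta> (\<lambda>t. A (\<alpha> + \<epsilon> * t))"
      unfolding slow_hyperbolic_def
    proof (intro conjI allI impI a A_affine_continuous)
      fix s t :: real and v :: "real^'n" assume st: "\<bar>s - t\<bar> \<le> W"
      have "dist (\<alpha> + \<epsilon> * s) (\<alpha> + \<epsilon> * t) = \<epsilon> * \<bar>s - t\<bar>"
        using \<epsilon> by (simp add: dist_real_def abs_mult flip: right_diff_distrib)
      also have "\<dots> \<le> \<epsilon> * W" using st \<epsilon> by (intro mult_left_mono) auto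
      also have "\<dots> < h" using \<epsilon> C(2) by (simp add: pos_less_divide_eq)
      finally have "norm (A (\<alpha> + \<epsilon> * s) - A (\<alpha> + \<epsilon> * t)) \<le> \<theta> / N" using h(2) by (simp add: dist_norm less_imp_le)
      then have "norm (A (\<alpha> + \<epsilon> * s) - A (\<alpha> + \<epsilon> * t)) * norm v * N \<le> \<theta> / N * norm v * N"
        using N by (intro mult_right_mono) auto
      then show "norm ((A (\<alpha> + \<epsilon> * s) - A (\<alpha> + \<epsilon> * t)) *v v) \<le> \<theta> * norm v"
        using N(1)[of "A (\<alpha> + \<epsilon> * s) - A (\<alpha> + \<epsilon> * t)" v] N(2) by simp
    qed
    moreover have "nearly_linear \<delta> (\<lambda>t. x0 (\<alpha> + \<epsilon> * t)) C (\<lambda>t. A (\<alpha> + \<epsilon> * t)) (\<lambda>t x. f (x, \<alpha> + \<epsilon> * t))"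
      unfolding nearly_linear_def
    proof (intro allI impI)
      fix t x y assume "dist x (x0 (\<alpha> + \<epsilon> * t)) \<le> \<delta>" "dist y (x0 (\<alpha> + \<epsilon> * t)) \<le> \<delta>"
      from \<delta>(3)[OF this] show "norm (f (x, \<alpha> + \<epsilon> * t) - f (y, \<alpha> + \<epsilon> * t) - A (\<alpha> + \<epsilon> * t) *v (x - y)) \<le> norm (x - y) / (4 * C)"
        by simp
    qed
    ultimately show "approx_invertible C (\<lambda>t. A (\<alpha> + \<epsilon> * t)) \<and>
     locally_controlled C W (\<lambda>t. A (\<alpha> + \<epsilon> * t)) \<and>
     nearly_linear \<delta> (\<lambda>t. x0 (\<alpha> + \<epsilon> * t)) C (\<lambda>t. A (\<alpha> + \<epsilon> * t)) (\<lambda>t x. f (x, \<alpha> + \<epsilon> * t))"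
      using C(4) by blast
  qed
  then show ?thesis using C \<delta> h(1) by (intro exI[of _ C] conjI exI[of _ W] exI[of _ \<delta>] exI[of _ "h / W"]) auto
qed

text \<open>Read at t = 0 for every base point, the near-linearity no longer involves \<epsilon>.
  One admissible \<epsilon> therefore yields a Lipschitz bound on the whole tube that can be used
  for all others.\<close>

lemma f_lipschitz:
  assumes "fast_ok C W \<delta> \<epsilon>" "0 < C"
  shows "\<exists>L>0. \<forall>\<alpha> x y. dist x (x0 \<alpha>) \<le> \<delta> \<longrightarrow> dist y (x0 \<alpha>) \<le> \<delta> \<longrightarrow> norm (f (x, \<alpha>) - f (y, \<alpha>)) \<le> L * norm (x - y)"
proof -
  obtain \<beta> where \<beta>: "\<beta> > 0" "\<And>\<alpha> v. norm (A \<alpha> *v v) \<le> \<beta> * norm v" using A_operator_bound by blast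
  have "norm (f (x, \<alpha>) - f (y, \<alpha>)) \<le> (1 / (4 * C) + \<beta>) * norm (x - y)"
    if "dist x (x0 \<alpha>) \<le> \<delta>" "dist y (x0 \<alpha>) \<le> \<delta>" for \<alpha> x y
  proof -
    have nl: "nearly_linear \<delta> (\<lambda>t. x0 (\<alpha> + \<epsilon> * t)) C (\<lambda>t. A (\<alpha> + \<epsilon> * t)) (\<lambda>t x. f (x, \<alpha> + \<epsilon> * t))"
      using assms(1) unfolding fast_ok_def by blast
    have "norm (f (x, \<alpha>) - f (y, \<alpha>) - A \<alpha> *v (x - y)) \<le> norm (x - y) / (4 * C)"
      using nl[unfolded nearly_linear_def, THEN spec[of _ 0], THEN spec[of _ x], THEN spec[of _ y]] that by simp
    from norm_triangle_mono[OF this \<beta>(2)[of \<alpha> "x - y"]]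
    show ?thesis by (simp add: distrib_right)
  qed
  moreover have "0 < 1 / (4 * C) + \<beta>" using \<beta> assms(2) by (simp add: add_pos_pos)
  ultimately show ?thesis by blast
qed

definition slow_sol :: "real \<Rightarrow> real \<Rightarrow> (real \<Rightarrow> real^'n) \<Rightarrow> bool" where
  "slow_sol \<delta> \<epsilon> u \<longleftrightarrow> (\<forall>\<alpha>. (u has_vector_derivative (1 / \<epsilon>) *\<^sub>R f (u \<alpha>, \<alpha>)) (at \<alpha>) \<and> dist (u \<alpha>) (x0 \<alpha>) \<le> \<delta>)"

lemma slow_solD:
  assumes "slow_sol \<delta> \<epsilon> u" "0 < \<epsilon>"
  shows "(u has_vector_derivative (1 / \<epsilon>) *\<^sub>R f (u \<alpha>, \<alpha>)) (at \<alpha>)" "dist (u \<alpha>) (x0 \<alpha>) \<le> \<delta>"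
    "((\<lambda>t. u (\<alpha> + \<epsilon> * t)) has_vector_derivative f (u (\<alpha> + \<epsilon> * t), \<alpha> + \<epsilon> * t)) (at t)"
proof -
  show 1: "(u has_vector_derivative (1 / \<epsilon>) *\<^sub>R f (u \<alpha>, \<alpha>)) (at \<alpha>)" "dist (u \<alpha>) (x0 \<alpha>) \<le> \<delta>" for \<alpha>
    using assms(1) by (auto simp: slow_sol_def)
  show "((\<lambda>t. u (\<alpha> + \<epsilon> * t)) has_vector_derivative f (u (\<alpha> + \<epsilon> * t), \<alpha> + \<epsilon> * t)) (at t)"
    using has_vector_derivative_affine[OF 1(1), of \<alpha> \<epsilon> t] assms(2) by simp
qed

text \<open>In fast time the critical manifold is the curve x0 (\<epsilon> t), and since f vanishes
  on it, its residual is just \<epsilon> x0'. The iteration started there moves by at most a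
  multiple of \<epsilon>, which also proves closeness of order \<epsilon>; scaling time back gives
  the slow trajectory.\<close>

lemma slow_sol_exists:
  assumes ok: "fast_ok C W \<delta> \<epsilon>" and C: "0 < C" "0 < \<epsilon>" and D: "\<And>\<alpha>. norm (X' 0 \<alpha>) \<le> D"
    and small: "2 * C * (\<epsilon> * D) \<le> \<delta> / 2"
  shows "\<exists>u. slow_sol \<delta> \<epsilon> u \<and> (\<forall>\<alpha>. norm (u \<alpha> - x0 \<alpha>) \<le> 2 * C * (\<epsilon> * D))"
proof -
  obtain a where a: "\<And>\<alpha>. admissible a K UNIV (A \<alpha>)" using A_admissible by blast
  have D0: "0 \<le> D" using D order_trans[OF norm_ge_zero] by blast
  then have pos: "0 \<le> 2 * C * (\<epsilon> * D)" using C by simp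
  have "0 \<le> \<delta> / 2" using small pos by linarith
  have UCr: "UC (Suc (r - 1)) x0" using UC_x0 r by simp
  have d: "(x0 has_vector_derivative X' 0 \<alpha>) (at \<alpha>)" for \<alpha> using UC_SucE(1)[OF UCr] by simp
  have X'c: "continuous_on UNIV (X' 0)"
    using UC_base(2)[OF UC_SucE(2)[OF UCr]] by (simp add: uniformly_continuous_imp_continuous)
  have "\<exists>u. (\<forall>t\<in>UNIV. (u has_vector_derivative f (u t, 0 + \<epsilon> * t)) (at t within UNIV)) \<and>
    (\<forall>t\<in>UNIV. norm (u t - x0 (0 + \<epsilon> * t)) \<le> 2 * C * (\<epsilon> * D)) \<and> (UNIV = {0::real..} \<longrightarrow> u 0 = x0 (0 + \<epsilon> * 0))"
  proof (rule newton_solution[OF C(1)])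
    show "approx_invertible C (\<lambda>t. A (0 + \<epsilon> * t))"
      "nearly_linear \<delta> (\<lambda>t. x0 (0 + \<epsilon> * t)) C (\<lambda>t. A (0 + \<epsilon> * t)) (\<lambda>t x. f (x, 0 + \<epsilon> * t))"
      using ok unfolding fast_ok_def by blast+
    show "time_domain UNIV (\<lambda>t. A (0 + \<epsilon> * t))" by (simp add: time_domain_def)
    show "admissible a K UNIV (A (0 + \<epsilon> * t))" for t by (rule a)
    show "((\<lambda>t. x0 (0 + \<epsilon> * t)) has_vector_derivative \<epsilon> *\<^sub>R X' 0 (0 + \<epsilon> * t)) (at t)" for t
      by (rule has_vector_derivative_affine[OF d])
    show "continuous_on UNIV (\<lambda>t. \<epsilon> *\<^sub>R X' 0 (0 + \<epsilon> * t))"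
      by (intro continuous_intros continuous_on_compose2[OF X'c]) auto
    show "norm (x0 (0 + \<epsilon> * t) - x0 (0 + \<epsilon> * t)) \<le> \<delta> / 2" for t using \<open>0 \<le> \<delta> / 2\<close> by simp
    show "norm (\<epsilon> *\<^sub>R X' 0 (0 + \<epsilon> * t) - f (x0 (0 + \<epsilon> * t), 0 + \<epsilon> * t)) \<le> \<epsilon> * D" for t
      using mult_left_mono[OF D[of "0 + \<epsilon> * t"], of \<epsilon>] C by (simp add: zero)
    show "continuous_on UNIV (\<lambda>t. f (u t, 0 + \<epsilon> * t))" if "continuous_on UNIV u" for u
      by (intro f_continuous that continuous_intros)
    show "2 * C * (\<epsilon> * D) \<le> \<delta> / 2" by (rule small)
  qed
  then obtain u where u: "\<And>t. (u has_vector_derivative f (u t, \<epsilon> * t)) (at t)"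
    "\<And>t. norm (u t - x0 (\<epsilon> * t)) \<le> 2 * C * (\<epsilon> * D)" by auto
  define w where "w \<alpha> = u (0 + (1 / \<epsilon>) * \<alpha>)" for \<alpha>
  have "(w has_vector_derivative (1 / \<epsilon>) *\<^sub>R f (w \<alpha>, \<alpha>)) (at \<alpha>)" for \<alpha>
    using has_vector_derivative_affine[OF u(1), of 0 "1 / \<epsilon>" \<alpha>] C unfolding w_def[abs_def] by simp
  moreover have b: "norm (w \<alpha> - x0 \<alpha>) \<le> 2 * C * (\<epsilon> * D)" for \<alpha>
    using u(2)[of "\<alpha> / \<epsilon>"] C by (simp add: w_def)
  moreover have "dist (w \<alpha>) (x0 \<alpha>) \<le> \<delta>" for \<alpha> using b[of \<alpha>] small \<open>0 \<le> \<delta> / 2\<close> unfolding dist_norm by linarith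
  ultimately show ?thesis unfolding slow_sol_def by blast
qed

text \<open>Converts the residual of an approximate solution into its distance from the slow
  trajectory; this is how the formal series yields the asymptotic expansion.\<close>

lemma slow_sol_close:
  assumes ok: "fast_ok C W \<delta> \<epsilon>" and C: "0 < C" "0 < W" "0 < \<epsilon>" and u: "slow_sol \<delta> \<epsilon> u"
    and w: "\<And>\<alpha>. (w has_vector_derivative w' \<alpha>) (at \<alpha>)" "continuous_on UNIV w'" "\<And>\<alpha>. dist (w \<alpha>) (x0 \<alpha>) \<le> \<delta>"
    and \<sigma>: "\<And>\<alpha>. norm (\<epsilon> *\<^sub>R w' \<alpha> - f (w \<alpha>, \<alpha>)) \<le> \<sigma>"
  shows "norm (u \<alpha> - w \<alpha>) \<le> 2 * C * \<sigma>"
proof -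
  have uc: "continuous_on S (\<lambda>t. u (0 + \<epsilon> * t))" for S
    by (rule continuous_of_vector_derivative[OF slow_solD(3)[OF u C(3)]])
  have "norm (u (0 + \<epsilon> * t) - w (0 + \<epsilon> * t)) \<le> 2 * C * \<sigma>" for t
  proof (rule tube_estimate[where B="\<lambda>t. A (0 + \<epsilon> * t)" and F="\<lambda>t x. f (x, 0 + \<epsilon> * t)" and W=W and
      c="\<lambda>t. x0 (0 + \<epsilon> * t)" and \<delta>=\<delta> and x="\<lambda>t. u (0 + \<epsilon> * t)" and y="\<lambda>t. w (0 + \<epsilon> * t)" and x'="\<lambda>t. f (u (0 + \<epsilon> * t), 0 + \<epsilon> * t)" and y'="\<lambda>t. \<epsilon> *\<^sub>R w' (0 + \<epsilon> * t)"])
    show "locally_controlled C W (\<lambda>t. A (0 + \<epsilon> * t))"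
      "nearly_linear \<delta> (\<lambda>t. x0 (0 + \<epsilon> * t)) C (\<lambda>t. A (0 + \<epsilon> * t)) (\<lambda>t x. f (x, 0 + \<epsilon> * t))"
      using ok unfolding fast_ok_def by blast+
    show "continuous_on UNIV (\<lambda>t. A (0 + \<epsilon> * t))" by (rule A_affine_continuous)
    show "((\<lambda>t. u (0 + \<epsilon> * t)) has_vector_derivative f (u (0 + \<epsilon> * t), 0 + \<epsilon> * t)) (at t)" for t
      by (rule slow_solD(3)[OF u C(3)])
    show "continuous_on UNIV (\<lambda>t. f (u (0 + \<epsilon> * t), 0 + \<epsilon> * t))"
      by (intro f_continuous uc continuous_intros)
    show "((\<lambda>t. w (0 + \<epsilon> * t)) has_vector_derivative \<epsilon> *\<^sub>R w' (0 + \<epsilon> * t)) (at t)" for t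
      by (rule has_vector_derivative_affine[OF w(1)])
    show "continuous_on UNIV (\<lambda>t. \<epsilon> *\<^sub>R w' (0 + \<epsilon> * t))"
      by (intro continuous_intros continuous_on_compose2[OF w(2)]) auto
    show "norm (f (u (0 + \<epsilon> * t), 0 + \<epsilon> * t) - f (u (0 + \<epsilon> * t), 0 + \<epsilon> * t) -
        (\<epsilon> *\<^sub>R w' (0 + \<epsilon> * t) - f (w (0 + \<epsilon> * t), 0 + \<epsilon> * t))) \<le> \<sigma>" for t
      using \<sigma>[of "0 + \<epsilon> * t"] by (simp add: norm_minus_commute)
  qed (use C w(3) slow_solD(2)[OF u C(3)] in auto)
  from this[of "\<alpha> / \<epsilon>"] show ?thesis using C by simp
qed

lemma solves_slow_component:
  assumes z: "solves f \<epsilon> z I" and I: "convex I" "0 \<in> I" "t \<in> I"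
  shows "snd (z t) = snd (z 0) + \<epsilon> * t"
proof -
  have "((\<lambda>t. snd (z t) - \<epsilon> * t) has_vector_derivative 0) (at s within I)" if "s \<in> I" for s
  proof -
    have "(z has_vector_derivative (f (z s), \<epsilon>)) (at s within I)" using z that by (auto simp: solves_def)
    from bounded_linear.has_vector_derivative[OF bounded_linear_snd this]
    have "((\<lambda>t. snd (z t)) has_vector_derivative \<epsilon>) (at s within I)" by simp
    moreover have "((\<lambda>t. \<epsilon> * t) has_vector_derivative \<epsilon>) (at s within I)" by (auto intro!: derivative_eq_intros)
    ultimately show ?thesis using has_vector_derivative_diff by fastforce
  qed
  then obtain c where c: "\<And>s. s \<in> I \<Longrightarrow> snd (z s) - \<epsilon> * s = c"
    using has_vector_derivative_zero_constant[OF I(1)] by blast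
  show ?thesis using c[OF I(2)] c[OF I(3)] by simp
qed

lemma solves_fast_component:
  assumes z: "solves f \<epsilon> z I" and I: "convex I" "0 \<in> I" "t \<in> I"
  shows "((\<lambda>t. fst (z t)) has_vector_derivative f (fst (z t), snd (z 0) + \<epsilon> * t)) (at t within I)"
proof -
  have "(z has_vector_derivative (f (z t), \<epsilon>)) (at t within I)" using z I by (auto simp: solves_def)
  from bounded_linear.has_vector_derivative[OF bounded_linear_fst this]
  show ?thesis using solves_slow_component[OF assms] by (metis fst_conv prod.collapse)
qed

lemma solvesI:
  assumes "\<And>t. t \<in> I \<Longrightarrow> (x has_vector_derivative f (x t, \<alpha> + \<epsilon> * t)) (at t within I)"
  shows "solves f \<epsilon> (\<lambda>t. (x t, \<alpha> + \<epsilon> * t)) I"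
  unfolding solves_def
proof
  fix t assume "t \<in> I"
  moreover have "((\<lambda>t. \<alpha> + \<epsilon> * t) has_vector_derivative \<epsilon>) (at t within I)" by (auto intro!: derivative_eq_intros)
  ultimately show "((\<lambda>t. (x t, \<alpha> + \<epsilon> * t)) has_vector_derivative (f (x t, \<alpha> + \<epsilon> * t), \<epsilon>)) (at t within I)"
    by (intro has_vector_derivative_Pair assms)
qed

text \<open>The orbit and the slow trajectory at the same slow time are two exact solutions in the
  tube on the whole line, so \<open>tube_estimate\<close> applies with residual 0.\<close>

lemma tube_solution_unique:
  assumes ok: "fast_ok C W \<delta> \<epsilon>" and C: "0 < C" "0 < W" "0 < \<epsilon>" and u: "slow_sol \<delta> \<epsilon> u"
    and z: "solves f \<epsilon> z UNIV" "range z \<subseteq> tube x0 \<delta>"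
  shows "z t = (u (snd (z 0) + \<epsilon> * t), snd (z 0) + \<epsilon> * t)"
proof -
  define \<alpha> where "\<alpha> = snd (z 0)"
  have s: "snd (z t) = \<alpha> + \<epsilon> * t" for t using solves_slow_component[OF z(1), of t] by (simp add: \<alpha>_def)
  have xd: "((\<lambda>t. fst (z t)) has_vector_derivative f (fst (z t), \<alpha> + \<epsilon> * t)) (at t)" for t
    using solves_fast_component[OF z(1), of t] by (simp add: \<alpha>_def)
  have "norm (fst (z t) - u (\<alpha> + \<epsilon> * t)) \<le> 2 * C * 0"
  proof (rule tube_estimate[where B="\<lambda>t. A (\<alpha> + \<epsilon> * t)" and F="\<lambda>t x. f (x, \<alpha> + \<epsilon> * t)" and W=W and
      c="\<lambda>t. x0 (\<alpha> + \<epsilon> * t)" and \<delta>=\<delta> and x="\<lambda>t. fst (z t)" and y="\<lambda>t. u (\<alpha> + \<epsilon> * t)" and x'="\<lambda>t. f (fst (z t), \<alpha> + \<epsilon> * t)" and y'="\<lambda>t. f (u (\<alpha> + \<epsilon> * t), \<alpha> + \<epsilon> * t)"])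
    show "locally_controlled C W (\<lambda>t. A (\<alpha> + \<epsilon> * t))"
      "nearly_linear \<delta> (\<lambda>t. x0 (\<alpha> + \<epsilon> * t)) C (\<lambda>t. A (\<alpha> + \<epsilon> * t)) (\<lambda>t x. f (x, \<alpha> + \<epsilon> * t))"
      using ok unfolding fast_ok_def by blast+
    show "continuous_on UNIV (\<lambda>t. A (\<alpha> + \<epsilon> * t))" by (rule A_affine_continuous)
    show "((\<lambda>t. fst (z t)) has_vector_derivative f (fst (z t), \<alpha> + \<epsilon> * t)) (at t)" for t by (rule xd)
    show "((\<lambda>t. u (\<alpha> + \<epsilon> * t)) has_vector_derivative f (u (\<alpha> + \<epsilon> * t), \<alpha> + \<epsilon> * t)) (at t)" for t
      by (rule slow_solD(3)[OF u C(3)])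
    show "continuous_on UNIV (\<lambda>t. f (fst (z t), \<alpha> + \<epsilon> * t))"
      by (intro f_continuous continuous_of_vector_derivative[OF xd] continuous_intros)
    show "continuous_on UNIV (\<lambda>t. f (u (\<alpha> + \<epsilon> * t), \<alpha> + \<epsilon> * t))"
      by (intro f_continuous continuous_of_vector_derivative[OF slow_solD(3)[OF u C(3)]] continuous_intros)
    show "dist (fst (z t)) (x0 (\<alpha> + \<epsilon> * t)) \<le> \<delta>" for t
    proof -
      have "z t \<in> tube x0 \<delta>" using z(2) by blast
      then show ?thesis using s[of t] by (auto simp: tube_def)
    qed
  qed (use C slow_solD(2)[OF u C(3)] in auto)
  then show ?thesis using s[of t] by (simp add: \<alpha>_def prod_eq_iff)
qed

text \<open>Every orbit inside a competing invariant set is the slow trajectory read from its own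
  slow time on, so the set lies in the graph. Conversely, one such orbit runs through all slow times
  because \<epsilon> > 0, and so covers the whole graph.\<close>

lemma slow_manifold_unique:
  assumes ok: "fast_ok C W \<delta> \<epsilon>" and C: "0 < C" "0 < W" "0 < \<epsilon>" and u: "slow_sol \<delta> \<epsilon> u"
  shows "slow_manifold f x0 \<delta> \<epsilon> (manifold_of u)" "slow_manifold f x0 \<delta> \<epsilon> N \<Longrightarrow> N = manifold_of u"
    "solves f \<epsilon> (\<lambda>t. (u (\<epsilon> * t), \<epsilon> * t)) UNIV"
proof -
  have sol: "solves f \<epsilon> (\<lambda>t. (u (\<alpha> + \<epsilon> * t), \<alpha> + \<epsilon> * t)) UNIV" for \<alpha>
    by (rule solvesI) (simp add: slow_solD(3)[OF u C(3)])
  from this[of 0] show "solves f \<epsilon> (\<lambda>t. (u (\<epsilon> * t), \<epsilon> * t)) UNIV" by simp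
  show "slow_manifold f x0 \<delta> \<epsilon> (manifold_of u)"
    unfolding slow_manifold_def invariant_set_def
  proof (intro conjI ballI)
    show "manifold_of u \<noteq> {}" by (auto simp: manifold_of_def)
    show "manifold_of u \<subseteq> tube x0 \<delta>" using slow_solD(2)[OF u C(3)] by (auto simp: manifold_of_def tube_def)
    fix p assume "p \<in> manifold_of u"
    then obtain \<alpha> where "p = (u \<alpha>, \<alpha>)" by (auto simp: manifold_of_def)
    then show "\<exists>z. solves f \<epsilon> z UNIV \<and> z 0 = p \<and> range z \<subseteq> manifold_of u"
      using sol[of \<alpha>] by (intro exI[of _ "\<lambda>t. (u (\<alpha> + \<epsilon> * t), \<alpha> + \<epsilon> * t)"]) (auto simp: manifold_of_def)
  qed
  show "N = manifold_of u" if N: "slow_manifold f x0 \<delta> \<epsilon> N"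
  proof
    have orbit: "\<exists>z. z 0 = p \<and> range z \<subseteq> N \<and> (\<forall>t. z t = (u (snd p + \<epsilon> * t), snd p + \<epsilon> * t))" if pN: "p \<in> N" for p
    proof -
      obtain z where z: "solves f \<epsilon> z UNIV" "z 0 = p" "range z \<subseteq> N"
        using N pN unfolding slow_manifold_def invariant_set_def by blast
      have "range z \<subseteq> tube x0 \<delta>" using z(3) N unfolding slow_manifold_def by blast
      from tube_solution_unique[OF ok C u z(1) this]
      have "\<forall>t. z t = (u (snd p + \<epsilon> * t), snd p + \<epsilon> * t)" unfolding z(2) by (rule allI)
      then show ?thesis using z(2,3) by (intro exI[of _ z] conjI)
    qed
    show "N \<subseteq> manifold_of u"
    proof
      fix p assume "p \<in> N"
      then obtain z where z: "z 0 = p" "\<And>t. z t = (u (snd p + \<epsilon> * t), snd p + \<epsilon> * t)" using orbit by blast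
      then have "p = (u (snd p), snd p)" using z(1) z(2)[of 0] by simp
      then show "p \<in> manifold_of u" by (auto simp: manifold_of_def)
    qed
    obtain p where p: "p \<in> N" using N by (auto simp: slow_manifold_def)
    obtain z where z: "range z \<subseteq> N" "\<And>t. z t = (u (snd p + \<epsilon> * t), snd p + \<epsilon> * t)" using orbit[OF p] by blast
    show "manifold_of u \<subseteq> N"
    proof
      fix q assume "q \<in> manifold_of u"
      then obtain \<alpha> where q: "q = (u \<alpha>, \<alpha>)" by (auto simp: manifold_of_def)
      have "z ((\<alpha> - snd p) / \<epsilon>) = q" using z(2)[of "(\<alpha> - snd p) / \<epsilon>"] C q by simp
      then show "q \<in> N" using z(1) by blast
    qed
  qed
qed

end

section \<open>Diffeomorphic graphs\<close>

lemma Ck_const: "Ck k (\<lambda>z. c)"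
proof (induction k arbitrary: c)
  case (Suc k)
  have "frechet_derivative (\<lambda>z::'a. c) (at z) = (\<lambda>v. 0)" for z
    by (rule frechet_derivative_at[symmetric]) simp
  then show ?case using Suc by simp
qed simp

lemma Ck_add: "Ck k g \<Longrightarrow> Ck k h \<Longrightarrow> Ck k (\<lambda>z. g z + h z)"
proof (induction k arbitrary: g h)
  case 0
  then show ?case by (simp add: continuous_on_add)
next
  case (Suc k)
  have d: "((\<lambda>z. g z + h z) has_derivative (\<lambda>v. frechet_derivative g (at z) v + frechet_derivative h (at z) v)) (at z)" for z
    by (intro has_derivative_add Ck_SucE(1)[OF Suc.prems(1)] Ck_SucE(1)[OF Suc.prems(2)])
  have e: "frechet_derivative (\<lambda>z. g z + h z) (at z) = (\<lambda>v. frechet_derivative g (at z) v + frechet_derivative h (at z) v)" for z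
    by (rule frechet_derivative_at[OF d, symmetric])
  have "(\<lambda>z. g z + h z) differentiable (at z)" for z using d differentiable_def by blast
  then show ?case unfolding Ck.simps e
    using Suc.IH[OF Ck_SucE(2)[OF Suc.prems(1)] Ck_SucE(2)[OF Suc.prems(2)]] by blast
qed

lemma Ck_compose_linear:
  assumes "bounded_linear h"
  shows "Ck k g \<Longrightarrow> Ck k (\<lambda>z. g (h z))"
proof (induction k arbitrary: g)
  case 0
  then show ?case
    using continuous_on_compose2[of UNIV g UNIV h] bounded_linear.continuous_on[OF assms continuous_on_id] by simp
next
  case (Suc k)
  have d: "((\<lambda>z. g (h z)) has_derivative (\<lambda>v. frechet_derivative g (at (h z)) (h v))) (at z)" for z
    by (rule has_derivative_compose[OF bounded_linear_imp_has_derivative[OF assms] Ck_SucE(1)[OF Suc.prems]])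
  have e: "frechet_derivative (\<lambda>z. g (h z)) (at z) = (\<lambda>v. frechet_derivative g (at (h z)) (h v))" for z
    by (rule frechet_derivative_at[OF d, symmetric])
  have "(\<lambda>z. g (h z)) differentiable (at z)" for z using d differentiable_def by blast
  moreover have "Ck k (\<lambda>z. frechet_derivative g (at (h z)) (h v))" for v
    by (rule Suc.IH[OF Ck_SucE(2)[OF Suc.prems]])
  ultimately show ?case unfolding Ck.simps e by blast
qed

lemma Ck_ident: "Ck k (\<lambda>z. z)"
proof (cases k)
  case (Suc j)
  have "frechet_derivative (\<lambda>z. z) (at z) = (\<lambda>v. v)" for z :: 'a
    by (rule frechet_derivative_at[symmetric]) simp
  then show ?thesis unfolding Suc by (simp add: Ck_const)
qed simp

text \<open>The shear that adds w - u, evaluated at the slow time, to the fast component maps one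
  graph onto the other. It is defined on the whole space, and exchanging u and w inverts it.\<close>

lemma graphs_diffeomorphic:
  fixes u w :: "real \<Rightarrow> real^'n"
  assumes "Ck r u" "Ck r w"
  shows "Ck_diffeomorphic r (manifold_of u) (manifold_of w)"
proof -
  define \<Phi> where "\<Phi> u w z = z + (w (snd z) - u (snd z), 0)" for u w :: "real \<Rightarrow> real^'n" and z :: "(real^'n) \<times> real"
  have C: "Ck r (\<Phi> u w)" if "Ck r u" "Ck r w" for u w
  proof -
    have "Ck r (\<lambda>s. w s + - u s)"
      by (intro Ck_add Ck_linear[OF bounded_linear_minus[OF bounded_linear_ident]] that)
    then have "Ck r (\<lambda>z::(real^'n) \<times> real. w (snd z) + - u (snd z))"
      by (rule Ck_compose_linear[OF bounded_linear_snd])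
    then have "Ck r (\<lambda>z::(real^'n) \<times> real. (w (snd z) + - u (snd z), 0::real))"
      by (rule Ck_linear[rotated]) (intro bounded_linear_Pair bounded_linear_ident bounded_linear_zero)
    then show ?thesis unfolding \<Phi>_def[abs_def] using Ck_add[OF Ck_ident] by fastforce
  qed
  have im: "\<Phi> u w ` manifold_of u = manifold_of w" for u w
    by (force simp: \<Phi>_def manifold_of_def)
  show ?thesis
    unfolding Ck_diffeomorphic_def
    by (rule exI[of _ "\<Phi> u w"], rule exI[of _ "\<Phi> w u"], intro conjI C assms im) (auto simp: \<Phi>_def manifold_of_def zero_prod_def[symmetric])
qed

section \<open>Regularity and attraction\<close>

context slow_fast
begin

text \<open>A bootstrap through the differential equation, which expresses u' by f along the graph
  of u. The bounds depend on \<epsilon>; only the regularity of each single trajectory is claimed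
  here.\<close>

lemma UC_slow_sol:
  assumes u: "slow_sol \<delta> \<epsilon> u" "0 < \<epsilon>" "\<delta> \<le> \<rho>"
  shows "UC r u"
proof -
  have tube: "(u \<alpha>, \<alpha>) \<in> tube x0 \<rho>" for \<alpha>
    using slow_solD(2)[OF u(1,2), of \<alpha>] u(3) by (simp add: tube_def)
  obtain B where B: "\<And>\<alpha>. norm (x0 \<alpha>) \<le> B" using bounded_x0 unfolding bounded_iff by blast
  have "norm (u \<alpha>) \<le> B + \<delta>" for \<alpha>
    using slow_solD(2)[OF u(1,2), of \<alpha>] B[of \<alpha>] norm_triangle_ineq[of "x0 \<alpha>" "u \<alpha> - x0 \<alpha>"]
    by (simp add: dist_norm)
  then have bu: "bounded (range u)" unfolding bounded_iff by blast
  have "UC k u" if "k \<le> r" for k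
    using that
  proof (induction k)
    case 0
    have "bounded (range (\<lambda>\<alpha>. f (u \<alpha>, \<alpha>)))"
      by (rule bounded_subset[of "f ` tube x0 \<rho>"]) (use uniform_Ck_on_base(1)[OF uniform_f] tube in auto)
    then have "bounded (range (\<lambda>\<alpha>. (1 / \<epsilon>) *\<^sub>R f (u \<alpha>, \<alpha>)))"
      by (rule bounded_scaleR_comp)
    then show ?case using uniformly_continuous_of_bounded_derivative[OF slow_solD(1)[OF u(1,2)]] bu by simp
  next
    case (Suc k)
    have k: "k \<le> r" "UC k u" using Suc by auto
    have "UC k (\<lambda>\<alpha>. f (u \<alpha>, \<alpha>))"
      by (rule UC_compose_graph[OF Ck_le[OF Ck_f k(1)] uniform_Ck_on_le[OF uniform_f k(1)] tube k(2)])
    then show ?case by (intro UC_SucI[OF slow_solD(1)[OF u(1,2)]] UC_scaleR_const bu)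
  qed
  then show ?thesis by simp
qed

lemma f_locally_lipschitz:
  assumes "compact I"
  shows "\<exists>L>0. \<forall>s\<in>I. \<forall>x\<in>cball 0 b. \<forall>y\<in>cball 0 b. norm (f (x, s) - f (y, s)) \<le> L * norm (x - y)"
proof -
  have "\<exists>c>0. \<forall>z\<in>cball 0 b \<times> I. norm (Df z (axis j 1, 0)) \<le> c" for j :: 'n
  proof -
    have "continuous_on (cball 0 b \<times> I) (\<lambda>z. Df z (axis j 1, 0))"
      using Ck_SucE(2)[OF Ck_f1, of "(axis j 1, 0)"] continuous_on_subset by auto
    then have "bounded ((\<lambda>z. Df z (axis j 1, 0)) ` (cball 0 b \<times> I))"
      by (intro compact_imp_bounded compact_continuous_image compact_Times compact_cball assms)
    then show ?thesis unfolding bounded_pos by auto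
  qed
  then obtain c where c: "\<And>j::'n. c j > 0" "\<And>j z. z \<in> cball 0 b \<times> I \<Longrightarrow> norm (Df z (axis j 1, 0)) \<le> c j" by metis
  define L where "L = (\<Sum>j\<in>UNIV. c j)"
  have L: "L > 0" unfolding L_def using c by (intro sum_pos) auto
  have "norm (f (x, s) - f (y, s)) \<le> L * norm (x - y)" if s: "s \<in> I" and xy: "x \<in> cball 0 b" "y \<in> cball 0 b" for s x y
  proof (rule differentiable_bound[of "cball 0 b" "\<lambda>x. f (x, s)" "\<lambda>w v. Df (w, s) (v, 0)"])
    fix w assume w: "w \<in> cball (0::real^'n) b"
    have "((\<lambda>x. (x, s)) has_derivative (\<lambda>h. (h, 0))) (at w within cball 0 b)" by (auto intro!: derivative_eq_intros)
    from has_derivative_compose[OF this f_deriv]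
    show "((\<lambda>x. f (x, s)) has_derivative (\<lambda>v. Df (w, s) (v, 0))) (at w within cball 0 b)" .
    show "onorm (\<lambda>v. Df (w, s) (v, 0)) \<le> L"
    proof (rule onorm_le)
      fix v :: "real^'n"
      have "(v, 0::real) = (\<Sum>j\<in>UNIV. v $ j *\<^sub>R (axis j 1, 0))"
        by (simp add: prod_eq_iff fst_sum snd_sum basis_expansion[of v, unfolded scalar_mult_eq_scaleR])
      then have "Df (w, s) (v, 0) = (\<Sum>j\<in>UNIV. v $ j *\<^sub>R Df (w, s) (axis j 1, 0))"
        by (simp only: linear_sum[OF Df_linear] linear_scale[OF Df_linear])
      also have "norm \<dots> \<le> (\<Sum>j\<in>UNIV. norm v * c j)"
        using c(2) w s component_le_norm_cart[of v] by (intro sum_norm_le) (auto intro!: mult_mono)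
      also have "\<dots> = L * norm v" by (simp add: L_def sum_distrib_left mult.commute)
      finally show "norm (Df (w, s) (v, 0)) \<le> L * norm v" .
    qed
  qed (use xy in auto)
  then show ?thesis using L by blast
qed

text \<open>Gronwall's argument: exp(-2 L t) times the squared distance does not increase.
  Attraction speaks of every solution from a given point, so an arbitrary one has to be identified
  with the solution that was constructed.\<close>

lemma ivp_unique:
  assumes x: "\<And>t. 0 \<le> t \<Longrightarrow> (x has_vector_derivative f (x t, \<alpha> + \<epsilon> * t)) (at t within {0..})"
    and y: "\<And>t. 0 \<le> t \<Longrightarrow> (y has_vector_derivative f (y t, \<alpha> + \<epsilon> * t)) (at t within {0..})"
    and init: "x 0 = y 0" and T: "0 \<le> T"
  shows "x T = y T"
proof -
  have xc: "continuous_on {0..} x" and yc: "continuous_on {0..} y"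
    using has_vector_derivative_continuous[OF x] has_vector_derivative_continuous[OF y]
    by (auto simp: continuous_on_eq_continuous_within)
  have "bounded (x ` {0..T})" "bounded (y ` {0..T})"
    by (intro compact_imp_bounded compact_continuous_image continuous_on_subset[OF xc] continuous_on_subset[OF yc]; auto)+
  then obtain b1 b2 where "\<forall>v\<in>x ` {0..T}. norm v \<le> b1" "\<forall>v\<in>y ` {0..T}. norm v \<le> b2"
    unfolding bounded_iff by blast
  then have b12: "\<And>t. t \<in> {0..T} \<Longrightarrow> norm (x t) \<le> b1" "\<And>t. t \<in> {0..T} \<Longrightarrow> norm (y t) \<le> b2"
    by blast+
  define b where "b = max b1 b2"
  have b: "x t \<in> cball 0 b" "y t \<in> cball 0 b" if "t \<in> {0..T}" for t
    using b12[OF that] by (auto simp: b_def)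
  have "compact ((\<lambda>t. \<alpha> + \<epsilon> * t) ` {0..T})" by (intro compact_continuous_image continuous_intros) auto
  from f_locally_lipschitz[OF this, of b] obtain L where L0: "L > 0"
    and lip: "\<forall>s\<in>(\<lambda>t. \<alpha> + \<epsilon> * t) ` {0..T}. \<forall>x\<in>cball 0 b. \<forall>y\<in>cball 0 b. norm (f (x, s) - f (y, s)) \<le> L * norm (x - y)"
    by (elim exE conjE)
  define d where "d t = x t - y t" for t
  define g where "g t = exp (- 2 * L * t) * (d t \<bullet> d t)" for t
  have at: "at t within {0..} = at t" if "t > 0" for t :: real
    by (rule at_within_interior) (use that in auto)
  have dc: "continuous_on {0..T} d"
    unfolding d_def[abs_def] by (intro continuous_intros continuous_on_subset[OF xc] continuous_on_subset[OF yc]) auto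
  have "g T \<le> g 0"
  proof (rule DERIV_nonpos_imp_decreasing_open[OF T])
    show "continuous_on {0..T} g"
      unfolding g_def[abs_def] by (intro continuous_intros dc)
    fix t assume t: "0 < t" "t < T"
    define d' where "d' = f (x t, \<alpha> + \<epsilon> * t) - f (y t, \<alpha> + \<epsilon> * t)"
    have "(d has_vector_derivative d') (at t)"
      unfolding d_def[abs_def] d'_def using has_vector_derivative_diff[OF x[of t] y[of t]] t by (simp add: at)
    from bounded_bilinear.has_vector_derivative[OF bounded_bilinear_inner this this]
    have 1: "((\<lambda>t. d t \<bullet> d t) has_real_derivative (d t \<bullet> d' + d' \<bullet> d t)) (at t)"
      by (simp add: has_real_derivative_iff_has_vector_derivative)
    have 2: "((\<lambda>t. exp (- 2 * L * t)) has_real_derivative (exp (- 2 * L * t) * (- 2 * L))) (at t)"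
      by (auto intro!: derivative_eq_intros)
    have D: "(g has_real_derivative (exp (- 2 * L * t) * (- 2 * L)) * (d t \<bullet> d t) + (d t \<bullet> d' + d' \<bullet> d t) * exp (- 2 * L * t)) (at t)"
      unfolding g_def[abs_def] by (rule DERIV_mult[OF 2 1])
    have nd: "norm d' \<le> L * norm (d t)" 
      unfolding d'_def d_def using t
      by (intro lip[THEN bspec, THEN bspec, THEN bspec] imageI b) auto
    have "d t \<bullet> d' \<le> norm (d t) * norm d'" by (rule norm_cauchy_schwarz)
    also have "\<dots> \<le> norm (d t) * (L * norm (d t))" using nd by (intro mult_left_mono) auto
    also have "\<dots> = L * (d t \<bullet> d t)" by (simp add: power2_norm_eq_inner[symmetric] power2_eq_square)
    finally have "d t \<bullet> d' \<le> L * (d t \<bullet> d t)" .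
    then have "exp (- 2 * L * t) * (2 * (d t \<bullet> d')) \<le> exp (- 2 * L * t) * (2 * (L * (d t \<bullet> d t)))"
      by (intro mult_left_mono) auto
    then have "(exp (- 2 * L * t) * (- 2 * L)) * (d t \<bullet> d t) + (d t \<bullet> d' + d' \<bullet> d t) * exp (- 2 * L * t) \<le> 0"
      by (simp add: inner_commute[of d'] algebra_simps)
    then show "\<exists>y. (g has_real_derivative y) (at t) \<and> y \<le> 0" using D by blast
  qed
  moreover have "g 0 = 0" by (simp add: g_def d_def init)
  ultimately have "d T \<bullet> d T \<le> 0" by (simp add: g_def mult_le_0_iff)
  then have "d T = 0" by (metis inner_ge_zero inner_eq_zero_iff order_antisym)
  then show ?thesis by (simp add: d_def)
qed

text \<open>Translate the slow trajectory by the initial displacement v. The translate has residual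
  at most L times the norm of v, so the Newton iteration on the half line turns it into a solution
  in the tube with the prescribed initial value, which the iteration preserves. By
  \<open>tube_decay\<close> it approaches the slow trajectory. Stability of all modes is what makes
  the half line admissible.\<close>

lemma slow_sol_attracting:
  assumes ok: "fast_ok C W \<delta> \<epsilon>" and C: "0 < C" "0 < W" "0 < \<epsilon>" "0 < \<delta>" "\<delta> \<le> \<rho>" and u: "slow_sol \<delta> \<epsilon> u"
    and close: "\<And>\<alpha>. norm (u \<alpha> - x0 \<alpha>) \<le> \<delta> / 4"
    and stable: "\<forall>\<alpha>. \<forall>\<mu> \<in> spect (A \<alpha>). Re \<mu> < 0"
  shows "attracting f \<epsilon> (manifold_of u)"
proof -
  obtain a where a: "\<And>\<alpha>. admissible a K UNIV (A \<alpha>)" using A_admissible by blast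
  obtain L where L: "L > 0" "\<And>\<alpha> x y. dist x (x0 \<alpha>) \<le> \<delta> \<Longrightarrow> dist y (x0 \<alpha>) \<le> \<delta> \<Longrightarrow> norm (f (x, \<alpha>) - f (y, \<alpha>)) \<le> L * norm (x - y)"
    using f_lipschitz[OF ok C(1)] by blast
  have ud: "(u has_vector_derivative (1 / \<epsilon>) *\<^sub>R f (u \<alpha>, \<alpha>)) (at \<alpha>)" for \<alpha> by (rule slow_solD(1)[OF u C(3)])
  obtain b where b: "b > 0" "\<And>\<alpha>. norm ((1 / \<epsilon>) *\<^sub>R f (u \<alpha>, \<alpha>)) \<le> b"
  proof -
    have "bounded (f ` tube x0 \<rho>)" by (rule uniform_Ck_on_base(1)[OF uniform_f])
    then obtain b0 where b0: "b0 > 0" "\<And>z. z \<in> tube x0 \<rho> \<Longrightarrow> norm (f z) \<le> b0" unfolding bounded_pos by auto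
    have "norm (f (u \<alpha>, \<alpha>)) \<le> b0" for \<alpha>
      using slow_solD(2)[OF u C(3), of \<alpha>] C(5) by (intro b0(2)) (simp add: tube_def)
    then have "norm ((1 / \<epsilon>) *\<^sub>R f (u \<alpha>, \<alpha>)) \<le> 1 / \<epsilon> * b0" for \<alpha>
      using C(3) by (simp add: divide_right_mono)
    then show ?thesis using that[of "1 / \<epsilon> * b0"] b0(1) C(3) by simp
  qed
  have ulip: "norm (u s - u t) \<le> b * norm (s - t)" for s t
  proof (rule differentiable_bound[of UNIV u "\<lambda>t h. h *\<^sub>R ((1 / \<epsilon>) *\<^sub>R f (u t, t))"])
    show "(u has_derivative (\<lambda>h. h *\<^sub>R ((1 / \<epsilon>) *\<^sub>R f (u t, t)))) (at t within UNIV)" for t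
      using ud[of t] by (simp add: has_vector_derivative_def)
    show "onorm (\<lambda>h. h *\<^sub>R ((1 / \<epsilon>) *\<^sub>R f (u t, t))) \<le> b" for t
    proof (rule onorm_le)
      show "norm (h *\<^sub>R ((1 / \<epsilon>) *\<^sub>R f (u t, t))) \<le> b * norm h" for h
        using mult_left_mono[OF b(2)[of t], of "\<bar>h\<bar>"] by (simp add: mult.commute)
    qed
  qed auto
  \<comment> \<open>The first bound keeps the translated trajectory within \<delta>/2 of the
    critical manifold, given that the slow trajectory is within \<delta>/4; the second keeps the
    displacement 2 C L q of the iteration below \<delta>/2.\<close>
  define q where "q = min (\<delta> / 4) (\<delta> / (4 * C * L))"
  \<comment> \<open>The nearby point of the manifold may belong to another slow time. Since b is a
    Lipschitz constant of u, the displacement at the slow time of p itself is at most (1 + b)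
    \<eta>.\<close>
  define \<eta> where "\<eta> = q / (1 + b)"
  have q: "q > 0" "q \<le> \<delta> / 4" "2 * C * (L * q) \<le> \<delta> / 2"
  proof -
    show "q > 0" "q \<le> \<delta> / 4" using C L by (auto simp: q_def)
    have "q \<le> \<delta> / (4 * C * L)" by (simp add: q_def)
    then have "q * (4 * C * L) \<le> \<delta>" using C L by (simp add: pos_le_divide_eq)
    then show "2 * C * (L * q) \<le> \<delta> / 2" by (simp add: mult_ac)
  qed
  have \<eta>: "\<eta> > 0" using q b by (simp add: \<eta>_def)
  have ne: "manifold_of u \<noteq> {}" by (auto simp: manifold_of_def)
  show ?thesis
    unfolding attracting_def
  proof (intro exI[of _ \<eta>] conjI allI impI \<eta>)
    fix p assume p: "infdist p (manifold_of u) < \<eta>"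
    obtain x \<alpha> where px: "p = (x, \<alpha>)" by (cases p)
    have "bdd_below (dist p ` manifold_of u)" by (rule bdd_belowI[of _ 0]) auto
    then obtain y where y: "y \<in> manifold_of u" "dist p y < \<eta>"
      using p unfolding infdist_notempty[OF ne] by (auto simp: cINF_less_iff[OF ne])
    obtain \<beta> where \<beta>: "y = (u \<beta>, \<beta>)" using y(1) by (auto simp: manifold_of_def)
    define v where "v = x - u \<alpha>"
    have v: "norm v \<le> q"
    proof -
      have 1: "norm (x - u \<beta>) \<le> \<eta>" "norm (\<beta> - \<alpha>) \<le> \<eta>"
        using y(2) dist_fst_le[of p y] dist_snd_le[of p y] by (auto simp: px \<beta> dist_norm norm_minus_commute)
      have "norm (u \<beta> - u \<alpha>) \<le> b * norm (\<beta> - \<alpha>)" by (rule ulip)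
      also have "\<dots> \<le> b * \<eta>" using 1 b by (intro mult_left_mono) auto
      finally have "norm (u \<beta> - u \<alpha>) \<le> b * \<eta>" .
      from norm_triangle_mono[OF 1(1) this] have "norm v \<le> (1 + b) * \<eta>" by (simp add: v_def distrib_right)
      then show ?thesis using b by (simp add: \<eta>_def)
    qed
    have near: "norm (u s + v - x0 s) \<le> \<delta> / 2" for s
    proof -
      have "norm ((u s - x0 s) + v) \<le> \<delta> / 4 + q" by (intro norm_triangle_mono close v)
      moreover have "(u s - x0 s) + v = u s + v - x0 s" by simp
      ultimately have "norm (u s + v - x0 s) \<le> \<delta> / 4 + q" by (simp only:)
      then show ?thesis using q(2) by linarith
    qed
    have ul: "((\<lambda>t. u (\<alpha> + \<epsilon> * t)) has_vector_derivative f (u (\<alpha> + \<epsilon> * t), \<alpha> + \<epsilon> * t)) (at t)" for t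
      by (rule slow_solD(3)[OF u C(3)])
    have fok: "approx_invertible C (\<lambda>t. A (\<alpha> + \<epsilon> * t))" "locally_controlled C W (\<lambda>t. A (\<alpha> + \<epsilon> * t))"
      "nearly_linear \<delta> (\<lambda>t. x0 (\<alpha> + \<epsilon> * t)) C (\<lambda>t. A (\<alpha> + \<epsilon> * t)) (\<lambda>t x. f (x, \<alpha> + \<epsilon> * t))"
      using ok unfolding fast_ok_def by blast+
    have "\<exists>w. (\<forall>t\<in>{0..}. (w has_vector_derivative f (w t, \<alpha> + \<epsilon> * t)) (at t within {0..})) \<and>
      (\<forall>t\<in>{0..}. norm (w t - (u (\<alpha> + \<epsilon> * t) + v)) \<le> 2 * C * (L * q)) \<and> ({0::real..} = {0..} \<longrightarrow> w 0 = u (\<alpha> + \<epsilon> * 0) + v)"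
    proof (rule newton_solution[OF C(1) fok(1) _ _ fok(3)])
      show "time_domain {0..} (\<lambda>t. A (\<alpha> + \<epsilon> * t))" using stable by (simp add: time_domain_def)
      show "admissible a K UNIV (A (\<alpha> + \<epsilon> * t))" for t by (rule a)
      show "continuous_on UNIV (\<lambda>t. f (w t, \<alpha> + \<epsilon> * t))" if "continuous_on UNIV w" for w
        by (intro f_continuous that continuous_intros)
      show "((\<lambda>t. u (\<alpha> + \<epsilon> * t) + v) has_vector_derivative f (u (\<alpha> + \<epsilon> * t), \<alpha> + \<epsilon> * t)) (at t)" for t
        using has_vector_derivative_add[OF ul has_vector_derivative_const[of v]] by simp
      show "continuous_on UNIV (\<lambda>t. f (u (\<alpha> + \<epsilon> * t), \<alpha> + \<epsilon> * t))"
        by (intro f_continuous continuous_of_vector_derivative[OF ul] continuous_intros)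
      show "norm (u (\<alpha> + \<epsilon> * t) + v - x0 (\<alpha> + \<epsilon> * t)) \<le> \<delta> / 2" for t by (rule near)
      show "norm (f (u (\<alpha> + \<epsilon> * t), \<alpha> + \<epsilon> * t) - f (u (\<alpha> + \<epsilon> * t) + v, \<alpha> + \<epsilon> * t)) \<le> L * q" for t
      proof -
        have "dist (u (\<alpha> + \<epsilon> * t) + v) (x0 (\<alpha> + \<epsilon> * t)) \<le> \<delta>"
          using near[of "\<alpha> + \<epsilon> * t"] C(4) unfolding dist_norm by linarith
        then have "norm (f (u (\<alpha> + \<epsilon> * t), \<alpha> + \<epsilon> * t) - f (u (\<alpha> + \<epsilon> * t) + v, \<alpha> + \<epsilon> * t)) \<le>
          L * norm (u (\<alpha> + \<epsilon> * t) - (u (\<alpha> + \<epsilon> * t) + v))"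
          using slow_solD(2)[OF u C(3)] by (intro L(2)) auto
        also have "\<dots> \<le> L * q" using v L(1) by simp
        finally show ?thesis .
      qed
      show "2 * C * (L * q) \<le> \<delta> / 2" by (rule q(3))
    qed
    then obtain w where w: "\<And>t. t \<ge> 0 \<Longrightarrow> (w has_vector_derivative f (w t, \<alpha> + \<epsilon> * t)) (at t within {0..})"
      "\<And>t. t \<ge> 0 \<Longrightarrow> norm (w t - (u (\<alpha> + \<epsilon> * t) + v)) \<le> 2 * C * (L * q)" "w 0 = x"
      by (auto simp: v_def)
    have wt: "dist (w t) (x0 (\<alpha> + \<epsilon> * t)) \<le> \<delta>" if "t \<ge> 0" for t
      using w(2)[OF that] near[of "\<alpha> + \<epsilon> * t"] q(3)
        norm_triangle_ineq[of "w t - (u (\<alpha> + \<epsilon> * t) + v)" "u (\<alpha> + \<epsilon> * t) + v - x0 (\<alpha> + \<epsilon> * t)"]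
      by (simp add: dist_norm)
    have lim: "((\<lambda>t. norm (w t - u (\<alpha> + \<epsilon> * t))) \<longlongrightarrow> 0) at_top"
      by (rule tube_decay[OF C(1,2) fok(2,3) A_affine_continuous])
        (use w(1) wt slow_solD(2)[OF u C(3)] in \<open>auto intro!: f_continuous continuous_intros has_vector_derivative_at_within ul\<close>)
    show "\<exists>z. solves f \<epsilon> z {0..} \<and> z 0 = p"
      using solvesI[of "{0..}" w \<alpha> \<epsilon>] w(1,3) px by (intro exI[of _ "\<lambda>t. (w t, \<alpha> + \<epsilon> * t)"]) auto
    fix z assume z: "solves f \<epsilon> z {0..} \<and> z 0 = p"
    have z0: "snd (z 0) = \<alpha>" "fst (z 0) = x" using z px by auto
    have zs: "snd (z t) = \<alpha> + \<epsilon> * t" if "t \<ge> 0" for t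
      using solves_slow_component[of \<epsilon> z "{0..}" t] z that z0 by simp
    have zf: "((\<lambda>t. fst (z t)) has_vector_derivative f (fst (z t), \<alpha> + \<epsilon> * t)) (at t within {0..})" if "t \<ge> 0" for t
      using solves_fast_component[of \<epsilon> z "{0..}" t] z that z0 by simp
    \<comment> \<open>An arbitrary solution from p might leave the tube; uniqueness of the initial
      value problem rules this out by identifying it with w.\<close>
    have zw: "fst (z t) = w t" if "t \<ge> 0" for t
      by (rule ivp_unique[where x="\<lambda>t. fst (z t)" and y=w, OF zf w(1) _ that]) (use z0 w(3) in auto)
    show "((\<lambda>t. infdist (z t) (manifold_of u)) \<longlongrightarrow> 0) at_top"
    proof (rule tendsto_sandwich[OF _ _ tendsto_const lim])
      show "\<forall>\<^sub>F t in at_top. 0 \<le> infdist (z t) (manifold_of u)" by (simp add: infdist_nonneg)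
      have "infdist (z t) (manifold_of u) \<le> norm (w t - u (\<alpha> + \<epsilon> * t))" if "t \<ge> 0" for t
      proof -
        have "infdist (z t) (manifold_of u) \<le> dist (z t) (u (\<alpha> + \<epsilon> * t), \<alpha> + \<epsilon> * t)"
          by (rule infdist_le) (auto simp: manifold_of_def)
        moreover have zt: "z t = (w t, \<alpha> + \<epsilon> * t)" using zw[OF that] zs[OF that] by (simp add: prod_eq_iff)
        ultimately show ?thesis unfolding zt by (simp add: dist_Pair_Pair dist_norm)
      qed
      then show "\<forall>\<^sub>F t in at_top. infdist (z t) (manifold_of u) \<le> norm (w t - u (\<alpha> + \<epsilon> * t))"
        unfolding eventually_at_top_linorder by blast
    qed
  qed
qed

end

text \<open>The average over an interval of length h is a difference quotient of a primitive, hence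
  continuously differentiable with derivative of size at most 2 sup |y| / h. Its distance from y is
  governed by the modulus of continuity. The bound b may be huge, but it does not depend on
  t.\<close>

lemma mollify:
  fixes y :: "real \<Rightarrow> 'a::euclidean_space"
  assumes y: "UC 0 y" and \<eta>: "0 < \<eta>"
  shows "\<exists>Y Y' b. (\<forall>t. (Y has_vector_derivative Y' t) (at t)) \<and> continuous_on UNIV Y' \<and>
    (\<forall>t. norm (Y' t) \<le> b) \<and> (\<forall>t. norm (Y t - y t) \<le> \<eta>)"
proof -
  have yc: "continuous_on UNIV y" using y by (simp add: uniformly_continuous_imp_continuous)
  obtain G where G: "\<And>t. (G has_vector_derivative y t) (at t)" using antiderivative_real[OF yc] by blast
  obtain d where d: "d > 0" "\<And>s t. dist s t < d \<Longrightarrow> dist (y s) (y t) < \<eta>"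
    using y \<eta> unfolding UC.simps uniformly_continuous_on_def by blast
  obtain B where B: "\<And>t. norm (y t) \<le> B" using y by (auto simp: bounded_iff)
  define h where "h = d / 2"
  have h: "h > 0" "h < d" using d by (auto simp: h_def)
  define Y where "Y t = (1 / h) *\<^sub>R (G (h + 1 * t) - G t)" for t
  define Y' where "Y' t = (1 / h) *\<^sub>R (y (h + 1 * t) - y t)" for t
  have "(Y has_vector_derivative Y' t) (at t)" for t
    unfolding Y_def[abs_def] Y'_def
    using bounded_linear.has_vector_derivative[OF bounded_linear_scaleR_right
        has_vector_derivative_diff[OF has_vector_derivative_affine[OF G, of h 1] G]] by simp
  moreover have "continuous_on UNIV Y'"
    unfolding Y'_def[abs_def] by (intro continuous_intros continuous_on_compose2[OF yc] yc) auto
  moreover have "norm (Y' t) \<le> (1 / h) * (B + B)" for t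
  proof -
    have "norm (y (h + 1 * t) - y t) \<le> B + B" by (rule order_trans[OF norm_triangle_ineq4 add_mono[OF B B]])
    then have "(1 / h) * norm (y (h + 1 * t) - y t) \<le> (1 / h) * (B + B)" using h by (intro mult_left_mono) auto
    then show ?thesis using h by (simp add: Y'_def)
  qed
  moreover have "norm (Y t - y t) \<le> \<eta>" for t
  proof -
    have "norm ((G (t + h) - (t + h) *\<^sub>R y t) - (G t - t *\<^sub>R y t)) \<le> \<eta> * (t + h) - \<eta> * t"
    proof (rule differentiable_bound_general[where f="\<lambda>s. G s - s *\<^sub>R y t" and \<phi>="\<lambda>s. \<eta> * s" and f'="\<lambda>s. y s - y t" and \<phi>'="\<lambda>s. \<eta>"])
      show "t < t + h" using h by simp
      have D: "((\<lambda>s. G s - s *\<^sub>R y t) has_vector_derivative y s - y t) (at s)" for s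
      proof -
        have "((\<lambda>s. s *\<^sub>R y t) has_vector_derivative y t) (at s)" by (auto intro!: derivative_eq_intros)
        then show ?thesis by (intro has_vector_derivative_diff G)
      qed
      then show "continuous_on {t..t + h} (\<lambda>s. G s - s *\<^sub>R y t)" by (rule continuous_of_vector_derivative)
      show "((\<lambda>s. G s - s *\<^sub>R y t) has_vector_derivative y s - y t) (at s)" for s by (rule D)
      show "((\<lambda>s. \<eta> * s) has_vector_derivative \<eta>) (at s)" for s by (auto intro!: derivative_eq_intros)
      show "norm (y s - y t) \<le> \<eta>" if "t < s" "s < t + h" for s
        using d(2)[of s t] that h by (simp add: dist_norm less_imp_le)
    qed (intro continuous_intros)
    moreover have "(G (t + h) - (t + h) *\<^sub>R y t) - (G t - t *\<^sub>R y t) = h *\<^sub>R (Y t - y t)"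
      using h by (simp add: Y_def algebra_simps)
    ultimately have "norm (h *\<^sub>R (Y t - y t)) \<le> \<eta> * (t + h) - \<eta> * t" by (simp only:)
    moreover have "\<eta> * (t + h) - \<eta> * t = h * \<eta>" by (simp add: algebra_simps)
    ultimately have "h * norm (Y t - y t) \<le> h * \<eta>" using h by (simp only: norm_scaleR abs_of_pos)
    then show ?thesis using h(1) by (rule mult_left_le_imp_le)
  qed
  ultimately show ?thesis by blast
qed

section \<open>The asymptotic expansion\<close>

context slow_fast
begin

lemma X'_bound: "\<exists>B>0. \<forall>\<nu><r. \<forall>\<alpha>. norm (X' \<nu> \<alpha>) \<le> B"
proof -
  have "\<forall>\<nu>. \<exists>b. \<nu> < r \<longrightarrow> (\<forall>\<alpha>. norm (X' \<nu> \<alpha>) \<le> b)"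
  proof
    fix \<nu>
    show "\<exists>b. \<nu> < r \<longrightarrow> (\<forall>\<alpha>. norm (X' \<nu> \<alpha>) \<le> b)"
    proof (cases "\<nu> < r")
      case True
      then have "UC (Suc (r - Suc \<nu>)) (slow_coeff f x0 \<nu>)" using UC_slow_coeff[of \<nu>] by (simp add: Suc_diff_Suc)
      from UC_base(1)[OF UC_SucE(2)[OF this]] show ?thesis unfolding bounded_iff by blast
    qed simp
  qed
  then obtain b where b: "\<And>\<nu> \<alpha>. \<nu> < r \<Longrightarrow> norm (X' \<nu> \<alpha>) \<le> b \<nu>" by metis
  have "norm (X' \<nu> \<alpha>) \<le> 1 + (\<Sum>\<nu><r. \<bar>b \<nu>\<bar>)" if "\<nu> < r" for \<nu> \<alpha>
    using b[OF that, of \<alpha>] member_le_sum[of \<nu> "{..<r}" "\<lambda>\<nu>. \<bar>b \<nu>\<bar>"] that by auto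
  moreover have "0 < 1 + (\<Sum>\<nu><r. \<bar>b \<nu>\<bar>)" by (simp add: sum_nonneg add_pos_nonneg)
  ultimately show ?thesis by blast
qed

lemma X_deriv:
  assumes "\<nu> < r"
  shows "(slow_coeff f x0 \<nu> has_vector_derivative X' \<nu> \<alpha>) (at \<alpha>)" "continuous_on UNIV (X' \<nu>)"
proof -
  have 1: "UC (Suc (r - Suc \<nu>)) (slow_coeff f x0 \<nu>)" using UC_slow_coeff[of \<nu>] assms by (simp add: Suc_diff_Suc)
  show "(slow_coeff f x0 \<nu> has_vector_derivative X' \<nu> \<alpha>) (at \<alpha>)" by (rule UC_SucE(1)[OF 1])
  show "continuous_on UNIV (X' \<nu>)"
    by (rule uniformly_continuous_imp_continuous[OF UC_base(2)[OF UC_SucE(2)[OF 1]]])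
qed

lemma x0_corr: "x0 \<alpha> + corr \<epsilon> \<alpha> = (\<Sum>\<nu>\<le>r. \<epsilon> ^ \<nu> *\<^sub>R X \<nu> \<alpha>)"
  unfolding corr_def atMost_atLeast0 by (subst sum.atLeast_Suc_atMost) simp_all

lemma X'_shift: "(\<Sum>m=1..r. \<epsilon> ^ m *\<^sub>R X' (m - 1) \<alpha>) = \<epsilon> *\<^sub>R (\<Sum>m<r. \<epsilon> ^ m *\<^sub>R X' m \<alpha>)"
  by (simp add: sum.atLeast1_atMost_eq scaleR_sum_right)

context
  fixes C W \<delta> e0 :: real and u :: "real \<Rightarrow> real \<Rightarrow> real^'n"
  assumes C: "0 < C" "0 < W" "0 < \<delta>" "0 < e0"
    and ok: "\<And>\<epsilon>. 0 < \<epsilon> \<Longrightarrow> \<epsilon> < e0 \<Longrightarrow> fast_ok C W \<delta> \<epsilon>"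
    and u: "\<And>\<epsilon>. 0 < \<epsilon> \<Longrightarrow> \<epsilon> < e0 \<Longrightarrow> slow_sol \<delta> \<epsilon> (u \<epsilon>)"
begin

text \<open>The last coefficient need not be differentiable, so it enters the approximate solution
  only after averaging over a short interval.\<close>

lemma slow_sol_expansion:
  assumes \<tau>: "0 < \<tau>"
  shows "\<exists>e>0. e \<le> e0 \<and> e \<le> 1 \<and> (\<forall>\<epsilon> \<alpha>. 0 < \<epsilon> \<longrightarrow> \<epsilon> < e \<longrightarrow>
    dist (x0 \<alpha> + corr \<epsilon> \<alpha>) (x0 \<alpha>) \<le> \<delta> \<and> norm (u \<epsilon> \<alpha> - (x0 \<alpha> + corr \<epsilon> \<alpha>)) \<le> \<tau> * \<epsilon> ^ r)"
proof -
  have "fast_ok C W \<delta> (e0 / 2)" using C by (intro ok) auto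
  from f_lipschitz[OF this C(1)] obtain L where L: "L > 0"
    "\<And>\<alpha> x y. dist x (x0 \<alpha>) \<le> \<delta> \<Longrightarrow> dist y (x0 \<alpha>) \<le> \<delta> \<Longrightarrow> norm (f (x, \<alpha>) - f (y, \<alpha>)) \<le> L * norm (x - y)"
    by blast
  \<comment> \<open>The error \<tau> is split into thirds: 2 C \<sigma> from the residual of the
    series, 2 C \<epsilon> b from differentiating the averaged last coefficient, and (2 C L + 1)
    \<eta> from averaging it, once through f and once directly.\<close>
  define \<eta> where "\<eta> = \<tau> / (3 * (2 * C * L + 1))"
  define \<sigma> where "\<sigma> = \<tau> / (6 * C)"
  have den: "2 * C * L + 1 > 0" using C L by (simp add: add_pos_pos)
  have \<eta>: "\<eta> > 0" "(2 * C * L + 1) * \<eta> = \<tau> / 3"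
  proof -
    define D where "D = 2 * C * L + 1"
    show "\<eta> > 0" "(2 * C * L + 1) * \<eta> = \<tau> / 3"
      using \<tau> den unfolding \<eta>_def D_def[symmetric] by simp_all
  qed
  have \<sigma>: "\<sigma> > 0" "2 * C * \<sigma> = \<tau> / 3" using \<tau> C by (simp_all add: \<sigma>_def)
  have "UC 0 (slow_coeff f x0 r)" using UC_slow_coeff[of r] by simp
  from mollify[OF this \<eta>(1)] obtain Y Y' b where
    Y: "\<And>t. (Y has_vector_derivative Y' t) (at t)" "continuous_on UNIV Y'" "\<And>t. norm (Y' t) \<le> b" "\<And>t. norm (Y t - X r t) \<le> \<eta>"
    by blast
  have b0: "b \<ge> 0" using Y(3) order_trans[OF norm_ge_zero] by blast
  obtain V where V: "V > 0" "\<And>\<epsilon> \<alpha>. 0 < \<epsilon> \<Longrightarrow> \<epsilon> \<le> 1 \<Longrightarrow> norm (corr \<epsilon> \<alpha>) \<le> V * \<epsilon>" using corr_bound by blast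
  obtain e1 where e1: "e1 > 0" "e1 \<le> 1" "\<And>\<epsilon> \<alpha>. 0 < \<epsilon> \<Longrightarrow> \<epsilon> < e1 \<Longrightarrow>
    norm (f (x0 \<alpha> + corr \<epsilon> \<alpha>, \<alpha>) - (\<Sum>m=1..r. \<epsilon> ^ m *\<^sub>R X' (m - 1) \<alpha>)) \<le> \<sigma> * \<epsilon> ^ r"
    using f_expansion[OF \<sigma>(1)] by blast
  \<comment> \<open>The third entry makes 2 C \<epsilon> b at most \<tau>/3; b is fixed by \<eta>
    before \<epsilon> is chosen. The fourth keeps the series and its averaged version inside the
    tube.\<close>
  define e where "e = Min {e0, e1, \<tau> / (6 * C * (b + 1)), \<delta> / (V + \<eta>)}"
  have epos: "e > 0" using C e1 \<tau> b0 V \<eta> by (simp add: e_def)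
  have ele: "e \<le> e0" "e \<le> e1" "e \<le> \<tau> / (6 * C * (b + 1))" "e \<le> \<delta> / (V + \<eta>)" by (simp_all add: e_def)
  have main: "dist (x0 \<alpha> + corr \<epsilon> \<alpha>) (x0 \<alpha>) \<le> \<delta> \<and> norm (u \<epsilon> \<alpha> - (x0 \<alpha> + corr \<epsilon> \<alpha>)) \<le> \<tau> * \<epsilon> ^ r"
    if \<epsilon>: "0 < \<epsilon>" "\<epsilon> < e" for \<epsilon> \<alpha>
  proof -
    have \<epsilon>1: "\<epsilon> \<le> 1" "\<epsilon> < e0" "\<epsilon> < e1" using \<epsilon> ele e1(2) by auto
    have \<epsilon>2: "V * \<epsilon> + \<eta> * \<epsilon> \<le> \<delta>"
    proof -
      have "\<epsilon> \<le> \<delta> / (V + \<eta>)" using \<epsilon> ele by linarith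
      then show ?thesis using V \<eta> by (simp add: pos_le_divide_eq distrib_left mult.commute)
    qed
    have \<epsilon>3: "2 * C * (\<epsilon> * b) \<le> \<tau> / 3"
    proof -
      have "\<epsilon> \<le> \<tau> / (6 * C * (b + 1))" using \<epsilon> ele by linarith
      then have "\<epsilon> * (6 * C * (b + 1)) \<le> \<tau>" using C b0 by (simp add: pos_le_divide_eq)
      moreover have "\<epsilon> * (6 * C * b) \<le> \<epsilon> * (6 * C * (b + 1))" using \<epsilon> C by (intro mult_left_mono) auto
      ultimately show ?thesis by (simp add: mult_ac)
    qed
    have er: "\<epsilon> ^ r \<le> \<epsilon>" using power_decreasing[of 1 r \<epsilon>] r \<epsilon> \<epsilon>1 by simp
    define w where "w \<alpha> = (\<Sum>\<nu><r. \<epsilon> ^ \<nu> *\<^sub>R X \<nu> \<alpha>) + \<epsilon> ^ r *\<^sub>R Y \<alpha>" for \<alpha>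
    define w' where "w' \<alpha> = (\<Sum>\<nu><r. \<epsilon> ^ \<nu> *\<^sub>R X' \<nu> \<alpha>) + \<epsilon> ^ r *\<^sub>R Y' \<alpha>" for \<alpha>
    have w_alt: "w \<alpha> = (x0 \<alpha> + corr \<epsilon> \<alpha>) + \<epsilon> ^ r *\<^sub>R (Y \<alpha> - X r \<alpha>)" for \<alpha>
      unfolding x0_corr lessThan_Suc_atMost[symmetric] by (simp add: w_def scaleR_diff_right)
    have cb: "norm (corr \<epsilon> \<alpha>) \<le> V * \<epsilon>" for \<alpha> using V(2) \<epsilon> \<epsilon>1 by blast
    have Yb: "norm (\<epsilon> ^ r *\<^sub>R (Y \<alpha> - X r \<alpha>)) \<le> \<eta> * \<epsilon> ^ r" for \<alpha>
      using mult_left_mono[OF Y(4), of "\<epsilon> ^ r"] \<epsilon> by (simp add: mult.commute)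
    have d1: "dist (x0 \<alpha> + corr \<epsilon> \<alpha>) (x0 \<alpha>) \<le> \<delta>" for \<alpha>
    proof -
      have "0 < \<eta> * \<epsilon>" using \<eta>(1) \<epsilon>(1) by (rule mult_pos_pos)
      then have "norm (corr \<epsilon> \<alpha>) \<le> \<delta>" using cb[of \<alpha>] \<epsilon>2 by linarith
      then show ?thesis by (simp add: dist_norm)
    qed
    have d2: "dist (w \<alpha>) (x0 \<alpha>) \<le> \<delta>" for \<alpha>
    proof -
      have "norm (corr \<epsilon> \<alpha> + \<epsilon> ^ r *\<^sub>R (Y \<alpha> - X r \<alpha>)) \<le> V * \<epsilon> + \<eta> * \<epsilon> ^ r" by (intro norm_triangle_mono cb Yb)
      also have "\<dots> \<le> V * \<epsilon> + \<eta> * \<epsilon>" using er \<eta> by simp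
      finally have "norm (corr \<epsilon> \<alpha> + \<epsilon> ^ r *\<^sub>R (Y \<alpha> - X r \<alpha>)) \<le> \<delta>" using \<epsilon>2 by linarith
      then show ?thesis by (simp add: dist_norm w_alt)
    qed
    have res: "norm (\<epsilon> *\<^sub>R w' \<alpha> - f (w \<alpha>, \<alpha>)) \<le> (\<sigma> + \<epsilon> * b + L * \<eta>) * \<epsilon> ^ r" for \<alpha>
    proof -
      have 1: "norm ((\<Sum>m=1..r. \<epsilon> ^ m *\<^sub>R X' (m - 1) \<alpha>) - f (x0 \<alpha> + corr \<epsilon> \<alpha>, \<alpha>)) \<le> \<sigma> * \<epsilon> ^ r"
        using e1(3)[OF \<epsilon>(1) \<epsilon>1(3)] by (simp add: norm_minus_commute)
      have 2: "norm (\<epsilon> *\<^sub>R \<epsilon> ^ r *\<^sub>R Y' \<alpha>) \<le> (\<epsilon> * b) * \<epsilon> ^ r"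
        using mult_left_mono[OF Y(3), of "\<epsilon> * \<epsilon> ^ r"] \<epsilon> by (simp add: mult_ac abs_mult)
      have "norm (f (x0 \<alpha> + corr \<epsilon> \<alpha>, \<alpha>) - f (w \<alpha>, \<alpha>)) \<le> L * norm ((x0 \<alpha> + corr \<epsilon> \<alpha>) - w \<alpha>)"
        by (rule L(2)[OF d1 d2])
      also have "(x0 \<alpha> + corr \<epsilon> \<alpha>) - w \<alpha> = - (\<epsilon> ^ r *\<^sub>R (Y \<alpha> - X r \<alpha>))" by (simp add: w_alt)
      also have "L * norm (- (\<epsilon> ^ r *\<^sub>R (Y \<alpha> - X r \<alpha>))) \<le> L * (\<eta> * \<epsilon> ^ r)"
        unfolding norm_minus_cancel using L(1) by (intro mult_left_mono Yb) auto
      finally have 3: "norm (f (x0 \<alpha> + corr \<epsilon> \<alpha>, \<alpha>) - f (w \<alpha>, \<alpha>)) \<le> L * (\<eta> * \<epsilon> ^ r)" .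
      \<comment> \<open>The residual consists of that of the series without its last derivative, the
        derivative of the averaged term, and the change of f caused by averaging.\<close>
      have "\<epsilon> *\<^sub>R w' \<alpha> - f (w \<alpha>, \<alpha>) = (((\<Sum>m=1..r. \<epsilon> ^ m *\<^sub>R X' (m - 1) \<alpha>) - f (x0 \<alpha> + corr \<epsilon> \<alpha>, \<alpha>)) +
          \<epsilon> *\<^sub>R \<epsilon> ^ r *\<^sub>R Y' \<alpha>) + (f (x0 \<alpha> + corr \<epsilon> \<alpha>, \<alpha>) - f (w \<alpha>, \<alpha>))"
        unfolding X'_shift by (simp add: w'_def scaleR_add_right)
      also have "norm \<dots> \<le> (\<sigma> * \<epsilon> ^ r + (\<epsilon> * b) * \<epsilon> ^ r) + L * (\<eta> * \<epsilon> ^ r)"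
        by (intro norm_triangle_mono 1 2 3)
      finally show ?thesis by (simp add: algebra_simps)
    qed
    have "norm (u \<epsilon> \<alpha> - w \<alpha>) \<le> 2 * C * ((\<sigma> + \<epsilon> * b + L * \<eta>) * \<epsilon> ^ r)" for \<alpha>
    proof (rule slow_sol_close[OF ok[OF \<epsilon>(1) \<epsilon>1(2)] C(1,2) \<epsilon>(1) u[OF \<epsilon>(1) \<epsilon>1(2)] _ _ d2 res])
      show "(w has_vector_derivative w' \<alpha>) (at \<alpha>)" for \<alpha>
        unfolding w_def[abs_def] w'_def
        by (intro has_vector_derivative_add has_vector_derivative_sum
            bounded_linear.has_vector_derivative[OF bounded_linear_scaleR_right] X_deriv(1) Y(1)) auto
      show "continuous_on UNIV w'"
        unfolding w'_def[abs_def] by (intro continuous_intros X_deriv(2) Y(2)) auto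
    qed
    from norm_triangle_mono[OF this Yb]
    have "norm (u \<epsilon> \<alpha> - w \<alpha> + \<epsilon> ^ r *\<^sub>R (Y \<alpha> - X r \<alpha>)) \<le> 2 * C * ((\<sigma> + \<epsilon> * b + L * \<eta>) * \<epsilon> ^ r) + \<eta> * \<epsilon> ^ r" .
    moreover have "u \<epsilon> \<alpha> - w \<alpha> + \<epsilon> ^ r *\<^sub>R (Y \<alpha> - X r \<alpha>) = u \<epsilon> \<alpha> - (x0 \<alpha> + corr \<epsilon> \<alpha>)" by (simp add: w_alt)
    moreover have "2 * C * ((\<sigma> + \<epsilon> * b + L * \<eta>) * \<epsilon> ^ r) + \<eta> * \<epsilon> ^ r =
      (2 * C * \<sigma> + 2 * C * (\<epsilon> * b) + (2 * C * L + 1) * \<eta>) * \<epsilon> ^ r" by (simp add: algebra_simps)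
    moreover have "\<dots> \<le> \<tau> * \<epsilon> ^ r"
      using \<sigma>(2) \<eta>(2) \<epsilon>3 \<epsilon> by (intro mult_right_mono) auto
    ultimately have "norm (u \<epsilon> \<alpha> - (x0 \<alpha> + corr \<epsilon> \<alpha>)) \<le> \<tau> * \<epsilon> ^ r" by simp
    then show ?thesis using d1 by blast
  qed
  have "e \<le> 1" using ele e1(2) by linarith
  then show ?thesis using epos ele(1) main by blast
qed

text \<open>An asymptotic expansion cannot be differentiated, but the equation gives the derivative
  as f along the trajectory divided by \<epsilon>. Lipschitz continuity carries the expansion of the
  trajectory over to f, and the division costs one power of \<epsilon>.\<close>

lemma slow_sol_deriv_expansion:
  assumes \<tau>: "0 < \<tau>"
  shows "\<exists>e>0. e \<le> e0 \<and> e \<le> 1 \<and> (\<forall>\<epsilon> \<alpha>. 0 < \<epsilon> \<longrightarrow> \<epsilon> < e \<longrightarrow>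
    norm (vector_derivative (u \<epsilon>) (at \<alpha>) - (\<Sum>m<r. \<epsilon> ^ m *\<^sub>R X' m \<alpha>)) \<le> \<tau> * \<epsilon> ^ (r - 1))"
proof -
  have "fast_ok C W \<delta> (e0 / 2)" using C by (intro ok) auto
  from f_lipschitz[OF this C(1)] obtain L where L: "L > 0"
    "\<And>\<alpha> x y. dist x (x0 \<alpha>) \<le> \<delta> \<Longrightarrow> dist y (x0 \<alpha>) \<le> \<delta> \<Longrightarrow> norm (f (x, \<alpha>) - f (y, \<alpha>)) \<le> L * norm (x - y)"
    by blast
  have "\<tau> / (2 * L) > 0" using \<tau> L by simp
  from slow_sol_expansion[OF this] obtain e1 where e1: "e1 > 0" "e1 \<le> e0" "e1 \<le> 1"
    "\<And>\<epsilon> \<alpha>. 0 < \<epsilon> \<Longrightarrow> \<epsilon> < e1 \<Longrightarrow> dist (x0 \<alpha> + corr \<epsilon> \<alpha>) (x0 \<alpha>) \<le> \<delta>"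
    "\<And>\<epsilon> \<alpha>. 0 < \<epsilon> \<Longrightarrow> \<epsilon> < e1 \<Longrightarrow> norm (u \<epsilon> \<alpha> - (x0 \<alpha> + corr \<epsilon> \<alpha>)) \<le> \<tau> / (2 * L) * \<epsilon> ^ r" by blast
  have "\<tau> / 2 > 0" using \<tau> by simp
  from f_expansion[OF this] obtain e2 where e2: "e2 > 0"
    "\<And>\<epsilon> \<alpha>. 0 < \<epsilon> \<Longrightarrow> \<epsilon> < e2 \<Longrightarrow>
      norm (f (x0 \<alpha> + corr \<epsilon> \<alpha>, \<alpha>) - (\<Sum>m=1..r. \<epsilon> ^ m *\<^sub>R X' (m - 1) \<alpha>)) \<le> \<tau> / 2 * \<epsilon> ^ r" by blast
  have "norm (vector_derivative (u \<epsilon>) (at \<alpha>) - (\<Sum>m<r. \<epsilon> ^ m *\<^sub>R X' m \<alpha>)) \<le> \<tau> * \<epsilon> ^ (r - 1)"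
    if \<epsilon>: "0 < \<epsilon>" "\<epsilon> < min e1 e2" for \<epsilon> \<alpha>
  proof -
    have \<epsilon>': "\<epsilon> < e1" "\<epsilon> < e2" "\<epsilon> < e0" using \<epsilon> e1 by auto
    have us: "slow_sol \<delta> \<epsilon> (u \<epsilon>)" by (rule u[OF \<epsilon>(1) \<epsilon>'(3)])
    have vd: "vector_derivative (u \<epsilon>) (at \<alpha>) = (1 / \<epsilon>) *\<^sub>R f (u \<epsilon> \<alpha>, \<alpha>)"
      by (rule vector_derivative_at[OF slow_solD(1)[OF us \<epsilon>(1)]])
    have "norm (f (u \<epsilon> \<alpha>, \<alpha>) - f (x0 \<alpha> + corr \<epsilon> \<alpha>, \<alpha>)) \<le> L * norm (u \<epsilon> \<alpha> - (x0 \<alpha> + corr \<epsilon> \<alpha>))"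
      by (rule L(2)[OF slow_solD(2)[OF us \<epsilon>(1)] e1(4)[OF \<epsilon>(1) \<epsilon>'(1)]])
    also have "\<dots> \<le> L * (\<tau> / (2 * L) * \<epsilon> ^ r)" using e1(5)[OF \<epsilon>(1) \<epsilon>'(1)] L(1) by (intro mult_left_mono) auto
    also have "\<dots> = \<tau> / 2 * \<epsilon> ^ r" using L(1) by simp
    finally have "norm (f (u \<epsilon> \<alpha>, \<alpha>) - f (x0 \<alpha> + corr \<epsilon> \<alpha>, \<alpha>)) \<le> \<tau> / 2 * \<epsilon> ^ r" .
    from norm_triangle_mono[OF this e2(2)[OF \<epsilon>(1) \<epsilon>'(2), of \<alpha>]]
    have "norm (f (u \<epsilon> \<alpha>, \<alpha>) - (\<Sum>m=1..r. \<epsilon> ^ m *\<^sub>R X' (m - 1) \<alpha>)) \<le> \<tau> * \<epsilon> ^ r" by simp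
    from mult_left_mono[OF this, of "1 / \<epsilon>"] have
      "norm ((1 / \<epsilon>) *\<^sub>R (f (u \<epsilon> \<alpha>, \<alpha>) - (\<Sum>m=1..r. \<epsilon> ^ m *\<^sub>R X' (m - 1) \<alpha>))) \<le> (1 / \<epsilon>) * (\<tau> * \<epsilon> ^ r)"
      using \<epsilon>(1) unfolding norm_scaleR by simp
    also have "(1 / \<epsilon>) *\<^sub>R (f (u \<epsilon> \<alpha>, \<alpha>) - (\<Sum>m=1..r. \<epsilon> ^ m *\<^sub>R X' (m - 1) \<alpha>)) =
       vector_derivative (u \<epsilon>) (at \<alpha>) - (\<Sum>m<r. \<epsilon> ^ m *\<^sub>R X' m \<alpha>)"
      unfolding X'_shift vd using \<epsilon>(1) by (simp add: scaleR_diff_right)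
    also have "(1 / \<epsilon>) * (\<tau> * \<epsilon> ^ r) = \<tau> * \<epsilon> ^ (r - 1)" using \<epsilon>(1) r by (cases r) auto
    finally show ?thesis .
  qed
  then show ?thesis using e1 e2(1) by (intro exI[of _ "min e1 e2"]) auto
qed

lemma lower_order_sum:
  assumes "0 < \<epsilon>" "\<epsilon> \<le> 1" "\<And>m. m < r \<Longrightarrow> norm (X' m \<alpha>) \<le> B" "0 \<le> B"
  shows "norm ((\<Sum>m<r. \<epsilon> ^ m *\<^sub>R X' m \<alpha>) - X' 0 \<alpha>) \<le> real r * B * \<epsilon>"
proof -
  have "(\<Sum>m<r. \<epsilon> ^ m *\<^sub>R X' m \<alpha>) - X' 0 \<alpha> = (\<Sum>m=Suc 0..<r. \<epsilon> ^ m *\<^sub>R X' m \<alpha>)"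
    unfolding lessThan_atLeast0 using r by (subst sum.atLeast_Suc_lessThan) simp_all
  also have "norm \<dots> \<le> (\<Sum>m=Suc 0..<r. \<epsilon> * B)"
  proof (rule sum_norm_le)
    fix m assume m: "m \<in> {Suc 0..<r}"
    have "\<epsilon> ^ m \<le> \<epsilon> ^ 1" using assms m by (intro power_decreasing) auto
    then show "norm (\<epsilon> ^ m *\<^sub>R X' m \<alpha>) \<le> \<epsilon> * B" using assms m by (auto intro!: mult_mono)
  qed
  also have "\<dots> = real (r - 1) * (\<epsilon> * B)" by simp
  also have "\<dots> \<le> real r * (\<epsilon> * B)" using assms by (intro mult_right_mono) auto
  finally show ?thesis by (simp add: mult_ac)
qed

text \<open>For r = 1 the power \<epsilon>^(r-1) is 1, and convergence comes only from the
  arbitrarily small factor in front of it.\<close>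

lemma slow_sol_deriv_limit:
  "uniform_limit UNIV (\<lambda>\<epsilon> \<alpha>. vector_derivative (u \<epsilon>) (at \<alpha>)) (\<lambda>\<alpha>. vector_derivative x0 (at \<alpha>)) (at_right 0)"
  unfolding uniform_limit_iff
proof (intro allI impI)
  fix s :: real assume s: "s > 0"
  obtain B where B: "B > 0" "\<And>m \<alpha>. m < r \<Longrightarrow> norm (X' m \<alpha>) \<le> B" using X'_bound by blast
  have "s / 2 > 0" using s by simp
  from slow_sol_deriv_expansion[OF this] obtain e where e: "e > 0" "e \<le> 1"
    "\<And>\<epsilon> \<alpha>. 0 < \<epsilon> \<Longrightarrow> \<epsilon> < e \<Longrightarrow> norm (vector_derivative (u \<epsilon>) (at \<alpha>) - (\<Sum>m<r. \<epsilon> ^ m *\<^sub>R X' m \<alpha>)) \<le> s / 2 * \<epsilon> ^ (r - 1)"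
    by blast
  have "dist (vector_derivative (u \<epsilon>) (at \<alpha>)) (vector_derivative x0 (at \<alpha>)) < s"
    if \<epsilon>: "0 < \<epsilon>" "\<epsilon> < min e (s / (2 * (real r * B)))" for \<epsilon> \<alpha>
  proof -
    have rB: "real r * B > 0" using r B by simp
    have "real r * B * \<epsilon> < s / 2" using \<epsilon>(2) rB by (simp add: pos_less_divide_eq mult_ac)
    moreover have "norm ((\<Sum>m<r. \<epsilon> ^ m *\<^sub>R X' m \<alpha>) - X' 0 \<alpha>) \<le> real r * B * \<epsilon>"
      using \<epsilon> e B by (intro lower_order_sum) auto
    moreover have "s / 2 * \<epsilon> ^ (r - 1) \<le> s / 2 * 1" using \<epsilon> e s by (intro mult_left_mono power_le_one) auto
    moreover have "norm (vector_derivative (u \<epsilon>) (at \<alpha>) - (\<Sum>m<r. \<epsilon> ^ m *\<^sub>R X' m \<alpha>)) \<le> s / 2 * \<epsilon> ^ (r - 1)"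
      using \<epsilon> by (intro e(3)) auto
    ultimately have "norm (vector_derivative (u \<epsilon>) (at \<alpha>) - X' 0 \<alpha>) < s"
      using norm_triangle_ineq[of "vector_derivative (u \<epsilon>) (at \<alpha>) - (\<Sum>m<r. \<epsilon> ^ m *\<^sub>R X' m \<alpha>)" "(\<Sum>m<r. \<epsilon> ^ m *\<^sub>R X' m \<alpha>) - X' 0 \<alpha>"]
      by simp
    then show ?thesis by (simp add: dist_norm)
  qed
  moreover have "min e (s / (2 * (real r * B))) > 0" using e s B r by simp
  ultimately show "\<forall>\<^sub>F \<epsilon> in at_right 0. \<forall>\<alpha>\<in>UNIV. dist (vector_derivative (u \<epsilon>) (at \<alpha>)) (vector_derivative x0 (at \<alpha>)) < s"
    unfolding eventually_at_right_field by blast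
qed

text \<open>The expansion of order r is truncated: the dropped terms are bounded and carry at least
  the power N + 1 of \<epsilon>, so they are o(\<epsilon>^N).\<close>

lemma slow_sol_series:
  assumes N: "N \<le> r"
  shows "uniform_limit UNIV
       (\<lambda>\<epsilon> \<alpha>. (u \<epsilon> \<alpha> - (\<Sum>\<nu>\<le>N. \<epsilon> ^ \<nu> *\<^sub>R slow_coeff f x0 \<nu> \<alpha>)) /\<^sub>R \<epsilon> ^ N) (\<lambda>\<alpha>. 0) (at_right 0)"
  unfolding uniform_limit_iff
proof (intro allI impI)
  fix s :: real assume s: "s > 0"
  obtain B where B: "1 \<le> B" "\<And>\<nu> \<alpha>. \<nu> \<le> r \<Longrightarrow> norm (X \<nu> \<alpha>) \<le> B" using coeff_bound by blast
  have rB: "real r * B > 0" using r B by simp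
  have "s / 2 > 0" using s by simp
  from slow_sol_expansion[OF this] obtain e where e: "e > 0" "e \<le> 1"
    "\<And>\<epsilon> \<alpha>. 0 < \<epsilon> \<Longrightarrow> \<epsilon> < e \<Longrightarrow> norm (u \<epsilon> \<alpha> - (x0 \<alpha> + corr \<epsilon> \<alpha>)) \<le> s / 2 * \<epsilon> ^ r"
    by blast
  have "dist ((u \<epsilon> \<alpha> - (\<Sum>\<nu>\<le>N. \<epsilon> ^ \<nu> *\<^sub>R X \<nu> \<alpha>)) /\<^sub>R \<epsilon> ^ N) 0 < s"
    if \<epsilon>: "0 < \<epsilon>" "\<epsilon> < min e (s / (2 * (real r * B)))" for \<epsilon> \<alpha>
  proof -
    have small: "real r * B * \<epsilon> < s / 2" using \<epsilon>(2) rB by (simp add: pos_less_divide_eq mult_ac)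
    have split: "(\<Sum>\<nu>\<le>r. \<epsilon> ^ \<nu> *\<^sub>R X \<nu> \<alpha>) = (\<Sum>\<nu>\<le>N. \<epsilon> ^ \<nu> *\<^sub>R X \<nu> \<alpha>) + (\<Sum>\<nu>\<in>{N<..r}. \<epsilon> ^ \<nu> *\<^sub>R X \<nu> \<alpha>)"
    proof -
      have "{..r} = {..N} \<union> {N<..r}" using N by auto
      then show ?thesis by (simp only:) (rule sum.union_disjoint; auto)
    qed
    have 1: "norm (u \<epsilon> \<alpha> - (\<Sum>\<nu>\<le>r. \<epsilon> ^ \<nu> *\<^sub>R X \<nu> \<alpha>)) \<le> s / 2 * \<epsilon> ^ N"
    proof -
      have "norm (u \<epsilon> \<alpha> - (\<Sum>\<nu>\<le>r. \<epsilon> ^ \<nu> *\<^sub>R X \<nu> \<alpha>)) \<le> s / 2 * \<epsilon> ^ r"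
        using e(3)[of \<epsilon> \<alpha>] \<epsilon> unfolding x0_corr by simp
      also have "\<dots> \<le> s / 2 * \<epsilon> ^ N" using N \<epsilon> e s by (intro mult_left_mono power_decreasing) auto
      finally show ?thesis .
    qed
    have 2: "norm (\<Sum>\<nu>\<in>{N<..r}. \<epsilon> ^ \<nu> *\<^sub>R X \<nu> \<alpha>) \<le> (real r * B * \<epsilon>) * \<epsilon> ^ N"
    proof -
      have "norm (\<Sum>\<nu>\<in>{N<..r}. \<epsilon> ^ \<nu> *\<^sub>R X \<nu> \<alpha>) \<le> (\<Sum>\<nu>\<in>{N<..r}. \<epsilon> ^ Suc N * B)"
      proof (rule sum_norm_le)
        fix \<nu> assume \<nu>: "\<nu> \<in> {N<..r}"
        have "\<epsilon> ^ \<nu> \<le> \<epsilon> ^ Suc N" using \<epsilon> e \<nu> by (intro power_decreasing) auto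
        then show "norm (\<epsilon> ^ \<nu> *\<^sub>R X \<nu> \<alpha>) \<le> \<epsilon> ^ Suc N * B"
          using \<epsilon> \<nu> B(2)[of \<nu> \<alpha>] unfolding norm_scaleR by (intro mult_mono) auto
      qed
      also have "\<dots> = real (r - N) * (\<epsilon> ^ Suc N * B)" by simp
      also have "\<dots> \<le> real r * (\<epsilon> ^ Suc N * B)" using \<epsilon> B by (intro mult_right_mono) auto
      finally show ?thesis by (simp add: mult_ac)
    qed
    have "norm (u \<epsilon> \<alpha> - (\<Sum>\<nu>\<le>N. \<epsilon> ^ \<nu> *\<^sub>R X \<nu> \<alpha>)) =
      norm ((u \<epsilon> \<alpha> - (\<Sum>\<nu>\<le>r. \<epsilon> ^ \<nu> *\<^sub>R X \<nu> \<alpha>)) + (\<Sum>\<nu>\<in>{N<..r}. \<epsilon> ^ \<nu> *\<^sub>R X \<nu> \<alpha>))" unfolding split by simp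
    also have "\<dots> \<le> s / 2 * \<epsilon> ^ N + (real r * B * \<epsilon>) * \<epsilon> ^ N" by (intro norm_triangle_mono 1 2)
    also have "\<dots> = (s / 2 + real r * B * \<epsilon>) * \<epsilon> ^ N" by (simp add: distrib_right)
    also have "\<dots> < s * \<epsilon> ^ N" using small \<epsilon> by (intro mult_strict_right_mono) auto
    finally have "norm (u \<epsilon> \<alpha> - (\<Sum>\<nu>\<le>N. \<epsilon> ^ \<nu> *\<^sub>R X \<nu> \<alpha>)) < s * \<epsilon> ^ N" .
    then show ?thesis using \<epsilon> by (simp add: divide_inverse[symmetric] pos_divide_less_eq mult.commute[of "inverse _"])
  qed
  moreover have "min e (s / (2 * (real r * B))) > 0" using e s rB by simp
  ultimately show "\<forall>\<^sub>F \<epsilon> in at_right 0. \<forall>\<alpha>\<in>UNIV. dist ((u \<epsilon> \<alpha> - (\<Sum>\<nu>\<le>N. \<epsilon> ^ \<nu> *\<^sub>R X \<nu> \<alpha>)) /\<^sub>R \<epsilon> ^ N) 0 < s"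
    unfolding eventually_at_right_field by blast
qed

end

text \<open>Hyperbolicity permits eigenvalues of either sign, so attraction is claimed when all real
  parts are negative. The derivative of the trajectory differs from that of \<open>x0\<close> by
  o(\<epsilon>^(r-1)) plus a term of order \<epsilon>; this gives the rate \<epsilon> for r >= 2 and
  plain uniform convergence for r = 1.\<close>

theorem slow_manifold_expansion:
  "\<exists>\<delta>>0. \<exists>\<epsilon>0>0. \<exists>xs :: real \<Rightarrow> real \<Rightarrow> real^'n.
    (\<forall>\<epsilon>. 0 < \<epsilon> \<and> \<epsilon> < \<epsilon>0 \<longrightarrow>
       (\<exists>!M. slow_manifold f x0 \<delta> \<epsilon> M) \<and>
       slow_manifold f x0 \<delta> \<epsilon> (manifold_of (xs \<epsilon>)) \<and>
       Ck r (xs \<epsilon>) \<and>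
       solves f \<epsilon> (\<lambda>t. (xs \<epsilon> (\<epsilon> * t), \<epsilon> * t)) UNIV \<and>
       bounded (range (xs \<epsilon>)) \<and>
       ((\<forall>\<alpha>. \<forall>\<mu> \<in> spect (jacobian_at f x0 \<alpha>). Re \<mu> < 0) \<longrightarrow>
          attracting f \<epsilon> (manifold_of (xs \<epsilon>))) \<and>
       Ck_diffeomorphic r (manifold_of x0) (manifold_of (xs \<epsilon>))) \<and>
    (\<exists>C. \<forall>\<epsilon> \<alpha>. 0 < \<epsilon> \<and> \<epsilon> < \<epsilon>0 \<longrightarrow> norm (xs \<epsilon> \<alpha> - x0 \<alpha>) \<le> C * \<epsilon>) \<and>
    uniform_limit UNIV (\<lambda>\<epsilon> \<alpha>. vector_derivative (xs \<epsilon>) (at \<alpha>))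
      (\<lambda>\<alpha>. vector_derivative x0 (at \<alpha>)) (at_right 0) \<and>
    (2 \<le> r \<longrightarrow> (\<exists>C. \<forall>\<epsilon> \<alpha>. 0 < \<epsilon> \<and> \<epsilon> < \<epsilon>0 \<longrightarrow>
       norm (vector_derivative (xs \<epsilon>) (at \<alpha>) - vector_derivative x0 (at \<alpha>)) \<le> C * \<epsilon>)) \<and>
    (\<forall>N\<le>r. uniform_limit UNIV
       (\<lambda>\<epsilon> \<alpha>. (xs \<epsilon> \<alpha> - (\<Sum>\<nu>\<le>N. \<epsilon> ^ \<nu> *\<^sub>R slow_coeff f x0 \<nu> \<alpha>)) /\<^sub>R \<epsilon> ^ N)
       (\<lambda>\<alpha>. 0) (at_right 0))"
proof -
  obtain C W \<delta> e where C: "C > 0" "W > 0" "\<delta> > 0" "\<delta> \<le> \<rho>" "e > 0"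
    and ok': "\<And>\<epsilon>. 0 < \<epsilon> \<Longrightarrow> \<epsilon> < e \<Longrightarrow> fast_ok C W \<delta> \<epsilon>"
    using fast_ok_exists by blast
  obtain B where B: "B > 0" "\<And>m \<alpha>. m < r \<Longrightarrow> norm (X' m \<alpha>) \<le> B" using X'_bound by blast
  \<comment> \<open>Makes the displacement 2 C \<epsilon> B of the slow trajectory at most
    \<delta>/4. Its existence would allow \<delta>/2; the rest is the room needed for
    attraction.\<close>
  define e0 where "e0 = min e (\<delta> / (8 * C * B))"
  have e0: "e0 > 0" using C B by (simp add: e0_def)
  have small: "2 * C * (\<epsilon> * B) \<le> \<delta> / 4" if "0 < \<epsilon>" "\<epsilon> < e0" for \<epsilon>
  proof -
    have "\<epsilon> \<le> \<delta> / (8 * C * B)" using that by (simp add: e0_def)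
    then have "\<epsilon> * (8 * C * B) \<le> \<delta>" using C B by (simp add: pos_le_divide_eq)
    then show ?thesis by (simp add: mult_ac)
  qed
  have ok: "fast_ok C W \<delta> \<epsilon>" if "0 < \<epsilon>" "\<epsilon> < e0" for \<epsilon> using ok' that by (simp add: e0_def)
  have "\<exists>v. 0 < \<epsilon> \<longrightarrow> \<epsilon> < e0 \<longrightarrow> slow_sol \<delta> \<epsilon> v \<and> (\<forall>\<alpha>. norm (v \<alpha> - x0 \<alpha>) \<le> 2 * C * (\<epsilon> * B))" for \<epsilon>
  proof (cases "0 < \<epsilon> \<and> \<epsilon> < e0")
    case True
    have "2 * C * (\<epsilon> * B) \<le> \<delta> / 2" using small[of \<epsilon>] True C by linarith
    from slow_sol_exists[OF ok C(1) _ B(2) this] True r show ?thesis by auto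
  qed auto
  then obtain u where u: "\<And>\<epsilon>. 0 < \<epsilon> \<Longrightarrow> \<epsilon> < e0 \<Longrightarrow> slow_sol \<delta> \<epsilon> (u \<epsilon>)"
    and near: "\<And>\<epsilon> \<alpha>. 0 < \<epsilon> \<Longrightarrow> \<epsilon> < e0 \<Longrightarrow> norm (u \<epsilon> \<alpha> - x0 \<alpha>) \<le> 2 * C * (\<epsilon> * B)" by metis
  \<comment> \<open>A fixed choice of the small factor, here 1, already gives the bound of order
    \<epsilon> for the derivative when r >= 2.\<close>
  obtain e1 where e1: "e1 > 0" "e1 \<le> e0" "e1 \<le> 1" "\<And>\<epsilon> \<alpha>. 0 < \<epsilon> \<Longrightarrow> \<epsilon> < e1 \<Longrightarrow>
    norm (vector_derivative (u \<epsilon>) (at \<alpha>) - (\<Sum>m<r. \<epsilon> ^ m *\<^sub>R X' m \<alpha>)) \<le> 1 * \<epsilon> ^ (r - 1)"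
    using slow_sol_deriv_expansion[OF C(1-3) e0 ok u zero_less_one] by blast
  have each: "(\<exists>!M. slow_manifold f x0 \<delta> \<epsilon> M) \<and> slow_manifold f x0 \<delta> \<epsilon> (manifold_of (u \<epsilon>)) \<and> Ck r (u \<epsilon>) \<and>
       solves f \<epsilon> (\<lambda>t. (u \<epsilon> (\<epsilon> * t), \<epsilon> * t)) UNIV \<and> bounded (range (u \<epsilon>)) \<and>
       ((\<forall>\<alpha>. \<forall>\<mu> \<in> spect (jacobian_at f x0 \<alpha>). Re \<mu> < 0) \<longrightarrow> attracting f \<epsilon> (manifold_of (u \<epsilon>))) \<and>
       Ck_diffeomorphic r (manifold_of x0) (manifold_of (u \<epsilon>))"
    if \<epsilon>: "0 < \<epsilon> \<and> \<epsilon> < e1" for \<epsilon>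
  proof -
    have \<epsilon>': "0 < \<epsilon>" "\<epsilon> < e0" using \<epsilon> e1 by auto
    have fo: "fast_ok C W \<delta> \<epsilon>" and us: "slow_sol \<delta> \<epsilon> (u \<epsilon>)" using ok u \<epsilon>' by auto
    note unique = slow_manifold_unique[OF fo C(1,2) \<epsilon>'(1) us]
    have UCu: "UC r (u \<epsilon>)" by (rule UC_slow_sol[OF us \<epsilon>'(1) C(4)])
    have Cu: "Ck r (u \<epsilon>)" by (rule UC_imp_Ck[OF UCu])
    have close: "norm (u \<epsilon> \<alpha> - x0 \<alpha>) \<le> \<delta> / 4" for \<alpha> using near[OF \<epsilon>'] small[OF \<epsilon>'] order_trans by blast
    have att: "(\<forall>\<alpha>. \<forall>\<mu> \<in> spect (jacobian_at f x0 \<alpha>). Re \<mu> < 0) \<longrightarrow> attracting f \<epsilon> (manifold_of (u \<epsilon>))"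
      using slow_sol_attracting[OF fo C(1,2) \<epsilon>'(1) C(3,4) us close] by blast
    show ?thesis
      by (intro conjI ex1I[where P="slow_manifold f x0 \<delta> \<epsilon>", OF unique(1,2)] unique(1,3) Cu UC_base(1)[OF UCu] att graphs_diffeomorphic[OF Ck_x0 Cu])
  qed
  have "norm (u \<epsilon> \<alpha> - x0 \<alpha>) \<le> (2 * C * B) * \<epsilon>" if "0 < \<epsilon> \<and> \<epsilon> < e1" for \<epsilon> \<alpha>
    using near[of \<epsilon> \<alpha>] that e1 by (simp add: mult_ac)
  then have lin: "\<exists>C. \<forall>\<epsilon> \<alpha>. 0 < \<epsilon> \<and> \<epsilon> < e1 \<longrightarrow> norm (u \<epsilon> \<alpha> - x0 \<alpha>) \<le> C * \<epsilon>" by blast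
  have dlin: "\<exists>C. \<forall>\<epsilon> \<alpha>. 0 < \<epsilon> \<and> \<epsilon> < e1 \<longrightarrow>
       norm (vector_derivative (u \<epsilon>) (at \<alpha>) - vector_derivative x0 (at \<alpha>)) \<le> C * \<epsilon>" if "2 \<le> r"
  proof -
    have "norm (vector_derivative (u \<epsilon>) (at \<alpha>) - vector_derivative x0 (at \<alpha>)) \<le> (1 + real r * B) * \<epsilon>"
      if \<epsilon>: "0 < \<epsilon> \<and> \<epsilon> < e1" for \<epsilon> \<alpha>
    proof -
      \<comment> \<open>For r >= 2 the exponent r - 1 is at least 1; this is where the rate needs a
        second derivative.\<close>
      have "1 * \<epsilon> ^ (r - 1) \<le> \<epsilon>"
        using power_decreasing[of 1 "r - 1" \<epsilon>] \<open>2 \<le> r\<close> \<epsilon> e1 by simp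
      then have 1: "norm (vector_derivative (u \<epsilon>) (at \<alpha>) - (\<Sum>m<r. \<epsilon> ^ m *\<^sub>R X' m \<alpha>)) \<le> \<epsilon>"
        using e1(4)[of \<epsilon> \<alpha>] \<epsilon> by linarith
      have 2: "norm ((\<Sum>m<r. \<epsilon> ^ m *\<^sub>R X' m \<alpha>) - X' 0 \<alpha>) \<le> real r * B * \<epsilon>"
        using \<epsilon> e1 B by (intro lower_order_sum[OF C(1-3) e0 ok u]) auto
      from norm_triangle_mono[OF 1 2] show ?thesis by (simp add: distrib_right)
    qed
    then show ?thesis by blast
  qed
  show ?thesis
  proof (rule exI[of _ \<delta>], rule conjI[OF C(3)], rule exI[of _ e1], rule conjI[OF e1(1)], rule exI[of _ u], intro conjI)
    show "uniform_limit UNIV (\<lambda>\<epsilon> \<alpha>. vector_derivative (u \<epsilon>) (at \<alpha>)) (\<lambda>\<alpha>. vector_derivative x0 (at \<alpha>)) (at_right 0)"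
      by (rule slow_sol_deriv_limit[OF C(1-3) e0 ok u])
    show "\<forall>N\<le>r. uniform_limit UNIV
       (\<lambda>\<epsilon> \<alpha>. (u \<epsilon> \<alpha> - (\<Sum>\<nu>\<le>N. \<epsilon> ^ \<nu> *\<^sub>R slow_coeff f x0 \<nu> \<alpha>)) /\<^sub>R \<epsilon> ^ N) (\<lambda>\<alpha>. 0) (at_right 0)"
      by (intro allI impI slow_sol_series[OF C(1-3) e0 ok u])
  qed (rule allI, rule impI, erule each, rule lin, rule impI, erule dlin)
qed

end

theorem theorem5:
  fixes f :: "(real^'n) \<times> real \<Rightarrow> real^'n" and x0 :: "real \<Rightarrow> real^'n"
    and r :: nat and K \<rho> :: real
  assumes "1 \<le> r"
    and "Ck r f" and "0 < \<rho>" and "uniform_Ck_on r (tube x0 \<rho>) f"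
    and "Ck r x0" and "bounded (range x0)"
    and "\<And>\<alpha>. f (x0 \<alpha>, \<alpha>) = 0"
    and "0 < K" and "\<And>\<alpha> \<mu>. \<mu> \<in> spect (jacobian_at f x0 \<alpha>) \<Longrightarrow> K \<le> \<bar>Re \<mu>\<bar>"
  shows "\<exists>\<delta>>0. \<exists>\<epsilon>0>0. \<exists>xs :: real \<Rightarrow> real \<Rightarrow> real^'n.
    (\<forall>\<epsilon>. 0 < \<epsilon> \<and> \<epsilon> < \<epsilon>0 \<longrightarrow>
       (\<exists>!M. slow_manifold f x0 \<delta> \<epsilon> M) \<and>
       slow_manifold f x0 \<delta> \<epsilon> (manifold_of (xs \<epsilon>)) \<and>
       Ck r (xs \<epsilon>) \<and>
       solves f \<epsilon> (\<lambda>t. (xs \<epsilon> (\<epsilon> * t), \<epsilon> * t)) UNIV \<and>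
       bounded (range (xs \<epsilon>)) \<and>
       ((\<forall>\<alpha>. \<forall>\<mu> \<in> spect (jacobian_at f x0 \<alpha>). Re \<mu> < 0) \<longrightarrow>
          attracting f \<epsilon> (manifold_of (xs \<epsilon>))) \<and>
       Ck_diffeomorphic r (manifold_of x0) (manifold_of (xs \<epsilon>))) \<and>
    (\<exists>C. \<forall>\<epsilon> \<alpha>. 0 < \<epsilon> \<and> \<epsilon> < \<epsilon>0 \<longrightarrow> norm (xs \<epsilon> \<alpha> - x0 \<alpha>) \<le> C * \<epsilon>) \<and>
    uniform_limit UNIV (\<lambda>\<epsilon> \<alpha>. vector_derivative (xs \<epsilon>) (at \<alpha>))
      (\<lambda>\<alpha>. vector_derivative x0 (at \<alpha>)) (at_right 0) \<and>
    (2 \<le> r \<longrightarrow> (\<exists>C. \<forall>\<epsilon> \<alpha>. 0 < \<epsilon> \<and> \<epsilon> < \<epsilon>0 \<longrightarrow>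
       norm (vector_derivative (xs \<epsilon>) (at \<alpha>) - vector_derivative x0 (at \<alpha>)) \<le> C * \<epsilon>)) \<and>
    (\<forall>N\<le>r. uniform_limit UNIV
       (\<lambda>\<epsilon> \<alpha>. (xs \<epsilon> \<alpha> - (\<Sum>\<nu>\<le>N. \<epsilon> ^ \<nu> *\<^sub>R slow_coeff f x0 \<nu> \<alpha>)) /\<^sub>R \<epsilon> ^ N)
       (\<lambda>\<alpha>. 0) (at_right 0))"
proof -
  interpret slow_fast f x0 r K \<rho> by (rule slow_fast.intro[OF assms])
  show ?thesis by (rule slow_manifold_expansion)
qed

end
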